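(* Let $C_0>0$ and $F=(1-e^{-z})^2$, $z\in(0,\infty)$, so that the Taub-NUT metric is $g_{TN}=\frac{C_0e^{-z}}{(1-e^{-z})^2}\left(\frac{1}{4F}dz^2+F(\eta^1)^2+(\eta^2)^2+(\eta^3)^2\right)$ (with one point, the nut, added at $z=\infty$). Then the conformal class of $g_{TN}$ contains the following two complete K\"ahler metrics, which form an ambiK\"ahler pair. (i) With complex structure $J^-$, the metric $C_0e^{z}\left(\frac{1}{4F}dz^2+F(\eta^1)^2+(\eta^2)^2+(\eta^3)^2\right)$ on $z\in(0,\infty)$ is a complete, two-ended, scalar-flat K\"ahler metric on $\mathbb{C}^2\setminus\{(0,0)\}$, with an ALE end at $z=\infty$ and a cusp-like end at $z=0$. (ii) With complex structure $J^+$, the metric $C_0e^{-z}\left(\frac{1}{4F}dz^2+F(\eta^1)^2+(\eta^2)^2+(\eta^3)^2\right)$ on $z\in(0,\infty]$ (with one point, the nut, added at $z=\infty$) is a complete, one-ended extremal K\"ahler metric on $\mathbb{C}^2$, with a cusp-like end at $z=0$. Its scalar curvature is $s=48C_0^{-1}(1-e^{-z})$, which is positive and approaches $0$ along the cusp.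
   Context: Let $\eta^1,\eta^2,\eta^3$ be the left-invariant coframe on $\mathbb{S}^3$ with $d\eta^1=-2\eta^2\wedge\eta^3$ and cyclic permutations, with dual frame $e_1,e_2,e_3$. The metrics are defined on $(0,\infty)\times\mathbb{S}^3$. A "nut" is a point added at $z=\infty$, at finite distance, where the 3-spheres $\{z\}\times\mathbb{S}^3$ contract to a point so that the nearby topology is that of a ball in $\mathbb{R}^4$. A cusp-like end at $z=0$ is an end, at infinite distance, where $F$ has a second-order zero while the conformal factor remains finite and nonzero; the Hopf fiber shrinks to zero and the local geometry is asymptotic to that of a pseudosphere times a 2-sphere. ALE means asymptotically locally Euclidean. Complex structures: $J^\pm=\mp2F\frac{\partial}{\partial z}\otimes\eta^1\pm\frac1{2F}e_1\otimes dz-e_2\otimes\eta^3+e_3\otimes\eta^2$. An ambiK\"ahler structure is a pair of K\"ahler structures $(M,J_1,g_1)$, $(M,J_2,g_2)$ where $J_1,J_2$ induce opposite orientations and $g_1,g_2$ are conformal (here, on the common domain $(0,\infty)\times\mathbb{S}^3$). A K\"ahler metric is extremal if it is critical for $\int s^2\,dVol$ under variations preserving the K\"ahler class; equivalently $J\nabla s$ is Killing. *)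

theory Defs
  imports "HOL-Analysis.Analysis"
begin

section \<open>Riemannian and complex geometry on open subsets of a Euclidean space\<close>

text \<open>
  All manifolds involved are open subsets \<open>U\<close> of a Euclidean space, so tensor fields are
  functions of a base point and of tangent vectors.  Vectors that are held fixed while the
  base point varies are the constant (coordinate) vector fields.
\<close>

type_synonym 'a metric_field = "'a \<Rightarrow> 'a \<Rightarrow> 'a \<Rightarrow> real"
type_synonym 'a endo_field = "'a \<Rightarrow> 'a \<Rightarrow> 'a"

text \<open>Iterated partial derivatives; the domains below are always open.\<close>

primrec iter_deriv :: "'a::euclidean_space list \<Rightarrow> ('a \<Rightarrow> 'b::real_normed_vector) \<Rightarrow> 'a \<Rightarrow> 'b" where
  "iter_deriv [] f = f"
| "iter_deriv (b # bs) f = (\<lambda>x. frechet_derivative (iter_deriv bs f) (at x) b)"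

definition smooth_on :: "'a::euclidean_space set \<Rightarrow> ('a \<Rightarrow> 'b::real_normed_vector) \<Rightarrow> bool" where
  "smooth_on U f \<longleftrightarrow> (\<forall>bs. set bs \<subseteq> Basis \<longrightarrow> iter_deriv bs f differentiable_on U)"

definition riemannian_on :: "'a::euclidean_space set \<Rightarrow> 'a metric_field \<Rightarrow> bool" where
  "riemannian_on U g \<longleftrightarrow>
     open U \<and>
     (\<forall>x\<in>U. bilinear (g x) \<and> (\<forall>v w. g x v w = g x w v) \<and> (\<forall>v. v \<noteq> 0 \<longrightarrow> 0 < g x v v)) \<and>
     (\<forall>v w. smooth_on U (\<lambda>x. g x v w))"

definition conformal_on :: "'a::euclidean_space set \<Rightarrow> 'a metric_field \<Rightarrow> 'a metric_field \<Rightarrow> bool" where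
  "conformal_on U g h \<longleftrightarrow>
     (\<exists>f. smooth_on U f \<and> (\<forall>x\<in>U. 0 < f x) \<and> (\<forall>x\<in>U. \<forall>v w. h x v w = f x * g x v w))"

subsection \<open>Distance and completeness\<close>

definition rspeed :: "'a::euclidean_space metric_field \<Rightarrow> (real \<Rightarrow> 'a) \<Rightarrow> real \<Rightarrow> real" where
  "rspeed g p t = sqrt (g (p t) (vector_derivative p (at t)) (vector_derivative p (at t)))"

definition rlength :: "'a::euclidean_space metric_field \<Rightarrow> (real \<Rightarrow> 'a) \<Rightarrow> real" where
  "rlength g p = integral {0..1} (rspeed g p)"

text \<open>
  The library's piecewise \<open>C\<^sup>1\<close> paths may have unbounded speed near a break point.  Since the
  integral of a non-integrable function is 0 by convention, integrability of the speed has to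
  be required; otherwise paths of infinite length would count as having length 0.
  The value 0 outside \<open>U\<close> is a convention, needed because \<^locale>\<open>Metric_space\<close> asks for
  nonnegativity and symmetry of the distance function everywhere.
\<close>

definition rdist :: "'a::euclidean_space set \<Rightarrow> 'a metric_field \<Rightarrow> 'a \<Rightarrow> 'a \<Rightarrow> real" where
  "rdist U g x y =
     (if x \<in> U \<and> y \<in> U
      then Inf {rlength g p | p. valid_path p \<and> path_image p \<subseteq> U \<and> pathstart p = x \<and>
                                 pathfinish p = y \<and> rspeed g p integrable_on {0..1}}
      else 0)"

definition complete_on :: "'a::euclidean_space set \<Rightarrow> 'a metric_field \<Rightarrow> bool" where
  "complete_on U g \<longleftrightarrow> Metric_space U (rdist U g) \<and> Metric_space.mcomplete U (rdist U g)"

subsection \<open>Levi-Civita connection and curvature\<close>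

definition sharp :: "'a::euclidean_space metric_field \<Rightarrow> 'a \<Rightarrow> ('a \<Rightarrow> real) \<Rightarrow> 'a" where
  "sharp g x l = (THE v. \<forall>w. g x v w = l w)"

definition grad :: "'a::euclidean_space metric_field \<Rightarrow> ('a \<Rightarrow> real) \<Rightarrow> 'a \<Rightarrow> 'a" where
  "grad g f x = sharp g x (frechet_derivative f (at x))"

text \<open>\<open>christoffel g x v w\<close> is the covariant derivative at \<open>x\<close> of the constant field \<open>w\<close> in direction \<open>v\<close>.\<close>

definition christoffel :: "'a::euclidean_space metric_field \<Rightarrow> 'a \<Rightarrow> 'a \<Rightarrow> 'a \<Rightarrow> 'a" where
  "christoffel g x v w = sharp g x (\<lambda>u.
     (frechet_derivative (\<lambda>y. g y w u) (at x) v + frechet_derivative (\<lambda>y. g y v u) (at x) w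
        - frechet_derivative (\<lambda>y. g y v w) (at x) u) / 2)"

definition riemann :: "'a::euclidean_space metric_field \<Rightarrow> 'a \<Rightarrow> 'a \<Rightarrow> 'a \<Rightarrow> 'a \<Rightarrow> 'a" where
  "riemann g x u v w =
     frechet_derivative (\<lambda>y. christoffel g y v w) (at x) u
     - frechet_derivative (\<lambda>y. christoffel g y u w) (at x) v
     + christoffel g x u (christoffel g x v w) - christoffel g x v (christoffel g x u w)"

definition ricci :: "'a::euclidean_space metric_field \<Rightarrow> 'a \<Rightarrow> 'a \<Rightarrow> 'a \<Rightarrow> real" where
  "ricci g x v w = (\<Sum>b\<in>Basis. riemann g x b v w \<bullet> b)"

definition scalar_curvature :: "'a::euclidean_space metric_field \<Rightarrow> 'a \<Rightarrow> real" where
  "scalar_curvature g x = (\<Sum>b\<in>Basis. sharp g x (ricci g x b) \<bullet> b)"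

text \<open>
  Covariant derivative of a covariant tensor field whose vector arguments are given as a list;
  the new (differentiating) slot comes first.
\<close>

definition cov_deriv ::
    "'a::euclidean_space metric_field \<Rightarrow> ('a \<Rightarrow> 'a list \<Rightarrow> real) \<Rightarrow> 'a \<Rightarrow> 'a list \<Rightarrow> real" where
  "cov_deriv g T x vs =
     (case vs of [] \<Rightarrow> 0
      | v # ws \<Rightarrow> frechet_derivative (\<lambda>y. T y ws) (at x) v
                  - (\<Sum>i<length ws. T x (ws[i := christoffel g x v (ws ! i)])))"

definition killing_on :: "'a::euclidean_space set \<Rightarrow> 'a metric_field \<Rightarrow> ('a \<Rightarrow> 'a) \<Rightarrow> bool" where
  "killing_on U g V \<longleftrightarrow>
     smooth_on U V \<and>
     (\<forall>x\<in>U. \<forall>v w. frechet_derivative (\<lambda>y. g y v w) (at x) (V x)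
        + g x (frechet_derivative V (at x) v) w + g x v (frechet_derivative V (at x) w) = 0)"

subsection \<open>Complex and Kaehler structures\<close>

definition lie_bracket :: "('a::euclidean_space \<Rightarrow> 'a) \<Rightarrow> ('a \<Rightarrow> 'a) \<Rightarrow> 'a \<Rightarrow> 'a" where
  "lie_bracket X Y x = frechet_derivative Y (at x) (X x) - frechet_derivative X (at x) (Y x)"

definition complex_structure_on :: "'a::euclidean_space set \<Rightarrow> 'a endo_field \<Rightarrow> bool" where
  "complex_structure_on U J \<longleftrightarrow>
     open U \<and>
     (\<forall>x\<in>U. linear (J x) \<and> (\<forall>v. J x (J x v) = - v)) \<and>
     (\<forall>v. smooth_on U (\<lambda>x. J x v)) \<and>
     (\<forall>X Y. smooth_on U X \<longrightarrow> smooth_on U Y \<longrightarrow>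
        (\<forall>x\<in>U. lie_bracket (\<lambda>y. J y (X y)) (\<lambda>y. J y (Y y)) x
                - J x (lie_bracket (\<lambda>y. J y (X y)) Y x)
                - J x (lie_bracket X (\<lambda>y. J y (Y y)) x)
                - lie_bracket X Y x = 0))"

definition fundamental_form :: "'a metric_field \<Rightarrow> 'a endo_field \<Rightarrow> 'a \<Rightarrow> 'a \<Rightarrow> 'a \<Rightarrow> real" where
  "fundamental_form g J x v w = g x (J x v) w"

definition ext_deriv1 :: "('a::euclidean_space \<Rightarrow> 'a \<Rightarrow> real) \<Rightarrow> 'a \<Rightarrow> 'a \<Rightarrow> 'a \<Rightarrow> real" where
  "ext_deriv1 \<alpha> x u v =
     frechet_derivative (\<lambda>y. \<alpha> y v) (at x) u - frechet_derivative (\<lambda>y. \<alpha> y u) (at x) v"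

definition ext_deriv2 ::
    "('a::euclidean_space \<Rightarrow> 'a \<Rightarrow> 'a \<Rightarrow> real) \<Rightarrow> 'a \<Rightarrow> 'a \<Rightarrow> 'a \<Rightarrow> 'a \<Rightarrow> real" where
  "ext_deriv2 \<omega> x u v w =
     frechet_derivative (\<lambda>y. \<omega> y v w) (at x) u + frechet_derivative (\<lambda>y. \<omega> y w u) (at x) v
     + frechet_derivative (\<lambda>y. \<omega> y u v) (at x) w"

definition kahler_on :: "'a::euclidean_space set \<Rightarrow> 'a metric_field \<Rightarrow> 'a endo_field \<Rightarrow> bool" where
  "kahler_on U g J \<longleftrightarrow>
     riemannian_on U g \<and> complex_structure_on U J \<and>
     (\<forall>x\<in>U. \<forall>v w. g x (J x v) (J x w) = g x v w) \<and>
     (\<forall>x\<in>U. \<forall>u v w. ext_deriv2 (fundamental_form g J) x u v w = 0)"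

definition extremal_kahler_on :: "'a::euclidean_space set \<Rightarrow> 'a metric_field \<Rightarrow> 'a endo_field \<Rightarrow> bool" where
  "extremal_kahler_on U g J \<longleftrightarrow>
     kahler_on U g J \<and> killing_on U g (\<lambda>x. J x (grad g (scalar_curvature g) x))"

definition biholomorphic ::
    "'a::euclidean_space set \<Rightarrow> 'a endo_field \<Rightarrow> 'b::euclidean_space set \<Rightarrow> 'b endo_field \<Rightarrow> bool" where
  "biholomorphic U J V K \<longleftrightarrow>
     (\<exists>\<Phi>. bij_betw \<Phi> U V \<and> smooth_on U \<Phi> \<and> smooth_on V (inv_into U \<Phi>) \<and>
        (\<forall>x\<in>U. \<forall>v. frechet_derivative \<Phi> (at x) (J x v)
                      = K (\<Phi> x) (frechet_derivative \<Phi> (at x) v)))"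

subsection \<open>Ends\<close>

text \<open>The number of ends is the largest number of unbounded components outside a compact set.\<close>

definition unbounded_components :: "'a::euclidean_space set \<Rightarrow> 'a set \<Rightarrow> 'a set set" where
  "unbounded_components U K = {C \<in> components (U - K). \<not> (\<exists>L. compact L \<and> L \<subseteq> U \<and> C \<subseteq> L)}"

definition has_num_ends :: "'a::euclidean_space set \<Rightarrow> nat \<Rightarrow> bool" where
  "has_num_ends U n \<longleftrightarrow>
     (\<forall>K. compact K \<and> K \<subseteq> U \<longrightarrow>
        finite (unbounded_components U K) \<and> card (unbounded_components U K) \<le> n) \<and>
     (\<exists>K. compact K \<and> K \<subseteq> U \<and> card (unbounded_components U K) = n)"

text \<open>A single (Freudenthal) end, given by a neighbourhood basis.\<close>

definition end_of :: "'a::euclidean_space set \<Rightarrow> (nat \<Rightarrow> 'a set) \<Rightarrow> bool" where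
  "end_of U E \<longleftrightarrow>
     (\<forall>n. open (E n) \<and> connected (E n) \<and> E n \<noteq> {} \<and> E n \<subseteq> U \<and> E (Suc n) \<subseteq> E n \<and>
          compact (U \<inter> frontier (E n))) \<and>
     (\<forall>K. compact K \<and> K \<subseteq> U \<longrightarrow> (\<exists>n. E n \<inter> K = {}))"

text \<open>
  ALE end: some neighbourhood of the end is the quotient of the complement of a ball by a
  finite group \<open>\<Gamma>\<close> of orthogonal maps acting freely on the unit sphere, and the metric lifted
  by the quotient map \<open>\<Psi>\<close> agrees with the Euclidean one up to \<open>O(|y|\<^sup>-\<^sup>\<tau>)\<close>, each derivative
  gaining one power of decay.
\<close>

definition ale_end :: "'a::euclidean_space set \<Rightarrow> 'a metric_field \<Rightarrow> (nat \<Rightarrow> 'a set) \<Rightarrow> bool" where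
  "ale_end U g E \<longleftrightarrow>
     end_of U E \<and>
     (\<exists>(\<Gamma> :: ('a \<Rightarrow> 'a) set) R \<tau> (\<Psi> :: 'a \<Rightarrow> 'a) n.
        finite \<Gamma> \<and> id \<in> \<Gamma> \<and> (\<forall>\<gamma>\<in>\<Gamma>. \<forall>\<delta>\<in>\<Gamma>. \<gamma> \<circ> \<delta> \<in> \<Gamma>) \<and>
        (\<forall>\<gamma>\<in>\<Gamma>. orthogonal_transformation \<gamma> \<and> (\<gamma> \<noteq> id \<longrightarrow> (\<forall>y. y \<noteq> 0 \<longrightarrow> \<gamma> y \<noteq> y))) \<and>
        0 < R \<and> 0 < \<tau> \<and>
        smooth_on {y. R < norm y} \<Psi> \<and>
        \<Psi> ` {y. R < norm y} = E n \<and>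
        (\<forall>y. R < norm y \<longrightarrow> inj (frechet_derivative \<Psi> (at y))) \<and>
        (\<forall>y y'. R < norm y \<and> R < norm y' \<longrightarrow> (\<Psi> y = \<Psi> y' \<longleftrightarrow> (\<exists>\<gamma>\<in>\<Gamma>. y' = \<gamma> y))) \<and>
        (\<forall>K. compact K \<and> K \<subseteq> U \<longrightarrow> bounded {y. R < norm y \<and> \<Psi> y \<in> K}) \<and>
        (\<forall>v w bs. set bs \<subseteq> Basis \<longrightarrow>
           (\<exists>C. \<forall>y. R < norm y \<longrightarrow>
              \<bar>iter_deriv bs (\<lambda>y. g (\<Psi> y) (frechet_derivative \<Psi> (at y) v)
                                           (frechet_derivative \<Psi> (at y) w) - v \<bullet> w) y\<bar>
                \<le> C * norm y powr (- \<tau> - real (length bs)))))"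

section \<open>The manifold \<open>(0,\<infinity>) \<times> S\<^sup>3\<close>\<close>

text \<open>
  \<open>S\<^sup>3\<close> is the group of unit quaternions, with \<open>(a, b)\<close> standing for \<open>a + j b\<close>.  The product
  \<open>(0,\<infinity>) \<times> S\<^sup>3\<close> is identified with the punctured unit ball of \<open>\<complex>\<^sup>2\<close> by the diffeomorphism
  \<open>(z, u) \<mapsto> e\<^sup>-\<^sup>z\<^sup>/\<^sup>2 u\<close>.  The 3-spheres contract to the origin as \<open>z \<rightarrow> \<infinity>\<close>, so that adding the nut
  means passing to the whole unit ball.
\<close>

type_synonym c2 = "complex \<times> complex"

definition polar :: "real \<times> c2 \<Rightarrow> c2" where
  "polar = (\<lambda>(z, u). exp (- z / 2) *\<^sub>R u)"

definition collar :: "real set \<Rightarrow> c2 set" where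
  "collar I = polar ` (I \<times> sphere 0 1)"

definition M0 :: "c2 set" where
  "M0 = collar {0<..}"

definition M1 :: "c2 set" where
  "M1 = insert 0 M0"

text \<open>Inverse of \<^const>\<open>polar\<close> in the first variable.  Its value at the nut is meaningless.\<close>

definition zcoord :: "c2 \<Rightarrow> real" where
  "zcoord x = - 2 * ln (norm x)"

text \<open>The limits \<open>z \<rightarrow> 0\<close> and \<open>z \<rightarrow> \<infinity>\<close>; neither filter sees the nut.\<close>

definition to_zero :: "c2 filter" where
  "to_zero = filtercomap zcoord (at_right 0)"

definition to_infinity :: "c2 filter" where
  "to_infinity = filtercomap zcoord at_top"

definition qmult :: "c2 \<Rightarrow> c2 \<Rightarrow> c2" where
  "qmult p q = (fst p * fst q - cnj (snd p) * snd q, cnj (fst p) * snd q + snd p * fst q)"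

definition E1 :: "c2 \<Rightarrow> c2" where "E1 x = qmult x (\<i>, 0)"
definition E2 :: "c2 \<Rightarrow> c2" where "E2 x = qmult x (0, 1)"
definition E3 :: "c2 \<Rightarrow> c2" where "E3 x = qmult x (0, - \<i>)"

definition ddz :: "c2 \<Rightarrow> c2" where "ddz x = - (1 / 2) *\<^sub>R x"

definition eta1 :: "c2 \<Rightarrow> c2 \<Rightarrow> real" where "eta1 x v = (v \<bullet> E1 x) / (norm x)\<^sup>2"
definition eta2 :: "c2 \<Rightarrow> c2 \<Rightarrow> real" where "eta2 x v = (v \<bullet> E2 x) / (norm x)\<^sup>2"
definition eta3 :: "c2 \<Rightarrow> c2 \<Rightarrow> real" where "eta3 x v = (v \<bullet> E3 x) / (norm x)\<^sup>2"

definition dz :: "c2 \<Rightarrow> c2 \<Rightarrow> real" where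
  "dz x v = frechet_derivative zcoord (at x) v"

text \<open>The Hopf fiber through \<open>x\<close>, an integral curve of \<open>2 \<pi> E1\<close>.\<close>

definition hopf_fiber :: "c2 \<Rightarrow> real \<Rightarrow> c2" where
  "hopf_fiber x t = (cis (2 * pi * t) * fst x, cis (2 * pi * t) * snd x)"

subsection \<open>The metrics and complex structures\<close>

definition warped_metric :: "(real \<Rightarrow> real) \<Rightarrow> (real \<Rightarrow> real) \<Rightarrow> c2 metric_field" where
  "warped_metric \<mu> F x v w =
     \<mu> (zcoord x) * (1 / (4 * F (zcoord x)) * (dz x v * dz x w)
        + F (zcoord x) * (eta1 x v * eta1 x w) + eta2 x v * eta2 x w + eta3 x v * eta3 x w)"

text \<open>\<open>J\<^sup>+\<close> and \<open>J\<^sup>-\<close> are obtained for \<open>\<epsilon> = 1\<close> and \<open>\<epsilon> = - 1\<close>.\<close>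

definition J_sign :: "real \<Rightarrow> (real \<Rightarrow> real) \<Rightarrow> c2 endo_field" where
  "J_sign \<epsilon> F x v =
     - (\<epsilon> * (2 * F (zcoord x)) * eta1 x v) *\<^sub>R ddz x + (\<epsilon> * (1 / (2 * F (zcoord x))) * dz x v) *\<^sub>R E1 x
     - eta3 x v *\<^sub>R E2 x + eta2 x v *\<^sub>R E3 x"

abbreviation J_plus :: "(real \<Rightarrow> real) \<Rightarrow> c2 endo_field" where
  "J_plus \<equiv> J_sign 1"

abbreviation J_minus :: "(real \<Rightarrow> real) \<Rightarrow> c2 endo_field" where
  "J_minus \<equiv> J_sign (- 1)"

definition J_std :: "c2 endo_field" where
  "J_std x v = (\<i> * fst v, \<i> * snd v)"

text \<open>\<open>gh\<close> is the smooth extension of \<open>g\<close> over the nut, which is at finite distance.\<close>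

definition extends_over_nut :: "c2 metric_field \<Rightarrow> c2 metric_field \<Rightarrow> bool" where
  "extends_over_nut g gh \<longleftrightarrow>
     riemannian_on M1 gh \<and> (\<forall>x\<in>M0. \<forall>v w. gh x v w = g x v w) \<and>
     ((rdist M1 gh 0) \<longlongrightarrow> 0) to_infinity"

subsection \<open>AmbiKaehler pairs\<close>

definition det_c2 :: "c2 \<Rightarrow> c2 \<Rightarrow> c2 \<Rightarrow> c2 \<Rightarrow> real" where
  "det_c2 a b c d =
     det (vector (map (\<lambda>v. vector [Re (fst v), Im (fst v), Re (snd v), Im (snd v)]) [a, b, c, d])
          :: real^4^4)"

text \<open>The orientation induced by \<open>J\<close> is the one for which all bases \<open>(v, J v, w, J w)\<close> are positive.\<close>

definition opposite_orientations :: "c2 set \<Rightarrow> c2 endo_field \<Rightarrow> c2 endo_field \<Rightarrow> bool" where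
  "opposite_orientations U J K \<longleftrightarrow>
     (\<exists>\<sigma>\<in>{1, - 1}. \<forall>x\<in>U. \<forall>v w.
        (det_c2 v (J x v) w (J x w) \<noteq> 0 \<longrightarrow> sgn (det_c2 v (J x v) w (J x w)) = \<sigma>) \<and>
        (det_c2 v (K x v) w (K x w) \<noteq> 0 \<longrightarrow> sgn (det_c2 v (K x v) w (K x w)) = - \<sigma>))"

definition ambikahler_on ::
    "c2 set \<Rightarrow> c2 metric_field \<Rightarrow> c2 endo_field \<Rightarrow> c2 metric_field \<Rightarrow> c2 endo_field \<Rightarrow> bool" where
  "ambikahler_on U g1 J1 g2 J2 \<longleftrightarrow>
     kahler_on U g1 J1 \<and> kahler_on U g2 J2 \<and>
     opposite_orientations U J1 J2 \<and> conformal_on U g1 g2"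

subsection \<open>The two kinds of ends in the coordinate \<open>z\<close>\<close>

definition z_infinity_end :: "nat \<Rightarrow> c2 set" where
  "z_infinity_end n = collar {real n<..}"

definition z_zero_end :: "nat \<Rightarrow> c2 set" where
  "z_zero_end n = collar {0<..<1 / real (Suc n)}"

text \<open>
  The pseudosphere of radius \<open>A\<close> (curvature \<open>- 1 / A\<^sup>2\<close>) is the half of the tractroid in
  \<open>\<real>\<^sup>3 = \<complex> \<times> \<real>\<close> above its singular rim; its cusp is at height \<open>\<infinity>\<close>.
\<close>

definition pseudosphere :: "real \<Rightarrow> (complex \<times> real) set" where
  "pseudosphere A = {(complex_of_real (A / cosh t) * cis \<theta>, A * (t - tanh t)) | t \<theta>. 0 < t}"

text \<open>
  Near every point of \<open>{0} \<times> S\<^sup>3\<close> there is a smooth map to the Riemannian product of a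
  pseudosphere and a round 2-sphere (both with the metric induced from \<open>\<real>\<^sup>3\<close>), going up the
  cusp as \<open>z \<rightarrow> 0\<close>, such that the difference of \<open>g\<close> and the pulled back product metric tends
  to 0 uniformly, together with all its covariant derivatives, in the norm given by \<open>g\<close>.
  (In particular the map is a local diffeomorphism for small \<open>z\<close>.)  Only local maps can be
  asked for, because the Hopf bundle is not trivial.
\<close>

definition asymptotic_to_pseudosphere_times_sphere :: "c2 metric_field \<Rightarrow> bool" where
  "asymptotic_to_pseudosphere_times_sphere g \<longleftrightarrow>
     (\<exists>A>0. \<exists>B>0. \<forall>u0 \<in> sphere 0 1. \<exists>W a E. \<exists>\<Psi>1 :: c2 \<Rightarrow> complex \<times> real. \<exists>\<Psi>2 :: c2 \<Rightarrow> complex \<times> real.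
        open W \<and> u0 \<in> W \<and> 0 < a \<and> E = polar ` ({0<..<a} \<times> (W \<inter> sphere 0 1)) \<and>
        smooth_on E \<Psi>1 \<and> \<Psi>1 ` E \<subseteq> pseudosphere A \<and>
        smooth_on E \<Psi>2 \<and> \<Psi>2 ` E \<subseteq> sphere 0 B \<and>
        filterlim (\<lambda>x. snd (\<Psi>1 x)) at_top (inf to_zero (principal E)) \<and>
        (\<forall>k. \<exists>\<epsilon>. (\<epsilon> \<longlongrightarrow> 0) (at_right 0) \<and>
           (\<forall>x\<in>E. \<forall>vs. length vs = k + 2 \<longrightarrow>
              \<bar>(cov_deriv g ^^ k)
                 (\<lambda>y ws. g y (ws ! 0) (ws ! 1)
                    - (frechet_derivative \<Psi>1 (at y) (ws ! 0) \<bullet> frechet_derivative \<Psi>1 (at y) (ws ! 1)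
                     + frechet_derivative \<Psi>2 (at y) (ws ! 0) \<bullet> frechet_derivative \<Psi>2 (at y) (ws ! 1)))
                 x vs\<bar>
                \<le> \<epsilon> (zcoord x) * (\<Prod>v\<leftarrow>vs. sqrt (g x v v)))))"

definition cusp_like_end ::
    "c2 set \<Rightarrow> c2 metric_field \<Rightarrow> (real \<Rightarrow> real) \<Rightarrow> (real \<Rightarrow> real) \<Rightarrow> bool" where
  "cusp_like_end U g \<mu> F \<longleftrightarrow>
     end_of U z_zero_end \<and>
     (\<forall>x\<in>M0. \<forall>v w. g x v w = warped_metric \<mu> F x v w) \<and>
     (\<forall>p\<in>U. filterlim (rdist U g p) at_top to_zero) \<and>
     (\<exists>c. c \<noteq> 0 \<and> ((\<lambda>z. F z / z\<^sup>2) \<longlongrightarrow> c) (at_right 0)) \<and>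
     (\<exists>c. c \<noteq> 0 \<and> (\<mu> \<longlongrightarrow> c) (at_right 0)) \<and>
     ((\<lambda>x. rlength g (hopf_fiber x)) \<longlongrightarrow> 0) to_zero \<and>
     asymptotic_to_pseudosphere_times_sphere g"

subsection \<open>The coordinates and the coframe satisfy the intended equations\<close>

lemma zcoord_polar:
  assumes "u \<in> sphere 0 1"
  shows "zcoord (polar (z, u)) = z"
  using assms by (simp add: zcoord_def polar_def)

lemma polar_zcoord:
  assumes "x \<noteq> 0"
  shows "polar (zcoord x, x /\<^sub>R norm x) = x"
  using assms by (simp add: zcoord_def polar_def)

lemma M0_eq: "M0 = ball 0 1 - {0}"
proof
  show "M0 \<subseteq> ball 0 1 - {0}"
  proof
    fix x assume "x \<in> M0"
    then obtain z u where "x = exp (- z / 2) *\<^sub>R u" "0 < z" "norm u = 1"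
      by (auto simp: M0_def collar_def polar_def simp del: scaleR_Pair)
    then show "x \<in> ball 0 1 - {0}" by auto
  qed
  show "ball 0 1 - {0} \<subseteq> M0"
  proof
    fix x :: c2 assume "x \<in> ball 0 1 - {0}"
    then have x: "x \<noteq> 0" "norm x < 1" by auto
    then have "0 < zcoord x" by (simp add: zcoord_def)
    moreover have "x /\<^sub>R norm x \<in> sphere 0 1" using x by simp
    ultimately show "x \<in> M0"
      unfolding M0_def collar_def
      using polar_zcoord[OF x(1)] by (intro image_eqI[where x = "(zcoord x, x /\<^sub>R norm x)"]) auto
  qed
qed

lemma M1_eq: "M1 = ball 0 1"
  by (auto simp: M1_def M0_eq)

lemma qmult_assoc: "qmult (qmult p q) r = qmult p (qmult q r)"
  by (simp add: qmult_def algebra_simps)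

lemma left_invariant:
  "qmult p (E1 x) = E1 (qmult p x)"
  "qmult p (E2 x) = E2 (qmult p x)"
  "qmult p (E3 x) = E3 (qmult p x)"
  by (simp_all add: E1_def E2_def E3_def qmult_assoc)

lemma norm_c2: "(norm x)\<^sup>2 = (Re (fst x))\<^sup>2 + (Im (fst x))\<^sup>2 + (Re (snd x))\<^sup>2 + (Im (snd x))\<^sup>2"
  for x :: c2
  by (simp add: norm_prod_def cmod_power2)

lemma inner_c2:
  "x \<bullet> y = Re (fst x) * Re (fst y) + Im (fst x) * Im (fst y) + Re (snd x) * Re (snd y) + Im (snd x) * Im (snd y)"
  for x y :: c2
  by (simp add: inner_prod_def inner_complex_def)

lemma norm_qmult: "norm (qmult p q) = norm p * norm q"
proof -
  have "(norm (qmult p q))\<^sup>2 = (norm p)\<^sup>2 * (norm q)\<^sup>2"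
    unfolding norm_c2 by (simp add: qmult_def power2_eq_square algebra_simps)
  then show ?thesis by (simp add: power2_eq_iff_nonneg flip: power_mult_distrib)
qed

lemma polar_has_ddz: "((\<lambda>z. polar (z, u)) has_vector_derivative ddz (polar (z, u))) (at z)"
  unfolding polar_def ddz_def split_conv has_vector_derivative_def
  by (auto intro!: derivative_eq_intros simp: fun_eq_iff simp del: scaleR_Pair)

lemma dz_eq:
  assumes "x \<noteq> 0"
  shows "dz x v = - 2 * (v \<bullet> x) / (norm x)\<^sup>2"
proof -
  have "(zcoord has_derivative (\<lambda>v. - 2 * (v \<bullet> x) / (norm x)\<^sup>2)) (at x)"
    unfolding zcoord_def using assms
    by (auto intro!: derivative_eq_intros has_derivative_norm
        simp: fun_eq_iff sgn_div_norm inner_commute field_simps power2_eq_square simp del: scaleR_Pair)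
  from fun_cong[OF frechet_derivative_at[OF this], of v] show ?thesis by (simp add: dz_def)
qed

lemma dual_frame:
  assumes "x \<noteq> 0"
  shows "dz x (ddz x) = 1" "dz x (E1 x) = 0" "dz x (E2 x) = 0" "dz x (E3 x) = 0"
    "eta1 x (ddz x) = 0" "eta1 x (E1 x) = 1" "eta1 x (E2 x) = 0" "eta1 x (E3 x) = 0"
    "eta2 x (ddz x) = 0" "eta2 x (E1 x) = 0" "eta2 x (E2 x) = 1" "eta2 x (E3 x) = 0"
    "eta3 x (ddz x) = 0" "eta3 x (E1 x) = 0" "eta3 x (E2 x) = 0" "eta3 x (E3 x) = 1"
proof -
  have n: "(norm x)\<^sup>2 \<noteq> 0" using assms by simp
  note defs = eta1_def eta2_def eta3_def E1_def E2_def E3_def ddz_def qmult_def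
    dz_eq[OF assms] inner_c2
  show "dz x (ddz x) = 1" "eta1 x (E1 x) = 1" "eta2 x (E2 x) = 1" "eta3 x (E3 x) = 1"
    using n unfolding defs norm_c2 by (simp_all add: divide_eq_eq power2_eq_square algebra_simps)
  show "dz x (E1 x) = 0" "dz x (E2 x) = 0" "dz x (E3 x) = 0"
    "eta1 x (ddz x) = 0" "eta1 x (E2 x) = 0" "eta1 x (E3 x) = 0"
    "eta2 x (ddz x) = 0" "eta2 x (E1 x) = 0" "eta2 x (E3 x) = 0"
    "eta3 x (ddz x) = 0" "eta3 x (E1 x) = 0" "eta3 x (E2 x) = 0"
    unfolding defs by (simp_all add: algebra_simps)
qed

lemma ext_deriv1_quotient:
  fixes E :: "c2 \<Rightarrow> c2"
  assumes "x \<noteq> 0" "bounded_linear E"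
  shows "ext_deriv1 (\<lambda>y w. (w \<bullet> E y) / (norm y)\<^sup>2) x u v =
    ((v \<bullet> E u - u \<bullet> E v) * (norm x)\<^sup>2 - 2 * ((v \<bullet> E x) * (x \<bullet> u) - (u \<bullet> E x) * (x \<bullet> v)))
      / ((norm x)\<^sup>2)\<^sup>2"
proof -
  have "((\<lambda>y. (w \<bullet> E y) / (norm y)\<^sup>2) has_derivative
      (\<lambda>h. ((w \<bullet> E h) * (norm x)\<^sup>2 - (w \<bullet> E x) * (2 * (x \<bullet> h))) / ((norm x)\<^sup>2)\<^sup>2)) (at x)" for w
    unfolding power2_norm_eq_inner using assms(1)
    by (auto intro!: derivative_eq_intros bounded_linear_imp_has_derivative[OF assms(2)]
        simp: fun_eq_iff inner_commute field_simps power2_eq_square)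
  note D = frechet_derivative_at[OF this, symmetric]
  show ?thesis
    unfolding ext_deriv1_def D by (simp add: diff_divide_distrib add_divide_distrib algebra_simps)
qed

lemma bounded_linear_E: "bounded_linear E1" "bounded_linear E2" "bounded_linear E3"
  by (auto intro!: linear_conv_bounded_linear[THEN iffD1] linearI
      simp: E1_def E2_def E3_def qmult_def algebra_simps scaleR_conv_of_real)

lemma structure_equations:
  assumes "x \<noteq> 0"
  shows "ext_deriv1 eta1 x u v = - 2 * (eta2 x u * eta3 x v - eta2 x v * eta3 x u)"
    "ext_deriv1 eta2 x u v = - 2 * (eta3 x u * eta1 x v - eta3 x v * eta1 x u)"
    "ext_deriv1 eta3 x u v = - 2 * (eta1 x u * eta2 x v - eta1 x v * eta2 x u)"
proof -
  have eta: "eta1 = (\<lambda>y w. (w \<bullet> E1 y) / (norm y)\<^sup>2)" "eta2 = (\<lambda>y w. (w \<bullet> E2 y) / (norm y)\<^sup>2)"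
    "eta3 = (\<lambda>y w. (w \<bullet> E3 y) / (norm y)\<^sup>2)"
    by (simp_all add: fun_eq_iff eta1_def eta2_def eta3_def)
  have *: "- 2 * (a / n * (b / n) - c / n * (d / n)) = - 2 * (a * b - c * d) / n\<^sup>2" for a b c d n :: real
    by (simp add: power2_eq_square diff_divide_distrib)
  note coord = E1_def E2_def E3_def qmult_def power2_eq_square
  show "ext_deriv1 eta1 x u v = - 2 * (eta2 x u * eta3 x v - eta2 x v * eta3 x u)"
    unfolding eta ext_deriv1_quotient[OF assms bounded_linear_E(1)] *
    by (rule arg_cong2[where f = "(/)", OF _ refl]) (unfold norm_c2 inner_c2, simp add: coord algebra_simps)
  show "ext_deriv1 eta2 x u v = - 2 * (eta3 x u * eta1 x v - eta3 x v * eta1 x u)"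
    unfolding eta ext_deriv1_quotient[OF assms bounded_linear_E(2)] *
    by (rule arg_cong2[where f = "(/)", OF _ refl]) (unfold norm_c2 inner_c2, simp add: coord algebra_simps)
  show "ext_deriv1 eta3 x u v = - 2 * (eta1 x u * eta2 x v - eta1 x v * eta2 x u)"
    unfolding eta ext_deriv1_quotient[OF assms bounded_linear_E(3)] *
    by (rule arg_cong2[where f = "(/)", OF _ refl]) (unfold norm_c2 inner_c2, simp add: coord algebra_simps)
qed

end

theory Submission imports Defs begin

text \<open>
  Put \<open>\<rho> = x \<bullet> x\<close>, so that \<open>\<rho> = exp (- z)\<close> on the punctured unit ball.  All metrics of the statement then
  have the form \<open>met a\<close>, a conformal factor \<open>a \<rho>\<close> times one rational symmetric form, and that form is smooth
  across the origin: \<open>a = C0\<close> gives the metric of (ii), \<open>a = C0 / \<rho>\<^sup>2\<close> the metric of (i), and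
  \<open>a = C0 / (1 - \<rho>)\<^sup>2\<close> the Taub-NUT metric.  This makes the extension over the nut and the conformal relations
  visible.  In the same way the two complex structures are of the form \<open>Jrad\<close>, and explicit maps
  \<open>x \<mapsto> f \<rho> x\<close>, followed by complex conjugation, carry them to the standard structure of \<open>\<complex>\<^sup>2\<close>, which gives
  integrability; the Kaehler form of (ii) is constant and that of (i) is the pullback of a constant form
  by inversion, so both are closed.

  Completeness follows from functions that are Lipschitz for the Riemannian distance and tend to infinity at
  the ends: \<open>ln (1 - \<rho>)\<close> at the cusp and, for (i), \<open>ln \<rho>\<close> at the puncture
  (\<open>complete_met_M0\<close>, \<open>complete_met_M1\<close>).  The connection of \<open>met a\<close> has a closed form (\<open>christoffel_met\<close>)
  in which the scalar curvature and the Killing equation are computed.  The end at infinity becomes the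
  outside of a ball under inversion, and the pulled back metric differs from the Euclidean one by a symbol of
  order \<open>- 2\<close> (\<open>ale_end_minus\<close>).

  At the cusp, the difference to the product of a pseudosphere and a sphere is estimated in the coframe
  \<open>theta\<close>, which has bounded length and whose members, together with an algebra of bounded invariant functions, are closed under covariant
  differentiation.  Hence every tensor that is \<open>1 - \<rho>\<close> times an expression in that coframe stays of this
  form, and decays, after any number of covariant derivatives (\<open>tens_derivative\<close>, \<open>tens_bound\<close>); that the
  difference of the two metrics is such a tensor is an explicit computation (\<open>cusp_difference\<close>).
\<close>

section \<open>Smooth functions\<close>

lemma iter_deriv_append: "iter_deriv (bs @ cs) f = iter_deriv bs (iter_deriv cs f)"
  by (induction bs) auto

lemma has_derivative_cong_open:
  assumes "open U" "x \<in> U" "\<And>y. y \<in> U \<Longrightarrow> f y = g y"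
  shows "(f has_derivative f') (at x) \<longleftrightarrow> (g has_derivative f') (at x)"
  using assms by (auto elim: has_derivative_transform_within_open)

lemma frechet_derivative_cong_open:
  assumes "open U" "x \<in> U" "\<And>y. y \<in> U \<Longrightarrow> f y = g y"
  shows "frechet_derivative f (at x) = frechet_derivative g (at x)"
  unfolding frechet_derivative_def using has_derivative_cong_open[OF assms] by simp

lemma differentiable_on_cong_open:
  assumes "open U" "\<And>y. y \<in> U \<Longrightarrow> f y = g y"
  shows "f differentiable_on U \<longleftrightarrow> g differentiable_on U"
  using assms has_derivative_cong_open[OF assms(1) _ assms(2)]
  by (simp add: differentiable_on_eq_differentiable_at differentiable_def)

lemma iter_deriv_cong:
  assumes "open U" "\<And>y. y \<in> U \<Longrightarrow> f y = g y" "x \<in> U"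
  shows "iter_deriv bs f x = iter_deriv bs g x"
  using assms(3)
proof (induction bs arbitrary: x)
  case (Cons b bs)
  show ?case
    using frechet_derivative_cong_open[OF assms(1) Cons.prems Cons.IH] by simp
qed (use assms in simp)

definition diff_order :: "nat \<Rightarrow> 'a::euclidean_space set \<Rightarrow> ('a \<Rightarrow> 'b::real_normed_vector) \<Rightarrow> bool" where
  "diff_order n U f \<longleftrightarrow> (\<forall>bs. set bs \<subseteq> Basis \<and> length bs \<le> n \<longrightarrow> iter_deriv bs f differentiable_on U)"

lemma smooth_on_diff_order: "smooth_on U f \<longleftrightarrow> (\<forall>n. diff_order n U f)"
  unfolding smooth_on_def diff_order_def by blast

lemma diff_order_0: "diff_order 0 U f \<longleftrightarrow> f differentiable_on U"
  by (simp add: diff_order_def)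

lemma diff_order_Suc:
  "diff_order (Suc n) U f \<longleftrightarrow>
     f differentiable_on U \<and> (\<forall>b\<in>Basis. diff_order n U (\<lambda>x. frechet_derivative f (at x) b))"
proof -
  have *: "iter_deriv bs (\<lambda>x. frechet_derivative f (at x) b) = iter_deriv (bs @ [b]) f" for bs b
    by (simp add: iter_deriv_append)
  show ?thesis (is "?L \<longleftrightarrow> ?R")
  proof
    assume L: ?L
    have "iter_deriv [] f differentiable_on U"
      using L unfolding diff_order_def by (metis empty_subsetI le0 list.set(1) list.size(3))
    then show ?R
      using L unfolding diff_order_def * by (auto simp del: iter_deriv.simps(2))
  next
    assume R: ?R
    show ?L
      unfolding diff_order_def
    proof (intro allI impI)
      fix bs :: "'a list" assume bs: "set bs \<subseteq> Basis \<and> length bs \<le> Suc n"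
      show "iter_deriv bs f differentiable_on U"
      proof (cases bs rule: rev_cases)
        case Nil with R show ?thesis by simp
      next
        case (snoc cs b)
        with R bs show ?thesis unfolding diff_order_def * by auto
      qed
    qed
  qed
qed

lemma diff_order_mono: "diff_order n U f \<Longrightarrow> m \<le> n \<Longrightarrow> diff_order m U f"
  unfolding diff_order_def by auto

lemma diff_order_differentiable: "diff_order n U f \<Longrightarrow> f differentiable_on U"
  using diff_order_mono[of n U f 0] by (simp add: diff_order_0)

lemma smooth_on_iff:
  "smooth_on U f \<longleftrightarrow>
     f differentiable_on U \<and> (\<forall>b\<in>Basis. smooth_on U (\<lambda>x. frechet_derivative f (at x) b))"
  (is "?L \<longleftrightarrow> ?R")
proof
  assume ?L
  then have n: "diff_order n U f" for n by (simp add: smooth_on_diff_order)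
  show ?R using n[of "Suc _"] diff_order_differentiable[OF n]
    by (auto simp: smooth_on_diff_order diff_order_Suc)
next
  assume R: ?R
  have "diff_order n U f" for n
    using R by (cases n) (auto simp: smooth_on_diff_order diff_order_Suc diff_order_0)
  then show ?L by (simp add: smooth_on_diff_order)
qed

lemma diff_order_cong:
  assumes "open U" "\<And>y. y \<in> U \<Longrightarrow> f y = g y"
  shows "diff_order n U f \<longleftrightarrow> diff_order n U g"
  unfolding diff_order_def
  using differentiable_on_cong_open[OF assms(1) iter_deriv_cong[OF assms]] by simp

lemma smooth_on_cong:
  assumes "open U" "\<And>y. y \<in> U \<Longrightarrow> f y = g y"
  shows "smooth_on U f \<longleftrightarrow> smooth_on U g"
  unfolding smooth_on_diff_order using diff_order_cong[OF assms(1), of f g] assms(2) by simp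

lemma smooth_on_subset:
  assumes "smooth_on U f" "V \<subseteq> U" shows "smooth_on V f"
  using assms unfolding smooth_on_def by (meson differentiable_on_subset)

lemma diff_order_has_derivative:
  assumes "open U" "diff_order n U f" "x \<in> U"
  shows "(f has_derivative frechet_derivative f (at x)) (at x)"
  using diff_order_differentiable[OF assms(2)] assms
  by (simp add: differentiable_on_eq_differentiable_at flip: frechet_derivative_works)

lemma smooth_on_has_derivative:
  assumes "open U" "smooth_on U f" "x \<in> U"
  shows "(f has_derivative frechet_derivative f (at x)) (at x)"
  using assms diff_order_has_derivative unfolding smooth_on_diff_order by blast

lemma diff_orderI:
  assumes "open U" "\<And>x. x \<in> U \<Longrightarrow> (f has_derivative f' x) (at x)"
    "\<And>m b. n = Suc m \<Longrightarrow> b \<in> Basis \<Longrightarrow> diff_order m U (\<lambda>x. f' x b)"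
  shows "diff_order n U f"
proof -
  have d: "f differentiable_on U"
    using assms(1,2) by (auto simp: differentiable_on_eq_differentiable_at differentiable_def)
  have fd: "frechet_derivative f (at x) = f' x" if "x \<in> U" for x
    using frechet_derivative_at[OF assms(2)[OF that]] by simp
  show ?thesis
  proof (cases n)
    case 0 with d show ?thesis by (simp add: diff_order_0)
  next
    case (Suc m)
    have "diff_order m U (\<lambda>x. frechet_derivative f (at x) b)" if "b \<in> Basis" for b
      using assms(3)[OF Suc that] by (subst diff_order_cong[OF assms(1)]) (auto simp: fd)
    with d Suc show ?thesis by (simp add: diff_order_Suc)
  qed
qed

lemma diff_order_const: "open U \<Longrightarrow> diff_order n U (\<lambda>x. c)"
proof (induction n arbitrary: c)
  case (Suc n)
  show ?case
  proof (rule diff_orderI[OF Suc.prems has_derivative_const])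
    fix m and b :: 'a assume "Suc n = Suc m"
    then show "diff_order m U (\<lambda>x. 0 :: 'b)" using Suc by simp
  qed
qed (simp add: diff_order_0)

lemma smooth_on_const: "open U \<Longrightarrow> smooth_on U (\<lambda>x. c)"
  by (simp add: smooth_on_diff_order diff_order_const)

lemma smooth_on_linear:
  assumes "open U" "bounded_linear f" shows "smooth_on U f"
  unfolding smooth_on_diff_order
  by (intro allI diff_orderI[OF assms(1) bounded_linear_imp_has_derivative[OF assms(2)]]
      diff_order_const assms(1))

lemma diff_order_bounded_linear:
  assumes "open U" "bounded_linear h" "diff_order n U f"
  shows "diff_order n U (\<lambda>x. h (f x))"
  using assms(3)
proof (induction n arbitrary: f)
  case (0 f)
  show ?case
    by (rule diff_orderI[OF assms(1) bounded_linear.has_derivative[OF assms(2)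
            diff_order_has_derivative[OF assms(1) 0]]]) auto
next
  case (Suc n f)
  show ?case
    by (rule diff_orderI[OF assms(1) bounded_linear.has_derivative[OF assms(2)
            diff_order_has_derivative[OF assms(1) Suc.prems]]])
      (use Suc in \<open>auto simp: diff_order_Suc\<close>)
qed

lemma diff_order_add:
  assumes "open U" "diff_order n U f" "diff_order n U g"
  shows "diff_order n U (\<lambda>x. f x + g x)"
  using assms(2,3)
proof (induction n arbitrary: f g)
  case (0 f g)
  show ?case
    by (rule diff_orderI[OF assms(1) has_derivative_add[OF
            diff_order_has_derivative[OF assms(1) 0(1)] diff_order_has_derivative[OF assms(1) 0(2)]]]) auto
next
  case (Suc n f g)
  note d = diff_order_has_derivative[OF assms(1) Suc.prems(1)]
    diff_order_has_derivative[OF assms(1) Suc.prems(2)]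
  show ?case
    by (rule diff_orderI[OF assms(1) has_derivative_add[OF d]])
      (use Suc in \<open>auto simp: diff_order_Suc\<close>)
qed

lemma diff_order_bilinear:
  assumes "open U" "bounded_bilinear pr" "diff_order n U f" "diff_order n U g"
  shows "diff_order n U (\<lambda>x. pr (f x) (g x))"
  using assms(3,4)
proof (induction n arbitrary: f g)
  case (0 f g)
  show ?case
    by (rule diff_orderI[OF assms(1) bounded_bilinear.FDERIV[OF assms(2)
            diff_order_has_derivative[OF assms(1) 0(1)] diff_order_has_derivative[OF assms(1) 0(2)]]]) auto
next
  case (Suc n f g)
  note d = diff_order_has_derivative[OF assms(1) Suc.prems(1)]
    diff_order_has_derivative[OF assms(1) Suc.prems(2)]
  show ?case
  proof (rule diff_orderI[OF assms(1) bounded_bilinear.FDERIV[OF assms(2) d]])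
    fix m b assume mb: "Suc n = Suc m" "b \<in> (Basis :: 'a set)"
    have "diff_order n U f" "diff_order n U g"
      "diff_order n U (\<lambda>x. frechet_derivative f (at x) b)"
      "diff_order n U (\<lambda>x. frechet_derivative g (at x) b)"
      using Suc.prems diff_order_mono[OF Suc.prems(1), of n] diff_order_mono[OF Suc.prems(2), of n] mb
      by (auto simp: diff_order_Suc)
    note IH = Suc.IH[OF this(1,4)] Suc.IH[OF this(3,2)]
    show "diff_order m U (\<lambda>x. pr (f x) (frechet_derivative g (at x) b)
        + pr (frechet_derivative f (at x) b) (g x))"
      using diff_order_add[OF assms(1) IH] mb by simp
  qed
qed

lemma diff_order_sum:
  assumes "open U" "\<And>i. i \<in> I \<Longrightarrow> diff_order n U (f i)"
  shows "diff_order n U (\<lambda>x. \<Sum>i\<in>I. f i x)"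
  using assms(2)
  by (induction I rule: infinite_finite_induct)
    (auto intro!: diff_order_add diff_order_const assms(1))

lemma derivative_euclidean_sum:
  fixes D :: "'a::euclidean_space \<Rightarrow> 'b::real_normed_vector"
  assumes "linear D" shows "D v = (\<Sum>i\<in>Basis. (v \<bullet> i) *\<^sub>R D i)"
proof -
  have "D v = D (\<Sum>i\<in>Basis. (v \<bullet> i) *\<^sub>R i)" by (simp add: euclidean_representation)
  also have "\<dots> = (\<Sum>i\<in>Basis. (v \<bullet> i) *\<^sub>R D i)"
    by (simp add: linear_sum[OF assms] linear_scale[OF assms])
  finally show ?thesis .
qed

lemma diff_order_compose:
  fixes f :: "'a::euclidean_space \<Rightarrow> 'b::euclidean_space"
  assumes U: "open U" and V: "open V" and fU: "f ` U \<subseteq> V"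
    and f: "diff_order n U f" and g: "diff_order n V g"
  shows "diff_order n U (\<lambda>x. g (f x))"
  using f g
proof (induction n arbitrary: g)
  case (0 g)
  show ?case
    by (rule diff_orderI[OF U has_derivative_compose[OF diff_order_has_derivative[OF U 0(1)]
            diff_order_has_derivative[OF V 0(2)]]]) (use fU in auto)
next
  case (Suc n g)
  note df = diff_order_has_derivative[OF U Suc.prems(1)]
    and dg = diff_order_has_derivative[OF V Suc.prems(2)]
  have lin: "linear (frechet_derivative g (at (f x)))" if "x \<in> U" for x
    by (rule has_derivative_linear[OF dg]) (use fU that in auto)
  show ?case
  proof (rule diff_orderI[OF U has_derivative_compose[OF df dg]])
    fix m b assume "Suc n = Suc m" and b: "b \<in> (Basis :: 'a set)"
    then have m: "m = n" by simp
    have "diff_order n U f" "diff_order n U (\<lambda>x. frechet_derivative f (at x) b)"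
      using Suc.prems(1) diff_order_mono[OF Suc.prems(1), of n] b by (auto simp: diff_order_Suc)
    moreover have "diff_order n V (\<lambda>y. frechet_derivative g (at y) i)" if "i \<in> Basis" for i
      using Suc.prems(2) that by (simp add: diff_order_Suc)
    ultimately have "diff_order n U (\<lambda>x. \<Sum>i\<in>Basis. (frechet_derivative f (at x) b \<bullet> i)
        *\<^sub>R frechet_derivative g (at (f x)) i)"
      by (intro diff_order_sum[OF U] diff_order_bilinear[OF U bounded_bilinear_scaleR] Suc.IH
          diff_order_bounded_linear[OF U bounded_linear_inner_left])
    then show "diff_order m U (\<lambda>x. frechet_derivative g (at (f x)) (frechet_derivative f (at x) b))"
      unfolding m using derivative_euclidean_sum[OF lin]
      by (subst diff_order_cong[OF U, of _ "\<lambda>x. \<Sum>i\<in>Basis. (frechet_derivative f (at x) b \<bullet> i)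
        *\<^sub>R frechet_derivative g (at (f x)) i"]) auto
  qed (use fU in auto)
qed

lemma smooth_on_bounded_linear:
  "open U \<Longrightarrow> bounded_linear h \<Longrightarrow> smooth_on U f \<Longrightarrow> smooth_on U (\<lambda>x. h (f x))"
  by (simp add: smooth_on_diff_order diff_order_bounded_linear)

lemma smooth_on_add:
  "open U \<Longrightarrow> smooth_on U f \<Longrightarrow> smooth_on U g \<Longrightarrow> smooth_on U (\<lambda>x. f x + g x)"
  by (simp add: smooth_on_diff_order diff_order_add)

lemma smooth_on_minus: "open U \<Longrightarrow> smooth_on U f \<Longrightarrow> smooth_on U (\<lambda>x. - f x)"
  by (rule smooth_on_bounded_linear[OF _ bounded_linear_minus[OF bounded_linear_ident]])

lemma smooth_on_diff:
  "open U \<Longrightarrow> smooth_on U f \<Longrightarrow> smooth_on U g \<Longrightarrow> smooth_on U (\<lambda>x. f x - g x)"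
  using smooth_on_add[of U f "\<lambda>x. - g x"] by (simp add: smooth_on_minus)

lemma smooth_on_bilinear:
  "open U \<Longrightarrow> bounded_bilinear pr \<Longrightarrow> smooth_on U f \<Longrightarrow> smooth_on U g \<Longrightarrow>
    smooth_on U (\<lambda>x. pr (f x) (g x))"
  by (simp add: smooth_on_diff_order diff_order_bilinear)

lemmas smooth_on_scaleR = smooth_on_bilinear[OF _ bounded_bilinear_scaleR]
lemmas smooth_on_mult = smooth_on_bilinear[OF _ bounded_bilinear_mult]
lemmas smooth_on_inner = smooth_on_bilinear[OF _ bounded_bilinear_inner]

lemma smooth_on_power:
  fixes f :: "'a::euclidean_space \<Rightarrow> 'b::real_normed_algebra_1"
  shows "open U \<Longrightarrow> smooth_on U f \<Longrightarrow> smooth_on U (\<lambda>x. f x ^ n)"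
  by (induction n) (auto intro: smooth_on_const smooth_on_mult)

lemma smooth_on_sum:
  "open U \<Longrightarrow> (\<And>i. i \<in> I \<Longrightarrow> smooth_on U (f i)) \<Longrightarrow> smooth_on U (\<lambda>x. \<Sum>i\<in>I. f i x)"
  by (simp add: smooth_on_diff_order diff_order_sum)

lemma smooth_on_compose:
  fixes f :: "'a::euclidean_space \<Rightarrow> 'b::euclidean_space"
  shows "open U \<Longrightarrow> open V \<Longrightarrow> f ` U \<subseteq> V \<Longrightarrow> smooth_on U f \<Longrightarrow> smooth_on V g \<Longrightarrow>
    smooth_on U (\<lambda>x. g (f x))"
  using diff_order_compose[of U V f _ g] by (simp add: smooth_on_diff_order)

lemma smooth_on_ident: "open U \<Longrightarrow> smooth_on U (\<lambda>x. x)"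
  by (rule smooth_on_linear[OF _ bounded_linear_ident])

lemma smooth_on_Pair:
  assumes "open U" "smooth_on U f" "smooth_on U g" shows "smooth_on U (\<lambda>x. (f x, g x))"
proof -
  have *: "bounded_linear (\<lambda>y::'b. (y, 0::'c))" "bounded_linear (\<lambda>y::'c. (0::'b, y))"
    by (auto intro!: bounded_linear_Pair bounded_linear_ident bounded_linear_zero)
  show ?thesis
    using smooth_on_add[OF assms(1) smooth_on_bounded_linear[OF assms(1) *(1) assms(2)]
        smooth_on_bounded_linear[OF assms(1) *(2) assms(3)]] by simp
qed

text \<open>A solution of an autonomous equation is one order smoother than the composite with the
  right-hand side.  This single principle covers the elementary functions.\<close>

lemma smooth_on_autonomous:
  fixes f R :: "real \<Rightarrow> real"
  assumes "open S" "open T" "f ` S \<subseteq> T" "smooth_on T R"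
    "\<And>x. x \<in> S \<Longrightarrow> (f has_real_derivative R (f x)) (at x)"
  shows "smooth_on S f"
proof -
  have d: "(f has_derivative (\<lambda>h. h * R (f x))) (at x)" if "x \<in> S" for x
    using assms(5)[OF that] by (simp add: has_field_derivative_def mult.commute[of _ "R _"])
  have "diff_order n S f" for n
  proof (induction n)
    case 0 show ?case by (rule diff_orderI[OF assms(1) d]) auto
  next
    case (Suc n)
    show ?case
    proof (rule diff_orderI[OF assms(1) d])
      fix m and b :: real assume "Suc n = Suc m" "b \<in> Basis"
      then show "diff_order m S (\<lambda>x. b * R (f x))"
        using diff_order_compose[OF assms(1,2,3) Suc.IH, of R] assms(4)
        by (simp add: smooth_on_diff_order)
    qed auto
  qed
  then show ?thesis by (simp add: smooth_on_diff_order)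
qed

lemma smooth_on_exp_real: "smooth_on UNIV (exp :: real \<Rightarrow> real)"
  by (rule smooth_on_autonomous[where R = "\<lambda>y. y" and T = UNIV])
    (auto intro: smooth_on_ident DERIV_exp)

lemma smooth_on_inverse_real: "smooth_on (- {0}) (inverse :: real \<Rightarrow> real)"
  by (rule smooth_on_autonomous[where R = "\<lambda>y. - (y * y)" and T = UNIV])
    (auto intro!: smooth_on_minus smooth_on_mult smooth_on_ident derivative_eq_intros simp: field_simps)

lemma smooth_on_inverse:
  fixes f :: "'a::euclidean_space \<Rightarrow> real"
  assumes "open U" "smooth_on U f" "\<And>x. x \<in> U \<Longrightarrow> f x \<noteq> 0"
  shows "smooth_on U (\<lambda>x. inverse (f x))"
  using assms by (intro smooth_on_compose[OF _ _ _ _ smooth_on_inverse_real]) auto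

lemma smooth_on_divide:
  fixes f g :: "'a::euclidean_space \<Rightarrow> real"
  assumes "open U" "smooth_on U f" "smooth_on U g" "\<And>x. x \<in> U \<Longrightarrow> g x \<noteq> 0"
  shows "smooth_on U (\<lambda>x. f x / g x)"
  using smooth_on_mult[OF assms(1,2) smooth_on_inverse[OF assms(1,3,4)]]
  by (simp add: divide_inverse)

lemma smooth_on_exp:
  fixes f :: "'a::euclidean_space \<Rightarrow> real"
  assumes "open U" "smooth_on U f" shows "smooth_on U (\<lambda>x. exp (f x))"
  using assms by (intro smooth_on_compose[OF _ _ _ _ smooth_on_exp_real]) auto

lemma smooth_on_sqrt:
  fixes f :: "'a::euclidean_space \<Rightarrow> real"
  assumes "open U" "smooth_on U f" "\<And>x. x \<in> U \<Longrightarrow> 0 < f x"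
  shows "smooth_on U (\<lambda>x. sqrt (f x))"
proof -
  have "smooth_on {0<..} (\<lambda>y::real. inverse (2 * y))"
    by (intro smooth_on_inverse smooth_on_mult smooth_on_const smooth_on_ident) auto
  then have "smooth_on {0<..} sqrt"
    by (rule smooth_on_autonomous[rotated 3])
      (auto intro!: derivative_eq_intros simp: field_simps)
  with assms show ?thesis by (intro smooth_on_compose[OF assms(1) _ _ assms(2)]) auto
qed

lemma smooth_on_ln:
  fixes f :: "'a::euclidean_space \<Rightarrow> real"
  assumes "open U" "smooth_on U f" "\<And>x. x \<in> U \<Longrightarrow> 0 < f x"
  shows "smooth_on U (\<lambda>x. ln (f x))"
proof -
  have "diff_order n {0<..} (ln :: real \<Rightarrow> real)" for n
  proof (rule diff_orderI[where f' = "\<lambda>x h. inverse x * h"])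
    fix m and b :: real assume "b \<in> Basis"
    have "smooth_on {0<..} (\<lambda>x::real. inverse x * b)"
      by (intro smooth_on_mult smooth_on_inverse smooth_on_ident smooth_on_const) auto
    then show "diff_order m {0<..} (\<lambda>x. inverse x * b)" by (simp add: smooth_on_diff_order)
  qed (auto intro!: derivative_eq_intros simp: field_simps)
  then have "smooth_on {0<..} (ln :: real \<Rightarrow> real)" by (simp add: smooth_on_diff_order)
  with assms show ?thesis by (intro smooth_on_compose[OF assms(1) _ _ assms(2)]) auto
qed

lemma smooth_on_continuous_on: "smooth_on U f \<Longrightarrow> continuous_on U f"
  using smooth_on_iff[of U f] differentiable_imp_continuous_on by blast

lemmas smooth_intros = smooth_on_const smooth_on_ident smooth_on_add smooth_on_minus smooth_on_diff
  smooth_on_mult smooth_on_scaleR smooth_on_inner smooth_on_power smooth_on_divide smooth_on_exp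

section \<open>The Riemannian distance\<close>

lemma riemannian_onD:
  assumes "riemannian_on U g"
  shows "open U" "x \<in> U \<Longrightarrow> bilinear (g x)" "x \<in> U \<Longrightarrow> g x v w = g x w v"
    "x \<in> U \<Longrightarrow> v \<noteq> 0 \<Longrightarrow> 0 < g x v v" "smooth_on U (\<lambda>x. g x v w)" "x \<in> U \<Longrightarrow> 0 \<le> g x v v"
proof -
  show "x \<in> U \<Longrightarrow> 0 \<le> g x v v"
    using assms unfolding riemannian_on_def by (cases "v = 0") (auto simp: bilinear_rzero less_imp_le)
qed (use assms in \<open>auto simp: riemannian_on_def\<close>)

lemma bilinear_euclidean_sum:
  fixes B :: "'a::euclidean_space \<Rightarrow> 'a \<Rightarrow> real"
  assumes "bilinear B"
  shows "B v w = (\<Sum>i\<in>Basis. \<Sum>j\<in>Basis. (v \<bullet> i) * (w \<bullet> j) * B i j)"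
proof -
  have l: "\<And>w. linear (\<lambda>v. B v w)" and l2: "\<And>v. linear (B v)"
    using assms by (auto simp: bilinear_def)
  have "B v w = (\<Sum>i\<in>Basis. (v \<bullet> i) *\<^sub>R B i w)" by (rule derivative_euclidean_sum[OF l])
  also have "\<dots> = (\<Sum>i\<in>Basis. (v \<bullet> i) *\<^sub>R (\<Sum>j\<in>Basis. (w \<bullet> j) *\<^sub>R B i j))"
    by (intro sum.cong arg_cong[where f = "scaleR _"] derivative_euclidean_sum[OF l2] refl)
  finally show ?thesis by (simp add: sum_distrib_left mult.assoc)
qed

lemma continuous_on_metric:
  fixes g :: "'a::euclidean_space metric_field"
  assumes g: "riemannian_on U g" and p: "continuous_on S p" "p ` S \<subseteq> U"
    and v: "continuous_on S v" "continuous_on S w"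
  shows "continuous_on S (\<lambda>t. g (p t) (v t) (w t))"
proof -
  have "continuous_on S (\<lambda>t. g (p t) i j)" for i j
    using continuous_on_compose2[OF smooth_on_continuous_on[OF riemannian_onD(5)[OF g]] p(1)] p(2) by auto
  then have "continuous_on S (\<lambda>t. \<Sum>i\<in>Basis. \<Sum>j\<in>Basis. (v t \<bullet> i) * (w t \<bullet> j) * g (p t) i j)"
    by (intro continuous_intros v)
  moreover have "g (p t) (v t) (w t) = (\<Sum>i\<in>Basis. \<Sum>j\<in>Basis. (v t \<bullet> i) * (w t \<bullet> j) * g (p t) i j)"
    if "t \<in> S" for t
    using that p(2) by (intro bilinear_euclidean_sum riemannian_onD(2)[OF g]) auto
  ultimately show ?thesis by (simp cong: continuous_on_cong)
qed

lemma metric_scale: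
  assumes "riemannian_on U g" "x \<in> U"
  shows "g x (c *\<^sub>R v) (c *\<^sub>R v) = c\<^sup>2 * g x v v"
  using riemannian_onD(2)[OF assms]
  by (simp add: bilinear_lmul bilinear_rmul power2_eq_square)

lemma metric_bounds_compact:
  fixes g :: "'a::euclidean_space metric_field"
  assumes g: "riemannian_on U g" and K: "compact K" "K \<subseteq> U"
  obtains c C where "0 < c" "0 < C"
    "\<And>x v. x \<in> K \<Longrightarrow> c * norm v \<le> sqrt (g x v v)" "\<And>x v. x \<in> K \<Longrightarrow> sqrt (g x v v) \<le> C * norm v"
proof (cases "K = {}")
  case True then show ?thesis using that[of 1 1] by auto
next
  case False
  let ?S = "K \<times> sphere (0::'a) 1"
  let ?f = "\<lambda>y. sqrt (g (fst y) (snd y) (snd y))"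
  have S: "compact ?S" using K by (intro compact_Times) auto
  have "sphere (0::'a) 1 \<noteq> {}" by simp
  then have ne: "?S \<noteq> {}" using False by simp
  have cont: "continuous_on ?S ?f"
    by (intro continuous_intros continuous_on_metric[OF g]) (use K in auto)
  obtain a where a: "a \<in> ?S" "\<And>y. y \<in> ?S \<Longrightarrow> ?f a \<le> ?f y"
    using continuous_attains_inf[OF S ne cont] by blast
  obtain b where b: "b \<in> ?S" "\<And>y. y \<in> ?S \<Longrightarrow> ?f y \<le> ?f b"
    using continuous_attains_sup[OF S ne cont] by blast
  have a0: "0 < ?f a" using a(1) K riemannian_onD(4)[OF g, of "fst a" "snd a"] by force
  have b0: "0 < ?f b" using a(2)[OF b(1)] a0 by linarith
  have *: "?f a * norm v \<le> sqrt (g x v v) \<and> sqrt (g x v v) \<le> ?f b * norm v" if x: "x \<in> K" for x v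
  proof (cases "v = 0")
    case True
    then show ?thesis using riemannian_onD(2)[OF g, of x] x K by (auto simp: bilinear_rzero)
  next
    case False
    have y: "(x, v /\<^sub>R norm v) \<in> ?S" using x False by auto
    have "sqrt (g x v v) = sqrt (g x (norm v *\<^sub>R (v /\<^sub>R norm v)) (norm v *\<^sub>R (v /\<^sub>R norm v)))"
      using False by simp
    also have "\<dots> = norm v * ?f (x, v /\<^sub>R norm v)"
      using x K by (subst metric_scale[OF g]) (auto simp: real_sqrt_mult)
    finally show ?thesis using a(2)[OF y] b(2)[OF y] by (simp add: mult.commute mult_left_mono)
  qed
  show ?thesis by (rule that[OF a0 b0]) (use * in auto)
qed

definition admissible where
  "admissible U g x y p \<longleftrightarrow> valid_path p \<and> path_image p \<subseteq> U \<and> pathstart p = x \<and>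
     pathfinish p = y \<and> rspeed g p integrable_on {0..1}"

lemma rdist_alt:
  "rdist U g x y = (if x \<in> U \<and> y \<in> U then Inf (rlength g ` {p. admissible U g x y p}) else 0)"
proof -
  have "{rlength g p | p. admissible U g x y p} = rlength g ` {p. admissible U g x y p}" by blast
  then show ?thesis unfolding rdist_def admissible_def by simp
qed

lemma admissible_in: "admissible U g x y p \<Longrightarrow> t \<in> {0..1} \<Longrightarrow> p t \<in> U"
  unfolding admissible_def path_image_def by auto

lemma rspeed_nonneg:
  assumes "riemannian_on U g" "p t \<in> U" shows "0 \<le> rspeed g p t"
  using riemannian_onD(6)[OF assms] by (simp add: rspeed_def)

lemma rlength_nonneg:
  assumes "riemannian_on U g" "admissible U g x y p" shows "0 \<le> rlength g p"
  unfolding rlength_def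
  using assms rspeed_nonneg[OF assms(1)] admissible_in[OF assms(2)]
  by (intro integral_nonneg) (auto simp: admissible_def)

lemma rlength_bdd_below:
  "riemannian_on U g \<Longrightarrow> bdd_below (rlength g ` {p. admissible U g x y p})"
  by (rule bdd_belowI[where m = 0]) (auto intro: rlength_nonneg)

lemma rdist_le_rlength:
  assumes "riemannian_on U g" "admissible U g x y p" shows "rdist U g x y \<le> rlength g p"
proof -
  have "x \<in> U" "y \<in> U"
    using assms(2) pathstart_in_path_image[of p] pathfinish_in_path_image[of p]
    by (auto simp: admissible_def)
  then show ?thesis
    unfolding rdist_alt using assms by (auto intro!: cINF_lower rlength_bdd_below)
qed

lemma valid_path_exceptions:
  assumes "valid_path p"
  obtains S where "finite S" "continuous_on {0..1} p" "\<And>t. t \<in> {0..1} - S \<Longrightarrow> p differentiable (at t)"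
  using assms unfolding valid_path_def piecewise_C1_differentiable_on_def C1_differentiable_on_eq by blast

lemma admissible_C1:
  assumes g: "riemannian_on U g" and p: "p C1_differentiable_on {0..1}" "path_image p \<subseteq> U"
  shows "admissible U g (pathstart p) (pathfinish p) p"
proof -
  have c: "continuous_on {0..1} (\<lambda>t. vector_derivative p (at t))" "continuous_on {0..1} p"
    using p(1) C1_differentiable_imp_piecewise[OF p(1)]
    by (auto simp: C1_differentiable_on_eq piecewise_C1_differentiable_on_def)
  have "continuous_on {0..1} (rspeed g p)"
    unfolding rspeed_def
    by (intro continuous_intros continuous_on_metric[OF g] c) (use p in \<open>auto simp: path_image_def\<close>)
  then show ?thesis
    unfolding admissible_def valid_path_def
    using p C1_differentiable_imp_piecewise by (auto intro: integrable_continuous_real)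
qed

lemma admissible_linepath:
  assumes "riemannian_on U g" "closed_segment x y \<subseteq> U"
  shows "admissible U g x y (linepath x y)"
proof -
  have "linepath x y C1_differentiable_on {0..1}"
    unfolding C1_differentiable_on_def
    by (intro exI[of _ "\<lambda>_. y - x"]) (auto simp: has_vector_derivative_linepath_within)
  from admissible_C1[OF assms(1) this] show ?thesis using assms(2) by simp
qed

lemma rdist_segment_le:
  assumes g: "riemannian_on U g" and s: "closed_segment x y \<subseteq> U"
    and C: "\<And>z v. z \<in> closed_segment x y \<Longrightarrow> sqrt (g z v v) \<le> C * norm v"
  shows "rdist U g x y \<le> C * norm (y - x)"
proof -
  have a: "admissible U g x y (linepath x y)" by (rule admissible_linepath[OF g s])
  have "rlength g (linepath x y) \<le> integral {0..1} (\<lambda>t::real. C * norm (y - x))"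
    unfolding rlength_def
  proof (rule integral_le)
    show "rspeed g (linepath x y) integrable_on {0..1}" using a by (simp add: admissible_def)
    fix t :: real assume "t \<in> {0..1}"
    then show "rspeed g (linepath x y) t \<le> C * norm (y - x)"
      unfolding rspeed_def using linepath_in_path[of t x y]
      by (auto intro!: C simp: vector_derivative_linepath_at)
  qed auto
  with rdist_le_rlength[OF g a] show ?thesis by simp
qed

lemma admissible_exists:
  fixes g :: "'a::euclidean_space metric_field"
  assumes g: "riemannian_on U g" and c: "connected U" "x \<in> U" "y \<in> U"
  shows "\<exists>p. admissible U g x y p"
proof -
  obtain p where p: "polynomial_function p" "path_image p \<subseteq> U" "pathstart p = x" "pathfinish p = y"
    using connected_open_polynomial_connected[OF riemannian_onD(1)[OF g] c] by blast
  obtain p' where p': "polynomial_function p'" "\<And>t. (p has_vector_derivative p' t) (at t)"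
    using has_vector_derivative_polynomial_function[OF p(1)] by blast
  have "p C1_differentiable_on {0..1}"
    unfolding C1_differentiable_on_def using p' continuous_on_polymonial_function[OF p'(1)] by blast
  with admissible_C1[OF g this p(2)] p show ?thesis by auto
qed

lemma rspeed_has_integral:
  "admissible U g x y p \<Longrightarrow> (rspeed g p has_integral rlength g p) {0..1}"
  by (simp add: admissible_def rlength_def has_integral_iff)

text \<open>The only tool used for bounding distances from below.\<close>

lemma lipschitz_rlength:
  fixes h :: "'a::euclidean_space \<Rightarrow> real"
  assumes g: "riemannian_on U g" and a: "admissible U g x y p"
    and h: "\<And>z. z \<in> U \<Longrightarrow> (h has_derivative h' z) (at z)"
    and K: "\<And>z v. z \<in> U \<Longrightarrow> \<bar>h' z v\<bar> \<le> K * sqrt (g z v v)"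
  shows "\<bar>h y - h x\<bar> \<le> K * rlength g p"
proof -
  have vp: "valid_path p" "pathstart p = x" "pathfinish p = y" using a by (auto simp: admissible_def)
  obtain S where S: "finite S" "continuous_on {0..1} p" "\<And>t. t \<in> {0..1} - S \<Longrightarrow> p differentiable (at t)"
    using valid_path_exceptions[OF vp(1)] by blast
  define f' where "f' t = h' (p t) (vector_derivative p (at t))" for t
  have hc: "continuous_on U h"
    using h by (meson continuous_at_imp_continuous_on has_derivative_continuous)
  have 1: "(f' has_integral ((h \<circ> p) 1 - (h \<circ> p) 0)) {0..1}"
  proof (rule fundamental_theorem_of_calculus_strong[OF S(1)])
    fix t assume t: "t \<in> {0..1} - S"
    have "(p has_vector_derivative vector_derivative p (at t)) (at t)"
      using S(3)[OF t] vector_derivative_works by blast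
    from vector_derivative_diff_chain_within[OF this has_derivative_at_withinI[OF h]]
    show "((h \<circ> p) has_vector_derivative f' t) (at t)"
      unfolding f'_def using admissible_in[OF a, of t] t by (auto simp: o_def)
  next
    show "continuous_on {0..1} (h \<circ> p)"
      by (rule continuous_on_compose[OF S(2) continuous_on_subset[OF hc]])
        (use admissible_in[OF a] in auto)
  qed simp
  have "norm (f' t) \<le> K * rspeed g p t" if "t \<in> {0..1}" for t
    using K[OF admissible_in[OF a that]] by (simp add: f'_def rspeed_def)
  then have "norm (integral {0..1} f') \<le> integral {0..1} (\<lambda>t. K * rspeed g p t)"
    using 1 rspeed_has_integral[OF a]
    by (intro integral_norm_bound_integral integrable_on_mult_right)
      (simp_all add: has_integral_iff)
  also have "integral {0..1} f' = h y - h x"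
    using 1 vp by (simp add: has_integral_iff pathstart_def pathfinish_def)
  finally show ?thesis by (simp add: rlength_def)
qed

lemma lipschitz_rdist:
  fixes h :: "'a::euclidean_space \<Rightarrow> real"
  assumes g: "riemannian_on U g" and c: "connected U" "x \<in> U" "y \<in> U"
    and h: "\<And>z. z \<in> U \<Longrightarrow> (h has_derivative h' z) (at z)"
    and K: "\<And>z v. z \<in> U \<Longrightarrow> \<bar>h' z v\<bar> \<le> K * sqrt (g z v v)" "0 < K"
  shows "\<bar>h y - h x\<bar> \<le> K * rdist U g x y"
proof -
  have "\<bar>h y - h x\<bar> / K \<le> Inf (rlength g ` {p. admissible U g x y p})"
    using admissible_exists[OF g c] lipschitz_rlength[OF g _ h K(1)] K(2)
    by (intro cINF_greatest) (auto simp: field_simps)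
  then show ?thesis using c K(2) by (simp add: rdist_alt field_simps)
qed

lemma admissible_reverse:
  assumes a: "admissible U g x y p" and g: "riemannian_on U g"
  shows "admissible U g y x (reversepath p)" "rlength g (reversepath p) = rlength g p"
proof -
  have vp: "valid_path p" using a by (auto simp: admissible_def)
  obtain S where S: "finite S" "\<And>t. t \<in> {0..1} - S \<Longrightarrow> p differentiable (at t)"
    using valid_path_exceptions[OF vp] by metis
  have eq: "rspeed g (reversepath p) t = rspeed g p (1 - t)" if t: "t \<in> {0..1} - (\<lambda>t. 1 - t) ` S" for t
  proof -
    have "1 - t \<in> {0..1} - S" using t by (auto simp: image_iff)
    then have d: "(p has_vector_derivative vector_derivative p (at (1 - t))) (at (1 - t))"
      using S(2) vector_derivative_works by blast
    have "(p \<circ> (\<lambda>x. 1 - x) has_vector_derivative -1 *\<^sub>R vector_derivative p (at (1 - t))) (at t)"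
      by (rule vector_diff_chain_at, unfold has_real_derivative_iff_has_vector_derivative[symmetric])
        (use d in \<open>auto intro!: derivative_eq_intros\<close>)
    then have "vector_derivative (reversepath p) (at t) = - vector_derivative p (at (1 - t))"
      by (intro vector_derivative_at) (simp add: reversepath_def o_def)
    then show ?thesis
      unfolding rspeed_def
      using metric_scale[OF g, of "p (1 - t)" "-1"] admissible_in[OF a, of "1 - t"] t
      by (simp add: reversepath_def)
  qed
  have "((\<lambda>t. rspeed g p (1 - t)) has_integral rlength g p) {0..1}"
    using has_integral_affinity01[OF rspeed_has_integral[OF a], where m = "-1" and c = 1] by simp
  then have i: "(rspeed g (reversepath p) has_integral rlength g p) {0..1}"
    by (rule has_integral_spike_finite[OF finite_imageI[OF S(1)] eq, rotated])
  then show "rlength g (reversepath p) = rlength g p" by (simp add: rlength_def has_integral_iff)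
  from i show "admissible U g y x (reversepath p)"
    using a by (auto simp: admissible_def has_integral_iff)
qed

lemma rdist_commute_le:
  fixes g :: "'a::euclidean_space metric_field"
  assumes g: "riemannian_on U g" and c: "connected U" "x \<in> U" "y \<in> U"
  shows "rdist U g x y \<le> rdist U g y x"
proof -
  have "rdist U g x y \<le> rlength g p" if "admissible U g y x p" for p
    using rdist_le_rlength[OF g admissible_reverse(1)[OF that g]] admissible_reverse(2)[OF that g] by simp
  then have "rdist U g x y \<le> Inf (rlength g ` {p. admissible U g y x p})"
    using admissible_exists[OF g c(1,3,2)] by (intro cINF_greatest) auto
  then show ?thesis using c by (simp add: rdist_alt)
qed

lemma admissible_join:
  assumes a1: "admissible U g x y p" and a2: "admissible U g y z q" and g: "riemannian_on U g"
  shows "admissible U g x z (p +++ q)" "rlength g (p +++ q) = rlength g p + rlength g q"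
proof -
  have vp: "valid_path p" "valid_path q" "pathfinish p = pathstart q"
    using a1 a2 by (auto simp: admissible_def)
  obtain S1 where S1: "finite S1" "\<And>t. t \<in> {0..1} - S1 \<Longrightarrow> p differentiable (at t)"
    using valid_path_exceptions[OF vp(1)] by metis
  obtain S2 where S2: "finite S2" "\<And>t. t \<in> {0..1} - S2 \<Longrightarrow> q differentiable (at t)"
    using valid_path_exceptions[OF vp(2)] by metis
  have scale: "sqrt (g w (2 *\<^sub>R v) (2 *\<^sub>R v)) = 2 * sqrt (g w v v)" if "w \<in> U" for w v
    using metric_scale[OF g that, of 2 v] by (simp add: real_sqrt_mult)
  have e1: "rspeed g (p +++ q) t = 2 * rspeed g p (2 * t)"
    if t: "t \<in> {0..1/2} - insert (1/2) ((*) 2 -` S1)" for t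
  proof -
    have t': "2 * t \<in> {0..1} - S1" "t < 1/2" using t by auto
    then have d: "(p has_vector_derivative vector_derivative p (at (2 * t))) (at (2 * t))"
      using S1(2) vector_derivative_works by blast
    have "(p \<circ> (\<lambda>x. 2 * x) has_vector_derivative 2 *\<^sub>R vector_derivative p (at (2 * t))) (at t)"
      by (rule vector_diff_chain_at, unfold has_real_derivative_iff_has_vector_derivative[symmetric])
        (use d in \<open>auto intro!: derivative_eq_intros\<close>)
    then have "((p +++ q) has_vector_derivative 2 *\<^sub>R vector_derivative p (at (2 * t))) (at t)"
      by (rule has_vector_derivative_transform_within_open[where S = "{..<1/2}"])
        (use t' in \<open>auto simp: joinpaths_def\<close>)
    then have "vector_derivative (p +++ q) (at t) = 2 *\<^sub>R vector_derivative p (at (2 * t))"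
      by (rule vector_derivative_at)
    then show ?thesis
      unfolding rspeed_def using scale[OF admissible_in[OF a1, of "2 * t"]] t' by (simp add: joinpaths_def)
  qed
  have e2: "rspeed g (p +++ q) t = 2 * rspeed g q (2 * t - 1)"
    if t: "t \<in> {1/2..1} - insert (1/2) ((\<lambda>t. 2 * t - 1) -` S2)" for t
  proof -
    have t': "2 * t - 1 \<in> {0..1} - S2" "t > 1/2" using t by auto
    then have d: "(q has_vector_derivative vector_derivative q (at (2 * t - 1))) (at (2 * t - 1))"
      using S2(2) vector_derivative_works by blast
    have "(q \<circ> (\<lambda>x. 2 * x - 1) has_vector_derivative 2 *\<^sub>R vector_derivative q (at (2 * t - 1))) (at t)"
      by (rule vector_diff_chain_at, unfold has_real_derivative_iff_has_vector_derivative[symmetric])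
        (use d in \<open>auto intro!: derivative_eq_intros\<close>)
    then have "((p +++ q) has_vector_derivative 2 *\<^sub>R vector_derivative q (at (2 * t - 1))) (at t)"
      by (rule has_vector_derivative_transform_within_open[where S = "{1/2<..}"])
        (use t' in \<open>auto simp: joinpaths_def\<close>)
    then have "vector_derivative (p +++ q) (at t) = 2 *\<^sub>R vector_derivative q (at (2 * t - 1))"
      by (rule vector_derivative_at)
    then show ?thesis
      unfolding rspeed_def using scale[OF admissible_in[OF a2, of "2 * t - 1"]] t' by (simp add: joinpaths_def)
  qed
  have i1: "((\<lambda>t. 2 * rspeed g p (2 * t)) has_integral rlength g p) {0..1/2}"
    and i2: "((\<lambda>t. 2 * rspeed g q (2 * t - 1)) has_integral rlength g q) {1/2..1}"
    using has_integral_affinity01[OF rspeed_has_integral[OF a1], where m = 2 and c = 0,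
        THEN has_integral_cmul[where c = 2]]
      has_integral_affinity01[OF rspeed_has_integral[OF a2], where m = 2 and c = "-1",
        THEN has_integral_cmul[where c = 2]]
    by (simp_all only: image_affinity_atLeastAtMost_div_diff, simp_all)
  have "(rspeed g (p +++ q) has_integral rlength g p) {0..1/2}"
  proof (rule has_integral_spike_finite[OF _ e1 i1])
    show "finite (insert (1/2) ((*) 2 -` S1))"
      using S1(1) by (force intro: finite_vimageI[where h = "(*) 2"] inj_onI)
  qed
  moreover have "(rspeed g (p +++ q) has_integral rlength g q) {1/2..1}"
  proof (rule has_integral_spike_finite[OF _ e2 i2])
    show "finite (insert (1/2) ((\<lambda>t. 2 * t - 1) -` S2))"
      using S2(1) by (force intro: finite_vimageI[where h = "\<lambda>t. 2 * t - 1"] inj_onI)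
  qed
  ultimately have i: "(rspeed g (p +++ q) has_integral rlength g p + rlength g q) {0..1}"
    using has_integral_combine[where c = "1/2" and a = 0 and b = "1::real"] by auto
  then show "rlength g (p +++ q) = rlength g p + rlength g q" by (simp add: rlength_def has_integral_iff)
  from i show "admissible U g x z (p +++ q)"
    using a1 a2 vp by (auto simp: admissible_def has_integral_iff valid_path_join path_image_join)
qed

lemma rdist_triangle:
  fixes g :: "'a::euclidean_space metric_field"
  assumes g: "riemannian_on U g" and c: "connected U" "x \<in> U" "y \<in> U" "z \<in> U"
  shows "rdist U g x z \<le> rdist U g x y + rdist U g y z"
proof -
  have "rdist U g x z \<le> rlength g p + rlength g q"
    if "admissible U g x y p" "admissible U g y z q" for p q
    using rdist_le_rlength[OF g admissible_join(1)[OF that g]] admissible_join(2)[OF that g] by simp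
  then have "rdist U g x z - rlength g p \<le> Inf (rlength g ` {q. admissible U g y z q})"
    if "admissible U g x y p" for p
    using admissible_exists[OF g c(1,3,4)] that by (intro cINF_greatest) force+
  then have "rdist U g x z - Inf (rlength g ` {q. admissible U g y z q})
      \<le> Inf (rlength g ` {q. admissible U g x y q})"
    using admissible_exists[OF g c(1,2,3)] by (intro cINF_greatest) force+
  then show ?thesis using c by (simp add: rdist_alt)
qed

text \<open>Distinct points are separated by a \<open>C\<^sup>1\<close> bump function, which is Lipschitz.\<close>

lemma rdist_pos:
  fixes g :: "'a::euclidean_space metric_field"
  assumes g: "riemannian_on U g" and c: "connected U" "x \<in> U" "y \<in> U" and ne: "x \<noteq> y"
  shows "0 < rdist U g x y"
proof -
  obtain e0 where e0: "0 < e0" "cball x e0 \<subseteq> U"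
    using riemannian_onD(1)[OF g] c(2) open_contains_cball by blast
  define e where "e = min e0 (dist x y)"
  have e: "0 < e" "cball x e \<subseteq> U" "e \<le> dist x y" using e0 ne by (auto simp: e_def)
  obtain k where k: "0 < k" "\<And>z v. z \<in> cball x e \<Longrightarrow> k * norm v \<le> sqrt (g z v v)"
    using metric_bounds_compact[OF g compact_cball e(2)] by metis
  define \<psi> where "\<psi> s = (if s \<le> e\<^sup>2 then (e\<^sup>2 - s)\<^sup>2 else 0)" for s :: real
  define \<psi>' where "\<psi>' s = (if s \<le> e\<^sup>2 then - 2 * (e\<^sup>2 - s) else 0)" for s :: real
  have psi: "(\<psi> has_real_derivative \<psi>' s) (at s)" for s
  proof -
    consider "s < e\<^sup>2" | "s > e\<^sup>2" | "s = e\<^sup>2" by linarith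
    then show ?thesis
    proof cases
      case 1
      have "((\<lambda>s. (e\<^sup>2 - s)\<^sup>2) has_real_derivative \<psi>' s) (at s)"
        using 1 by (auto intro!: derivative_eq_intros simp: \<psi>'_def)
      then show ?thesis
        by (rule has_field_derivative_transform_within_open[where S = "{..<e\<^sup>2}"])
          (use 1 in \<open>auto simp: \<psi>_def\<close>)
    next
      case 2
      have "((\<lambda>s. 0) has_real_derivative \<psi>' s) (at s)" using 2 by (auto simp: \<psi>'_def)
      then show ?thesis
        by (rule has_field_derivative_transform_within_open[where S = "{e\<^sup>2<..}"])
          (use 2 in \<open>auto simp: \<psi>_def\<close>)
    next
      case 3
      have "((\<lambda>t. (\<psi> t - \<psi> s) / (t - s)) \<longlongrightarrow> 0) (at s)"
      proof (rule Lim_null_comparison)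
        show "\<forall>\<^sub>F t in at s. norm ((\<psi> t - \<psi> s) / (t - s)) \<le> \<bar>t - s\<bar>"
          using 3 by (auto simp: \<psi>_def power2_eq_square abs_mult eventually_at_filter)
        show "((\<lambda>t. \<bar>t - s\<bar>) \<longlongrightarrow> 0) (at s)"
          by (auto intro!: tendsto_eq_intros)
      qed
      then show ?thesis using 3 by (simp add: has_field_derivative_iff \<psi>'_def)
    qed
  qed
  define h where "h z = \<psi> ((z - x) \<bullet> (z - x))" for z
  have h: "(h has_derivative (\<lambda>v. \<psi>' ((z - x) \<bullet> (z - x)) * (2 * ((z - x) \<bullet> v)))) (at z)" for z
    unfolding h_def
    by (rule has_derivative_compose[OF _ psi[unfolded has_field_derivative_def], THEN has_derivative_eq_rhs])
      (auto intro!: derivative_eq_intros simp: inner_commute)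
  have "\<bar>\<psi>' ((z - x) \<bullet> (z - x)) * (2 * ((z - x) \<bullet> v))\<bar> \<le> (4 * e\<^sup>2 * e / k) * sqrt (g z v v)"
    if z: "z \<in> U" for z v
  proof (cases "z \<in> cball x e")
    case True
    have n: "norm (z - x) \<le> e" using True by (simp add: dist_norm norm_minus_commute)
    then have "(z - x) \<bullet> (z - x) \<le> e\<^sup>2" unfolding dot_square_norm by (simp add: power_mono)
    then have "\<bar>\<psi>' ((z - x) \<bullet> (z - x))\<bar> \<le> 2 * e\<^sup>2" by (simp add: \<psi>'_def)
    moreover have "\<bar>(z - x) \<bullet> v\<bar> \<le> e * norm v"
      using Cauchy_Schwarz_ineq2[of "z - x" v] n mult_right_mono[OF n norm_ge_zero[of v]] by linarith
    ultimately have "\<bar>\<psi>' ((z - x) \<bullet> (z - x)) * (2 * ((z - x) \<bullet> v))\<bar> \<le> (2 * e\<^sup>2) * (2 * (e * norm v))"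
      unfolding abs_mult by (intro mult_mono) auto
    also have "\<dots> = (4 * e\<^sup>2 * e / k) * (k * norm v)" using k(1) by simp
    also have "\<dots> \<le> (4 * e\<^sup>2 * e / k) * sqrt (g z v v)"
      using e k by (intro mult_left_mono k(2)[OF True]) auto
    finally show ?thesis .
  next
    case False
    then have "e < norm (z - x)" by (simp add: dist_norm norm_minus_commute)
    then have "e\<^sup>2 < (z - x) \<bullet> (z - x)" unfolding dot_square_norm using e by (intro power_strict_mono) auto
    then show ?thesis using e k riemannian_onD(6)[OF g z] by (simp add: \<psi>'_def)
  qed
  from lipschitz_rdist[OF g c h this]
  have "\<bar>h y - h x\<bar> \<le> (4 * e\<^sup>2 * e / k) * rdist U g x y" using e k by simp
  moreover have "h x = e\<^sup>2 * e\<^sup>2" by (simp add: h_def \<psi>_def power2_eq_square)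
  moreover have "e\<^sup>2 \<le> (y - x) \<bullet> (y - x)"
    unfolding dot_square_norm using e by (intro power_mono) (auto simp: dist_norm norm_minus_commute)
  then have "h y = 0" by (auto simp: h_def \<psi>_def)
  moreover have "0 < e\<^sup>2 * e\<^sup>2" using e by simp
  ultimately have "0 < (4 * e\<^sup>2 * e / k) * rdist U g x y" by linarith
  moreover have "0 < 4 * e\<^sup>2 * e / k" using e k by simp
  ultimately show ?thesis by (rule zero_less_mult_pos)
qed

lemma metric_space_rdist:
  fixes g :: "'a::euclidean_space metric_field"
  assumes g: "riemannian_on U g" and c: "connected U"
  shows "Metric_space U (rdist U g)"
proof
  show nn: "0 \<le> rdist U g x y" for x y
    unfolding rdist_alt using admissible_exists[OF g c, of x y] rlength_nonneg[OF g, of x y]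
    by (simp, intro impI cINF_greatest) auto
  show "rdist U g x y = rdist U g y x" for x y
    using rdist_commute_le[OF g c, of x y] rdist_commute_le[OF g c, of y x] by (auto simp: rdist_def)
  show "rdist U g x y = 0 \<longleftrightarrow> x = y" if "x \<in> U" "y \<in> U" for x y
  proof
    assume "x = y"
    then have "closed_segment x y \<subseteq> U" using that by simp
    have x: "compact {x}" "{x} \<subseteq> U" using that by auto
    obtain C where "\<And>z v. z \<in> {x} \<Longrightarrow> sqrt (g z v v) \<le> C * norm v"
      using metric_bounds_compact[OF g x] by metis
    then have "rdist U g x y \<le> C * norm (y - x)"
      using \<open>x = y\<close> that by (intro rdist_segment_le[OF g]) auto
    then show "rdist U g x y = 0" using nn[of x y] \<open>x = y\<close> by simp
  qed (use rdist_pos[OF g c that] in fastforce)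
  show "rdist U g x z \<le> rdist U g x y + rdist U g y z" if "x \<in> U" "y \<in> U" "z \<in> U" for x y z
    by (rule rdist_triangle[OF g c that])
qed

text \<open>Near a point the distance is bounded by a multiple of the Euclidean one.\<close>

lemma rdist_tendsto:
  fixes g :: "'a::euclidean_space metric_field"
  assumes g: "riemannian_on U g" and c: "connected U" and l: "l \<in> U" and s: "(s \<longlongrightarrow> l) net"
  shows "((\<lambda>n. rdist U g (s n) l) \<longlongrightarrow> 0) net"
proof -
  interpret Metric_space U "rdist U g" by (rule metric_space_rdist[OF g c])
  obtain e where e: "0 < e" "cball l e \<subseteq> U"
    using riemannian_onD(1)[OF g] l open_contains_cball by blast
  obtain C where C: "0 < C" "\<And>z v. z \<in> cball l e \<Longrightarrow> sqrt (g z v v) \<le> C * norm v"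
    using metric_bounds_compact[OF g compact_cball e(2)] by metis
  have "rdist U g z l \<le> C * norm (l - z)" if "z \<in> ball l e" for z
  proof -
    have "closed_segment z l \<subseteq> cball l e" using that e by (intro closed_segment_subset) auto
    then show ?thesis using e C by (intro rdist_segment_le[OF g]) auto
  qed
  then have "\<forall>\<^sub>F n in net. norm (rdist U g (s n) l) \<le> C * norm (l - s n)"
    using topological_tendstoD[OF s open_ball, of l e] e by (auto elim: eventually_mono)
  moreover have "((\<lambda>n. C * norm (l - s n)) \<longlongrightarrow> 0) net"
    using s by (auto intro!: tendsto_eq_intros)
  ultimately show ?thesis by (rule Lim_null_comparison)
qed

text \<open>The easy half of the Hopf-Rinow theorem: if bounded sets are relatively compact, then
  Cauchy sequences converge.\<close>

lemma complete_onI: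
  fixes g :: "'a::euclidean_space metric_field"
  assumes g: "riemannian_on U g" and c: "connected U"
    and K: "\<And>p r. p \<in> U \<Longrightarrow> \<exists>K. compact K \<and> K \<subseteq> U \<and> {x \<in> U. rdist U g p x \<le> r} \<subseteq> K"
  shows "complete_on U g"
proof -
  interpret Metric_space U "rdist U g" by (rule metric_space_rdist[OF g c])
  have "mcomplete"
    unfolding mcomplete_def
  proof (intro allI impI)
    fix s assume s: "MCauchy s"
    then have sU: "\<And>n. s n \<in> U" by (auto simp: MCauchy_def)
    obtain N where N: "\<And>n. n \<ge> N \<Longrightarrow> rdist U g (s N) (s n) < 1"
      using s unfolding MCauchy_def by (metis order_refl zero_less_one)
    obtain K where K': "compact K" "K \<subseteq> U" "{x \<in> U. rdist U g (s N) x \<le> 1} \<subseteq> K"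
      using K[OF sU] by blast
    have "s (n + N) \<in> K" for n using K'(3) N[of "n + N"] sU by force
    then obtain l r where l: "l \<in> K" "strict_mono r" "((\<lambda>n. s (n + N)) \<circ> r) \<longlonglongrightarrow> l"
      using K'(1) unfolding compact_eq_seq_compact_metric seq_compact_def by metis
    have lU: "l \<in> U" using l K' by auto
    have t: "(\<lambda>n. rdist U g (s (r n + N)) l) \<longlonglongrightarrow> 0"
      using rdist_tendsto[OF g c lU l(3)] by (simp add: o_def)
    have "\<forall>\<^sub>F n in sequentially. s n \<in> U \<and> rdist U g (s n) l < e" if e: "0 < e" for e
    proof -
      have e2: "0 < e / 2" using e by simp
      obtain M where M: "\<And>n m. n \<ge> M \<Longrightarrow> m \<ge> M \<Longrightarrow> rdist U g (s n) (s m) < e / 2"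
        using s e2 unfolding MCauchy_def by blast
      obtain k where k: "k \<ge> M" "rdist U g (s (r k + N)) l < e / 2"
        using eventually_happens[OF eventually_conj[OF eventually_ge_at_top[of M]
            order_tendstoD(2)[OF t e2]]] by auto
      have rk: "r k + N \<ge> M" using k(1) seq_suble[OF l(2), of k] by linarith
      have "rdist U g (s n) l < e" if "n \<ge> M" for n
        using triangle[OF sU[of n] sU[of "r k + N"] lU] M[OF that rk] k(2) by linarith
      then show ?thesis using sU by (auto simp: eventually_sequentially)
    qed
    then show "\<exists>x. limitin mtopology s x sequentially"
      unfolding limitin_metric using lU by blast
  qed
  then show ?thesis using metric_space_rdist[OF g c] by (simp add: complete_on_def)
qed

section \<open>The family of metrics on the ball\<close>

text \<open>Multiplication by \<open>\<i>\<close>, that is \<^const>\<open>J_std\<close> without its base point; at \<open>x\<close> it also gives the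
  field \<^const>\<open>E1\<close>.\<close>

definition imul :: "c2 \<Rightarrow> c2" where "imul v = (\<i> * fst v, \<i> * snd v)"

lemma bounded_linear_imul: "bounded_linear imul"
  by (auto intro!: linear_conv_bounded_linear[THEN iffD1] linearI
      simp: imul_def algebra_simps scaleR_conv_of_real)

lemma imul_simps [simp]:
  "imul (u + v) = imul u + imul v" "imul (u - v) = imul u - imul v" "imul (- v) = - imul v"
  "imul (c *\<^sub>R v) = c *\<^sub>R imul v" "imul 0 = 0" "imul (imul v) = - v"
  by (auto simp: imul_def algebra_simps scaleR_conv_of_real prod_eq_iff)

lemma inner_imul [simp]:
  "imul u \<bullet> imul v = u \<bullet> v" "imul u \<bullet> u = 0" "u \<bullet> imul u = 0"
  by (auto simp: imul_def inner_c2 algebra_simps)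

lemma inner_imul_right: "u \<bullet> imul v = - (imul u \<bullet> v)"
  by (auto simp: imul_def inner_c2 algebra_simps)

lemma norm_imul [simp]: "norm (imul v) = norm v"
  by (simp add: norm_eq_sqrt_inner)

lemma E1_imul: "E1 x = imul x"
  by (simp add: E1_def imul_def qmult_def mult.commute)

lemma J_std_imul: "J_std x v = imul v"
  by (simp add: J_std_def imul_def)

lemma frame_norm:
  "(x \<bullet> x) * (v \<bullet> w) = (x \<bullet> v) * (x \<bullet> w) + (imul x \<bullet> v) * (imul x \<bullet> w)
     + (E2 x \<bullet> v) * (E2 x \<bullet> w) + (E3 x \<bullet> v) * (E3 x \<bullet> w)"
  unfolding inner_c2 by (simp add: E2_def E3_def imul_def qmult_def algebra_simps)

text \<open>All metrics of the conformal class have the form below with a function \<open>a\<close> of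
  \<open>|x|\<^sup>2 = e\<^sup>-\<^sup>z\<close>.  In this form it is visible that they extend over the nut whenever \<open>a\<close> does.\<close>

definition met :: "(real \<Rightarrow> real) \<Rightarrow> c2 metric_field" where
  "met a x v w = a (x \<bullet> x) * (v \<bullet> w + (2 - x \<bullet> x) / (1 - x \<bullet> x)\<^sup>2 * ((x \<bullet> v) * (x \<bullet> w))
     - (2 - x \<bullet> x) * ((imul x \<bullet> v) * (imul x \<bullet> w)))"

lemma M1_iff: "x \<in> M1 \<longleftrightarrow> x \<bullet> x < 1"
  unfolding M1_eq by (simp add: dot_square_norm power_less_one_iff abs_square_less_1)

lemma M0_iff: "x \<in> M0 \<longleftrightarrow> x \<bullet> x < 1 \<and> x \<noteq> 0"
  using M1_iff[of x] unfolding M0_eq M1_eq by auto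

lemma M0_pos: "x \<in> M0 \<Longrightarrow> 0 < x \<bullet> x"
  by (simp add: M0_iff)

lemma M0_M1: "M0 \<subseteq> M1" by (auto simp: M1_def)

lemma open_M: "open M0" "open M1"
  by (auto simp: M0_eq M1_eq intro: open_Diff)

lemma connected_M: "connected M0" "connected M1"
proof -
  show "connected M1" by (simp add: M1_eq)
  have "M0 = {x. 0 < norm (x - 0) \<and> norm (x - 0) < 1}" by (auto simp: M0_eq)
  moreover have "connected {x :: c2. 0 < norm (x - 0) \<and> norm (x - 0) < 1}"
    by (rule connected_annulus) simp
  ultimately show "connected M0" by simp
qed

lemma exp_zcoord:
  assumes "x \<noteq> 0" shows "exp (- zcoord x) = x \<bullet> x"
proof -
  have "exp (2 * ln (norm x)) = (norm x)\<^sup>2"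
    using assms by (simp add: exp_double)
  then show ?thesis by (simp add: zcoord_def dot_square_norm)
qed

lemma met_frame:
  assumes "x \<in> M1"
  shows "(x \<bullet> x) * met a x v w = a (x \<bullet> x) * ((x \<bullet> v) * (x \<bullet> w) / (1 - x \<bullet> x)\<^sup>2
    + (1 - x \<bullet> x)\<^sup>2 * ((imul x \<bullet> v) * (imul x \<bullet> w)) + (E2 x \<bullet> v) * (E2 x \<bullet> w) + (E3 x \<bullet> v) * (E3 x \<bullet> w))"
proof -
  define s where "s = 1 - x \<bullet> x"
  have s: "s \<noteq> 0" "x \<bullet> x = 1 - s" using assms by (auto simp: s_def M1_iff)
  have *: "(1 - s) * (V + (2 - (1 - s)) / (1 - (1 - s))\<^sup>2 * A - (2 - (1 - s)) * B)
      = A / (1 - (1 - s))\<^sup>2 + (1 - (1 - s))\<^sup>2 * B + C + D"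
    if "(1 - s) * V = A + B + C + D" for V A B C D :: real
    using that s(1) by (simp add: field_simps power2_eq_square) algebra
  show ?thesis
    using *[OF frame_norm[of x v w, unfolded s(2)]] unfolding met_def s(2)
    by (simp add: mult.left_commute)
qed

lemma warped_metric_met:
  assumes x: "x \<in> M0" and F: "F = (\<lambda>z. (1 - exp (- z))\<^sup>2)"
    and mu: "\<mu> (zcoord x) = a (x \<bullet> x) * (x \<bullet> x)"
  shows "warped_metric \<mu> F x v w = met a x v w"
proof -
  have x0: "x \<noteq> 0" "x \<in> M1" and r: "0 < x \<bullet> x" using x M0_M1 by (auto simp: M0_iff)
  have Fx: "F (zcoord x) = (1 - x \<bullet> x)\<^sup>2" using exp_zcoord[OF x0(1)] by (simp add: F)
  have s: "(1 - x \<bullet> x)\<^sup>2 \<noteq> 0" using x by (simp add: M0_iff)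
  have alg: "a * r * (1 / (4 * S) * (- 2 * A / r * (- 2 * A' / r)) + S * (B / r * (B' / r)) + C / r * (C' / r)
      + D / r * (D' / r)) = a * (A * A' / S + S * (B * B') + C * C' + D * D') / r"
    if "r \<noteq> 0" "S \<noteq> 0" for a r S A A' B B' C C' D D' :: real
    using that by (simp add: field_simps)
  have eq: "warped_metric \<mu> F x v w = a (x \<bullet> x) * ((x \<bullet> v) * (x \<bullet> w) / (1 - x \<bullet> x)\<^sup>2
    + (1 - x \<bullet> x)\<^sup>2 * ((imul x \<bullet> v) * (imul x \<bullet> w)) + (E2 x \<bullet> v) * (E2 x \<bullet> w)
    + (E3 x \<bullet> v) * (E3 x \<bullet> w)) / (x \<bullet> x)"
    unfolding warped_metric_def Fx mu dz_eq[OF x0(1)] eta1_def eta2_def eta3_def E1_imul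
      dot_square_norm[symmetric] inner_commute[of v] inner_commute[of w]
    by (rule alg) (use r s in auto)
  then show ?thesis using r by (simp add: eq flip: met_frame[OF x0(2)])
qed

lemma bilinear_met: "bilinear (met a x)"
  unfolding bilinear_def met_def
  by (intro conjI allI linearI) (simp_all add: inner_add_left inner_add_right algebra_simps add_divide_distrib diff_divide_distrib)

lemma met_commute: "met a x v w = met a x w v"
  by (simp add: met_def inner_commute mult.commute)

text \<open>Only the Hopf direction is contracted, by the factor \<open>1 - |x|\<^sup>2\<close>.\<close>

lemma met_lower:
  assumes x: "x \<in> M1" and a: "0 \<le> a (x \<bullet> x)"
  shows "a (x \<bullet> x) * (1 - x \<bullet> x)\<^sup>2 * (v \<bullet> v) \<le> met a x v v"
proof -
  define r where "r = x \<bullet> x"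
  have r: "0 \<le> r" "r < 1" using x by (auto simp: r_def M1_iff)
  have b: "(imul x \<bullet> v) * (imul x \<bullet> v) \<le> r * (v \<bullet> v)"
    using Cauchy_Schwarz_ineq[of "imul x" v] by (simp add: r_def power2_eq_square)
  have "(1 - r)\<^sup>2 * (v \<bullet> v) = v \<bullet> v - (2 - r) * (r * (v \<bullet> v))"
    by (simp add: power2_eq_square algebra_simps)
  also have "\<dots> \<le> v \<bullet> v - (2 - r) * ((imul x \<bullet> v) * (imul x \<bullet> v))"
    using b r by (simp add: mult_left_mono)
  also have "\<dots> \<le> v \<bullet> v + (2 - r) / (1 - r)\<^sup>2 * ((x \<bullet> v) * (x \<bullet> v))
      - (2 - r) * ((imul x \<bullet> v) * (imul x \<bullet> v))"
    using r by simp
  finally show ?thesis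
    using a mult_left_mono unfolding met_def r_def by (simp add: mult.assoc mult_left_mono)
qed

lemma met_radial:
  assumes x: "x \<in> M1" and a: "0 \<le> a (x \<bullet> x)"
  shows "a (x \<bullet> x) * (x \<bullet> v)\<^sup>2 \<le> (x \<bullet> x) * (1 - x \<bullet> x)\<^sup>2 * met a x v v"
proof -
  have s: "0 < (1 - x \<bullet> x)\<^sup>2" using x by (simp add: M1_iff)
  have "(x \<bullet> x) * met a x v v \<ge> a (x \<bullet> x) * ((x \<bullet> v) * (x \<bullet> v) / (1 - x \<bullet> x)\<^sup>2)"
    unfolding met_frame[OF x] by (intro mult_left_mono a) simp
  then show ?thesis using s by (simp add: field_simps power2_eq_square)
qed

lemma met_pos:
  assumes x: "x \<in> M1" and a: "0 < a (x \<bullet> x)" and v: "v \<noteq> 0"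
  shows "0 < met a x v v"
proof -
  have "0 < a (x \<bullet> x) * (1 - x \<bullet> x)\<^sup>2 * (v \<bullet> v)" using assms by (simp add: M1_iff)
  also have "\<dots> \<le> met a x v v" using a by (intro met_lower[OF x]) simp
  finally show ?thesis .
qed

lemma smooth_on_imul: "open U \<Longrightarrow> smooth_on U imul"
  by (rule smooth_on_linear[OF _ bounded_linear_imul])

lemma smooth_on_met:
  assumes "open U" "U \<subseteq> M1" "smooth_on U (\<lambda>x. a (x \<bullet> x))"
  shows "smooth_on U (\<lambda>x. met a x v w)"
proof -
  have "(1 - x \<bullet> x)\<^sup>2 \<noteq> 0" if "x \<in> U" for x
    using subsetD[OF assms(2) that] by (simp add: M1_iff)
  then show ?thesis
    unfolding met_def using assms(1,3) by (intro smooth_intros smooth_on_imul)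
qed

lemma riemannian_met:
  assumes "open U" "U \<subseteq> M1" "smooth_on U (\<lambda>x. a (x \<bullet> x))" "\<And>x. x \<in> U \<Longrightarrow> 0 < a (x \<bullet> x)"
  shows "riemannian_on U (met a)"
  unfolding riemannian_on_def
  using assms bilinear_met met_commute met_pos smooth_on_met[OF assms(1-3)] by (auto simp: subset_iff)

section \<open>Completeness\<close>

text \<open>The functions \<open>ln (1 - |x|\<^sup>2)\<close> and \<open>ln |x|\<^sup>2\<close> tend to infinity at the cusp and at the
  puncture, respectively, and have bounded gradient.\<close>

lemma bounded_gradient:
  assumes C: "0 < C" and g: "0 \<le> G" and h: "C * d\<^sup>2 \<le> 4 * G"
  shows "\<bar>d\<bar> \<le> 2 / sqrt C * sqrt G"
proof -
  have "sqrt (d\<^sup>2) \<le> sqrt (4 * G / C)" using C h by (intro real_sqrt_le_mono) (simp add: field_simps)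
  also have "\<dots> = 2 / sqrt C * sqrt G" by (simp add: real_sqrt_divide real_sqrt_mult)
  finally show ?thesis by simp
qed

lemma rdist_cusp_lower:
  assumes U: "U = M0 \<or> U = M1" and R: "riemannian_on U (met a)" and C: "0 < C"
    and a: "\<And>x. x \<in> U \<Longrightarrow> C * (x \<bullet> x) \<le> a (x \<bullet> x)" "\<And>x. x \<in> U \<Longrightarrow> 0 < a (x \<bullet> x)"
    and p: "p \<in> U" "x \<in> U"
  shows "\<bar>ln (1 - x \<bullet> x) - ln (1 - p \<bullet> p)\<bar> \<le> 2 / sqrt C * rdist U (met a) p x"
proof -
  have UM: "U \<subseteq> M1" "connected U" using U M0_M1 connected_M by auto
  have d: "((\<lambda>x. ln (1 - x \<bullet> x)) has_derivative (\<lambda>v. - (2 * (x \<bullet> v)) / (1 - x \<bullet> x))) (at x)"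
    if "x \<in> U" for x
    using subsetD[OF UM(1) that]
    by (auto intro!: derivative_eq_intros simp: M1_iff inner_commute field_simps)
  have b: "\<bar>- (2 * (x \<bullet> v)) / (1 - x \<bullet> x)\<bar> \<le> 2 / sqrt C * sqrt (met a x v v)" if x: "x \<in> U" for x v
  proof (rule bounded_gradient[OF C riemannian_onD(6)[OF R x]])
    have x1: "x \<in> M1" using x UM by auto
    then have s: "0 < 1 - x \<bullet> x" by (simp add: M1_iff)
    have G: "0 \<le> met a x v v" by (rule riemannian_onD(6)[OF R x])
    have rad: "a (x \<bullet> x) * (x \<bullet> v)\<^sup>2 \<le> (x \<bullet> x) * (1 - x \<bullet> x)\<^sup>2 * met a x v v"
      using a(2)[OF x] by (intro met_radial[OF x1]) simp
    have "C * (x \<bullet> v)\<^sup>2 \<le> (1 - x \<bullet> x)\<^sup>2 * met a x v v"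
    proof (cases "x = 0")
      case True then show ?thesis using G by simp
    next
      case False
      then have r: "0 < x \<bullet> x" by simp
      have "(x \<bullet> x) * (C * (x \<bullet> v)\<^sup>2) \<le> a (x \<bullet> x) * (x \<bullet> v)\<^sup>2"
        using mult_right_mono[OF a(1)[OF x], of "(x \<bullet> v)\<^sup>2"] by (simp add: mult_ac)
      also note rad
      finally show ?thesis using r by (simp add: mult.assoc)
    qed
    then show "C * (- (2 * (x \<bullet> v)) / (1 - x \<bullet> x))\<^sup>2 \<le> 4 * met a x v v"
      using s by (simp add: power_divide divide_le_eq field_simps)
  qed
  show ?thesis by (rule lipschitz_rdist[OF R UM(2) p d b]) (use C in auto)
qed

lemma rdist_puncture_lower:
  assumes R: "riemannian_on M0 (met a)" and C: "0 < C"
    and a: "\<And>x. x \<in> M0 \<Longrightarrow> C \<le> a (x \<bullet> x) * (x \<bullet> x)"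
    and p: "p \<in> M0" "x \<in> M0"
  shows "\<bar>ln (x \<bullet> x) - ln (p \<bullet> p)\<bar> \<le> 2 / sqrt C * rdist M0 (met a) p x"
proof -
  have d: "((\<lambda>x. ln (x \<bullet> x)) has_derivative (\<lambda>v. 2 * (x \<bullet> v) / (x \<bullet> x))) (at x)"
    if "x \<in> M0" for x
    using that by (auto intro!: derivative_eq_intros simp: M0_iff inner_commute field_simps)
  have b: "\<bar>2 * (x \<bullet> v) / (x \<bullet> x)\<bar> \<le> 2 / sqrt C * sqrt (met a x v v)" if x: "x \<in> M0" for x v
  proof (rule bounded_gradient[OF C riemannian_onD(6)[OF R x]])
    have x1: "x \<in> M1" "0 < x \<bullet> x" "x \<bullet> x < 1" using x M0_M1 by (auto simp: M0_iff)
    have G: "0 \<le> met a x v v" by (rule riemannian_onD(6)[OF R x])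
    have ap: "0 < a (x \<bullet> x)" using a[OF x] C x1 by (smt (verit) mult_nonpos_nonneg)
    have "C * (x \<bullet> v)\<^sup>2 \<le> (x \<bullet> x) * (a (x \<bullet> x) * (x \<bullet> v)\<^sup>2)"
      using mult_right_mono[OF a[OF x], of "(x \<bullet> v)\<^sup>2"] by (simp add: mult_ac)
    also have "\<dots> \<le> (x \<bullet> x) * ((x \<bullet> x) * (1 - x \<bullet> x)\<^sup>2 * met a x v v)"
      using ap x1 by (intro mult_left_mono met_radial[OF x1(1)]) auto
    also have "\<dots> = (x \<bullet> x)\<^sup>2 * met a x v v * (1 - x \<bullet> x)\<^sup>2" by (simp add: power2_eq_square)
    also have "\<dots> \<le> (x \<bullet> x)\<^sup>2 * met a x v v * 1"
      using x1 G by (intro mult_left_mono power_le_one) auto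
    finally show "C * (2 * (x \<bullet> v) / (x \<bullet> x))\<^sup>2 \<le> 4 * met a x v v"
      using x1 by (simp add: power_divide divide_le_eq field_simps)
  qed
  show ?thesis by (rule lipschitz_rdist[OF R connected_M(1) p d b]) (use C in auto)
qed

lemma ln_ball_bound:
  fixes u u0 c :: real
  assumes "0 < u" "0 < u0" "\<bar>ln u - ln u0\<bar> \<le> c" shows "u0 * exp (- c) \<le> u"
proof -
  have "ln u0 - c \<le> ln u" using assms(3) by linarith
  then have "exp (ln u0 - c) \<le> exp (ln u)" by simp
  then show ?thesis using assms by (simp add: exp_diff exp_minus divide_inverse)
qed

lemma complete_met_M1:
  assumes R: "riemannian_on M1 (met a)" and C: "0 < C"
    and a: "\<And>x. x \<in> M1 \<Longrightarrow> C * (x \<bullet> x) \<le> a (x \<bullet> x)" "\<And>x. x \<in> M1 \<Longrightarrow> 0 < a (x \<bullet> x)"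
  shows "complete_on M1 (met a)"
proof (rule complete_onI[OF R connected_M(2)])
  fix p r assume p: "p \<in> M1"
  define d where "d = (1 - p \<bullet> p) * exp (- (2 / sqrt C * r))"
  have d: "0 < d" using p by (simp add: d_def M1_iff)
  let ?K = "{x :: c2. x \<bullet> x \<le> 1 - d}"
  have "norm x \<le> 1" if "x \<in> ?K" for x
    using that d by (intro power2_le_imp_le[of "norm x" 1]) (auto simp: dot_square_norm)
  then have "bounded ?K" by (rule boundedI)
  moreover have "closed ?K" by (intro closed_Collect_le continuous_intros)
  ultimately have "compact ?K" by (simp add: compact_eq_bounded_closed)
  moreover have "?K \<subseteq> M1" using d by (intro subsetI) (simp add: M1_iff)
  moreover have "x \<in> ?K" if x: "x \<in> M1" "rdist M1 (met a) p x \<le> r" for x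
  proof -
    have "\<bar>ln (1 - x \<bullet> x) - ln (1 - p \<bullet> p)\<bar> \<le> 2 / sqrt C * rdist M1 (met a) p x"
      by (rule rdist_cusp_lower[OF _ R C a p x(1)]) auto
    also have "\<dots> \<le> 2 / sqrt C * r" using x(2) C by (intro mult_left_mono) auto
    finally have "d \<le> 1 - x \<bullet> x"
      unfolding d_def using x p by (intro ln_ball_bound) (auto simp: M1_iff)
    then show ?thesis by simp
  qed
  ultimately show "\<exists>K. compact K \<and> K \<subseteq> M1 \<and> {x \<in> M1. rdist M1 (met a) p x \<le> r} \<subseteq> K" by blast
qed

lemma complete_met_M0:
  assumes R: "riemannian_on M0 (met a)" and C: "0 < C"
    and a: "\<And>x. x \<in> M0 \<Longrightarrow> C * (x \<bullet> x) \<le> a (x \<bullet> x)" "\<And>x. x \<in> M0 \<Longrightarrow> 0 < a (x \<bullet> x)"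
      "\<And>x. x \<in> M0 \<Longrightarrow> C \<le> a (x \<bullet> x) * (x \<bullet> x)"
  shows "complete_on M0 (met a)"
proof (rule complete_onI[OF R connected_M(1)])
  fix p r assume p: "p \<in> M0"
  define d where "d = (1 - p \<bullet> p) * exp (- (2 / sqrt C * r))"
  define e where "e = (p \<bullet> p) * exp (- (2 / sqrt C * r))"
  have d: "0 < d" "0 < e" using p by (auto simp: d_def e_def M0_iff)
  let ?K = "{x :: c2. x \<bullet> x \<le> 1 - d} \<inter> {x. e \<le> x \<bullet> x}"
  have "norm x \<le> 1" if "x \<in> ?K" for x
    using that d by (intro power2_le_imp_le[of "norm x" 1]) (auto simp: dot_square_norm)
  then have "bounded ?K" by (rule boundedI)
  moreover have "closed ?K" by (intro closed_Int closed_Collect_le continuous_intros)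
  ultimately have "compact ?K" by (simp add: compact_eq_bounded_closed)
  moreover have "x \<noteq> 0" if "e \<le> x \<bullet> x" for x :: c2
    using that d by (cases "x = 0") simp_all
  then have "?K \<subseteq> M0" using d by (intro subsetI) (simp add: M0_iff)
  moreover have "x \<in> ?K" if x: "x \<in> M0" "rdist M0 (met a) p x \<le> r" for x
  proof -
    have le: "2 / sqrt C * rdist M0 (met a) p x \<le> 2 / sqrt C * r"
      using x(2) C by (intro mult_left_mono) auto
    have "d \<le> 1 - x \<bullet> x"
      unfolding d_def using x p
      by (intro ln_ball_bound order_trans[OF rdist_cusp_lower[OF _ R C a(1,2) p x(1)] le])
        (auto simp: M0_iff)
    moreover have "e \<le> x \<bullet> x"
      unfolding e_def using x p
      by (intro ln_ball_bound order_trans[OF rdist_puncture_lower[OF R C a(3) p x(1)] le])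
        (auto simp: M0_iff)
    ultimately show ?thesis by simp
  qed
  ultimately show "\<exists>K. compact K \<and> K \<subseteq> M0 \<and> {x \<in> M0. rdist M0 (met a) p x \<le> r} \<subseteq> K" by blast
qed

lemma eventually_to_zero:
  "eventually P to_zero \<longleftrightarrow> (\<exists>e>0. \<forall>x. 0 < zcoord x \<and> zcoord x < e \<longrightarrow> P x)"
proof -
  have "eventually P to_zero \<longleftrightarrow> (\<exists>Q. eventually Q (at_right 0) \<and> (\<forall>x. Q (zcoord x) \<longrightarrow> P x))"
    by (simp add: to_zero_def eventually_filtercomap)
  also have "\<dots> \<longleftrightarrow> (\<exists>e>0. \<forall>x. 0 < zcoord x \<and> zcoord x < e \<longrightarrow> P x)"
  proof
    assume "\<exists>Q. eventually Q (at_right 0) \<and> (\<forall>x. Q (zcoord x) \<longrightarrow> P x)"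
    then obtain Q b where "0 < b" "\<forall>y>0. y < b \<longrightarrow> Q y" "\<forall>x. Q (zcoord x) \<longrightarrow> P x"
      unfolding eventually_at_right_field by blast
    then show "\<exists>e>0. \<forall>x. 0 < zcoord x \<and> zcoord x < e \<longrightarrow> P x"
      by (intro exI[of _ b]) blast
  next
    assume "\<exists>e>0. \<forall>x. 0 < zcoord x \<and> zcoord x < e \<longrightarrow> P x"
    then obtain e where "0 < e" "\<forall>x. 0 < zcoord x \<and> zcoord x < e \<longrightarrow> P x" by blast
    then show "\<exists>Q. eventually Q (at_right 0) \<and> (\<forall>x. Q (zcoord x) \<longrightarrow> P x)"
      unfolding eventually_at_right_field by (intro exI[of _ "\<lambda>z. 0 < z \<and> z < e"]) blast
  qed
  finally show ?thesis .
qed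

lemma zcoord_pos_iff: "0 < zcoord x \<longleftrightarrow> x \<in> M0"
  by (cases "x = 0") (auto simp: zcoord_def M0_eq)

lemma eventually_to_zero_M0: "\<forall>\<^sub>F x in to_zero. x \<in> M0"
  unfolding eventually_to_zero by (intro exI[of _ 1]) (auto simp: zcoord_pos_iff)

lemma tendsto_zcoord_to_zero: "filterlim zcoord (at_right 0) to_zero"
  unfolding to_zero_def by (rule filterlim_filtercomap)

lemma tendsto_rho_to_zero: "((\<lambda>x. x \<bullet> x) \<longlongrightarrow> 1) to_zero"
proof -
  have "((\<lambda>z::real. exp (- z)) \<longlongrightarrow> 1) (at_right 0)"
    by (auto intro!: tendsto_eq_intros)
  from filterlim_compose[OF this tendsto_zcoord_to_zero]
  have "((\<lambda>x. exp (- zcoord x)) \<longlongrightarrow> 1) to_zero" .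
  then show ?thesis
    by (rule Lim_transform_eventually)
      (use eventually_to_zero_M0 in \<open>auto elim!: eventually_mono intro: exp_zcoord simp: M0_iff\<close>)
qed

lemma rdist_cusp_at_top:
  assumes U: "U = M0 \<or> U = M1" and R: "riemannian_on U (met a)" and C: "0 < C"
    and a: "\<And>x. x \<in> U \<Longrightarrow> C * (x \<bullet> x) \<le> a (x \<bullet> x)" "\<And>x. x \<in> U \<Longrightarrow> 0 < a (x \<bullet> x)"
    and p: "p \<in> U"
  shows "filterlim (rdist U (met a) p) at_top to_zero"
proof -
  have "filterlim (\<lambda>x::c2. 1 - x \<bullet> x) (at_right 0) to_zero"
    unfolding filterlim_at
  proof
    show "\<forall>\<^sub>F x::c2 in to_zero. 1 - x \<bullet> x \<in> {0<..} \<and> 1 - x \<bullet> x \<noteq> 0"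
      by (rule eventually_mono[OF eventually_to_zero_M0]) (simp add: M0_iff)
    show "((\<lambda>x::c2. 1 - x \<bullet> x) \<longlongrightarrow> 0) to_zero"
      using tendsto_diff[OF tendsto_const[of 1] tendsto_rho_to_zero] by simp
  qed
  then have l: "filterlim (\<lambda>x::c2. ln (1 - x \<bullet> x)) at_bot to_zero"
    by (rule filterlim_compose[OF ln_at_0])
  have "filterlim (\<lambda>x. sqrt C / 2 * (ln (1 - p \<bullet> p) - ln (1 - x \<bullet> x))) at_top to_zero"
    using C l unfolding diff_conv_add_uminus
    by (intro filterlim_tendsto_pos_mult_at_top[OF tendsto_const] filterlim_tendsto_add_at_top[OF tendsto_const])
      (auto simp: filterlim_uminus_at_bot)
  then show ?thesis
  proof (rule filterlim_at_top_mono)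
    show "\<forall>\<^sub>F x in to_zero. sqrt C / 2 * (ln (1 - p \<bullet> p) - ln (1 - x \<bullet> x)) \<le> rdist U (met a) p x"
      using eventually_to_zero_M0
    proof (rule eventually_mono)
      fix x assume "x \<in> M0"
      then have x: "x \<in> U" using U M0_M1 by auto
      show "sqrt C / 2 * (ln (1 - p \<bullet> p) - ln (1 - x \<bullet> x)) \<le> rdist U (met a) p x"
        using rdist_cusp_lower[OF U R C a p x] C by (simp add: field_simps abs_le_iff)
    qed
  qed
qed

section \<open>Curvature\<close>

lemma imul_swap: "imul u \<bullet> v = - (imul v \<bullet> u)"
  using inner_imul_right[of v u] by (simp add: inner_commute)

lemma sharp_eqI:
  assumes g: "riemannian_on U g" "x \<in> U" and v: "\<And>w. g x v w = l w"
  shows "sharp g x l = v"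
  unfolding sharp_def
proof (rule the_equality)
  fix u assume u: "\<forall>w. g x u w = l w"
  have b: "bilinear (g x)" by (rule riemannian_onD(2)[OF g])
  have "g x (u - v) (u - v) = 0"
    using u v bilinear_lsub[OF b, of u v "u - v"] by simp
  then show "u = v" using riemannian_onD(4)[OF g, of "u - v"] by auto
qed (use v in simp)

lemma met_coeff_nonzero:
  assumes R: "riemannian_on U (met a)" and x: "x \<in> U" shows "a (x \<bullet> x) \<noteq> 0"
proof
  assume "a (x \<bullet> x) = 0"
  then have "met a x (1, 0) (1, 0) = 0" by (simp add: met_def)
  moreover have "0 < met a x (1, 0) (1, 0)" by (rule riemannian_onD(4)[OF R x]) (simp add: prod_eq_iff)
  ultimately show False by simp
qed

lemma met_sharp:
  assumes R: "riemannian_on U (met a)" and x: "x \<in> U" "x \<in> M1"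
  shows "sharp (met a) x (\<lambda>w. u \<bullet> w) = (1 / a (x \<bullet> x)) *\<^sub>R
    (u - ((2 - x \<bullet> x) * (x \<bullet> u)) *\<^sub>R x + ((2 - x \<bullet> x) / (1 - x \<bullet> x)\<^sup>2 * (imul x \<bullet> u)) *\<^sub>R imul x)"
proof (rule sharp_eqI[OF R x(1)])
  fix w
  define s where "s = 1 - x \<bullet> x"
  have s: "s \<noteq> 0" "x \<bullet> x = 1 - s" using x by (auto simp: s_def M1_iff)
  have a: "a (1 - s) \<noteq> 0" using met_coeff_nonzero[OF R x(1)] s by simp
  show "met a x ((1 / a (x \<bullet> x)) *\<^sub>R
    (u - ((2 - x \<bullet> x) * (x \<bullet> u)) *\<^sub>R x + ((2 - x \<bullet> x) / (1 - x \<bullet> x)\<^sup>2 * (imul x \<bullet> u)) *\<^sub>R imul x)) w = u \<bullet> w"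
    unfolding met_def using a s(1)
    by (simp add: inner_add_left inner_add_right inner_diff_left inner_diff_right inner_imul_right s(2)
        divide_simps) (simp add: power2_eq_square algebra_simps)
qed

lemma has_derivative_radial:
  fixes x :: c2
  assumes "(f has_real_derivative f') (at (x \<bullet> x))"
  shows "((\<lambda>y. f (y \<bullet> y)) has_derivative (\<lambda>h. 2 * (x \<bullet> h) * f')) (at x)"
proof -
  have "((\<lambda>y::c2. y \<bullet> y) has_derivative (\<lambda>h. 2 * (x \<bullet> h))) (at x)"
    by (auto intro!: derivative_eq_intros simp: inner_commute)
  from has_derivative_compose[OF this assms[unfolded has_field_derivative_def]]
  show ?thesis by (simp add: mult_ac)
qed

lemma has_derivative_imul: "(imul has_derivative imul) (at x)"
  by (rule bounded_linear_imp_has_derivative[OF bounded_linear_imul])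

lemma met_has_derivative:
  assumes x: "x \<in> M1" and a: "(a has_real_derivative a') (at (x \<bullet> x))"
  shows "((\<lambda>y. met a y v w) has_derivative (\<lambda>h.
      a (x \<bullet> x) * (2 * (x \<bullet> h) * ((3 - x \<bullet> x) / (1 - x \<bullet> x)^3) * ((x \<bullet> v) * (x \<bullet> w))
        + (2 - x \<bullet> x) / (1 - x \<bullet> x)\<^sup>2 * ((h \<bullet> v) * (x \<bullet> w) + (x \<bullet> v) * (h \<bullet> w))
        + 2 * (x \<bullet> h) * ((imul x \<bullet> v) * (imul x \<bullet> w))
        - (2 - x \<bullet> x) * ((imul h \<bullet> v) * (imul x \<bullet> w) + (imul x \<bullet> v) * (imul h \<bullet> w)))
      + 2 * (x \<bullet> h) * a' * (v \<bullet> w + (2 - x \<bullet> x) / (1 - x \<bullet> x)\<^sup>2 * ((x \<bullet> v) * (x \<bullet> w))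
        - (2 - x \<bullet> x) * ((imul x \<bullet> v) * (imul x \<bullet> w))))) (at x)"
proof -
  define s where "s = 1 - x \<bullet> x"
  have s: "s \<noteq> 0" "x \<bullet> x = 1 - s" using x by (auto simp: s_def M1_iff)
  have "((\<lambda>r. (2 - r) / (1 - r)\<^sup>2) has_real_derivative (3 - x \<bullet> x) / (1 - x \<bullet> x)^3) (at (x \<bullet> x))"
    using s(1) unfolding s(2)
    by (auto intro!: derivative_eq_intros simp: divide_simps) (simp add: algebra_simps eval_nat_numeral)
  note p = has_derivative_radial[OF this]
  have "((\<lambda>r. 2 - r) has_real_derivative - 1) (at (x \<bullet> x))"
    by (auto intro!: derivative_eq_intros)
  note q = has_derivative_radial[OF this]
  show ?thesis
    unfolding met_def
    by (rule has_derivative_eq_rhs, (rule has_derivative_mult has_derivative_add has_derivative_diff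
      has_derivative_inner has_derivative_const has_derivative_ident has_derivative_imul p q
      has_derivative_radial[OF a])+) (simp add: fun_eq_iff algebra_simps)
qed

text \<open>The general connection with the symmetries of the metrics.\<close>

definition conn :: "(real \<Rightarrow> real) \<Rightarrow> (real \<Rightarrow> real) \<Rightarrow> (real \<Rightarrow> real) \<Rightarrow> (real \<Rightarrow> real) \<Rightarrow>
    (real \<Rightarrow> real) \<Rightarrow> (real \<Rightarrow> real) \<Rightarrow> c2 \<Rightarrow> c2 \<Rightarrow> c2 \<Rightarrow> c2" where
  "conn c1 c2 c3 c4 c5 c6 x v w =
     c1 (x \<bullet> x) *\<^sub>R ((x \<bullet> v) *\<^sub>R w + (x \<bullet> w) *\<^sub>R v)
     + (c2 (x \<bullet> x) * (v \<bullet> w) + c3 (x \<bullet> x) * ((x \<bullet> v) * (x \<bullet> w))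
        + c4 (x \<bullet> x) * ((imul x \<bullet> v) * (imul x \<bullet> w))) *\<^sub>R x
     + (c5 (x \<bullet> x) * ((x \<bullet> v) * (imul x \<bullet> w) + (x \<bullet> w) * (imul x \<bullet> v))) *\<^sub>R imul x
     + c6 (x \<bullet> x) *\<^sub>R ((imul x \<bullet> w) *\<^sub>R imul v + (imul x \<bullet> v) *\<^sub>R imul w)"

text \<open>Here \<open>k\<close> is the logarithmic derivative of \<open>a\<close>.\<close>

abbreviation met_conn :: "(real \<Rightarrow> real) \<Rightarrow> c2 \<Rightarrow> c2 \<Rightarrow> c2 \<Rightarrow> c2" where
  "met_conn k \<equiv> conn k (\<lambda>r. (2 - r) - k r * (1 - r)\<^sup>2) (\<lambda>r. 1 + 2 / (1 - r) - k r * (2 - r))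
     (\<lambda>r. (k r * (2 - r) - 1) * (1 - r)\<^sup>2 - 2 * (2 - r)\<^sup>2) (\<lambda>r. - 1 - 2 / (1 - r)) (\<lambda>r. r - 2)"

lemma christoffel_met:
  assumes R: "riemannian_on U (met a)" and x: "x \<in> U" "x \<in> M1"
    and a: "(a has_real_derivative k (x \<bullet> x) * a (x \<bullet> x)) (at (x \<bullet> x))"
  shows "christoffel (met a) x v w = met_conn k x v w"
  unfolding christoffel_def
proof (rule sharp_eqI[OF R x(1)])
  fix u
  define s where "s = 1 - x \<bullet> x"
  have s: "s \<noteq> 0" "x \<bullet> x = 1 - s" using x by (auto simp: s_def M1_iff)
  note D = frechet_derivative_at[OF met_has_derivative[OF x(2) a], symmetric]
  have c: "imul u \<bullet> v = - (imul v \<bullet> u)" "imul u \<bullet> w = - (imul w \<bullet> u)" "imul w \<bullet> v = - (imul v \<bullet> w)"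
    "w \<bullet> v = v \<bullet> w" "u \<bullet> v = v \<bullet> u" "u \<bullet> w = w \<bullet> u"
    by (rule imul_swap inner_commute)+
  show "met a x (met_conn k x v w) u = (frechet_derivative (\<lambda>y. met a y w u) (at x) v
      + frechet_derivative (\<lambda>y. met a y v u) (at x) w - frechet_derivative (\<lambda>y. met a y v w) (at x) u) / 2"
    unfolding D unfolding met_def conn_def using s(1)
    by (simp add: inner_add_left inner_add_right inner_imul_right s(2) c divide_simps)
      (simp add: eval_nat_numeral algebra_simps)
qed

lemma conn_has_derivative:
  assumes "(c1 has_real_derivative d1) (at (x \<bullet> x))" "(c2 has_real_derivative d2) (at (x \<bullet> x))"
    "(c3 has_real_derivative d3) (at (x \<bullet> x))" "(c4 has_real_derivative d4) (at (x \<bullet> x))"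
    "(c5 has_real_derivative d5) (at (x \<bullet> x))" "(c6 has_real_derivative d6) (at (x \<bullet> x))"
  shows "((\<lambda>y. conn c1 c2 c3 c4 c5 c6 y v w) has_derivative (\<lambda>u.
     (2 * (x \<bullet> u) * d1) *\<^sub>R ((x \<bullet> v) *\<^sub>R w + (x \<bullet> w) *\<^sub>R v)
     + c1 (x \<bullet> x) *\<^sub>R ((u \<bullet> v) *\<^sub>R w + (u \<bullet> w) *\<^sub>R v)
     + (2 * (x \<bullet> u) * (d2 * (v \<bullet> w) + d3 * ((x \<bullet> v) * (x \<bullet> w)) + d4 * ((imul x \<bullet> v) * (imul x \<bullet> w)))
        + c3 (x \<bullet> x) * ((u \<bullet> v) * (x \<bullet> w) + (x \<bullet> v) * (u \<bullet> w))
        + c4 (x \<bullet> x) * ((imul u \<bullet> v) * (imul x \<bullet> w) + (imul x \<bullet> v) * (imul u \<bullet> w))) *\<^sub>R x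
     + (c2 (x \<bullet> x) * (v \<bullet> w) + c3 (x \<bullet> x) * ((x \<bullet> v) * (x \<bullet> w))
        + c4 (x \<bullet> x) * ((imul x \<bullet> v) * (imul x \<bullet> w))) *\<^sub>R u
     + (2 * (x \<bullet> u) * d5 * ((x \<bullet> v) * (imul x \<bullet> w) + (x \<bullet> w) * (imul x \<bullet> v))
        + c5 (x \<bullet> x) * ((u \<bullet> v) * (imul x \<bullet> w) + (x \<bullet> v) * (imul u \<bullet> w)
            + (u \<bullet> w) * (imul x \<bullet> v) + (x \<bullet> w) * (imul u \<bullet> v))) *\<^sub>R imul x
     + (c5 (x \<bullet> x) * ((x \<bullet> v) * (imul x \<bullet> w) + (x \<bullet> w) * (imul x \<bullet> v))) *\<^sub>R imul u
     + (2 * (x \<bullet> u) * d6) *\<^sub>R ((imul x \<bullet> w) *\<^sub>R imul v + (imul x \<bullet> v) *\<^sub>R imul w)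
     + c6 (x \<bullet> x) *\<^sub>R ((imul u \<bullet> w) *\<^sub>R imul v + (imul u \<bullet> v) *\<^sub>R imul w))) (at x)"
  unfolding conn_def
  by (rule has_derivative_eq_rhs, (rule has_derivative_scaleR has_derivative_mult has_derivative_add
      has_derivative_inner has_derivative_const has_derivative_ident has_derivative_imul
      assms[THEN has_derivative_radial])+) (simp add: fun_eq_iff algebra_simps)

text \<open>Traces of endomorphisms; all those below are sums of a multiple of the identity, of
  \<^const>\<open>imul\<close> and of rank one terms.\<close>

definition tr :: "(c2 \<Rightarrow> c2) \<Rightarrow> real" where "tr L = (\<Sum>b\<in>Basis. L b \<bullet> b)"

lemma sum_Basis_inner: "(\<Sum>b\<in>Basis. (y \<bullet> b) * (z \<bullet> b)) = y \<bullet> z" for y z :: c2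
  by (simp add: euclidean_inner[of y z])

lemma tr_simps:
  "tr (\<lambda>u. f u + g u) = tr f + tr g"
  "tr (\<lambda>u. f u - g u) = tr f - tr g"
  "tr (\<lambda>u. - f u) = - tr f"
  "tr (\<lambda>u. (h u - h' u) *\<^sub>R f u) = tr (\<lambda>u. h u *\<^sub>R f u) - tr (\<lambda>u. h' u *\<^sub>R f u)"
  "tr (\<lambda>u. c *\<^sub>R f u) = c * tr f"
  "tr (\<lambda>u. (h u + h' u) *\<^sub>R f u) = tr (\<lambda>u. h u *\<^sub>R f u) + tr (\<lambda>u. h' u *\<^sub>R f u)"
  "tr (\<lambda>u. (c * h u) *\<^sub>R f u) = c * tr (\<lambda>u. h u *\<^sub>R f u)"
  "tr (\<lambda>u. (h u * c) *\<^sub>R f u) = c * tr (\<lambda>u. h u *\<^sub>R f u)"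
  "tr (\<lambda>u. h u *\<^sub>R (h' u *\<^sub>R f u)) = tr (\<lambda>u. (h u * h' u) *\<^sub>R f u)"
  "tr (\<lambda>u. (y \<bullet> u) *\<^sub>R z) = y \<bullet> z"
  "tr (\<lambda>u. (u \<bullet> y) *\<^sub>R z) = y \<bullet> z"
  "tr (\<lambda>u. (imul u \<bullet> y) *\<^sub>R z) = - (imul y \<bullet> z)"
  "tr (\<lambda>u. u) = 4"
  "tr imul = 0"
proof -
  show "tr (\<lambda>u. (y \<bullet> u) *\<^sub>R z) = y \<bullet> z" "tr (\<lambda>u. (u \<bullet> y) *\<^sub>R z) = y \<bullet> z"
    using sum_Basis_inner[of y z] by (simp_all add: tr_def inner_commute)
  have "(imul u \<bullet> y) *\<^sub>R z = ((- imul y) \<bullet> u) *\<^sub>R z" for u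
    using inner_imul_right[of y u] by (simp add: inner_commute)
  then show "tr (\<lambda>u. (imul u \<bullet> y) *\<^sub>R z) = - (imul y \<bullet> z)"
    using sum_Basis_inner[of "- imul y" z] by (simp add: tr_def)
  show "tr (\<lambda>u. u) = 4" by (simp add: tr_def inner_same_Basis)
qed (simp_all add: tr_def inner_add_left inner_diff_left sum.distrib sum_subtractf sum_negf sum_distrib_left
    algebra_simps)

lemma tr_conn:
  fixes x :: c2
  defines "r \<equiv> x \<bullet> x"
  shows "tr (\<lambda>u. conn c1 c2 c3 c4 c5 c6 x v u)
      = (5 * c1 r + c2 r + r * c3 r + r * c5 r + c6 r) * (x \<bullet> v)"
    "tr (\<lambda>u. conn c1 c2 c3 c4 c5 c6 x u v)
      = (5 * c1 r + c2 r + r * c3 r + r * c5 r + c6 r) * (x \<bullet> v)"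
    "tr (\<lambda>u. conn c1 c2 c3 c4 c5 c6 x v (imul u))
      = (- c1 r + c2 r + r * (c4 r - c5 r) - 5 * c6 r) * (imul x \<bullet> v)"
  unfolding conn_def r_def
  by (simp_all add: tr_simps scaleR_add_right inner_commute[of v x] imul_swap[of v x] inner_imul_right)
    (simp_all add: algebra_simps)

lemma linear_conn: "linear (conn c1 c2 c3 c4 c5 c6 x v)"
  by (rule linearI) (simp_all add: conn_def inner_add_left inner_add_right algebra_simps)

lemma tr_conn_conn:
  fixes x v w :: c2 and c1 c2 c3 c4 c5 c6 :: "real \<Rightarrow> real"
  defines "r \<equiv> x \<bullet> x" and "\<Gamma> \<equiv> conn c1 c2 c3 c4 c5 c6 x"
    and "\<kappa> \<equiv> 5 * c1 (x \<bullet> x) + c2 (x \<bullet> x) + (x \<bullet> x) * c3 (x \<bullet> x) + (x \<bullet> x) * c5 (x \<bullet> x) + c6 (x \<bullet> x)"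
  shows "tr (\<lambda>u. \<Gamma> v (\<Gamma> u w)) =
    2 * c1 r * c2 r * r * (v \<bullet> w)
    + (c1 r * (2 * c1 r + r * c3 r) + c1 r * \<kappa> + c2 r * (c1 r + c2 r + r * c3 r)
       + c3 r * r * (2 * c1 r + c2 r + r * c3 r) + (c5 r * r + c6 r) * (c1 r + r * c5 r + c6 r))
      * ((x \<bullet> v) * (x \<bullet> w))
    + (c1 r * (r * c4 r - 2 * c6 r) + c2 r * (r * c5 r + c6 r) + c4 r * r * (c1 r + r * c5 r + c6 r)
       + c5 r * r * (c2 r + r * c4 r - 2 * c6 r) - c6 r * (c1 r + r * c5 r + c6 r)
       + c6 r * (- c1 r + c2 r + r * (c4 r - c5 r) - 5 * c6 r)) * ((imul x \<bullet> v) * (imul x \<bullet> w))"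
proof -
  note lin = linear_conn[of c1 c2 c3 c4 c5 c6 x v, folded \<Gamma>_def]
  have "\<Gamma> v (\<Gamma> u w) = (x \<bullet> u) *\<^sub>R (c1 r *\<^sub>R \<Gamma> v w + (c3 r * (x \<bullet> w)) *\<^sub>R \<Gamma> v x
        + (c5 r * (imul x \<bullet> w)) *\<^sub>R \<Gamma> v (imul x))
      + (imul x \<bullet> u) *\<^sub>R ((c4 r * (imul x \<bullet> w)) *\<^sub>R \<Gamma> v x + (c5 r * (x \<bullet> w)) *\<^sub>R \<Gamma> v (imul x)
        + c6 r *\<^sub>R \<Gamma> v (imul w))
      + (w \<bullet> u) *\<^sub>R (c2 r *\<^sub>R \<Gamma> v x) + (c1 r * (x \<bullet> w)) *\<^sub>R \<Gamma> v u
      + (c6 r * (imul x \<bullet> w)) *\<^sub>R \<Gamma> v (imul u)" for u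
  proof -
    have "\<Gamma> u w = (x \<bullet> u) *\<^sub>R (c1 r *\<^sub>R w + (c3 r * (x \<bullet> w)) *\<^sub>R x
        + (c5 r * (imul x \<bullet> w)) *\<^sub>R imul x)
      + (imul x \<bullet> u) *\<^sub>R ((c4 r * (imul x \<bullet> w)) *\<^sub>R x + (c5 r * (x \<bullet> w)) *\<^sub>R imul x
        + c6 r *\<^sub>R imul w)
      + (w \<bullet> u) *\<^sub>R (c2 r *\<^sub>R x) + (c1 r * (x \<bullet> w)) *\<^sub>R u
      + (c6 r * (imul x \<bullet> w)) *\<^sub>R imul u"
      by (simp add: \<Gamma>_def conn_def r_def inner_commute algebra_simps)
    then show ?thesis by (simp only: linear_add[OF lin] linear_scale[OF lin])
  qed
  then have "tr (\<lambda>u. \<Gamma> v (\<Gamma> u w)) = x \<bullet> (c1 r *\<^sub>R \<Gamma> v w + (c3 r * (x \<bullet> w)) *\<^sub>R \<Gamma> v x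
        + (c5 r * (imul x \<bullet> w)) *\<^sub>R \<Gamma> v (imul x))
      + imul x \<bullet> ((c4 r * (imul x \<bullet> w)) *\<^sub>R \<Gamma> v x + (c5 r * (x \<bullet> w)) *\<^sub>R \<Gamma> v (imul x)
        + c6 r *\<^sub>R \<Gamma> v (imul w))
      + w \<bullet> (c2 r *\<^sub>R \<Gamma> v x) + c1 r * (x \<bullet> w) * tr (\<Gamma> v)
      + c6 r * (imul x \<bullet> w) * tr (\<lambda>u. \<Gamma> v (imul u))"
    by (simp only: tr_simps inner_scaleR_right)
  also have "tr (\<Gamma> v) = \<kappa> * (x \<bullet> v)" unfolding \<Gamma>_def \<kappa>_def by (rule tr_conn(1))
  also have "tr (\<lambda>u. \<Gamma> v (imul u))
      = (- c1 r + c2 r + r * (c4 r - c5 r) - 5 * c6 r) * (imul x \<bullet> v)"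
    unfolding \<Gamma>_def r_def by (rule tr_conn(3))
  also have "x \<bullet> (c1 r *\<^sub>R \<Gamma> v w + (c3 r * (x \<bullet> w)) *\<^sub>R \<Gamma> v x + (c5 r * (imul x \<bullet> w)) *\<^sub>R \<Gamma> v (imul x))
      = c1 r * (2 * c1 r * (x \<bullet> v) * (x \<bullet> w) + r * (c2 r * (v \<bullet> w) + c3 r * (x \<bullet> v) * (x \<bullet> w)
          + c4 r * (imul x \<bullet> v) * (imul x \<bullet> w)) - 2 * c6 r * (imul x \<bullet> v) * (imul x \<bullet> w))
        + c3 r * (x \<bullet> w) * (x \<bullet> v) * r * (2 * c1 r + c2 r + r * c3 r)
        + c5 r * (imul x \<bullet> w) * (imul x \<bullet> v) * r * (c2 r + r * c4 r - 2 * c6 r)"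
    unfolding \<Gamma>_def conn_def r_def
    by (simp add: inner_add_right inner_imul_right inner_commute[of v x] imul_swap[of v x])
      (simp add: algebra_simps inner_imul_right)
  also have "imul x \<bullet> ((c4 r * (imul x \<bullet> w)) *\<^sub>R \<Gamma> v x + (c5 r * (x \<bullet> w)) *\<^sub>R \<Gamma> v (imul x)
        + c6 r *\<^sub>R \<Gamma> v (imul w))
      = c4 r * (imul x \<bullet> w) * (imul x \<bullet> v) * r * (c1 r + r * c5 r + c6 r)
        + c5 r * (x \<bullet> w) * (x \<bullet> v) * r * (c1 r + r * c5 r + c6 r)
        + c6 r * ((x \<bullet> v) * (x \<bullet> w) - (imul x \<bullet> v) * (imul x \<bullet> w)) * (c1 r + r * c5 r + c6 r)"
    unfolding \<Gamma>_def conn_def r_def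
    by (simp add: inner_add_right inner_imul_right inner_commute[of v x] imul_swap[of v x])
      (simp add: algebra_simps inner_imul_right)
  also have "w \<bullet> (c2 r *\<^sub>R \<Gamma> v x) = c2 r * ((c1 r + c2 r + r * c3 r) * (x \<bullet> v) * (x \<bullet> w)
        + c1 r * r * (v \<bullet> w) + (c5 r * r + c6 r) * (imul x \<bullet> v) * (imul x \<bullet> w))"
    unfolding \<Gamma>_def conn_def r_def
    by (simp add: inner_add_right inner_imul_right inner_commute[of v x] inner_commute[of w]
      imul_swap[of v x] imul_swap[of w x]) (simp add: algebra_simps inner_imul_right)
  finally show ?thesis by (simp add: algebra_simps)
qed

lemma ricci_conn:
  fixes x :: c2
  assumes U: "open U" "x \<in> U" and \<Gamma>: "\<And>y v w. y \<in> U \<Longrightarrow> christoffel g y v w = conn c1 c2 c3 c4 c5 c6 y v w"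
    and d: "(c1 has_real_derivative d1) (at (x \<bullet> x))" "(c2 has_real_derivative d2) (at (x \<bullet> x))"
      "(c3 has_real_derivative d3) (at (x \<bullet> x))" "(c4 has_real_derivative d4) (at (x \<bullet> x))"
      "(c5 has_real_derivative d5) (at (x \<bullet> x))" "(c6 has_real_derivative d6) (at (x \<bullet> x))"
    and r: "r = x \<bullet> x"
    and C: "C1 = c1 r" "C2 = c2 r" "C3 = c3 r" "C4 = c4 r" "C5 = c5 r" "C6 = c6 r"
    and K: "K = 5 * C1 + C2 + r * C3 + r * C5 + C6"
  shows "ricci g x v w =
    (2 * C1 + 2 * r * d2 + 4 * C2 - 2 * C6 - K + K * r * C2 - 2 * C1 * C2 * r) * (v \<bullet> w)
    + (4 * d1 + 2 * r * d3 + 6 * C3 - 2 * C5 - 2 * (5 * d1 + d2 + C3 + r * d3 + C5 + r * d5 + d6)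
       + K * (2 * C1 + r * C3)
       - (C1 * (2 * C1 + r * C3) + C1 * K + C2 * (C1 + C2 + r * C3)
       + C3 * r * (2 * C1 + C2 + r * C3) + (C5 * r + C6) * (C1 + r * C5 + C6))) * ((x \<bullet> v) * (x \<bullet> w))
    + (2 * r * d4 + 6 * C4 + 2 * C5 - 4 * d6 + K * (r * C4 - 2 * C6)
       - (C1 * (r * C4 - 2 * C6) + C2 * (r * C5 + C6) + C4 * r * (C1 + r * C5 + C6)
       + C5 * r * (C2 + r * C4 - 2 * C6) - C6 * (C1 + r * C5 + C6)
       + C6 * (- C1 + C2 + r * (C4 - C5) - 5 * C6))) * ((imul x \<bullet> v) * (imul x \<bullet> w))"
proof -
  let ?G = "conn c1 c2 c3 c4 c5 c6"
  have D: "frechet_derivative (\<lambda>y. christoffel g y v w) (at x) = frechet_derivative (\<lambda>y. ?G y v w) (at x)" for v w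
    by (rule frechet_derivative_cong_open[OF U]) (simp add: \<Gamma>)
  note D' = frechet_derivative_at[OF conn_has_derivative[OF d], symmetric]
  have "ricci g x v w = tr (\<lambda>u. riemann g x u v w)" by (simp add: ricci_def tr_def)
  also have "\<dots> = tr (\<lambda>u. frechet_derivative (\<lambda>y. ?G y v w) (at x) u)
      - tr (\<lambda>u. frechet_derivative (\<lambda>y. ?G y u w) (at x) v)
      + tr (\<lambda>u. ?G x u (?G x v w)) - tr (\<lambda>u. ?G x v (?G x u w))"
    unfolding riemann_def D \<Gamma>[OF U(2)] by (simp only: tr_simps)
  also have "tr (\<lambda>u. frechet_derivative (\<lambda>y. ?G y v w) (at x) u)
      = (2 * C1 + 2 * r * d2 + 4 * C2 - 2 * C6) * (v \<bullet> w)
       + (4 * d1 + 2 * r * d3 + 6 * C3 - 2 * C5) * ((x \<bullet> v) * (x \<bullet> w))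
       + (2 * r * d4 + 6 * C4 + 2 * C5 - 4 * d6) * ((imul x \<bullet> v) * (imul x \<bullet> w))"
    unfolding D' C r by (simp add: tr_simps scaleR_add_right inner_imul_right inner_commute[of v x]
      inner_commute[of w x] imul_swap[of v x] imul_swap[of w x] inner_commute[of w v]) (simp add: algebra_simps inner_imul_right)
  also have "tr (\<lambda>u. frechet_derivative (\<lambda>y. ?G y u w) (at x) v)
      = K * (v \<bullet> w) + 2 * (5 * d1 + d2 + C3 + r * d3 + C5 + r * d5 + d6) * ((x \<bullet> v) * (x \<bullet> w))"
    unfolding D' K C r by (simp add: tr_simps scaleR_add_right inner_imul_right inner_commute[of v x]
      inner_commute[of w x] imul_swap[of v x] imul_swap[of w x] inner_commute[of w v]) (simp add: algebra_simps inner_imul_right)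
  also have "tr (\<lambda>u. ?G x u (?G x v w)) = K * (x \<bullet> ?G x v w)"
    unfolding K C r by (rule tr_conn(2))
  also have "x \<bullet> ?G x v w = 2 * C1 * ((x \<bullet> v) * (x \<bullet> w)) + r * (C2 * (v \<bullet> w) + C3 * ((x \<bullet> v) * (x \<bullet> w))
      + C4 * ((imul x \<bullet> v) * (imul x \<bullet> w))) - 2 * C6 * ((imul x \<bullet> v) * (imul x \<bullet> w))"
    unfolding conn_def C r by (simp add: inner_add_right inner_imul_right algebra_simps)
  also note tr_conn_conn[of c1 c2 c3 c4 c5 c6 x v w, folded r, folded C, folded K]
  finally show ?thesis by (simp add: algebra_simps)
qed

lemma scalar_curvature_met:
  assumes R: "riemannian_on U (met a)" and x: "x \<in> U" "x \<in> M1" and s: "s = 1 - x \<bullet> x"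
    and ric: "\<And>v w. ricci (met a) x v w
      = R1 * (v \<bullet> w) + R2 * ((x \<bullet> v) * (x \<bullet> w)) + R3 * ((imul x \<bullet> v) * (imul x \<bullet> w))"
  shows "scalar_curvature (met a) x = (1 / a (1 - s)) * (4 * R1 + (1 - s) * (R2 + R3)
    - (1 + s) * (1 - s) * (R1 + (1 - s) * R2) + (1 + s) / s\<^sup>2 * (1 - s) * (R1 + (1 - s) * R3))"
proof -
  have r: "x \<bullet> x = 1 - s" "2 - (1 - s) = 1 + s" "1 - (1 - s) = s" using s by auto
  define u where "u b = R1 *\<^sub>R b + (R2 * (x \<bullet> b)) *\<^sub>R x + (R3 * (imul x \<bullet> b)) *\<^sub>R imul x" for b
  have "ricci (met a) x b = (\<lambda>w. u b \<bullet> w)" for b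
    by (simp add: ric fun_eq_iff u_def inner_add_left)
  moreover have "x \<bullet> u b = (R1 + (1 - s) * R2) * (x \<bullet> b)"
    "imul x \<bullet> u b = (R1 + (1 - s) * R3) * (imul x \<bullet> b)" for b
    by (simp_all add: u_def r(1) inner_add_right algebra_simps)
  ultimately have sh: "sharp (met a) x (ricci (met a) x b) = (1 / a (1 - s)) *\<^sub>R
    ((R1 *\<^sub>R b + (R2 * (x \<bullet> b)) *\<^sub>R x + (R3 * (imul x \<bullet> b)) *\<^sub>R imul x)
      - ((1 + s) * (R1 + (1 - s) * R2) * (x \<bullet> b)) *\<^sub>R x
      + ((1 + s) / s\<^sup>2 * (R1 + (1 - s) * R3) * (imul x \<bullet> b)) *\<^sub>R imul x)" for b
    by (simp only: met_sharp[OF R x] r mult.assoc flip: u_def)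
  have "scalar_curvature (met a) x = tr (\<lambda>b. sharp (met a) x (ricci (met a) x b))"
    by (simp add: scalar_curvature_def tr_def)
  also have "\<dots> = (1 / a (1 - s)) * (R1 * 4 + R2 * (x \<bullet> x) + R3 * (imul x \<bullet> imul x)
      - (1 + s) * (R1 + (1 - s) * R2) * (x \<bullet> x)
      + (1 + s) / s\<^sup>2 * (R1 + (1 - s) * R3) * (imul x \<bullet> imul x))"
    unfolding sh by (simp only: tr_simps)
  finally show ?thesis by (simp add: r algebra_simps)
qed

lemma curvature_identity:
  fixes s t K k' :: real
  assumes st: "s * t = 1" and C: "C1 = K" "C2 = 1 + s - K * s\<^sup>2" "C3 = 1 + 2 * t - K * (1 + s)" 
    "C4 = (K * (1 + s) - 1) * s\<^sup>2 - 2 * (1 + s)\<^sup>2" "C5 = - 1 - 2 * t" "C6 = - 1 - s"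
   and d: "d1 = k'" "d2 = - 1 - k' * s\<^sup>2 + 2 * K * s" "d3 = 2 * t\<^sup>2 - k' * (1 + s) + K"
    "d4 = (k' * (1 + s) - K) * s\<^sup>2 - 2 * (K * (1 + s) - 1) * s + 4 * (1 + s)" "d5 = - 2 * t\<^sup>2" "d6 = 1"
   and k4: "k4 = 4 * K" and r: "r = 1 - s"
   and R1: "R1 = 2 * C1 + 2 * r * d2 + 4 * C2 - 2 * C6 - k4 + k4 * r * C2 - 2 * C1 * C2 * r"
   and R2: "R2 = 4 * d1 + 2 * r * d3 + 6 * C3 - 2 * C5 - 2 * (5 * d1 + d2 + C3 + r * d3 + C5 + r * d5 + d6)
       + k4 * (2 * C1 + r * C3)
       - (C1 * (2 * C1 + r * C3) + C1 * k4 + C2 * (C1 + C2 + r * C3)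
       + C3 * r * (2 * C1 + C2 + r * C3) + (C5 * r + C6) * (C1 + r * C5 + C6))"
   and R3: "R3 = 2 * r * d4 + 6 * C4 + 2 * C5 - 4 * d6 + k4 * (r * C4 - 2 * C6)
       - (C1 * (r * C4 - 2 * C6) + C2 * (r * C5 + C6) + C4 * r * (C1 + r * C5 + C6)
       + C5 * r * (C2 + r * C4 - 2 * C6) - C6 * (C1 + r * C5 + C6)
       + C6 * (- C1 + C2 + r * (C4 - C5) - 5 * C6))"
  shows "4 * R1 + (1 - s) * (R2 + R3) - (1 + s) * (1 - s) * (R1 + (1 - s) * R2)
      + (1 + s) * t\<^sup>2 * (1 - s) * (R1 + (1 - s) * R3)
     = 48 * s - 6 * ((1 - s) * s\<^sup>2 * (2 * k' + K\<^sup>2) + 4 * s * (2 * s - 1) * K)"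
proof -
  have t: "t = 1 / s" and s0: "s \<noteq> 0" using st by (auto simp: eq_divide_eq mult.commute)
  show ?thesis
    unfolding R2 R3 R1 C d k4 r t using s0 by (simp add: field_simps eval_nat_numeral)
qed

lemma scalar_curvature_met_conn:
  assumes R: "riemannian_on U (met a)" and x: "x \<in> U" and UM: "U \<subseteq> M1" and s: "s = 1 - x \<bullet> x"
    and a: "\<And>y. y \<in> U \<Longrightarrow> (a has_real_derivative k (y \<bullet> y) * a (y \<bullet> y)) (at (y \<bullet> y))"
    and k: "(k has_real_derivative k') (at (x \<bullet> x))"
    and A: "A = a (1 - s)" and K: "K = k (1 - s)"
  shows "scalar_curvature (met a) x = (48 * s - 6 * ((1 - s) * s\<^sup>2 * (2 * k' + K\<^sup>2)
     + 4 * s * (2 * s - 1) * K)) / A"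
proof -
  have s0: "s \<noteq> 0" and x1: "x \<in> M1" using x UM by (auto simp: s M1_iff)
  have r: "x \<bullet> x = 1 - s" using s by simp
  have U: "open U" by (rule riemannian_onD(1)[OF R])
  have \<Gamma>: "christoffel (met a) y v w = met_conn k y v w" if "y \<in> U" for y v w
    by (rule christoffel_met[of U a y k, OF R that subsetD[OF UM that] a[OF that]])
  note k = k[unfolded r]
  define t where "t = 1 / s"
  have d2: "((\<lambda>r. (2 - r) - k r * (1 - r)\<^sup>2) has_real_derivative - 1 - k' * s\<^sup>2 + 2 * K * s) (at (1 - s))"
    unfolding K by (rule derivative_eq_intros k refl)+ simp
  have d3: "((\<lambda>r. 1 + 2 / (1 - r) - k r * (2 - r)) has_real_derivative 2 * t\<^sup>2 - k' * (1 + s) + K) (at (1 - s))"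
    unfolding K t_def using s0 by (auto intro!: derivative_eq_intros k simp: field_simps power2_eq_square)
  have d4: "((\<lambda>r. (k r * (2 - r) - 1) * (1 - r)\<^sup>2 - 2 * (2 - r)\<^sup>2) has_real_derivative
      (k' * (1 + s) - K) * s\<^sup>2 - 2 * (K * (1 + s) - 1) * s + 4 * (1 + s)) (at (1 - s))"
    unfolding K by (auto intro!: derivative_eq_intros k simp: field_simps power2_eq_square)
  have d5: "((\<lambda>r::real. - 1 - 2 / (1 - r)) has_real_derivative - 2 * t\<^sup>2) (at (1 - s))"
    unfolding t_def using s0 by (auto intro!: derivative_eq_intros simp: field_simps power2_eq_square)
  have d6: "((\<lambda>r::real. r - 2) has_real_derivative 1) (at (1 - s))"
    by (auto intro!: derivative_eq_intros)
  define C1 C2 C3 C4 C5 C6 where C: "C1 = K" "C2 = 1 + s - K * s\<^sup>2" "C3 = 1 + 2 * t - K * (1 + s)"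
    "C4 = (K * (1 + s) - 1) * s\<^sup>2 - 2 * (1 + s)\<^sup>2" "C5 = - 1 - 2 * t" "C6 = - 1 - s"
  define d1' d2' d3' d4' d5' d6' where d: "d1' = k'" "d2' = - 1 - k' * s\<^sup>2 + 2 * K * s"
    "d3' = 2 * t\<^sup>2 - k' * (1 + s) + K"
    "d4' = (k' * (1 + s) - K) * s\<^sup>2 - 2 * (K * (1 + s) - 1) * s + 4 * (1 + s)"
    "d5' = - 2 * t\<^sup>2" "d6' = (1 :: real)"
  define k4 \<rho> where k4: "k4 = 4 * K" and \<rho>: "\<rho> = 1 - s"
  define R1 R2 R3 where R1: "R1 = 2 * C1 + 2 * \<rho> * d2' + 4 * C2 - 2 * C6 - k4 + k4 * \<rho> * C2 - 2 * C1 * C2 * \<rho>"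
    and R2: "R2 = 4 * d1' + 2 * \<rho> * d3' + 6 * C3 - 2 * C5
       - 2 * (5 * d1' + d2' + C3 + \<rho> * d3' + C5 + \<rho> * d5' + d6') + k4 * (2 * C1 + \<rho> * C3)
       - (C1 * (2 * C1 + \<rho> * C3) + C1 * k4 + C2 * (C1 + C2 + \<rho> * C3)
       + C3 * \<rho> * (2 * C1 + C2 + \<rho> * C3) + (C5 * \<rho> + C6) * (C1 + \<rho> * C5 + C6))"
    and R3: "R3 = 2 * \<rho> * d4' + 6 * C4 + 2 * C5 - 4 * d6' + k4 * (\<rho> * C4 - 2 * C6)
       - (C1 * (\<rho> * C4 - 2 * C6) + C2 * (\<rho> * C5 + C6) + C4 * \<rho> * (C1 + \<rho> * C5 + C6)
       + C5 * \<rho> * (C2 + \<rho> * C4 - 2 * C6) - C6 * (C1 + \<rho> * C5 + C6)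
       + C6 * (- C1 + C2 + \<rho> * (C4 - C5) - 5 * C6))"
  have ric: "ricci (met a) x v w
      = R1 * (v \<bullet> w) + R2 * ((x \<bullet> v) * (x \<bullet> w)) + R3 * ((imul x \<bullet> v) * (imul x \<bullet> w))" for v w
    unfolding R1 R2 R3
  proof (rule ricci_conn[OF U x \<Gamma>])
    show "\<rho> = x \<bullet> x" using r \<rho> by simp
    show "k4 = 5 * C1 + C2 + \<rho> * C3 + \<rho> * C5 + C6"
      by (simp add: k4 C \<rho> algebra_simps power2_eq_square)
  qed (use k d2 d3 d4 d5 d6 in \<open>simp_all add: r d C \<rho> K t_def\<close>)
  have A0: "A \<noteq> 0" using met_coeff_nonzero[OF R x] by (simp add: A r)
  have st: "s * t = 1" using s0 by (simp add: t_def)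
  have p: "(1 + s) / s\<^sup>2 = (1 + s) * t\<^sup>2" by (simp add: t_def power_divide)
  show ?thesis
    using scalar_curvature_met[OF R x x1 s ric, folded A]
    unfolding p curvature_identity[OF st C d k4 \<rho> R1 R2 R3] by simp
qed

section \<open>Ends\<close>

lemma collar_iff: "x \<in> collar I \<longleftrightarrow> x \<noteq> 0 \<and> zcoord x \<in> I"
proof
  assume "x \<in> collar I"
  then obtain z u where u: "x = polar (z, u)" "z \<in> I" "norm u = 1" by (auto simp: collar_def)
  then have "u \<noteq> 0" by force
  then show "x \<noteq> 0 \<and> zcoord x \<in> I"
    using u zcoord_polar[of u z] by (simp add: polar_def)
next
  assume x: "x \<noteq> 0 \<and> zcoord x \<in> I"
  then show "x \<in> collar I"
    unfolding collar_def using polar_zcoord[of x]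
    by (intro image_eqI[where x = "(zcoord x, x /\<^sub>R norm x)"]) auto
qed

lemma zcoord_less_iff: "x \<noteq> 0 \<Longrightarrow> zcoord x < a \<longleftrightarrow> exp (- a / 2) < norm x"
  using exp_less_cancel_iff[of "- a / 2" "ln (norm x)"] by (auto simp: zcoord_def)

lemma zcoord_greater_iff: "x \<noteq> 0 \<Longrightarrow> a < zcoord x \<longleftrightarrow> norm x < exp (- a / 2)"
  using exp_less_cancel_iff[of "ln (norm x)" "- a / 2"] by (auto simp: zcoord_def)

definition annulus :: "real \<Rightarrow> real \<Rightarrow> c2 set" where
  "annulus r s = {x. r < norm x \<and> norm x < s}"

lemma z_zero_end_eq: "z_zero_end n = annulus (exp (- 1 / (2 * real (Suc n)))) 1"
proof -
  have e: "- (1 / real (Suc n)) / 2 = - 1 / (2 * real (Suc n))" by simp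
  show ?thesis
  proof (rule set_eqI)
    fix x :: c2
    have "x \<noteq> 0" if "exp c < norm x" for c using that exp_gt_zero[of c] by fastforce
    then show "x \<in> z_zero_end n \<longleftrightarrow> x \<in> annulus (exp (- 1 / (2 * real (Suc n)))) 1"
      unfolding z_zero_end_def annulus_def collar_iff
      using zcoord_less_iff[of x "1 / real (Suc n)"] zcoord_greater_iff[of x 0] unfolding e by auto
  qed
qed

lemma z_infinity_end_eq: "z_infinity_end n = annulus 0 (exp (- real n / 2))"
  unfolding z_infinity_end_def annulus_def
  by (auto simp: collar_iff zcoord_greater_iff simp del: norm_Pair)

lemma annulus_basic:
  "open (annulus r s)" "connected (annulus r s)" "frontier (annulus r s) \<subseteq> sphere 0 r \<union> sphere 0 s"
proof -
  have e: "annulus r s = {x. r < norm (x - 0) \<and> norm (x - 0) < s}" by (simp add: annulus_def)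
  show o: "open (annulus r s)"
    unfolding annulus_def by (intro open_Collect_conj open_Collect_less continuous_intros)
  show "connected (annulus r s)" unfolding e by (rule connected_annulus) simp
  have "closed {x::c2. r \<le> norm x \<and> norm x \<le> s}"
    by (intro closed_Collect_conj closed_Collect_le continuous_intros)
  then have "closure (annulus r s) \<subseteq> {x. r \<le> norm x \<and> norm x \<le> s}"
    by (intro closure_minimal) (auto simp: annulus_def simp del: norm_Pair)
  then show "frontier (annulus r s) \<subseteq> sphere 0 r \<union> sphere 0 s"
    unfolding frontier_def interior_open[OF o] by (auto simp: annulus_def subset_iff simp del: norm_Pair split_paired_All)
qed

lemma annulus_nonempty:
  assumes "0 \<le> r" "r < s" shows "annulus r s \<noteq> {}"
proof -
  have "norm (((r + s) / 2) *\<^sub>R (1, 0) :: c2) = (r + s) / 2" using assms by (simp add: norm_Pair)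
  then have "((r + s) / 2) *\<^sub>R (1, 0) \<in> annulus r s" using assms by (simp add: annulus_def)
  then show ?thesis by blast
qed

lemma compact_frontier_annulus:
  assumes "\<And>t. t \<in> {r, s} \<Longrightarrow> sphere 0 t \<subseteq> U \<or> U \<inter> sphere 0 t = {}"
  shows "compact (U \<inter> frontier (annulus r s))"
proof -
  have c: "compact (U \<inter> sphere 0 t)" if "t \<in> {r, s}" for t
    using assms[OF that] by (auto simp: Int_absorb1)
  have "U \<inter> frontier (annulus r s) = frontier (annulus r s) \<inter> (U \<inter> sphere 0 r)
      \<union> frontier (annulus r s) \<inter> (U \<inter> sphere 0 s)"
    using annulus_basic(3)[of r s] by blast
  also have "compact \<dots>" by (intro compact_Un closed_Int_compact frontier_closed c) auto
  finally show ?thesis .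
qed

lemma compact_M1_bound:
  assumes "compact K" "K \<subseteq> M1"
  obtains b where "0 < b" "b < 1" "\<And>x. x \<in> K \<Longrightarrow> norm x \<le> b"
proof (cases "K = {}")
  case True then show ?thesis using that[of "1/2"] by auto
next
  case False
  obtain y where y: "y \<in> K" "\<And>x. x \<in> K \<Longrightarrow> norm x \<le> norm y"
    using continuous_attains_sup[OF assms(1) False continuous_on_norm_id] by blast
  have "y \<in> M1" using y assms by blast
  then have "norm y < 1" by (simp add: M1_eq)
  then show ?thesis
    using y(2) by (intro that[of "max (1/2) (norm y)"]) (simp_all add: le_max_iff_disj)
qed

lemma compact_M0_bound:
  assumes "compact K" "K \<subseteq> M0"
  obtains a where "0 < a" "a < 1" "\<And>x. x \<in> K \<Longrightarrow> a \<le> norm x"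
proof (cases "K = {}")
  case True then show ?thesis using that[of "1/2"] by auto
next
  case False
  obtain y where y: "y \<in> K" "\<And>x. x \<in> K \<Longrightarrow> norm y \<le> norm x"
    using continuous_attains_inf[OF assms(1) False continuous_on_norm_id] by blast
  have "y \<in> M0" using y assms by blast
  then have "norm y < 1" "0 < norm y" by (simp_all add: M0_eq)
  then show ?thesis using y(2) that by blast
qed

lemma exp_arb_close_1:
  assumes "b < 1" obtains n where "b < exp (- 1 / (2 * real (Suc n)))"
proof -
  have "(\<lambda>n. exp (- 1 / 2 * inverse (real (Suc n)))) \<longlonglongrightarrow> exp (- 1 / 2 * 0)"
    by (intro tendsto_intros LIMSEQ_inverse_real_of_nat)
  then have "\<forall>\<^sub>F n in sequentially. b < exp (- 1 / 2 * inverse (real (Suc n)))"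
    using assms by (intro order_tendstoD(1)[where a = b]) auto
  then obtain n where "b < exp (- 1 / 2 * inverse (real (Suc n)))"
    unfolding eventually_sequentially by blast
  then show ?thesis by (intro that[of n]) (simp add: field_simps)
qed

lemma end_of_z_zero:
  assumes U: "U = M0 \<or> U = M1" shows "end_of U z_zero_end"
  unfolding end_of_def z_zero_end_eq
proof (intro conjI allI impI)
  fix n
  define r where "r n = exp (- 1 / (2 * real (Suc n)))" for n
  have r: "0 < r n" "r n < 1" "r n \<le> r (Suc n)" by (auto simp: r_def field_simps)
  show "open (annulus (r n) 1)" "connected (annulus (r n) 1)" by (rule annulus_basic)+
  show "annulus (r n) 1 \<noteq> {}" using r by (intro annulus_nonempty) auto
  show "annulus (r n) 1 \<subseteq> U"
    using U r by (auto simp: annulus_def M0_eq M1_eq simp del: norm_Pair)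
  show "annulus (r (Suc n)) 1 \<subseteq> annulus (r n) 1"
    using r by (auto simp: annulus_def simp del: norm_Pair)
  show "compact (U \<inter> frontier (annulus (r n) 1))"
    using U r by (intro compact_frontier_annulus) (auto simp: M0_eq M1_eq simp del: norm_Pair)
next
  fix K assume "compact K \<and> K \<subseteq> U"
  then have "compact K" "K \<subseteq> M1" using U M0_M1 by auto
  from compact_M1_bound[OF this] obtain b where b: "b < 1" "\<And>x. x \<in> K \<Longrightarrow> norm x \<le> b" by metis
  obtain n where "b < exp (- 1 / (2 * real (Suc n)))" using exp_arb_close_1[OF b(1)] .
  with b(2) show "\<exists>n. annulus (exp (- 1 / (2 * real (Suc n)))) 1 \<inter> K = {}"
    by (intro exI[of _ n]) (force simp: annulus_def simp del: norm_Pair of_nat_Suc)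
qed

lemma end_of_z_infinity: "end_of M0 z_infinity_end"
  unfolding end_of_def z_infinity_end_eq
proof (intro conjI allI impI)
  fix n :: nat
  define r where "r n = exp (- real n / 2)" for n
  have r: "0 < r n" "r n \<le> 1" "r (Suc n) \<le> r n" by (auto simp: r_def)
  show "open (annulus 0 (r n))" "connected (annulus 0 (r n))" by (rule annulus_basic)+
  show "annulus 0 (r n) \<noteq> {}" using r by (intro annulus_nonempty) auto
  show "annulus 0 (r n) \<subseteq> M0" using r by (auto simp: annulus_def M0_eq simp del: norm_Pair)
  show "annulus 0 (r (Suc n)) \<subseteq> annulus 0 (r n)"
    using r by (auto simp: annulus_def simp del: norm_Pair)
  have "r n = 1 \<or> r n < 1" using r by linarith
  then show "compact (M0 \<inter> frontier (annulus 0 (r n)))"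
    using r by (intro compact_frontier_annulus) (auto simp: M0_eq simp del: norm_Pair)
next
  fix K assume "compact K \<and> K \<subseteq> M0"
  then obtain a where a: "0 < a" "\<And>x. x \<in> K \<Longrightarrow> a \<le> norm x" using compact_M0_bound by metis
  obtain n :: nat where n: "- 2 * ln a < real n" using reals_Archimedean2 by blast
  then have "- real n / 2 < ln a" by simp
  then have "exp (- real n / 2) < a" using a(1) by (metis exp_less_cancel_iff exp_ln)
  with a(2) show "\<exists>n. annulus 0 (exp (- real n / 2)) \<inter> K = {}"
    by (intro exI[of _ n]) (force simp: annulus_def simp del: norm_Pair)
qed

text \<open>An unbounded component contains one of the annuli near the boundary, hence is one of
  finitely many.\<close>

lemma unbounded_component_meets:
  assumes L: "compact L" "L \<subseteq> U" and C: "C \<in> unbounded_components U K" and V: "U - L \<subseteq> V"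
  shows "C \<inter> V \<noteq> {}"
proof
  assume "C \<inter> V = {}"
  moreover have "C \<subseteq> U" using C in_components_subset by (fastforce simp: unbounded_components_def)
  ultimately have "C \<subseteq> L" using V by blast
  with L C show False by (auto simp: unbounded_components_def)
qed

lemma component_unique:
  assumes "C \<in> components S" "connected A" "A \<subseteq> S" "a \<in> A" "C \<inter> A \<noteq> {}"
  shows "C = connected_component_set S a"
proof -
  obtain c where c: "c \<in> C" "c \<in> A" using assms(5) by blast
  have "C = connected_component_set S c"
    using assms(1) c(1) by (metis components_iff connected_component_eq)
  also have "\<dots> = connected_component_set S a"
    using assms c(2) connected_component_maximal[of c A S] by (metis connected_component_eq in_mono)
  finally show ?thesis .
qed

lemma annulus_component_unbounded:
  assumes "annulus b 1 \<subseteq> U - K" "U \<subseteq> M1" "x \<in> annulus b 1" "b < 1" "0 < b"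
  shows "connected_component_set (U - K) x \<in> unbounded_components U K"
  unfolding unbounded_components_def
proof (intro CollectI conjI notI)
  show "connected_component_set (U - K) x \<in> components (U - K)"
    using assms by (auto intro!: componentsI)
  assume "\<exists>L. compact L \<and> L \<subseteq> U \<and> connected_component_set (U - K) x \<subseteq> L"
  then obtain L where L: "compact L" "L \<subseteq> U" "connected_component_set (U - K) x \<subseteq> L" by blast
  obtain c where c: "0 < c" "c < 1" "\<And>y. y \<in> L \<Longrightarrow> norm y \<le> c"
    using compact_M1_bound[OF L(1)] L(2) assms(2) by (metis subset_trans)
  have "annulus b 1 \<subseteq> connected_component_set (U - K) x"
    using assms by (intro connected_component_maximal annulus_basic) auto
  then have "annulus (max b c) 1 \<subseteq> L" using L(3) by (auto simp: annulus_def simp del: norm_Pair)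
  moreover have "annulus (max b c) 1 \<noteq> {}" using assms c by (intro annulus_nonempty) auto
  then obtain y where "y \<in> annulus (max b c) 1" by blast
  ultimately show False using c(3)[of y] by (auto simp: annulus_def simp del: norm_Pair)
qed

lemma has_num_ends_M1: "has_num_ends M1 1"
  unfolding has_num_ends_def
proof (intro conjI allI impI)
  fix K assume K: "compact K \<and> K \<subseteq> M1"
  then obtain b where b: "0 < b" "b < 1" "\<And>x. x \<in> K \<Longrightarrow> norm x \<le> b" using compact_M1_bound by metis
  have A: "annulus b 1 \<subseteq> M1 - K" using b by (fastforce simp: annulus_def M1_eq simp del: norm_Pair)
  obtain a where a: "a \<in> annulus b 1" using annulus_nonempty[of b 1] b by auto
  have "C = connected_component_set (M1 - K) a" if C: "C \<in> unbounded_components M1 K" for C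
  proof (rule component_unique[OF _ annulus_basic(2) A a])
    show "C \<in> components (M1 - K)" using C by (simp add: unbounded_components_def)
    show "C \<inter> annulus b 1 \<noteq> {}"
      by (rule unbounded_component_meets[OF compact_cball _ C, of 0 b])
        (use b in \<open>auto simp: M1_eq annulus_def simp del: norm_Pair\<close>)
  qed
  then have *: "unbounded_components M1 K \<subseteq> {connected_component_set (M1 - K) a}" by blast
  then show "finite (unbounded_components M1 K)" by (rule finite_subset) simp
  show "card (unbounded_components M1 K) \<le> 1" using card_mono[OF _ *] by simp
next
  obtain a where a: "a \<in> annulus (1/2) 1" using annulus_nonempty[of "1/2" 1] by auto
  have "connected_component_set (M1 - {}) a \<in> unbounded_components M1 {}"
    by (rule annulus_component_unbounded[OF _ _ a]) (auto simp: annulus_def M1_eq simp del: norm_Pair)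
  moreover have "unbounded_components M1 {} \<subseteq> {M1}"
    using components_eq_sing_iff[of M1] connected_M(2)
    by (auto simp: unbounded_components_def M1_eq)
  ultimately have "unbounded_components M1 {} = {M1}" by (metis empty_iff subset_singletonD)
  then show "\<exists>K. compact K \<and> K \<subseteq> M1 \<and> card (unbounded_components M1 K) = 1"
    by (intro exI[of _ "{}"]) simp
qed

lemma has_num_ends_M0: "has_num_ends M0 2"
  unfolding has_num_ends_def
proof (intro conjI allI impI)
  fix K assume K: "compact K \<and> K \<subseteq> M0"
  then obtain b where b: "0 < b" "b < 1" "\<And>x. x \<in> K \<Longrightarrow> norm x \<le> b"
    using compact_M1_bound M0_M1 by (metis subset_trans)
  obtain c where c: "0 < c" "c < 1" "\<And>x. x \<in> K \<Longrightarrow> c \<le> norm x" using K compact_M0_bound by metis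
  have A: "annulus b 1 \<subseteq> M0 - K" "annulus 0 c \<subseteq> M0 - K"
    using b c by (fastforce simp: annulus_def M0_eq simp del: norm_Pair)+
  obtain a where a: "a \<in> annulus b 1" using annulus_nonempty[of b 1] b by auto
  obtain a' where a': "a' \<in> annulus 0 c" using annulus_nonempty[of 0 c] c by auto
  have "C = connected_component_set (M0 - K) a \<or> C = connected_component_set (M0 - K) a'"
    if C: "C \<in> unbounded_components M0 K" for C
  proof -
    let ?L = "cball 0 b - ball 0 c"
    have "C \<inter> (annulus b 1 \<union> annulus 0 c) \<noteq> {}"
      by (rule unbounded_component_meets[OF _ _ C, of ?L])
        (use b c in \<open>auto simp: M0_eq annulus_def compact_diff simp del: norm_Pair\<close>)
    then have "C \<inter> annulus b 1 \<noteq> {} \<or> C \<inter> annulus 0 c \<noteq> {}" by blast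
    moreover have "C \<in> components (M0 - K)" using C by (simp add: unbounded_components_def)
    ultimately show ?thesis
      using component_unique[OF _ annulus_basic(2) A(1) a] component_unique[OF _ annulus_basic(2) A(2) a']
      by blast
  qed
  then have *: "unbounded_components M0 K
      \<subseteq> {connected_component_set (M0 - K) a, connected_component_set (M0 - K) a'}" by blast
  then show "finite (unbounded_components M0 K)" by (rule finite_subset) simp
  have "card (unbounded_components M0 K)
      \<le> card {connected_component_set (M0 - K) a, connected_component_set (M0 - K) a'}"
    by (rule card_mono[OF _ *]) simp
  also have "\<dots> \<le> 2" by (simp add: card_insert_if)
  finally show "card (unbounded_components M0 K) \<le> 2" .
next
  let ?K = "sphere (0 :: c2) (1/2)"
  let ?C = "connected_component_set (M0 - ?K)"
  have A: "annulus (1/2) 1 \<subseteq> M0 - ?K" "annulus 0 (1/2) \<subseteq> M0 - ?K"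
    by (auto simp: annulus_def M0_eq simp del: norm_Pair)
  obtain a where a: "a \<in> annulus (1/2) 1" using annulus_nonempty[of "1/2" 1] by auto
  obtain a' where a': "a' \<in> annulus 0 (1/2)" using annulus_nonempty[of 0 "1/2"] by auto
  have U1: "?C a \<in> unbounded_components M0 ?K"
    by (rule annulus_component_unbounded[OF A(1) M0_M1 a]) auto
  have "?C a' \<in> unbounded_components M0 ?K"
    unfolding unbounded_components_def
  proof (intro CollectI conjI notI)
    show "?C a' \<in> components (M0 - ?K)" using A a' by (auto intro!: componentsI)
    assume "\<exists>L. compact L \<and> L \<subseteq> M0 \<and> ?C a' \<subseteq> L"
    then obtain L where L: "compact L" "L \<subseteq> M0" "?C a' \<subseteq> L" by blast
    obtain c where c: "0 < c" "c < 1" "\<And>y. y \<in> L \<Longrightarrow> c \<le> norm y"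
      using compact_M0_bound[OF L(1,2)] by metis
    have "annulus 0 (1/2) \<subseteq> ?C a'"
      using A a' by (intro connected_component_maximal annulus_basic) auto
    then have "annulus 0 (min (1/2) c) \<subseteq> L" using L(3) by (auto simp: annulus_def simp del: norm_Pair)
    moreover have "annulus 0 (min (1/2) c) \<noteq> {}" using c by (intro annulus_nonempty) auto
    then obtain y where "y \<in> annulus 0 (min (1/2) c)" by blast
    ultimately show False using c(3)[of y] by (auto simp: annulus_def simp del: norm_Pair)
  qed
  moreover have "?C a \<noteq> ?C a'"
  proof
    assume eq: "?C a = ?C a'"
    have "a \<in> ?C a" "a' \<in> ?C a'" using A a a' by (auto intro: connected_component_refl)
    then have "a \<in> ?C a" "a' \<in> ?C a" unfolding eq by simp_all
    moreover have "connected (norm ` ?C a)"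
      by (intro connected_continuous_image continuous_on_norm_id connected_connected_component)
    ultimately have "1/2 \<in> norm ` ?C a"
      using a a' connectedD_interval[of "norm ` ?C a" "norm a'" "norm a" "1/2"]
      by (auto simp: annulus_def simp del: norm_Pair)
    then show False using connected_component_subset[of "M0 - ?K" a] by (auto simp del: norm_Pair)
  qed
  ultimately have *: "{?C a, ?C a'} \<subseteq> unbounded_components M0 ?K" "card {?C a, ?C a'} = 2"
    using U1 by auto
  have "C = ?C a \<or> C = ?C a'" if C: "C \<in> unbounded_components M0 ?K" for C
  proof -
    have "C \<inter> (annulus (1/2) 1 \<union> annulus 0 (1/2)) \<noteq> {}"
      by (rule unbounded_component_meets[OF compact_sphere _ C, of 0 "1/2"])
        (auto simp: M0_eq annulus_def simp del: norm_Pair)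
    then have "C \<inter> annulus (1/2) 1 \<noteq> {} \<or> C \<inter> annulus 0 (1/2) \<noteq> {}" by blast
    moreover have "C \<in> components (M0 - ?K)" using C by (simp add: unbounded_components_def)
    ultimately show ?thesis
      using component_unique[OF _ annulus_basic(2) A(1) a] component_unique[OF _ annulus_basic(2) A(2) a']
      by blast
  qed
  then have "unbounded_components M0 ?K = {?C a, ?C a'}" using *(1) by blast
  then show "\<exists>K. compact K \<and> K \<subseteq> M0 \<and> card (unbounded_components M0 K) = 2"
    using *(2) by (intro exI[of _ ?K]) (auto simp: M0_eq simp del: norm_Pair)
qed

section \<open>Complex structures\<close>

lemma endo_apply_derivative:
  fixes A :: "c2 \<Rightarrow> c2 \<Rightarrow> c2"
  assumes U: "open U" "x \<in> U" and A: "\<And>y. y \<in> U \<Longrightarrow> linear (A y)"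
    and B: "\<And>v. ((\<lambda>y. A y v) has_derivative (\<lambda>u. B u v)) (at x)"
    and X: "(X has_derivative X') (at x)"
  shows "((\<lambda>y. A y (X y)) has_derivative (\<lambda>u. A x (X' u) + (\<Sum>i\<in>Basis. (X x \<bullet> i) *\<^sub>R B u i))) (at x)"
proof -
  have "((\<lambda>y. \<Sum>i\<in>Basis. (X y \<bullet> i) *\<^sub>R A y i) has_derivative
      (\<lambda>u. \<Sum>i\<in>Basis. (X x \<bullet> i) *\<^sub>R B u i + (X' u \<bullet> i) *\<^sub>R A x i)) (at x)"
    by (intro has_derivative_sum has_derivative_scaleR has_derivative_inner_left X B)
  then have "((\<lambda>y. A y (X y)) has_derivative
      (\<lambda>u. \<Sum>i\<in>Basis. (X x \<bullet> i) *\<^sub>R B u i + (X' u \<bullet> i) *\<^sub>R A x i)) (at x)"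
    by (rule has_derivative_transform_within_open[OF _ U]) (simp add: derivative_euclidean_sum[OF A])
  moreover have "(\<Sum>i\<in>Basis. (X' u \<bullet> i) *\<^sub>R A x i) = A x (X' u)" for u
    using derivative_euclidean_sum[OF A[OF U(2)], of "X' u"] by simp
  ultimately show ?thesis by (simp add: sum.distrib add.commute)
qed

lemma smooth_on_endo_apply:
  fixes A :: "c2 \<Rightarrow> c2 \<Rightarrow> c2"
  assumes U: "open U" and A: "\<And>y. y \<in> U \<Longrightarrow> linear (A y)" "\<And>v. smooth_on U (\<lambda>y. A y v)"
    and X: "smooth_on U X"
  shows "smooth_on U (\<lambda>y. A y (X y))"
proof -
  have "smooth_on U (\<lambda>y. \<Sum>i\<in>Basis. (X y \<bullet> i) *\<^sub>R A y i)"
    by (intro smooth_on_sum smooth_on_scaleR smooth_on_inner smooth_on_const assms)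
  then show ?thesis
    by (subst smooth_on_cong[OF U]) (auto intro!: derivative_euclidean_sum A)
qed

text \<open>A structure is integrable if it is the pullback of the standard one by a local
  diffeomorphism, whose differential is \<open>A\<close>: the bracket of two fields is pulled back to the bracket
  because the second derivative \<open>B\<close> is symmetric, and \<^const>\<open>imul\<close> is constant.\<close>

lemma complex_structure_onI:
  fixes A J :: "c2 \<Rightarrow> c2 \<Rightarrow> c2"
  assumes U: "open U" and A: "\<And>y. y \<in> U \<Longrightarrow> linear (A y)"
    and inj: "\<And>y v. y \<in> U \<Longrightarrow> A y v = 0 \<Longrightarrow> v = 0"
    and B: "\<And>x v. x \<in> U \<Longrightarrow> ((\<lambda>y. A y v) has_derivative (\<lambda>u. B x u v)) (at x)"
    and sym: "\<And>x u v. x \<in> U \<Longrightarrow> B x u v = B x v u"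
    and J: "\<And>y. y \<in> U \<Longrightarrow> linear (J y)" "\<And>v. smooth_on U (\<lambda>y. J y v)"
    and AJ: "\<And>y v. y \<in> U \<Longrightarrow> A y (J y v) = imul (A y v)"
  shows "complex_structure_on U J"
  unfolding complex_structure_on_def
proof (intro conjI ballI allI impI)
  show "J x (J x v) = - v" if x: "x \<in> U" for x v
  proof -
    have "A x (J x (J x v) + v) = 0"
      using x by (simp add: AJ linear_add[OF A])
    then show ?thesis using inj[OF x] by (metis eq_neg_iff_add_eq_0)
  qed
next
  fix X Y :: "c2 \<Rightarrow> c2" and x assume X: "smooth_on U X" and Y: "smooth_on U Y" and x: "x \<in> U"
  define S where "S Z u = (\<Sum>i\<in>Basis. (Z x \<bullet> i) *\<^sub>R B x u i)" for Z :: "c2 \<Rightarrow> c2" and u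
  have BS: "S Z u = B x u (Z x)" for Z u
  proof -
    have "linear (\<lambda>v. B x v u)" using B[OF x, of u] has_derivative_linear by blast
    then have "B x (Z x) u = (\<Sum>i\<in>Basis. (Z x \<bullet> i) *\<^sub>R B x i u)" by (rule derivative_euclidean_sum)
    then show ?thesis unfolding S_def using sym[OF x] by simp
  qed
  define D where "D Z = frechet_derivative Z (at x)" for Z :: "c2 \<Rightarrow> c2"
  define JX where "JX = (\<lambda>y. J y (X y))"
  define JY where "JY = (\<lambda>y. J y (Y y))"
  have smJ: "smooth_on U (\<lambda>y. J y (Z y))" if "smooth_on U Z" for Z :: "c2 \<Rightarrow> c2"
    using U J that by (rule smooth_on_endo_apply)
  have push: "((\<lambda>y. A y (Z y)) has_derivative (\<lambda>u. A x (D Z u) + B x u (Z x))) (at x)"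
    if "smooth_on U Z" for Z
    using endo_apply_derivative[OF U x A B[OF x] smooth_on_has_derivative[OF U that x]]
    unfolding D_def BS[symmetric] S_def by simp
  have twist: "A x (D (\<lambda>y. J y (Z y)) u) + B x u (J x (Z x)) = imul (A x (D Z u) + B x u (Z x))"
    if Z: "smooth_on U Z" for Z u
  proof -
    have "((\<lambda>y. imul (A y (Z y))) has_derivative (\<lambda>u. imul (A x (D Z u) + B x u (Z x)))) (at x)"
      by (rule bounded_linear.has_derivative[OF bounded_linear_imul push[OF Z]])
    then have 1: "((\<lambda>y. A y (J y (Z y))) has_derivative (\<lambda>u. imul (A x (D Z u) + B x u (Z x)))) (at x)"
      by (rule has_derivative_transform_within_open[OF _ U x]) (simp add: AJ)
    have 2: "((\<lambda>y. A y (J y (Z y))) has_derivative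
        (\<lambda>u. A x (D (\<lambda>y. J y (Z y)) u) + B x u (J x (Z x)))) (at x)"
      by (rule push[OF smJ[OF Z]])
    show ?thesis using has_derivative_unique[OF 1 2] by (metis (no_types, lifting))
  qed
  have br: "A x (lie_bracket V W x) = (A x (D W (V x)) + B x (V x) (W x)) - (A x (D V (W x)) + B x (W x) (V x))"
    for V W
    using sym[OF x] by (simp add: lie_bracket_def D_def linear_diff[OF A[OF x]])
  let ?N = "lie_bracket JX JY x - J x (lie_bracket JX Y x) - J x (lie_bracket X JY x) - lie_bracket X Y x"
  have "A x ?N = A x (lie_bracket JX JY x) - imul (A x (lie_bracket JX Y x))
      - imul (A x (lie_bracket X JY x)) - A x (lie_bracket X Y x)"
    using x by (simp add: linear_diff[OF A] AJ)
  also have "\<dots> = 0"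
    unfolding br using twist[OF X] twist[OF Y] unfolding JX_def[symmetric] JY_def[symmetric]
    by (simp add: JX_def[THEN fun_cong] JY_def[THEN fun_cong])
  finally show "lie_bracket (\<lambda>y. J y (X y)) (\<lambda>y. J y (Y y)) x - J x (lie_bracket (\<lambda>y. J y (X y)) Y x)
      - J x (lie_bracket X (\<lambda>y. J y (Y y)) x) - lie_bracket X Y x = 0"
    using inj[OF x] unfolding JX_def JY_def by blast
qed (use U J in auto)

text \<open>Complex conjugation on \<open>\<complex>\<^sup>2\<close> enters because the orbits of the Hopf action are parametrised
  backwards by the structures in question.\<close>

definition conj2 :: "c2 \<Rightarrow> c2" where "conj2 v = (cnj (fst v), cnj (snd v))"

lemma bounded_linear_conj2: "bounded_linear conj2"
  by (auto intro!: linear_conv_bounded_linear[THEN iffD1] linearI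
      simp: conj2_def scaleR_conv_of_real)

lemma conj2_simps [simp]:
  "conj2 (u + v) = conj2 u + conj2 v" "conj2 (- v) = - conj2 v" "conj2 (u - v) = conj2 u - conj2 v"
  "conj2 (c *\<^sub>R v) = c *\<^sub>R conj2 v" "conj2 0 = 0" "conj2 (conj2 v) = v"
  "imul (conj2 v) = - conj2 (imul v)" "conj2 v \<bullet> conj2 w = v \<bullet> w" "conj2 v = 0 \<longleftrightarrow> v = 0"
  by (auto simp: conj2_def imul_def inner_c2 scaleR_conv_of_real prod_eq_iff)

text \<open>The structures below are \<open>-\<i>\<close> on the horizontal distribution, and \<open>c\<close>, \<open>d\<close> modify them in the
  complex lines through the origin.\<close>

definition Jrad :: "(real \<Rightarrow> real) \<Rightarrow> (real \<Rightarrow> real) \<Rightarrow> c2 endo_field" where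
  "Jrad c d x v = - imul v + (c (x \<bullet> x) * (x \<bullet> v)) *\<^sub>R imul x + (d (x \<bullet> x) * (imul x \<bullet> v)) *\<^sub>R x"

definition radial_map :: "(real \<Rightarrow> real) \<Rightarrow> c2 \<Rightarrow> c2" where
  "radial_map f x = conj2 (f (x \<bullet> x) *\<^sub>R x)"

lemma radial_map_has_derivative:
  assumes "(f has_real_derivative f') (at (x \<bullet> x))"
  shows "(radial_map f has_derivative (\<lambda>v. conj2 (f (x \<bullet> x) *\<^sub>R v + (2 * (x \<bullet> v) * f') *\<^sub>R x))) (at x)"
  unfolding radial_map_def
  by (rule bounded_linear.has_derivative[OF bounded_linear_conj2], rule has_derivative_scaleR[THEN has_derivative_eq_rhs])
    (auto intro: has_derivative_radial[OF assms])

lemma linear_Jrad: "linear (Jrad c d x)"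
  by (rule linearI) (simp_all add: Jrad_def inner_add_right algebra_simps)

lemma smooth_on_Jrad:
  assumes "open U" "smooth_on U (\<lambda>x. c (x \<bullet> x))" "smooth_on U (\<lambda>x. d (x \<bullet> x))"
  shows "smooth_on U (\<lambda>x. Jrad c d x v)"
  unfolding Jrad_def using assms by (intro smooth_intros smooth_on_imul)

text \<open>The two differential equations say that the map \<open>x \<mapsto> f(|x|\<^sup>2) x\<close>, followed by conjugation,
  is holomorphic in the direction of \<open>x\<close> and of \<open>\<i>x\<close>.\<close>

lemma radial_map_holomorphic:
  assumes f: "(f has_real_derivative f') (at (x \<bullet> x))" and r: "r = x \<bullet> x"
    and c: "f r * c r = - 2 * f'" and d: "f r * d r + 2 * f' * (1 + d r * r) = 0"
  shows "frechet_derivative (radial_map f) (at x) (Jrad c d x v)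
    = imul (frechet_derivative (radial_map f) (at x) v)"
proof -
  have c': "f r * (c r * (x \<bullet> v)) = - 2 * f' * (x \<bullet> v)" using c by (simp flip: mult.assoc)
  have d': "(f r * (d r * (imul x \<bullet> v)) + 2 * (imul x \<bullet> v + d r * (imul x \<bullet> v) * r) * f') = 0"
    using arg_cong[OF d, of "\<lambda>y. y * (imul x \<bullet> v)"] by (simp add: algebra_simps)
  have "f r *\<^sub>R Jrad c d x v + (2 * (x \<bullet> Jrad c d x v) * f') *\<^sub>R x
     = - f r *\<^sub>R imul v + (f r * (c r * (x \<bullet> v))) *\<^sub>R imul x
       + (f r * (d r * (imul x \<bullet> v)) + 2 * (imul x \<bullet> v + d r * (imul x \<bullet> v) * r) * f') *\<^sub>R x"
    by (simp add: Jrad_def r inner_add_right inner_diff_right inner_imul_right algebra_simps)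
  also have "\<dots> = - imul (f r *\<^sub>R v + (2 * (x \<bullet> v) * f') *\<^sub>R x)"
    unfolding c' d' by (simp add: algebra_simps)
  finally show ?thesis
    unfolding frechet_derivative_at[OF radial_map_has_derivative[OF f], symmetric] r by simp
qed

lemma complex_structure_Jrad:
  assumes U: "open U" and f: "\<And>x. x \<in> U \<Longrightarrow> (f has_real_derivative f' (x \<bullet> x)) (at (x \<bullet> x))"
    "\<And>x. x \<in> U \<Longrightarrow> (f' has_real_derivative f'' (x \<bullet> x)) (at (x \<bullet> x))"
    and c: "\<And>x. x \<in> U \<Longrightarrow> f (x \<bullet> x) * c (x \<bullet> x) = - 2 * f' (x \<bullet> x)"
    and d: "\<And>x. x \<in> U \<Longrightarrow> f (x \<bullet> x) * d (x \<bullet> x) + 2 * f' (x \<bullet> x) * (1 + d (x \<bullet> x) * (x \<bullet> x)) = 0"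
    and sm: "smooth_on U (\<lambda>x. c (x \<bullet> x))" "smooth_on U (\<lambda>x. d (x \<bullet> x))"
    and g: "\<And>x. x \<in> U \<Longrightarrow> g differentiable (at (radial_map f x))" "\<And>x. x \<in> U \<Longrightarrow> g (radial_map f x) = x"
  shows "complex_structure_on U (Jrad c d)"
proof (rule complex_structure_onI[OF U, where
    A = "\<lambda>x v. conj2 (f (x \<bullet> x) *\<^sub>R v + (2 * (x \<bullet> v) * f' (x \<bullet> x)) *\<^sub>R x)" and
    B = "\<lambda>x u v. conj2 ((2 * (x \<bullet> u) * f' (x \<bullet> x)) *\<^sub>R v
      + (2 * (x \<bullet> v) * f' (x \<bullet> x)) *\<^sub>R u + (2 * (2 * (x \<bullet> v) * (x \<bullet> u) * f'' (x \<bullet> x)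
        + (u \<bullet> v) * f' (x \<bullet> x))) *\<^sub>R x)"])
  fix x assume x: "x \<in> U"
  show "linear (\<lambda>v. conj2 (f (x \<bullet> x) *\<^sub>R v + (2 * (x \<bullet> v) * f' (x \<bullet> x)) *\<^sub>R x))"
    by (rule linearI) (simp_all add: inner_add_right algebra_simps)
  have A: "frechet_derivative (radial_map f) (at x)
      = (\<lambda>v. conj2 (f (x \<bullet> x) *\<^sub>R v + (2 * (x \<bullet> v) * f' (x \<bullet> x)) *\<^sub>R x))"
    using frechet_derivative_at[OF radial_map_has_derivative[OF f(1)[OF x]]] by simp
  show "linear (Jrad c d x)" by (rule linear_Jrad)
  show "conj2 (f (x \<bullet> x) *\<^sub>R Jrad c d x v + (2 * (x \<bullet> Jrad c d x v) * f' (x \<bullet> x)) *\<^sub>R x)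
      = imul (conj2 (f (x \<bullet> x) *\<^sub>R v + (2 * (x \<bullet> v) * f' (x \<bullet> x)) *\<^sub>R x))" for v
    using radial_map_holomorphic[of f "f' (x \<bullet> x)" x "x \<bullet> x" c d v, OF f(1)[OF x] refl c[OF x] d[OF x]]
    unfolding A .
  show "v = 0" if "conj2 (f (x \<bullet> x) *\<^sub>R v + (2 * (x \<bullet> v) * f' (x \<bullet> x)) *\<^sub>R x) = 0" for v
  proof -
    obtain g' where g': "(g has_derivative g') (at (radial_map f x))"
      using g(1)[OF x] by (auto simp: differentiable_def)
    have "((\<lambda>y. g (radial_map f y)) has_derivative
        (\<lambda>v. g' (conj2 (f (x \<bullet> x) *\<^sub>R v + (2 * (x \<bullet> v) * f' (x \<bullet> x)) *\<^sub>R x)))) (at x)"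
      by (rule has_derivative_compose[OF radial_map_has_derivative[OF f(1)[OF x]] g'])
    then have "((\<lambda>y. y) has_derivative
        (\<lambda>v. g' (conj2 (f (x \<bullet> x) *\<^sub>R v + (2 * (x \<bullet> v) * f' (x \<bullet> x)) *\<^sub>R x)))) (at x)"
      by (rule has_derivative_transform_within_open[OF _ U x]) (simp add: g)
    from has_derivative_unique[OF this has_derivative_ident]
    have "g' (conj2 (f (x \<bullet> x) *\<^sub>R v + (2 * (x \<bullet> v) * f' (x \<bullet> x)) *\<^sub>R x)) = v" by metis
    then show "v = 0" using that has_derivative_linear[OF g'] by (simp add: linear_0)
  qed
  show "((\<lambda>y. conj2 (f (y \<bullet> y) *\<^sub>R v + (2 * (y \<bullet> v) * f' (y \<bullet> y)) *\<^sub>R y)) has_derivative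
      (\<lambda>u. conj2 ((2 * (x \<bullet> u) * f' (x \<bullet> x)) *\<^sub>R v
      + (2 * (x \<bullet> v) * f' (x \<bullet> x)) *\<^sub>R u + (2 * (2 * (x \<bullet> v) * (x \<bullet> u) * f'' (x \<bullet> x)
        + (u \<bullet> v) * f' (x \<bullet> x))) *\<^sub>R x))) (at x)" for v
    by (rule bounded_linear.has_derivative[OF bounded_linear_conj2], rule has_derivative_eq_rhs,
        (rule has_derivative_add has_derivative_scaleR has_derivative_mult has_derivative_inner
          has_derivative_const has_derivative_ident has_derivative_radial[OF f(1)[OF x]]
          has_derivative_radial[OF f(2)[OF x]])+) (simp add: fun_eq_iff algebra_simps)
qed (auto simp: inner_commute algebra_simps intro!: smooth_on_Jrad U sm)

lemma biholomorphic_radial_map: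
  assumes U: "open U" and f: "\<And>x. x \<in> U \<Longrightarrow> (f has_real_derivative f' (x \<bullet> x)) (at (x \<bullet> x))"
    and c: "\<And>x. x \<in> U \<Longrightarrow> f (x \<bullet> x) * c (x \<bullet> x) = - 2 * f' (x \<bullet> x)"
    and d: "\<And>x. x \<in> U \<Longrightarrow> f (x \<bullet> x) * d (x \<bullet> x) + 2 * f' (x \<bullet> x) * (1 + d (x \<bullet> x) * (x \<bullet> x)) = 0"
    and sm: "smooth_on U (\<lambda>x. f (x \<bullet> x))" and V: "open V" "smooth_on V g"
    and bij: "\<And>x. x \<in> U \<Longrightarrow> radial_map f x \<in> V" "\<And>y. y \<in> V \<Longrightarrow> g y \<in> U"
      "\<And>x. x \<in> U \<Longrightarrow> g (radial_map f x) = x" "\<And>y. y \<in> V \<Longrightarrow> radial_map f (g y) = y"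
    and J: "\<And>x v. x \<in> U \<Longrightarrow> J x v = Jrad c d x v"
  shows "biholomorphic U J V J_std"
  unfolding biholomorphic_def
proof (intro exI[of _ "radial_map f"] conjI ballI allI)
  show b: "bij_betw (radial_map f) U V"
    by (rule bij_betw_byWitness[where f' = g]) (use bij in auto)
  show "smooth_on U (radial_map f)"
    unfolding radial_map_def
    by (intro smooth_on_bounded_linear[OF U bounded_linear_conj2] smooth_on_scaleR U sm smooth_on_ident)
  have "inv_into U (radial_map f) y = g y" if "y \<in> V" for y
    by (rule inv_into_f_eq) (use b bij that in \<open>auto simp: bij_betw_def\<close>)
  then show "smooth_on V (inv_into U (radial_map f))"
    using V smooth_on_cong[OF V(1), of "inv_into U (radial_map f)" g] by simp
  show "frechet_derivative (radial_map f) (at x) (J x v)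
      = J_std (radial_map f x) (frechet_derivative (radial_map f) (at x) v)" if "x \<in> U" for x v
    unfolding J[OF that] J_std_imul by (rule radial_map_holomorphic[of f "f' (x \<bullet> x)" x "x \<bullet> x" c d v, OF f[OF that] refl c[OF that] d[OF that]])
qed

section \<open>Kaehler structures and orientations\<close>

lemma kahler_onI:
  assumes R: "riemannian_on U g" and J: "complex_structure_on U J"
    and om: "\<And>x v w. x \<in> U \<Longrightarrow> g x (J x v) w = \<omega> x v w" "\<And>x v w. \<omega> x v w = - \<omega> x w v"
    and cl: "\<And>x u v w. x \<in> U \<Longrightarrow> ext_deriv2 \<omega> x u v w = 0"
  shows "kahler_on U g J"
  unfolding kahler_on_def
proof (intro conjI ballI allI R J)
  fix x v w assume x: "x \<in> U"
  have JJ: "J x (J x w) = - w" using J x by (auto simp: complex_structure_on_def)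
  have "g x (J x v) (J x w) = - g x (J x (J x w)) v" using x om(2)[of x v "J x w"] by (simp add: om(1))
  also have "\<dots> = g x w v"
    unfolding JJ using riemannian_onD(2)[OF R x] by (simp add: bilinear_lneg)
  finally show "g x (J x v) (J x w) = g x v w" using riemannian_onD(3)[OF R x] by simp
next
  fix x u v w assume x: "x \<in> U"
  have "frechet_derivative (\<lambda>y. g y (J y a) b) (at x) = frechet_derivative (\<lambda>y. \<omega> y a b) (at x)" for a b
    by (rule frechet_derivative_cong_open[OF riemannian_onD(1)[OF R] x om(1)])
  then have "ext_deriv2 (fundamental_form g J) x u v w = ext_deriv2 \<omega> x u v w"
    by (simp add: ext_deriv2_def fundamental_form_def)
  then show "ext_deriv2 (fundamental_form g J) x u v w = 0" using cl[OF x] by simp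
qed

lemma det_4:
  "det (A :: real^4^4) =
    A$1$1 * (A$2$2 * (A$3$3 * A$4$4 - A$3$4 * A$4$3) - A$2$3 * (A$3$2 * A$4$4 - A$3$4 * A$4$2)
      + A$2$4 * (A$3$2 * A$4$3 - A$3$3 * A$4$2))
    - A$1$2 * (A$2$1 * (A$3$3 * A$4$4 - A$3$4 * A$4$3) - A$2$3 * (A$3$1 * A$4$4 - A$3$4 * A$4$1)
      + A$2$4 * (A$3$1 * A$4$3 - A$3$3 * A$4$1))
    + A$1$3 * (A$2$1 * (A$3$2 * A$4$4 - A$3$4 * A$4$2) - A$2$2 * (A$3$1 * A$4$4 - A$3$4 * A$4$1)
      + A$2$4 * (A$3$1 * A$4$2 - A$3$2 * A$4$1))
    - A$1$4 * (A$2$1 * (A$3$2 * A$4$3 - A$3$3 * A$4$2) - A$2$2 * (A$3$1 * A$4$3 - A$3$3 * A$4$1)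
      + A$2$3 * (A$3$1 * A$4$2 - A$3$2 * A$4$1))"
proof -
  have f: "finite {2::4, 3, 4}" "1 \<notin> {2::4, 3, 4}" "finite {3::4, 4}" "2 \<notin> {3::4, 4}"
    "finite {4::4}" "3 \<notin> {4::4}" by auto
  show ?thesis
    unfolding det_def UNIV_4 sum_over_permutations_insert[OF f(1,2)]
      sum_over_permutations_insert[OF f(3,4)] sum_over_permutations_insert[OF f(5,6)] permutes_sing
    by (simp add: sign_swap_id permutation_swap_id permutation_compose sign_compose sign_id swap_id_eq)
      (simp add: algebra_simps)
qed

lemma det_c2_pfaffian:
  "det_c2 a b c d = (imul a \<bullet> b) * (imul c \<bullet> d) - (imul a \<bullet> c) * (imul b \<bullet> d) + (imul a \<bullet> d) * (imul b \<bullet> c)"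
proof -
  have v: "(vector [p, q, r, s] :: 'x^4) $ 1 = p" "(vector [p, q, r, s] :: 'x^4) $ 2 = q"
    "(vector [p, q, r, s] :: 'x^4) $ 3 = r" "(vector [p, q, r, s] :: 'x^4) $ 4 = s" for p q r s :: "'x::zero"
    by (simp_all add: vector_def)
  show ?thesis
    unfolding det_c2_def det_4 by (simp add: v inner_c2 imul_def algebra_simps)
qed

section \<open>Holomorphic coordinates\<close>

text \<open>The branch on \<open>(0, \<infinity>)\<close> of the inverse of \<open>t \<mapsto> (t - 1) e\<^sup>t\<close>, a translate of Lambert's function. It
  inverts the radial part of the holomorphic coordinates.\<close>

definition lam :: "real \<Rightarrow> real" where "lam y = (THE t. 0 < t \<and> (t - 1) * exp t = y)"

lemma lam_deriv_direct: "((\<lambda>t. (t - 1) * exp t) has_real_derivative t * exp t) (at t)"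
  by (auto intro!: derivative_eq_intros simp: algebra_simps)

lemma lam_strict_mono:
  assumes "0 < s" "s < t" shows "(s - 1) * exp s < (t - 1) * exp (t::real)"
  using assms(2) by (rule DERIV_pos_imp_increasing) (use assms lam_deriv_direct in \<open>force\<close>)

lemma lam_unique: "0 < s \<Longrightarrow> 0 < t \<Longrightarrow> (s - 1) * exp s = (t - 1) * exp (t::real) \<Longrightarrow> s = t"
  using lam_strict_mono[of s t] lam_strict_mono[of t s] by (cases s t rule: linorder_cases) auto

lemma lam_eq: "0 < t \<Longrightarrow> lam ((t - 1) * exp t) = t"
  unfolding lam_def by (rule the_equality) (auto dest: lam_unique)

lemma lam:
  assumes "- 1 < y" shows "0 < lam y" "(lam y - 1) * exp (lam y) = y"
proof -
  let ?h = "\<lambda>t::real. (t - 1) * exp t"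
  have "y \<le> (\<bar>y\<bar> + 1) * 1" by simp
  also have "\<dots> \<le> (\<bar>y\<bar> + 1) * exp (\<bar>y\<bar> + 2)" by (intro mult_left_mono) auto
  finally have "y \<le> ?h (\<bar>y\<bar> + 2)" by (simp add: algebra_simps)
  moreover have "?h 0 \<le> y" using assms by simp
  moreover have "continuous_on {0..\<bar>y\<bar> + 2} ?h" by (intro continuous_intros)
  moreover have "0 \<le> \<bar>y\<bar> + 2" by simp
  ultimately obtain t where t: "0 \<le> t" "?h t = y" using IVT'[of ?h 0 y "\<bar>y\<bar> + 2"] by blast
  then have "0 < t" using assms by (cases "t = 0") auto
  then have "lam y = t" using lam_eq t by blast
  then show "0 < lam y" "?h (lam y) = y" using t \<open>0 < t\<close> by simp_all
qed

lemma lam_has_derivative: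
  assumes "- 1 < y" shows "(lam has_real_derivative exp (- lam y) / lam y) (at y)"
proof -
  let ?h = "\<lambda>t::real. (t - 1) * exp t"
  note l = lam[OF assms]
  have "(lam has_derivative (\<lambda>k. k / (lam y * exp (lam y)))) (at (?h (lam y)))"
  proof (rule has_derivative_inverse_strong[of "{0<..}" "lam y" ?h])
    show "(?h has_derivative (\<lambda>k. k * (lam y * exp (lam y)))) (at (lam y))"
      by (rule has_derivative_eq_rhs[OF lam_deriv_direct[of "lam y", unfolded has_field_derivative_def]])
        (simp add: fun_eq_iff)
    show "(\<lambda>k. k * (lam y * exp (lam y))) \<circ> (\<lambda>k. k / (lam y * exp (lam y))) = id"
      using l by (auto simp: fun_eq_iff)
  qed (use l lam_eq in \<open>auto intro!: continuous_intros\<close>)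
  then have d: "(lam has_derivative (\<lambda>k. k / (lam y * exp (lam y)))) (at y)" unfolding l(2) .
  show ?thesis
    unfolding has_field_derivative_def
    by (rule has_derivative_eq_rhs[OF d]) (simp add: fun_eq_iff exp_minus divide_inverse)
qed

lemma smooth_on_lam: "smooth_on {- 1<..} lam"
proof (rule smooth_on_autonomous)
  show "smooth_on {0<..} (\<lambda>t::real. exp (- t) / t)"
    by (intro smooth_intros) auto
qed (use lam lam_has_derivative in auto)

definition f_plus :: "real \<Rightarrow> real" where "f_plus r = exp ((1 / (1 - r) - ln (1 - r)) / 2)"
definition f_minus :: "real \<Rightarrow> real" where "f_minus r = exp (- (1 / (1 - r) - ln (1 - r)) / 2 - ln r)"

definition g_plus :: "c2 \<Rightarrow> c2" where
  "g_plus y = exp (- (lam (y \<bullet> y) + ln (lam (y \<bullet> y))) / 2) *\<^sub>R conj2 y"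
definition invert :: "c2 \<Rightarrow> c2" where "invert y = (1 / (y \<bullet> y)) *\<^sub>R y"

definition c_plus :: "real \<Rightarrow> real" where "c_plus r = - (2 - r) / (1 - r)\<^sup>2"
definition d_plus :: "real \<Rightarrow> real" where "d_plus r = r - 2"
definition c_minus :: "real \<Rightarrow> real" where "c_minus r = (1 + (1 - r)\<^sup>2) / (r * (1 - r)\<^sup>2)"
definition d_minus :: "real \<Rightarrow> real" where "d_minus r = - (1 + (1 - r)\<^sup>2) / r"

abbreviation J_ext :: "c2 endo_field" where "J_ext \<equiv> Jrad c_plus d_plus"

lemma coefficient_identities:
  assumes "r < 1"
  shows "(1 / (1 - r)\<^sup>2 + 1 / (1 - r)) / 2 = - c_plus r / 2"
    "0 < r \<Longrightarrow> - ((1 / (1 - r)\<^sup>2 + 1 / (1 - r)) / 2) - inverse r = - c_minus r / 2"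
proof -
  define s where "s = 1 - r"
  have s: "s \<noteq> 0" "r = 1 - s" using assms by (auto simp: s_def)
  show "(1 / (1 - r)\<^sup>2 + 1 / (1 - r)) / 2 = - c_plus r / 2"
    unfolding c_plus_def s(2) using s(1) by (simp add: divide_simps power2_eq_square)
  assume r: "0 < r"
  have 1: "(1 / s\<^sup>2 + 1 / s) = (1 + s) / s\<^sup>2" using s(1) by (simp add: field_simps power2_eq_square)
  have "- ((1 + s) / s\<^sup>2 / 2) - 1 / r = - (((1 + s) * r + 2 * s\<^sup>2) / (2 * (r * s\<^sup>2)))"
    using r s(1) by (simp add: divide_simps)
  also have "(1 + s) * r + 2 * s\<^sup>2 = 1 + s\<^sup>2" by (simp add: s(2) algebra_simps power2_eq_square)
  finally have "- ((1 + s) / s\<^sup>2 / 2) - 1 / r = - ((1 + s\<^sup>2) / (2 * (r * s\<^sup>2)))" .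
  then show "- ((1 / (1 - r)\<^sup>2 + 1 / (1 - r)) / 2) - inverse r = - c_minus r / 2"
    unfolding c_minus_def s_def[symmetric] 1 inverse_eq_divide by (rule trans) (simp add: mult_ac)
qed

lemma f_plus_exponent:
  assumes "r < 1"
  shows "((\<lambda>r. (1 / (1 - r) - ln (1 - r)) / 2) has_real_derivative (1 / (1 - r)\<^sup>2 + 1 / (1 - r)) / 2) (at r)"
  using assms by (auto intro!: derivative_eq_intros simp: power2_eq_square)

lemma f_plus_derivs:
  assumes "r < 1"
  shows "(f_plus has_real_derivative - c_plus r * f_plus r / 2) (at r)"
    "((\<lambda>r. - c_plus r * f_plus r / 2) has_real_derivative
       (- c_plus r)\<^sup>2 * f_plus r / 4 + (3 - r) / (1 - r)^3 * f_plus r / 2) (at r)"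
proof -
  show 1: "(f_plus has_real_derivative - c_plus r * f_plus r / 2) (at r)"
    unfolding f_plus_def[abs_def]
    by (rule DERIV_cong[OF DERIV_fun_exp[OF f_plus_exponent[OF assms]]]) (simp add: coefficient_identities[OF assms])
  have 2: "((\<lambda>r. - c_plus r) has_real_derivative (3 - r) / (1 - r)^3) (at r)"
    unfolding c_plus_def using assms
    by (auto intro!: derivative_eq_intros simp: divide_simps) (simp add: algebra_simps eval_nat_numeral)
  show "((\<lambda>r. - c_plus r * f_plus r / 2) has_real_derivative
       (- c_plus r)\<^sup>2 * f_plus r / 4 + (3 - r) / (1 - r)^3 * f_plus r / 2) (at r)"
    by (rule DERIV_cong[OF DERIV_cdivide[OF DERIV_mult[OF 2 1]]]) (simp add: power2_eq_square)
qed

lemma f_minus_derivs: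
  assumes "0 < r" "r < 1"
  shows "(f_minus has_real_derivative - c_minus r * f_minus r / 2) (at r)"
    "\<exists>D. ((\<lambda>r. - c_minus r * f_minus r / 2) has_real_derivative D) (at r)"
proof -
  show 1: "(f_minus has_real_derivative - c_minus r * f_minus r / 2) (at r)"
    unfolding f_minus_def[abs_def] minus_divide_left[symmetric]
    by (rule DERIV_cong[OF DERIV_fun_exp[OF DERIV_diff[OF DERIV_minus[OF f_plus_exponent[OF assms(2)]]
            DERIV_ln[OF assms(1)]]]])
      (simp add: coefficient_identities(2)[OF assms(2,1)])
  have "\<exists>D. (c_minus has_real_derivative D) (at r)"
    unfolding c_minus_def[abs_def] using assms
    by (intro exI) (auto intro!: derivative_eq_intros)
  then obtain D where "(c_minus has_real_derivative D) (at r)" ..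
  from DERIV_cdivide[OF DERIV_mult[OF DERIV_minus[OF this] 1]]
  show "\<exists>D. ((\<lambda>r. - c_minus r * f_minus r / 2) has_real_derivative D) (at r)" by blast
qed

lemma smooth_on_inner_self: "open U \<Longrightarrow> smooth_on U (\<lambda>x::c2. x \<bullet> x)"
  by (intro smooth_intros)

lemma smooth_on_coefficients:
  "smooth_on M1 (\<lambda>x. c_plus (x \<bullet> x))" "smooth_on M1 (\<lambda>x. d_plus (x \<bullet> x))"
  "smooth_on M0 (\<lambda>x. c_minus (x \<bullet> x))" "smooth_on M0 (\<lambda>x. d_minus (x \<bullet> x))"
  "smooth_on M1 (\<lambda>x. f_plus (x \<bullet> x))" "smooth_on M0 (\<lambda>x. f_minus (x \<bullet> x))"
proof -
  have M1: "1 - x \<bullet> x \<noteq> 0" "(1 - x \<bullet> x)\<^sup>2 \<noteq> 0" "0 < 1 - x \<bullet> x" if "x \<in> M1" for x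
    using that by (auto simp: M1_iff)
  have M0: "1 - x \<bullet> x \<noteq> 0" "x \<bullet> x \<noteq> 0" "0 < 1 - x \<bullet> x" "0 < x \<bullet> x" "(x \<bullet> x) * (1 - x \<bullet> x)\<^sup>2 \<noteq> 0"
    if "x \<in> M0" for x using that by (auto simp: M0_iff)
  have two: "(2 :: real) \<noteq> 0" by simp
  note sm = smooth_on_inner_self[OF open_M(1)] smooth_on_inner_self[OF open_M(2)]
    smooth_on_const[OF open_M(1)] smooth_on_const[OF open_M(2)]
  show "smooth_on M1 (\<lambda>x. c_plus (x \<bullet> x))" unfolding c_plus_def
    by (intro smooth_on_divide[OF open_M(2)] smooth_on_minus[OF open_M(2)] smooth_on_diff[OF open_M(2)]
      smooth_on_power[OF open_M(2)] sm M1)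
  show "smooth_on M1 (\<lambda>x. d_plus (x \<bullet> x))" unfolding d_plus_def
    by (intro smooth_on_diff[OF open_M(2)] sm)
  show "smooth_on M0 (\<lambda>x. c_minus (x \<bullet> x))" unfolding c_minus_def
    by (intro smooth_on_divide[OF open_M(1)] smooth_on_add[OF open_M(1)] smooth_on_diff[OF open_M(1)]
      smooth_on_mult[OF open_M(1)] smooth_on_power[OF open_M(1)] sm M0)
  show "smooth_on M0 (\<lambda>x. d_minus (x \<bullet> x))" unfolding d_minus_def
    by (intro smooth_on_divide[OF open_M(1)] smooth_on_minus[OF open_M(1)] smooth_on_add[OF open_M(1)]
      smooth_on_diff[OF open_M(1)] smooth_on_power[OF open_M(1)] sm M0)
  show "smooth_on M1 (\<lambda>x. f_plus (x \<bullet> x))" unfolding f_plus_def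
    by (intro smooth_on_exp[OF open_M(2)] smooth_on_divide[OF open_M(2)] smooth_on_diff[OF open_M(2)]
      smooth_on_ln[OF open_M(2)] sm M1 two)
  show "smooth_on M0 (\<lambda>x. f_minus (x \<bullet> x))" unfolding f_minus_def
    by (intro smooth_on_exp[OF open_M(1)] smooth_on_divide[OF open_M(1)] smooth_on_diff[OF open_M(1)]
      smooth_on_minus[OF open_M(1)] smooth_on_ln[OF open_M(1)] sm M0 two)
qed

lemma f_plus_sq: "r < 1 \<Longrightarrow> (f_plus r)\<^sup>2 = exp (1 / (1 - r)) / (1 - r)"
proof -
  assume r: "r < 1"
  have e: "(exp (y / 2))\<^sup>2 = exp y" for y :: real using exp_double[of "y / 2"] by simp
  show ?thesis unfolding f_plus_def e using r by (simp add: exp_diff)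
qed

lemma f_minus_eq: "0 < r \<Longrightarrow> f_minus r = 1 / (r * f_plus r)"
proof -
  assume r: "0 < r"
  have e: "exp (- y / 2 - l) = 1 / (exp l * exp (y / 2))" for y l :: real
    by (simp only: minus_divide_left[symmetric] exp_diff exp_minus) (simp add: field_simps)
  show ?thesis unfolding f_plus_def f_minus_def e using r by simp
qed

lemma exp_half_cancel: "exp (- y / 2) * exp (y / 2) = (1 :: real)"
  using exp_add[of "- y / 2" "y / 2"] by simp

lemma radial_map_norm: "radial_map f x \<bullet> radial_map f x = (x \<bullet> x) * (f (x \<bullet> x))\<^sup>2"
  by (simp add: radial_map_def power2_eq_square)

lemma plus_inverse:
  assumes x: "x \<in> M1" shows "g_plus (radial_map f_plus x) = x"
proof -
  define t where "t = 1 / (1 - x \<bullet> x)"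
  have r: "x \<bullet> x < 1" using x by (simp add: M1_iff)
  then have t: "0 < t" "x \<bullet> x = 1 - 1 / t" by (auto simp: t_def)
  have "radial_map f_plus x \<bullet> radial_map f_plus x = (t - 1) * exp t"
    unfolding radial_map_norm f_plus_sq[OF r] using t(1) by (simp add: t(2) field_simps)
  then have l: "lam (radial_map f_plus x \<bullet> radial_map f_plus x) = t" using lam_eq[OF t(1)] by simp
  have "ln t = - ln (1 - x \<bullet> x)" using r by (simp add: t_def ln_div)
  then have "f_plus (x \<bullet> x) = exp ((t + ln t) / 2)" by (simp add: f_plus_def t_def)
  then show ?thesis
    unfolding g_plus_def l using exp_half_cancel[of "t + ln t"] by (simp add: radial_map_def)
qed

lemma g_plus_in:
  shows "g_plus y \<bullet> g_plus y = 1 - 1 / lam (y \<bullet> y)" "g_plus y \<in> M1" "radial_map f_plus (g_plus y) = y"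
proof -
  define t where "t = lam (y \<bullet> y)"
  have "- 1 < y \<bullet> y" using inner_ge_zero[of y] by linarith
  note l = lam[OF this, folded t_def]
  have e: "(exp (- u / 2))\<^sup>2 = exp (- u)" for u :: real using exp_double[of "- u / 2"] by simp
  have "g_plus y \<bullet> g_plus y = (exp (- (t + ln t) / 2))\<^sup>2 * (y \<bullet> y)"
    by (simp add: g_plus_def t_def power2_eq_square)
  also have "(exp (- (t + ln t) / 2))\<^sup>2 = exp (- (t + ln t))"
    using e by blast
  also have "\<dots> = 1 / (exp t * t)" using l(1) by (simp add: exp_diff exp_minus divide_inverse)
  also have "1 / (exp t * t) * (y \<bullet> y) = 1 - 1 / t"
    using l(1) unfolding l(2)[symmetric] by (simp add: field_simps)
  finally show n: "g_plus y \<bullet> g_plus y = 1 - 1 / lam (y \<bullet> y)" by (simp add: t_def)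
  then show "g_plus y \<in> M1" using l(1) by (simp add: M1_iff t_def)
  have "f_plus (g_plus y \<bullet> g_plus y) = exp ((t + ln t) / 2)"
    unfolding n t_def[symmetric] f_plus_def using l(1) by (simp add: ln_div)
  then show "radial_map f_plus (g_plus y) = y"
    using exp_half_cancel[of "t + ln t"] by (simp add: radial_map_def g_plus_def mult.commute flip: t_def)
qed

lemma smooth_on_conj2: "open U \<Longrightarrow> smooth_on U conj2"
  by (rule smooth_on_linear[OF _ bounded_linear_conj2])

lemma smooth_on_g_plus: "smooth_on UNIV g_plus"
proof -
  have l: "smooth_on UNIV (\<lambda>y::c2. lam (y \<bullet> y))"
  proof (rule smooth_on_compose[OF _ _ _ _ smooth_on_lam])
    show "(\<lambda>y::c2. y \<bullet> y) ` UNIV \<subseteq> {- 1<..}" using inner_ge_zero by (auto intro: less_le_trans[of "-1" 0])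
  qed (auto intro: smooth_on_inner_self)
  have "0 < lam (y \<bullet> y)" for y :: c2 using lam(1) inner_ge_zero[of y] by (metis less_le_trans neg_less_0_iff_less zero_less_one)
  then show ?thesis
    unfolding g_plus_def[abs_def] by (intro smooth_intros smooth_on_conj2 smooth_on_ln l) auto
qed

lemma invert_simps: "y \<noteq> 0 \<Longrightarrow> invert y \<bullet> invert y = 1 / (y \<bullet> y)" "y \<noteq> 0 \<Longrightarrow> invert (invert y) = y"
  "y \<noteq> 0 \<Longrightarrow> invert y \<noteq> 0"
proof -
  show 1: "y \<noteq> 0 \<Longrightarrow> invert y \<bullet> invert y = 1 / (y \<bullet> y)" for y by (simp add: invert_def field_simps)
  show "y \<noteq> 0 \<Longrightarrow> invert (invert y) = y" using 1[of y] by (simp add: invert_def)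
  show "y \<noteq> 0 \<Longrightarrow> invert y \<noteq> 0" by (simp add: invert_def)
qed

lemma smooth_on_invert: "smooth_on (- {0}) invert"
  unfolding invert_def[abs_def] by (intro smooth_intros) auto

lemma radial_map_minus:
  assumes "x \<in> M0" shows "radial_map f_minus x = invert (radial_map f_plus x)"
proof -
  have f: "f_plus (x \<bullet> x) \<noteq> 0" by (simp add: f_plus_def)
  show ?thesis
    unfolding invert_def radial_map_norm using M0_pos[OF assms] f
    by (simp add: radial_map_def f_minus_eq power2_eq_square field_simps)
qed

lemma radial_map_plus_nonzero: "x \<noteq> 0 \<Longrightarrow> radial_map f_plus x \<noteq> 0"
  by (simp add: radial_map_def f_plus_def)

lemma minus_inverse:
  "x \<in> M0 \<Longrightarrow> g_plus (invert (radial_map f_minus x)) = x"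
  "x \<in> M0 \<Longrightarrow> radial_map f_minus x \<noteq> 0"
  "y \<noteq> 0 \<Longrightarrow> g_plus (invert y) \<in> M0"
  "y \<noteq> 0 \<Longrightarrow> radial_map f_minus (g_plus (invert y)) = y"
proof -
  show "g_plus (invert (radial_map f_minus x)) = x" "radial_map f_minus x \<noteq> 0" if "x \<in> M0"
    using that M0_M1 radial_map_plus_nonzero[of x]
    by (auto simp: radial_map_minus invert_simps plus_inverse M0_iff simp del: split_paired_All)
  assume y: "y \<noteq> 0"
  have "g_plus (invert y) \<noteq> 0" using invert_simps(3)[OF y] by (simp add: g_plus_def)
  then show m: "g_plus (invert y) \<in> M0" using g_plus_in(2)[of "invert y"] by (simp add: M0_iff M1_iff)
  show "radial_map f_minus (g_plus (invert y)) = y"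
    unfolding radial_map_minus[OF m] by (simp add: g_plus_in invert_simps y)
qed

lemma smooth_on_g_minus: "smooth_on (- {0}) (\<lambda>y. g_plus (invert y))"
  by (rule smooth_on_compose[OF _ _ _ smooth_on_invert smooth_on_g_plus]) auto

lemma ode_plus:
  assumes "x \<in> M1"
  shows "f_plus (x \<bullet> x) * c_plus (x \<bullet> x) = - 2 * (- c_plus (x \<bullet> x) * f_plus (x \<bullet> x) / 2)"
    "f_plus (x \<bullet> x) * d_plus (x \<bullet> x)
      + 2 * (- c_plus (x \<bullet> x) * f_plus (x \<bullet> x) / 2) * (1 + d_plus (x \<bullet> x) * (x \<bullet> x)) = 0"
proof -
  define s where "s = 1 - x \<bullet> x"
  have s: "s \<noteq> 0" "x \<bullet> x = 1 - s" using assms by (auto simp: s_def M1_iff)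
  show "f_plus (x \<bullet> x) * d_plus (x \<bullet> x)
      + 2 * (- c_plus (x \<bullet> x) * f_plus (x \<bullet> x) / 2) * (1 + d_plus (x \<bullet> x) * (x \<bullet> x)) = 0"
    unfolding s(2) c_plus_def d_plus_def using s(1) by (simp add: field_simps power2_eq_square)
qed simp

lemma ode_minus:
  assumes "x \<in> M0"
  shows "f_minus (x \<bullet> x) * c_minus (x \<bullet> x) = - 2 * (- c_minus (x \<bullet> x) * f_minus (x \<bullet> x) / 2)"
    "f_minus (x \<bullet> x) * d_minus (x \<bullet> x)
      + 2 * (- c_minus (x \<bullet> x) * f_minus (x \<bullet> x) / 2) * (1 + d_minus (x \<bullet> x) * (x \<bullet> x)) = 0"
proof -
  define r s where "r = x \<bullet> x" and "s = 1 - x \<bullet> x"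
  have s: "s \<noteq> 0" "r \<noteq> 0" using assms by (auto simp: s_def r_def M0_iff)
  have d: "1 + d_minus r * r = - s\<^sup>2" "c_minus r * s\<^sup>2 = - d_minus r"
    using s by (simp_all add: d_minus_def c_minus_def r_def s_def field_simps)
  show "f_minus (x \<bullet> x) * d_minus (x \<bullet> x)
      + 2 * (- c_minus (x \<bullet> x) * f_minus (x \<bullet> x) / 2) * (1 + d_minus (x \<bullet> x) * (x \<bullet> x)) = 0"
    unfolding r_def[symmetric] d(1) using d(2) by algebra
qed simp

lemma complex_structure_plus:
  assumes U: "open U" "U \<subseteq> M1" shows "complex_structure_on U J_ext"
proof (rule complex_structure_Jrad[OF U(1) _ _ ode_plus smooth_on_subset[OF smooth_on_coefficients(1) U(2)]
      smooth_on_subset[OF smooth_on_coefficients(2) U(2)]])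
  fix x assume "x \<in> U"
  then show x: "x \<in> M1" "x \<in> M1" using U(2) by auto
  show "(f_plus has_real_derivative - c_plus (x \<bullet> x) * f_plus (x \<bullet> x) / 2) (at (x \<bullet> x))"
    using f_plus_derivs(1) x by (simp add: M1_iff)
  show "((\<lambda>r. - c_plus r * f_plus r / 2) has_real_derivative (\<lambda>r. (- c_plus r)\<^sup>2 * f_plus r / 4
      + (3 - r) / (1 - r)^3 * f_plus r / 2) (x \<bullet> x)) (at (x \<bullet> x))"
    using f_plus_derivs(2) x by (simp add: M1_iff)
  show "g_plus differentiable (at (radial_map f_plus x))"
    using smooth_on_has_derivative[OF open_UNIV smooth_on_g_plus UNIV_I] unfolding differentiable_def by blast
  show "g_plus (radial_map f_plus x) = x" by (rule plus_inverse[OF x(1)])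
qed

lemma complex_structure_minus: "complex_structure_on M0 (Jrad c_minus d_minus)"
proof -
  obtain D where D: "\<And>r. 0 < r \<Longrightarrow> r < 1 \<Longrightarrow>
      ((\<lambda>r. - c_minus r * f_minus r / 2) has_real_derivative D r) (at r)"
    using f_minus_derivs(2) by metis
  show ?thesis
  proof (rule complex_structure_Jrad[OF open_M(1) _ _ ode_minus smooth_on_coefficients(3,4)])
    fix x assume x: "x \<in> M0"
    show "(f_minus has_real_derivative - c_minus (x \<bullet> x) * f_minus (x \<bullet> x) / 2) (at (x \<bullet> x))"
      using f_minus_derivs(1) x M0_pos[OF x] by (simp add: M0_iff)
    show "((\<lambda>r. - c_minus r * f_minus r / 2) has_real_derivative D (x \<bullet> x)) (at (x \<bullet> x))"
      using D x M0_pos[OF x] by (simp add: M0_iff)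
    have "radial_map f_minus x \<in> - {0}" using minus_inverse(2)[OF x] by simp
    from smooth_on_has_derivative[OF open_Compl[OF closed_singleton] smooth_on_g_minus this]
    show "(\<lambda>y. g_plus (invert y)) differentiable (at (radial_map f_minus x))"
      unfolding differentiable_def by blast
    show "g_plus (invert (radial_map f_minus x)) = x" by (rule minus_inverse(1)[OF x])
  qed auto
qed

lemma biholomorphic_plus:
  assumes "\<And>x v. x \<in> M1 \<Longrightarrow> J x v = J_ext x v" shows "biholomorphic M1 J UNIV J_std"
  by (rule biholomorphic_radial_map[OF open_M(2) _ ode_plus smooth_on_coefficients(5) open_UNIV
        smooth_on_g_plus]) (use f_plus_derivs(1) g_plus_in plus_inverse assms in \<open>auto simp: M1_iff simp del: split_paired_All\<close>)

lemma biholomorphic_minus: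
  assumes "\<And>x v. x \<in> M0 \<Longrightarrow> J x v = Jrad c_minus d_minus x v"
  shows "biholomorphic M0 J (- {(0, 0)}) J_std"
proof -
  have z: "- {(0, 0)} = - {0 :: c2}" by (simp add: zero_prod_def)
  show ?thesis
    unfolding z
    by (rule biholomorphic_radial_map[OF open_M(1) _ ode_minus smooth_on_coefficients(6) _ smooth_on_g_minus])
      (use f_minus_derivs(1) minus_inverse assms M0_pos in \<open>auto simp: M0_iff simp del: split_paired_All\<close>)
qed

lemma frame_imul:
  "(x \<bullet> x) *\<^sub>R imul v = (x \<bullet> v) *\<^sub>R imul x - (imul x \<bullet> v) *\<^sub>R x - (E2 x \<bullet> v) *\<^sub>R E3 x + (E3 x \<bullet> v) *\<^sub>R E2 x"
  unfolding inner_c2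
  by (simp add: E2_def E3_def imul_def qmult_def prod_eq_iff complex_eq_iff algebra_simps)

lemma J_sign_eq:
  assumes x: "x \<in> M0" and F: "F = (\<lambda>z. (1 - exp (- z))\<^sup>2)"
  shows "J_sign e F x v = - imul v + ((1 - e / (1 - x \<bullet> x)\<^sup>2) / (x \<bullet> x) * (x \<bullet> v)) *\<^sub>R imul x
    + ((e * (1 - x \<bullet> x)\<^sup>2 - 1) / (x \<bullet> x) * (imul x \<bullet> v)) *\<^sub>R x"
proof -
  have x0: "x \<noteq> 0" and r: "x \<bullet> x \<noteq> 0" and s: "(1 - x \<bullet> x)\<^sup>2 \<noteq> 0" using x by (auto simp: M0_iff)
  have Fx: "F (zcoord x) = (1 - x \<bullet> x)\<^sup>2" using exp_zcoord[OF x0] by (simp add: F)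
  have "(x \<bullet> x) *\<^sub>R J_sign e F x v = (e * (1 - x \<bullet> x)\<^sup>2 * (imul x \<bullet> v)) *\<^sub>R x
      - (e / (1 - x \<bullet> x)\<^sup>2 * (x \<bullet> v)) *\<^sub>R imul x - (E3 x \<bullet> v) *\<^sub>R E2 x + (E2 x \<bullet> v) *\<^sub>R E3 x"
    unfolding J_sign_def Fx dz_eq[OF x0] eta1_def eta2_def eta3_def E1_imul ddz_def
      dot_square_norm[symmetric] inner_commute[of v] using r s
    by (simp add: scaleR_add_right scaleR_diff_right field_simps)
  also have "\<dots> = - ((x \<bullet> x) *\<^sub>R imul v) + ((1 - e / (1 - x \<bullet> x)\<^sup>2) * (x \<bullet> v)) *\<^sub>R imul x
      + ((e * (1 - x \<bullet> x)\<^sup>2 - 1) * (imul x \<bullet> v)) *\<^sub>R x"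
    unfolding frame_imul by (simp add: algebra_simps)
  finally have "(1 / (x \<bullet> x)) *\<^sub>R ((x \<bullet> x) *\<^sub>R J_sign e F x v) = (1 / (x \<bullet> x)) *\<^sub>R
      (- ((x \<bullet> x) *\<^sub>R imul v) + ((1 - e / (1 - x \<bullet> x)\<^sup>2) * (x \<bullet> v)) *\<^sub>R imul x
      + ((e * (1 - x \<bullet> x)\<^sup>2 - 1) * (imul x \<bullet> v)) *\<^sub>R x)" by simp
  then show ?thesis using r by (simp add: scaleR_add_right scaleR_diff_right divide_inverse mult_ac)
qed

lemma J_plus_eq:
  assumes x: "x \<in> M0" and F: "F = (\<lambda>z. (1 - exp (- z))\<^sup>2)" shows "J_plus F x v = J_ext x v"
proof -
  define s where "s = 1 - x \<bullet> x"
  have s: "s \<noteq> 0" "s \<noteq> 1" "x \<bullet> x = 1 - s" using x by (auto simp: s_def M0_iff)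
  have "(1 - 1 / s\<^sup>2) / (1 - s) = c_plus (1 - s)" "(1 * s\<^sup>2 - 1) / (1 - s) = d_plus (1 - s)"
    unfolding c_plus_def d_plus_def using s(1,2)
    by (simp_all add: divide_simps) (simp_all add: algebra_simps power2_eq_square)
  then show ?thesis unfolding J_sign_eq[OF x F] Jrad_def s(3) by simp
qed

lemma J_minus_eq:
  assumes x: "x \<in> M0" and F: "F = (\<lambda>z. (1 - exp (- z))\<^sup>2)"
  shows "J_minus F x v = Jrad c_minus d_minus x v"
proof -
  have r: "x \<bullet> x \<noteq> 0" and s: "(1 - x \<bullet> x)\<^sup>2 \<noteq> 0" using x by (auto simp: M0_iff)
  have "(1 - - 1 / (1 - x \<bullet> x)\<^sup>2) / (x \<bullet> x) = c_minus (x \<bullet> x)"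
    "(- 1 * (1 - x \<bullet> x)\<^sup>2 - 1) / (x \<bullet> x) = d_minus (x \<bullet> x)"
    unfolding c_minus_def d_minus_def using r s by (simp_all add: divide_simps)
  then show ?thesis unfolding J_sign_eq[OF x F] Jrad_def by simp
qed

section \<open>The two Kaehler metrics\<close>

lemma riemannian_on_cong:
  assumes "\<And>x. x \<in> U \<Longrightarrow> g' x = g x" and R: "riemannian_on U g" shows "riemannian_on U g'"
proof -
  have "smooth_on U (\<lambda>x. g' x v w)" for v w
    using smooth_on_cong[OF riemannian_onD(1)[OF R], of "\<lambda>x. g' x v w" "\<lambda>x. g x v w"] assms(1)
      riemannian_onD(5)[OF R] by simp
  then show ?thesis using R assms(1) unfolding riemannian_on_def by simp
qed

lemma rdist_cong:
  assumes g: "\<And>x. x \<in> U \<Longrightarrow> g' x = g x" shows "rdist U g' = rdist U g"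
proof -
  have s: "rspeed g' p t = rspeed g p t" if "path_image p \<subseteq> U" "t \<in> {0..1}" for p t
  proof -
    have "p t \<in> U" using that by (auto simp: path_image_def)
    then show ?thesis by (simp add: rspeed_def g)
  qed
  have "rlength g' p = rlength g p" "rspeed g' p integrable_on {0..1} \<longleftrightarrow> rspeed g p integrable_on {0..1}"
    if "path_image p \<subseteq> U" for p
    unfolding rlength_def
    by (rule integral_cong, rule s[OF that], assumption) (rule integrable_cong, rule s[OF that], assumption)
  then have "{rlength g' p | p. valid_path p \<and> path_image p \<subseteq> U \<and> pathstart p = x \<and>
      pathfinish p = y \<and> rspeed g' p integrable_on {0..1}} = {rlength g p | p. valid_path p \<and>
      path_image p \<subseteq> U \<and> pathstart p = x \<and> pathfinish p = y \<and> rspeed g p integrable_on {0..1}}" for x y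
    by (intro Collect_cong) metis
  then show ?thesis unfolding rdist_def by (intro ext) simp
qed

lemma complete_on_cong: "(\<And>x. x \<in> U \<Longrightarrow> g' x = g x) \<Longrightarrow> complete_on U g' \<longleftrightarrow> complete_on U g"
  using rdist_cong[of U g' g] by (simp add: complete_on_def)

lemma christoffel_cong:
  assumes U: "open U" "x \<in> U" and g: "\<And>x. x \<in> U \<Longrightarrow> g' x = g x"
  shows "christoffel g' x v w = christoffel g x v w"
proof -
  have "frechet_derivative (\<lambda>y. g' y a b) (at x) = frechet_derivative (\<lambda>y. g y a b) (at x)" for a b
    by (rule frechet_derivative_cong_open[OF U]) (simp add: g)
  then show ?thesis unfolding christoffel_def sharp_def using g[OF U(2)] by simp
qed

lemma scalar_curvature_cong:
  assumes U: "open U" "x \<in> U" and g: "\<And>x. x \<in> U \<Longrightarrow> g' x = g x"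
  shows "scalar_curvature g' x = scalar_curvature g x"
proof -
  note c = christoffel_cong[OF U(1) _ g]
  have cx: "christoffel g' x a b = christoffel g x a b" for a b by (rule c[OF U(2)])
  have "frechet_derivative (\<lambda>y. christoffel g' y a b) (at x) = frechet_derivative (\<lambda>y. christoffel g y a b) (at x)" for a b
    by (rule frechet_derivative_cong_open[OF U c])
  then have "riemann g' x u v w = riemann g x u v w" for u v w by (simp add: riemann_def cx)
  then show ?thesis unfolding scalar_curvature_def sharp_def ricci_def using g[OF U(2)] by simp
qed

lemma complex_structure_on_cong:
  assumes J: "complex_structure_on U J" and eq: "\<And>x. x \<in> U \<Longrightarrow> J' x = J x"
  shows "complex_structure_on U J'"
proof -
  have U: "open U" using J by (simp add: complex_structure_on_def)
  have b: "lie_bracket X Y x = lie_bracket X' Y' x"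
    if "x \<in> U" "\<And>y. y \<in> U \<Longrightarrow> X y = X' y" "\<And>y. y \<in> U \<Longrightarrow> Y y = Y' y" for X Y X' Y' x
    unfolding lie_bracket_def
    using frechet_derivative_cong_open[OF U that(1), of X X'] frechet_derivative_cong_open[OF U that(1), of Y Y'] that
    by simp
  have s: "smooth_on U (\<lambda>x. J' x v)" for v
    using smooth_on_cong[OF U, of "\<lambda>x. J' x v" "\<lambda>x. J x v"] eq J by (simp add: complex_structure_on_def)
  have "lie_bracket (\<lambda>y. J' y (X y)) (\<lambda>y. J' y (Y y)) x - J' x (lie_bracket (\<lambda>y. J' y (X y)) Y x)
      - J' x (lie_bracket X (\<lambda>y. J' y (Y y)) x) - lie_bracket X Y x = 0"
    if "smooth_on U X" "smooth_on U Y" "x \<in> U" for X Y x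
    using J that eq b[OF that(3), of "\<lambda>y. J' y (X y)" "\<lambda>y. J y (X y)" "\<lambda>y. J' y (Y y)" "\<lambda>y. J y (Y y)"]
      b[OF that(3), of "\<lambda>y. J' y (X y)" "\<lambda>y. J y (X y)" Y Y] b[OF that(3), of X X "\<lambda>y. J' y (Y y)" "\<lambda>y. J y (Y y)"]
    by (simp add: complex_structure_on_def)
  then show ?thesis using J s eq unfolding complex_structure_on_def by simp
qed

lemma kahler_on_cong:
  assumes K: "kahler_on U g J" and g: "\<And>x. x \<in> U \<Longrightarrow> g' x = g x" and J: "\<And>x. x \<in> U \<Longrightarrow> J' x = J x"
  shows "kahler_on U g' J'"
proof -
  have R: "riemannian_on U g" and C: "complex_structure_on U J" using K by (auto simp: kahler_on_def)
  have "frechet_derivative (\<lambda>y. fundamental_form g' J' y v w) (at x)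
      = frechet_derivative (\<lambda>y. fundamental_form g J y v w) (at x)" if "x \<in> U" for x v w
    by (rule frechet_derivative_cong_open[OF riemannian_onD(1)[OF R] that]) (simp add: fundamental_form_def g J)
  then have "ext_deriv2 (fundamental_form g' J') x u v w = ext_deriv2 (fundamental_form g J) x u v w"
    if "x \<in> U" for x u v w
    using that by (simp add: ext_deriv2_def)
  then show ?thesis
    using K riemannian_on_cong[OF g R] complex_structure_on_cong[OF C J] g J
    unfolding kahler_on_def by simp
qed

abbreviation met_plus :: "real \<Rightarrow> c2 metric_field" where "met_plus C \<equiv> met (\<lambda>_. C)"
abbreviation met_minus :: "real \<Rightarrow> c2 metric_field" where "met_minus C \<equiv> met (\<lambda>r. C / r\<^sup>2)"

lemma riemannian_met_plus: "0 < C \<Longrightarrow> open U \<Longrightarrow> U \<subseteq> M1 \<Longrightarrow> riemannian_on U (met_plus C)"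
  by (intro riemannian_met smooth_on_const) auto

lemma riemannian_met_minus:
  assumes "0 < C" shows "riemannian_on M0 (met_minus C)"
proof -
  have "smooth_on M0 (\<lambda>x. C / (x \<bullet> x)\<^sup>2)"
    by (intro smooth_on_divide smooth_on_const smooth_on_power smooth_on_inner_self open_M) (simp add: M0_iff)
  then show ?thesis using assms M0_M1 M0_pos by (intro riemannian_met open_M) auto
qed

text \<open>The first Kaehler form is constant, the second one is the pullback of a constant form by
  inversion; this is where the conformal factors come from.\<close>

lemma kahler_form_plus:
  assumes x: "x \<in> M1" shows "met_plus C x (J_ext x v) w = - C * (imul v \<bullet> w)"
proof -
  define s where "s = 1 - x \<bullet> x"
  have s: "s \<noteq> 0" "x \<bullet> x = 1 - s" using x by (auto simp: s_def M1_iff)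
  show ?thesis
    unfolding met_def Jrad_def c_plus_def d_plus_def using s(1)
    by (simp add: s(2) inner_add_left inner_add_right inner_diff_left inner_diff_right inner_imul_right divide_simps)
      (simp add: algebra_simps power2_eq_square)
qed

lemma kahler_form_minus:
  assumes x: "x \<in> M0"
  shows "met_minus C x (Jrad c_minus d_minus x v) w = - C * ((imul v \<bullet> w) / (x \<bullet> x)\<^sup>2
    - 2 * ((x \<bullet> v) * (imul x \<bullet> w) - (imul x \<bullet> v) * (x \<bullet> w)) / (x \<bullet> x)^3)"
proof -
  define s where "s = 1 - x \<bullet> x"
  have s: "s \<noteq> 0" "s \<noteq> 1" "x \<bullet> x = 1 - s" using x by (auto simp: s_def M0_iff)
  show ?thesis
    unfolding met_def Jrad_def c_minus_def d_minus_def using s(1,2)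
    by (simp add: s(3) inner_add_left inner_add_right inner_diff_left inner_diff_right inner_imul_right divide_simps)
      (simp add: algebra_simps eval_nat_numeral)
qed

lemma kahler_plus:
  assumes "0 < C" "open U" "U \<subseteq> M1" shows "kahler_on U (met_plus C) J_ext"
proof (rule kahler_onI[OF riemannian_met_plus[OF assms] complex_structure_plus[OF assms(2,3)],
      where \<omega> = "\<lambda>x v w. - C * (imul v \<bullet> w)"])
  show "met_plus C x (J_ext x v) w = - C * (imul v \<bullet> w)" if "x \<in> U" for x v w
    using that assms(3) by (intro kahler_form_plus) auto
  show "- C * (imul v \<bullet> w) = - (- C * (imul w \<bullet> v))" for v w using imul_swap[of v w] by simp
qed (simp add: ext_deriv2_def)

lemma kahler_minus:
  assumes C: "0 < C" shows "kahler_on M0 (met_minus C) (Jrad c_minus d_minus)"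
proof (rule kahler_onI[OF riemannian_met_minus[OF C] complex_structure_minus kahler_form_minus])
  show "- C * ((imul v \<bullet> w) / (x \<bullet> x)\<^sup>2 - 2 * ((x \<bullet> v) * (imul x \<bullet> w) - (imul x \<bullet> v) * (x \<bullet> w)) / (x \<bullet> x)^3)
    = - (- C * ((imul w \<bullet> v) / (x \<bullet> x)\<^sup>2 - 2 * ((x \<bullet> w) * (imul x \<bullet> v) - (imul x \<bullet> w) * (x \<bullet> v)) / (x \<bullet> x)^3))"
    for x v w using imul_swap[of v w] by (simp add: algebra_simps diff_divide_distrib)
  fix x u v w assume x: "x \<in> M0"
  define r where "r = x \<bullet> x"
  have r: "r \<noteq> 0" using x by (simp add: r_def M0_iff)
  have p: "((\<lambda>r. 1 / r\<^sup>2) has_real_derivative - 2 / r^3) (at (x \<bullet> x))"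
    "((\<lambda>r. 1 / r^3) has_real_derivative - 3 / r^4) (at (x \<bullet> x))"
    using r by (auto intro!: derivative_eq_intros simp: eval_nat_numeral field_simps simp flip: r_def)
  have D: "((\<lambda>y. - C * ((imul v \<bullet> w) / (y \<bullet> y)\<^sup>2
      - 2 * ((y \<bullet> v) * (imul y \<bullet> w) - (imul y \<bullet> v) * (y \<bullet> w)) / (y \<bullet> y)^3)) has_derivative
    (\<lambda>h. - C * ((imul v \<bullet> w) * (2 * (x \<bullet> h) * (- 2 / r^3))
      - 2 * (((h \<bullet> v) * (imul x \<bullet> w) + (x \<bullet> v) * (imul h \<bullet> w) - (imul h \<bullet> v) * (x \<bullet> w) - (imul x \<bullet> v) * (h \<bullet> w)) * (1 / r^3)
        + ((x \<bullet> v) * (imul x \<bullet> w) - (imul x \<bullet> v) * (x \<bullet> w)) * (2 * (x \<bullet> h) * (- 3 / r^4)))))) (at x)" for v w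
  proof -
    have "((\<lambda>y. - C * ((imul v \<bullet> w) * (1 / (y \<bullet> y)\<^sup>2)
        - 2 * (((y \<bullet> v) * (imul y \<bullet> w) - (imul y \<bullet> v) * (y \<bullet> w)) * (1 / (y \<bullet> y)^3)))) has_derivative
      (\<lambda>h. - C * ((imul v \<bullet> w) * (2 * (x \<bullet> h) * (- 2 / r^3))
      - 2 * (((h \<bullet> v) * (imul x \<bullet> w) + (x \<bullet> v) * (imul h \<bullet> w) - (imul h \<bullet> v) * (x \<bullet> w) - (imul x \<bullet> v) * (h \<bullet> w)) * (1 / r^3)
        + ((x \<bullet> v) * (imul x \<bullet> w) - (imul x \<bullet> v) * (x \<bullet> w)) * (2 * (x \<bullet> h) * (- 3 / r^4)))))) (at x)"
      by (rule has_derivative_eq_rhs, (rule has_derivative_add has_derivative_diff has_derivative_mult has_derivative_inner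
          has_derivative_const has_derivative_ident has_derivative_imul has_derivative_radial[OF p(1)]
          has_derivative_radial[OF p(2)])+) (simp add: fun_eq_iff r_def algebra_simps)
    then show ?thesis by simp
  qed
  note D' = frechet_derivative_at[OF D, symmetric]
  have c: "imul u \<bullet> v = - (imul v \<bullet> u)" "imul u \<bullet> w = - (imul w \<bullet> u)" "imul w \<bullet> v = - (imul v \<bullet> w)"
    "w \<bullet> v = v \<bullet> w" "u \<bullet> v = v \<bullet> u" "u \<bullet> w = w \<bullet> u"
    by (rule imul_swap inner_commute)+
  show "ext_deriv2 (\<lambda>x v w. - C * ((imul v \<bullet> w) / (x \<bullet> x)\<^sup>2
      - 2 * ((x \<bullet> v) * (imul x \<bullet> w) - (imul x \<bullet> v) * (x \<bullet> w)) / (x \<bullet> x)^3)) x u v w = 0"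
    unfolding ext_deriv2_def D' unfolding c by (simp add: algebra_simps)
qed

subsection \<open>Orientations\<close>

lemma hermitian_ineq:
  fixes G :: "'a::real_vector \<Rightarrow> 'a \<Rightarrow> real" and J :: "'a \<Rightarrow> 'a"
  assumes b: "bilinear G" and sym: "\<And>v w. G v w = G w v" and nn: "\<And>v. 0 \<le> G v v"
    and pos: "\<And>v. v \<noteq> 0 \<Longrightarrow> 0 < G v v"
    and J: "\<And>v. J (J v) = - v" "\<And>v w. G (J v) (J w) = G v w"
  shows "0 \<le> G (J v) (J v) * G (J w) (J w) - G (J v) w * G (J (J v)) (J w) + G (J v) (J w) * G (J (J v)) w"
proof -
  have Jv: "G v (J v) = 0" "G (J v) v = 0"
  proof -
    have "G (J v) (- v) = G v (J v)" using J(2)[of v "J v"] by (simp add: J(1))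
    moreover have "G (J v) (- v) = - G (J v) v" by (rule bilinear_rneg[OF b])
    ultimately show "G v (J v) = 0" using sym[of v "J v"] by linarith
    then show "G (J v) v = 0" using sym by metis
  qed
  define a b' c where "a = G v v" and "b' = G v w" and "c = G (J v) w"
  have "0 \<le> G (a *\<^sub>R w - b' *\<^sub>R v - c *\<^sub>R J v) (a *\<^sub>R w - b' *\<^sub>R v - c *\<^sub>R J v)" by (rule nn)
  also have "\<dots> = a * (a * G w w - b'\<^sup>2 - c\<^sup>2)"
    using Jv sym[of w v] sym[of w "J v"] J(2)[of v v]
    by (simp add: bilinear_ladd[OF b] bilinear_radd[OF b] bilinear_lsub[OF b] bilinear_rsub[OF b] bilinear_lmul[OF b] bilinear_rmul[OF b]
        a_def b'_def c_def algebra_simps power2_eq_square)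
  finally have "0 \<le> a * (a * G w w - b'\<^sup>2 - c\<^sup>2)" .
  moreover have "0 < a \<or> v = 0" using pos by (auto simp: a_def)
  moreover have "b' = 0 \<and> c = 0 \<and> a = 0" if "v = 0"
  proof -
    have "G (J v) (J v) = 0" using that by (simp add: J(2) bilinear_lzero[OF b])
    then have "J v = 0" using pos[of "J v"] by force
    then show ?thesis using that by (simp add: a_def b'_def c_def bilinear_lzero[OF b])
  qed
  ultimately have "0 \<le> a * G w w - b'\<^sup>2 - c\<^sup>2" by (auto simp: zero_le_mult_iff)
  moreover have "G (J (J v)) w = - G v w" unfolding J(1) by (rule bilinear_lneg[OF b])
  ultimately show ?thesis
    unfolding J(2) by (simp add: a_def b'_def c_def power2_eq_square)
qed

lemma pfaffian_minus:
  fixes x :: c2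
  defines "\<omega> \<equiv> \<lambda>v w. (x \<bullet> x) * (imul v \<bullet> w) - 2 * ((x \<bullet> v) * (imul x \<bullet> w) - (imul x \<bullet> v) * (x \<bullet> w))"
  shows "\<omega> a b * \<omega> c d - \<omega> a c * \<omega> b d + \<omega> a d * \<omega> b c = - (x \<bullet> x)\<^sup>2 * det_c2 a b c d"
proof -
  obtain x1 x2 x3 x4 a1 a2 a3 a4 b1 b2 b3 b4 c1 c2 c3 c4 d1 d2 d3 d4 where
    e: "x = (Complex x1 x2, Complex x3 x4)" "a = (Complex a1 a2, Complex a3 a4)"
      "b = (Complex b1 b2, Complex b3 b4)" "c = (Complex c1 c2, Complex c3 c4)"
      "d = (Complex d1 d2, Complex d3 d4)"
    by (metis complex.exhaust surj_pair)
  show ?thesis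
    unfolding \<omega>_def det_c2_pfaffian e by (simp add: inner_c2 imul_def) algebra
qed

lemma opposite_orientations_pm:
  "opposite_orientations M0 (Jrad c_minus d_minus) J_ext"
  unfolding opposite_orientations_def
proof (rule bexI[of _ "- 1"], intro ballI allI conjI impI)
  fix x v w assume x: "x \<in> M0"
  have x1: "x \<in> M1" using x M0_M1 by auto
  have herm: "0 \<le> g x (J x v) (J x v) * g x (J x w) (J x w) - g x (J x v) w * g x (J x (J x v)) (J x w)
      + g x (J x v) (J x w) * g x (J x (J x v)) w" if K: "kahler_on M0 g J" for g J
  proof (rule hermitian_ineq)
    have R: "riemannian_on M0 g" using K by (simp add: kahler_on_def)
    show "bilinear (g x)" "\<And>v w. g x v w = g x w v" "\<And>v. 0 \<le> g x v v" "\<And>v. v \<noteq> 0 \<Longrightarrow> 0 < g x v v"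
      using riemannian_onD[OF R] x by auto
    show "\<And>v. J x (J x v) = - v" "\<And>v w. g x (J x v) (J x w) = g x v w"
      using K x by (auto simp: kahler_on_def complex_structure_on_def)
  qed
  let ?J = "J_ext x"
  have "0 \<le> det_c2 v (?J v) w (?J w)"
    using herm[OF kahler_plus[of 1, OF _ open_M(1) M0_M1]]
    unfolding kahler_form_plus[OF x1] det_c2_pfaffian by simp
  then show "sgn (det_c2 v (?J v) w (?J w)) = - (- 1)" if "det_c2 v (?J v) w (?J w) \<noteq> 0"
    using that by simp
  let ?K = "Jrad c_minus d_minus x"
  define \<omega> where "\<omega> v w = (x \<bullet> x) * (imul v \<bullet> w) - 2 * ((x \<bullet> v) * (imul x \<bullet> w) - (imul x \<bullet> v) * (x \<bullet> w))" for v w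
  have r: "0 < x \<bullet> x" by (rule M0_pos[OF x])
  have om: "met_minus 1 x (?K v) w = - \<omega> v w / (x \<bullet> x)^3" for v w
    unfolding kahler_form_minus[OF x] \<omega>_def using r by (simp add: field_simps eval_nat_numeral)
  have "0 \<le> (\<omega> v (?K v) * \<omega> w (?K w) - \<omega> v w * \<omega> (?K v) (?K w) + \<omega> v (?K w) * \<omega> (?K v) w) / ((x \<bullet> x)^3)\<^sup>2"
    using herm[OF kahler_minus[of 1]] unfolding om
    by (simp add: diff_divide_distrib add_divide_distrib power2_eq_square)
  then have "0 \<le> - (x \<bullet> x)\<^sup>2 * det_c2 v (?K v) w (?K w)"
    unfolding pfaffian_minus[of x v "?K v" w "?K w", folded \<omega>_def, symmetric] using r
    by (simp add: zero_le_divide_iff)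
  then have "det_c2 v (?K v) w (?K w) \<le> 0" using r by (simp add: mult_le_0_iff)
  then show "sgn (det_c2 v (?K v) w (?K w)) = - 1" if "det_c2 v (?K v) w (?K w) \<noteq> 0"
    using that by simp
qed simp

subsection \<open>The scalar curvatures and the Killing field\<close>

lemma scalar_curvature_plus:
  assumes C: "0 < C" and x: "x \<in> M1"
  shows "scalar_curvature (met_plus C) x = 48 / C * (1 - x \<bullet> x)"
  using scalar_curvature_met_conn[OF riemannian_met_plus[OF C open_M(2) order_refl] x order_refl refl,
      where k = "\<lambda>_. 0" and k' = 0, OF _ _ refl refl] by simp

lemma scalar_curvature_minus:
  assumes C: "0 < C" and x: "x \<in> M0"
  shows "scalar_curvature (met_minus C) x = 0"
proof -
  define r where "r = x \<bullet> x"
  have r: "r \<noteq> 0" using x by (simp add: r_def M0_iff)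
  have a: "((\<lambda>r. C / r\<^sup>2) has_real_derivative - 2 / (y \<bullet> y) * (C / (y \<bullet> y)\<^sup>2)) (at (y \<bullet> y))" if "y \<in> M0" for y
    using that by (auto intro!: derivative_eq_intros simp: M0_iff power2_eq_square)
  have k: "((\<lambda>r. - 2 / r) has_real_derivative 2 / r\<^sup>2) (at (x \<bullet> x))"
    using r by (auto intro!: derivative_eq_intros simp: power2_eq_square simp flip: r_def)
  have "48 * (1 - r) - 6 * (r * (1 - r)\<^sup>2 * (2 * (2 / r\<^sup>2) + (- 2 / r)\<^sup>2)
      + 4 * (1 - r) * (2 * (1 - r) - 1) * (- 2 / r)) = 0"
    using r by (simp add: field_simps power2_eq_square)
  then show ?thesis
    using scalar_curvature_met_conn[OF riemannian_met_minus[OF C] x M0_M1 refl a k refl refl]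
    by (simp add: r_def)
qed

lemma killing_plus:
  assumes C: "0 < C"
  shows "killing_on M1 (met_plus C) (\<lambda>x. J_ext x (grad (met_plus C) (scalar_curvature (met_plus C)) x))"
proof -
  note R = riemannian_met_plus[OF C open_M(2) order_refl]
  define k where "k = 96 / C\<^sup>2"
  have V: "J_ext x (grad (met_plus C) (scalar_curvature (met_plus C)) x) = k *\<^sub>R imul x" if x: "x \<in> M1" for x
  proof -
    define s where "s = 1 - x \<bullet> x"
    have s: "s \<noteq> 0" "x \<bullet> x = 1 - s" using x by (auto simp: s_def M1_iff)
    have "((\<lambda>x::c2. 48 / C * (1 - x \<bullet> x)) has_derivative (\<lambda>h. ((- 96 / C) *\<^sub>R x) \<bullet> h)) (at x)"
      using C by (auto intro!: derivative_eq_intros simp: inner_commute)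
    then have "(scalar_curvature (met_plus C) has_derivative (\<lambda>h. ((- 96 / C) *\<^sub>R x) \<bullet> h)) (at x)"
      by (rule has_derivative_transform_within_open[OF _ open_M(2) x]) (simp add: scalar_curvature_plus[OF C])
    note D = frechet_derivative_at[OF this, symmetric]
    have "grad (met_plus C) (scalar_curvature (met_plus C)) x = (- k * s\<^sup>2) *\<^sub>R x"
    proof -
      have "grad (met_plus C) (scalar_curvature (met_plus C)) x
          = (1 / C * (- 96 / C) - 1 / C * ((1 + s) * (- 96 / C * (1 - s)))) *\<^sub>R x"
        unfolding grad_def D met_sharp[OF R x x] scaleR_left_diff_distrib
        by (simp add: s(2) scaleR_diff_right)
      also have "1 / C * (- 96 / C) - 1 / C * ((1 + s) * (- 96 / C * (1 - s))) = - k * s\<^sup>2"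
        using C by (simp add: k_def field_simps power2_eq_square)
      finally show ?thesis .
    qed
    then show ?thesis
      unfolding Jrad_def c_plus_def d_plus_def using s(1)
      by (simp add: s(2) power2_eq_square field_simps flip: scaleR_left_diff_distrib scaleR_left_distrib)
  qed
  have sm: "smooth_on M1 (\<lambda>x. k *\<^sub>R imul x)"
    by (intro smooth_on_scaleR smooth_on_const smooth_on_imul open_M)
  show ?thesis
    unfolding killing_on_def
  proof (intro conjI ballI allI)
    show "smooth_on M1 (\<lambda>x. J_ext x (grad (met_plus C) (scalar_curvature (met_plus C)) x))"
      using sm by (subst smooth_on_cong[OF open_M(2) V])
    fix x v w assume x: "x \<in> M1"
    have "((\<lambda>x. k *\<^sub>R imul x) has_derivative (\<lambda>h. k *\<^sub>R imul h)) (at x)"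
      by (intro has_derivative_scaleR_right has_derivative_imul)
    then have "((\<lambda>x. J_ext x (grad (met_plus C) (scalar_curvature (met_plus C)) x)) has_derivative
        (\<lambda>h. k *\<^sub>R imul h)) (at x)"
      by (rule has_derivative_transform_within_open[OF _ open_M(2) x]) (simp add: V)
    note D = frechet_derivative_at[OF this, symmetric]
    note G = frechet_derivative_at[OF met_has_derivative[OF x DERIV_const], symmetric]
    show "frechet_derivative (\<lambda>y. met_plus C y v w) (at x)
          (J_ext x (grad (met_plus C) (scalar_curvature (met_plus C)) x))
        + met_plus C x (frechet_derivative (\<lambda>x. J_ext x (grad (met_plus C) (scalar_curvature (met_plus C)) x)) (at x) v) w
        + met_plus C x v (frechet_derivative (\<lambda>x. J_ext x (grad (met_plus C) (scalar_curvature (met_plus C)) x)) (at x) w) = 0"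
      unfolding D G V[OF x] unfolding met_def
      by (simp add: inner_imul_right algebra_simps add_divide_distrib diff_divide_distrib)
  qed
qed

lemma tendsto_to_infinity: "((\<lambda>x. x) \<longlongrightarrow> 0) to_infinity"
proof (rule Lim_null_comparison)
  have "norm x \<le> exp (- zcoord x / 2)" for x :: c2
    by (cases "x = 0") (simp_all add: zcoord_def)
  then show "\<forall>\<^sub>F x in to_infinity. norm x \<le> exp (- zcoord x / 2)" by simp
  have "filterlim zcoord at_top to_infinity" unfolding to_infinity_def by (rule filterlim_filtercomap)
  moreover have "((\<lambda>z::real. exp (- z / 2)) \<longlongrightarrow> 0) at_top"
    by (rule filterlim_compose[OF exp_at_bot])
      (auto intro!: filterlim_tendsto_neg_mult_at_bot[of "\<lambda>_. -1/2" "-1/2", simplified] filterlim_ident)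
  ultimately show "((\<lambda>x. exp (- zcoord x / 2)) \<longlongrightarrow> 0) to_infinity" by (rule filterlim_compose[rotated])
qed

lemma extends_over_nut_met:
  assumes R: "riemannian_on M1 (met a)" and g: "\<And>x. x \<in> M0 \<Longrightarrow> g x = met a x"
  shows "extends_over_nut g (met a)"
  unfolding extends_over_nut_def
proof (intro conjI R ballI allI)
  interpret Metric_space M1 "rdist M1 (met a)" by (rule metric_space_rdist[OF R connected_M(2)])
  have "0 \<in> M1" by (simp add: M1_def)
  then have "((\<lambda>x. rdist M1 (met a) x 0) \<longlongrightarrow> 0) to_infinity"
    by (intro rdist_tendsto[OF R connected_M(2) _ tendsto_to_infinity])
  moreover have "rdist M1 (met a) 0 = (\<lambda>x. rdist M1 (met a) x 0)" by (rule ext) (rule commute)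
  ultimately show "(rdist M1 (met a) 0 \<longlongrightarrow> 0) to_infinity" by simp
qed (simp add: g)

lemma conformal_on_met:
  assumes "\<And>x. x \<in> U \<Longrightarrow> g x = met a x" "\<And>x. x \<in> U \<Longrightarrow> h x = met b x" "smooth_on U (\<lambda>x. f (x \<bullet> x))"
    "\<And>x. x \<in> U \<Longrightarrow> 0 < f (x \<bullet> x)" "\<And>x. x \<in> U \<Longrightarrow> b (x \<bullet> x) = f (x \<bullet> x) * a (x \<bullet> x)"
  shows "conformal_on U g h"
  unfolding conformal_on_def
  by (rule exI[of _ "\<lambda>x. f (x \<bullet> x)"]) (use assms in \<open>simp add: met_def\<close>)

section \<open>The asymptotically Euclidean end\<close>

text \<open>Symbols of order \<open>m\<close> outside a ball: each derivative gains one power of decay.\<close>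

primrec symb :: "nat \<Rightarrow> real \<Rightarrow> real \<Rightarrow> (c2 \<Rightarrow> real) \<Rightarrow> bool" where
  "symb 0 R m f \<longleftrightarrow> f differentiable_on {y. R < norm y} \<and> (\<exists>C. \<forall>y. R < norm y \<longrightarrow> \<bar>f y\<bar> \<le> C * norm y powr m)"
| "symb (Suc n) R m f \<longleftrightarrow> f differentiable_on {y. R < norm y} \<and> (\<exists>C. \<forall>y. R < norm y \<longrightarrow> \<bar>f y\<bar> \<le> C * norm y powr m)
     \<and> (\<forall>b\<in>Basis. symb n R (m - 1) (\<lambda>x. frechet_derivative f (at x) b))"

lemma open_outside: "open {y :: c2. R < norm y}"
  by (intro open_Collect_less continuous_intros)

lemma symb_0: "symb n R m f \<Longrightarrow> symb 0 R m f"
  by (cases n) auto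

lemma symb_cong:
  assumes "\<And>y. R < norm y \<Longrightarrow> f y = g y" shows "symb n R m f = symb n R m g"
  using assms
proof (induction n arbitrary: f g m)
  case 0
  then show ?case using differentiable_on_cong_open[OF open_outside, of R f g] by auto
next
  case (Suc n)
  have "frechet_derivative f (at x) b = frechet_derivative g (at x) b" if "R < norm x" for x b
    using frechet_derivative_cong_open[OF open_outside, of x R f g] that Suc.prems by auto
  then have "symb n R (m - 1) (\<lambda>x. frechet_derivative f (at x) b)
      = symb n R (m - 1) (\<lambda>x. frechet_derivative g (at x) b)" for b
    by (rule Suc.IH)
  then show ?case
    using differentiable_on_cong_open[OF open_outside, of R f g] Suc.prems by auto
qed

lemma symbI:
  assumes d: "\<And>y. R < norm y \<Longrightarrow> (f has_derivative f' y) (at y)"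
    and b: "\<And>y. R < norm y \<Longrightarrow> \<bar>f y\<bar> \<le> C * norm y powr m"
    and s: "\<And>k b. n = Suc k \<Longrightarrow> b \<in> Basis \<Longrightarrow> symb k R (m - 1) (\<lambda>y. f' y b)"
  shows "symb n R m f"
proof -
  have 1: "f differentiable_on {y. R < norm y}"
    using d by (auto simp: differentiable_on_eq_differentiable_at open_outside differentiable_def)
  have 2: "frechet_derivative f (at y) = f' y" if "R < norm y" for y
    using frechet_derivative_at[OF d[OF that]] by simp
  show ?thesis
  proof (cases n)
    case 0 then show ?thesis using 1 b by auto
  next
    case (Suc k)
    have "symb k R (m - 1) (\<lambda>x. frechet_derivative f (at x) b)" if "b \<in> Basis" for b
      using s[OF Suc that] symb_cong[of R "\<lambda>x. frechet_derivative f (at x) b" "\<lambda>y. f' y b"] 2 by simp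
    then show ?thesis using Suc 1 b by auto
  qed
qed

lemma symb_has_derivative:
  assumes "symb n R m f" "R < norm y"
  shows "(f has_derivative frechet_derivative f (at y)) (at y)"
proof -
  have "f differentiable_on {y. R < norm y}" using symb_0[OF assms(1)] by simp
  then have "f differentiable (at y)"
    using assms(2) unfolding differentiable_on_eq_differentiable_at[OF open_outside] by blast
  then show ?thesis by (simp flip: frechet_derivative_works)
qed

lemma symb_bound:
  assumes "symb n R m f" obtains C where "0 \<le> C" "\<And>y. R < norm y \<Longrightarrow> \<bar>f y\<bar> \<le> C * norm y powr m"
proof -
  obtain C where C: "\<And>y. R < norm y \<Longrightarrow> \<bar>f y\<bar> \<le> C * norm y powr m" using symb_0[OF assms] by auto
  have "\<bar>f y\<bar> \<le> \<bar>C\<bar> * norm y powr m" if "R < norm y" for y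
    using C[OF that] mult_right_mono[OF abs_ge_self[of C], of "norm y powr m"] by simp
  then show ?thesis using that[of "\<bar>C\<bar>"] by simp
qed

lemma symb_SucD: "symb (Suc n) R m f \<Longrightarrow> symb n R m f"
  by (induction n arbitrary: f m) auto

lemma symb_weaken:
  assumes R: "0 < R" and m: "m \<le> m'" and s: "symb n R m f" shows "symb n R m' f"
  using m s
proof (induction n arbitrary: f m m')
  case (0 f m m')
  obtain C where C: "0 \<le> C" "\<And>y. R < norm y \<Longrightarrow> \<bar>f y\<bar> \<le> C * norm y powr m" using symb_bound[OF 0(2)] by blast
  show ?case
  proof (rule symbI[OF symb_has_derivative[OF 0(2)]])
    fix y :: c2 assume y: "R < norm y"
    have "norm y powr m = norm y powr m' * norm y powr (m - m')" by (simp flip: powr_add)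
    also have "\<dots> \<le> norm y powr m' * R powr (m - m')"
      using R y 0(1) by (intro mult_left_mono powr_mono2') auto
    finally have "C * norm y powr m \<le> C * (norm y powr m' * R powr (m - m'))"
      by (rule mult_left_mono[OF _ C(1)])
    then show "\<bar>f y\<bar> \<le> (C * R powr (m - m')) * norm y powr m'"
      using C(2)[OF y] by (simp add: mult_ac)
  qed auto
next
  case (Suc n f m m')
  have "symb 0 R m' f" using Suc.IH[OF Suc.prems(1) symb_SucD[OF Suc.prems(2)]] by (rule symb_0)
  moreover have "symb n R (m' - 1) (\<lambda>x. frechet_derivative f (at x) b)" if "b \<in> Basis" for b
    by (rule Suc.IH[of "m - 1" "m' - 1"]) (use Suc.prems that in simp_all)
  ultimately show ?case by simp
qed

lemma symb_add:
  assumes "symb n R m f" "symb n R m g" shows "symb n R m (\<lambda>x. f x + g x)"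
  using assms
proof (induction n arbitrary: f g m)
  case (0 f g m)
  obtain C where C: "\<And>y. R < norm y \<Longrightarrow> \<bar>f y\<bar> \<le> C * norm y powr m" using symb_bound[OF 0(1)] by metis
  obtain D where D: "\<And>y. R < norm y \<Longrightarrow> \<bar>g y\<bar> \<le> D * norm y powr m" using symb_bound[OF 0(2)] by metis
  show ?case
  proof (rule symbI[OF has_derivative_add[OF symb_has_derivative[OF 0(1)] symb_has_derivative[OF 0(2)]]])
    fix y :: c2 assume y: "R < norm y"
    show "\<bar>f y + g y\<bar> \<le> (C + D) * norm y powr m"
      using C[OF y] D[OF y] abs_triangle_ineq[of "f y" "g y"] by (simp add: distrib_right)
  qed auto
next
  case (Suc n f g m)
  have "symb 0 R m (\<lambda>x. f x + g x)"
    using Suc.IH[OF symb_SucD[OF Suc.prems(1)] symb_SucD[OF Suc.prems(2)]] by (rule symb_0)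
  then obtain C where C: "\<And>y. R < norm y \<Longrightarrow> \<bar>f y + g y\<bar> \<le> C * norm y powr m" by auto
  show ?case
    by (rule symbI[OF has_derivative_add[OF symb_has_derivative[OF Suc.prems(1)] symb_has_derivative[OF Suc.prems(2)]] C])
      (use Suc in auto)
qed

lemma symb_mult:
  assumes "symb n R m f" "symb n R m' g" shows "symb n R (m + m') (\<lambda>x. f x * g x)"
  using assms
proof (induction n arbitrary: f g m m')
  case (0 f g m m')
  obtain C where C: "0 \<le> C" "\<And>y. R < norm y \<Longrightarrow> \<bar>f y\<bar> \<le> C * norm y powr m" using symb_bound[OF 0(1)] by blast
  obtain D where D: "0 \<le> D" "\<And>y. R < norm y \<Longrightarrow> \<bar>g y\<bar> \<le> D * norm y powr m'" using symb_bound[OF 0(2)] by blast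
  show ?case
  proof (rule symbI[OF has_derivative_mult[OF symb_has_derivative[OF 0(1)] symb_has_derivative[OF 0(2)]]])
    fix y :: c2 assume y: "R < norm y"
    have "\<bar>f y * g y\<bar> \<le> (C * norm y powr m) * (D * norm y powr m')"
      unfolding abs_mult using C D y by (intro mult_mono) auto
    then show "\<bar>f y * g y\<bar> \<le> (C * D) * norm y powr (m + m')" by (simp add: powr_add mult_ac)
  qed auto
next
  case (Suc n f g m m')
  have "symb 0 R (m + m') (\<lambda>x. f x * g x)"
    using Suc.IH[OF symb_SucD[OF Suc.prems(1)] symb_SucD[OF Suc.prems(2)]] by (rule symb_0)
  then obtain C where C: "\<And>y. R < norm y \<Longrightarrow> \<bar>f y * g y\<bar> \<le> C * norm y powr (m + m')" by auto
  show ?case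
  proof (rule symbI[OF has_derivative_mult[OF symb_has_derivative[OF Suc.prems(1)] symb_has_derivative[OF Suc.prems(2)]] C])
    fix k and b :: c2 assume k: "Suc n = Suc k" "b \<in> Basis"
    have 1: "symb n R (m + (m' - 1)) (\<lambda>y. f y * frechet_derivative g (at y) b)"
      using Suc.prems(2) k by (intro Suc.IH symb_SucD[OF Suc.prems(1)]) auto
    have 2: "symb n R ((m - 1) + m') (\<lambda>y. frechet_derivative f (at y) b * g y)"
      using Suc.prems(1) k by (intro Suc.IH symb_SucD[OF Suc.prems(2)]) auto
    have e: "m + (m' - 1) = m + m' - 1" "(m - 1) + m' = m + m' - 1" by simp_all
    show "symb k R (m + m' - 1) (\<lambda>y. f y * frechet_derivative g (at y) b + frechet_derivative f (at y) b * g y)"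
      using symb_add[OF 1[unfolded e] 2[unfolded e]] k by simp
  qed
qed

lemma symb_zero: "symb n R m (\<lambda>x. 0)"
proof (induction n arbitrary: m)
  case 0
  then show ?case by (auto intro!: exI[of _ 0])
next
  case (Suc n)
  show ?case
  proof (rule symbI[OF has_derivative_const, where C = 0])
    fix k and b :: c2 assume "Suc n = Suc k"
    then show "symb k R (m - 1) (\<lambda>y. 0)" using Suc by simp
  qed simp
qed

lemma symb_const:
  assumes "0 < R" shows "symb n R 0 (\<lambda>x. c)"
proof (rule symbI[OF has_derivative_const, where C = "\<bar>c\<bar>"])
  fix y :: c2 assume "R < norm y"
  then have "norm y \<noteq> 0" using assms by linarith
  then show "\<bar>c\<bar> \<le> \<bar>c\<bar> * norm y powr 0" by simp
qed (rule symb_zero)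

lemma symb_cmult: "0 < R \<Longrightarrow> symb n R m f \<Longrightarrow> symb n R m (\<lambda>x. c * f x)"
  using symb_mult[OF symb_const[of R n c]] by simp

lemma symb_linear:
  assumes R: "0 < R" and "bounded_linear (l :: c2 \<Rightarrow> real)" shows "symb n R 1 l"
proof -
  obtain K where "\<And>y. norm (l y) \<le> norm y * K" using bounded_linear.bounded[OF assms(2)] by blast
  then show ?thesis
    by (intro symbI[OF bounded_linear_imp_has_derivative[OF assms(2)], where C = K])
      (simp_all add: symb_const[OF R] mult.commute)
qed

lemma symb_inverse_square:
  assumes R: "0 < R" shows "symb n R (- 2) (\<lambda>y. 1 / (y \<bullet> y))"
proof (induction n)
  have d: "((\<lambda>y::c2. 1 / (y \<bullet> y)) has_derivative (\<lambda>h. - 2 * ((y \<bullet> h) * (1 / (y \<bullet> y) * (1 / (y \<bullet> y)))))) (at y)"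
    if "R < norm y" for y :: c2
    using that R by (auto intro!: derivative_eq_intros simp: inner_commute power2_eq_square divide_simps)
  have b: "\<bar>1 / (y \<bullet> y)\<bar> \<le> 1 * norm y powr - 2" if "R < norm y" for y :: c2
    using that R by (simp add: powr_minus powr_numeral dot_square_norm divide_inverse)
  {
    case 0 show ?case by (rule symbI[OF d b]) auto
  next
    case (Suc n)
    have "symb n R (- 2 - 1) (\<lambda>y. - 2 * ((y \<bullet> b) * (1 / (y \<bullet> y) * (1 / (y \<bullet> y)))))" for b
      using symb_cmult[OF R symb_mult[OF symb_linear[OF R bounded_linear_inner_left[of b]] symb_mult[OF Suc Suc]], of "- 2"]
      by simp
    then show ?case by (intro symbI[OF d b]) auto
  }
qed

lemma symb_pole:
  assumes R: "0 < R" "c < R\<^sup>2" "0 < c"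
  shows "symb n R 0 (\<lambda>y. 1 / (1 - c * (1 / (y \<bullet> y))))"
proof (induction n)
  have pos: "1 - c / R\<^sup>2 \<le> 1 - c * (1 / (y \<bullet> y))" "0 < 1 - c / R\<^sup>2" if "R < norm y" for y :: c2
  proof -
    have "R\<^sup>2 \<le> y \<bullet> y" unfolding dot_square_norm using that R by (intro power_mono) auto
    then show "1 - c / R\<^sup>2 \<le> 1 - c * (1 / (y \<bullet> y))" using R by (simp add: frac_le)
    show "0 < 1 - c / R\<^sup>2" using R by simp
  qed
  have d: "((\<lambda>y::c2. 1 / (1 - c * (1 / (y \<bullet> y)))) has_derivative (\<lambda>h. (- 2 * c) * ((y \<bullet> h) *
      (1 / (y \<bullet> y) * (1 / (y \<bullet> y)) * (1 / (1 - c * (1 / (y \<bullet> y))) * (1 / (1 - c * (1 / (y \<bullet> y))))))))) (at y)"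
    if y: "R < norm y" for y :: c2
  proof -
    have n: "y \<bullet> y \<noteq> 0" "1 - c * (1 / (y \<bullet> y)) \<noteq> 0" using pos[OF y] R y by auto
    have N: "((\<lambda>y::c2. 1 / (y \<bullet> y)) has_derivative (\<lambda>h. - 2 * (y \<bullet> h) * (1 / (y \<bullet> y))\<^sup>2)) (at y)"
      using n by (auto intro!: derivative_eq_intros simp: inner_commute power2_eq_square divide_simps)
    show ?thesis
      by (rule has_derivative_eq_rhs[OF has_derivative_divide[OF has_derivative_const
              has_derivative_diff[OF has_derivative_const has_derivative_mult_right[OF N]] n(2)]])
        (simp add: fun_eq_iff divide_inverse power2_eq_square)
  qed
  have b: "\<bar>1 / (1 - c * (1 / (y \<bullet> y)))\<bar> \<le> (1 / (1 - c / R\<^sup>2)) * norm y powr 0" if "R < norm y" for y :: c2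
  proof -
    have "norm y \<noteq> 0" using that R by linarith
    then show ?thesis using pos[OF that] by (auto simp: frac_le)
  qed
  {
    case 0 show ?case by (rule symbI[OF d b]) auto
  next
    case (Suc n)
    note N = symb_inverse_square[OF R(1), of n]
    have "symb n R (- 3) (\<lambda>y. (- 2 * c) * ((y \<bullet> b) *
        (1 / (y \<bullet> y) * (1 / (y \<bullet> y)) * (1 / (1 - c * (1 / (y \<bullet> y))) * (1 / (1 - c * (1 / (y \<bullet> y))))))))" for b
      using symb_cmult[OF R(1) symb_mult[OF symb_linear[OF R(1) bounded_linear_inner_left[of b]]
          symb_mult[OF symb_mult[OF N N] symb_mult[OF Suc Suc]]], of "- 2 * c"] by simp
    then have "symb n R (0 - 1) (\<lambda>y. (- 2 * c) * ((y \<bullet> b) *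
        (1 / (y \<bullet> y) * (1 / (y \<bullet> y)) * (1 / (1 - c * (1 / (y \<bullet> y))) * (1 / (1 - c * (1 / (y \<bullet> y))))))))" for b
      by (rule symb_weaken[OF R(1), rotated]) simp
    then show ?case by (intro symbI[OF d b]) auto
  }
qed

lemma symb_iter_deriv:
  assumes "\<And>n. symb n R m f" "set bs \<subseteq> Basis"
  shows "\<exists>C. \<forall>y. R < norm y \<longrightarrow> \<bar>iter_deriv bs f y\<bar> \<le> C * norm y powr (m - real (length bs))"
  using assms
proof (induction bs arbitrary: f m rule: rev_induct)
  case Nil
  have "symb 0 R m f" by (rule Nil)
  then show ?case by simp
next
  case (snoc b bs)
  have "symb n R (m - 1) (\<lambda>x. frechet_derivative f (at x) b)" for n
    using snoc.prems(1)[of "Suc n"] snoc.prems(2) by simp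
  from snoc.IH[OF this] snoc.prems(2)
  have "\<exists>C. \<forall>y. R < norm y \<longrightarrow> \<bar>iter_deriv bs (\<lambda>x. frechet_derivative f (at x) b) y\<bar>
      \<le> C * norm y powr (m - 1 - real (length bs))" by simp
  moreover have "m - 1 - real (length bs) = m - real (length (bs @ [b]))" by simp
  moreover have "iter_deriv (bs @ [b]) f = iter_deriv bs (\<lambda>x. frechet_derivative f (at x) b)"
    by (simp add: iter_deriv_append)
  ultimately show ?case by metis
qed

text \<open>Inversion pulls the metric back to the Euclidean one up to terms of order \<open>-2\<close>.\<close>

definition inversion :: "real \<Rightarrow> c2 \<Rightarrow> c2" where "inversion c y = (c * (1 / (y \<bullet> y))) *\<^sub>R y"

lemma inversion_has_derivative:
  assumes "y \<noteq> 0"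
  shows "(inversion c has_derivative
    (\<lambda>v. (c * (1 / (y \<bullet> y))) *\<^sub>R v - (2 * c * (y \<bullet> v) * (1 / (y \<bullet> y))\<^sup>2) *\<^sub>R y)) (at y)"
proof -
  have "((\<lambda>y::c2. c * (1 / (y \<bullet> y))) has_derivative (\<lambda>h. - (2 * c * (y \<bullet> h) * (1 / (y \<bullet> y))\<^sup>2))) (at y)"
    using assms by (auto intro!: derivative_eq_intros simp: inner_commute power2_eq_square divide_simps)
  from has_derivative_scaleR[OF this has_derivative_ident] show ?thesis
    unfolding inversion_def[abs_def] by simp
qed

lemma inversion_pullback:
  fixes C :: real and y v w :: c2
  defines "N \<equiv> 1 / (y \<bullet> y)" and "D \<equiv> \<lambda>v. (sqrt C * (1 / (y \<bullet> y))) *\<^sub>R v - (2 * sqrt C * (y \<bullet> v) * (1 / (y \<bullet> y))\<^sup>2) *\<^sub>R y"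
  assumes C: "0 < C" and y: "y \<noteq> 0"
  shows "D v \<bullet> D w = C * N\<^sup>2 * (v \<bullet> w)"
    "met_minus C (inversion (sqrt C) y) (D v) (D w) = v \<bullet> w + C * (N * N) *
      ((2 - C * N) * ((1 / (1 - C * N)) * (1 / (1 - C * N))) * ((y \<bullet> v) * (y \<bullet> w))
       + (- 1) * ((2 - C * N) * ((imul y \<bullet> v) * (imul y \<bullet> w))))"
proof -
  define c where "c = sqrt C"
  have cc: "c * c = C" using C by (simp add: c_def)
  have Ny: "N * (y \<bullet> y) = 1" "N \<noteq> 0" using y by (auto simp: N_def)
  have D: "D v = (c * N) *\<^sub>R v - (2 * c * (y \<bullet> v) * N\<^sup>2) *\<^sub>R y" for v by (simp add: D_def c_def N_def)
  have P: "inversion (sqrt C) y = (c * N) *\<^sub>R y" by (simp add: inversion_def c_def N_def)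
  have r: "(c * N) *\<^sub>R y \<bullet> (c * N) *\<^sub>R y = C * N"
    using cc Ny by (simp add: inner_simps)
  have aux: "c * N * (c * N * t) - 2 * c * t * N\<^sup>2 * (c * N * Y) = - (C * N\<^sup>2 * t)"
    if "c * c = C" "N * Y = 1" for c N t Y C :: real
  proof -
    have "c * N * (c * N * t) - 2 * c * t * N\<^sup>2 * (c * N * Y) = (c * c) * N\<^sup>2 * t * (1 - 2 * (N * Y))"
      by (simp add: power2_eq_square algebra_simps)
    then show ?thesis unfolding that by simp
  qed
  have xd: "(c * N) *\<^sub>R y \<bullet> D v = - (C * N\<^sup>2 * (y \<bullet> v))" for v
    unfolding D using aux[OF cc Ny(1)] by (simp add: inner_diff_right)
  have id: "imul ((c * N) *\<^sub>R y) \<bullet> D v = C * N\<^sup>2 * (imul y \<bullet> v)" for v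
    unfolding D by (simp add: inner_diff_right power2_eq_square flip: cc)
  have aux2: "c * N * (c * N * V - 2 * c * t * N\<^sup>2 * u) - 2 * c * u * N\<^sup>2 * (c * N * t - 2 * c * t * N\<^sup>2 * Y) = C * N\<^sup>2 * V"
    if "c * c = C" "N * Y = 1" for c N t u V Y C :: real
  proof -
    have "c * N * (c * N * V - 2 * c * t * N\<^sup>2 * u) - 2 * c * u * N\<^sup>2 * (c * N * t - 2 * c * t * N\<^sup>2 * Y)
        = (c * c) * N\<^sup>2 * (V - 4 * N * t * u * (1 - N * Y))"
      by (simp add: power2_eq_square algebra_simps)
    then show ?thesis unfolding that by simp
  qed
  show dd: "D v \<bullet> D w = C * N\<^sup>2 * (v \<bullet> w)" for v w
    unfolding D using aux2[OF cc Ny(1)] by (simp add: inner_diff_right inner_diff_left inner_commute[of v y])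
  have "C / (C * N)\<^sup>2 * (C * N\<^sup>2 * V + X / (1 - C * N)\<^sup>2 * ((- (C * N\<^sup>2 * a)) * (- (C * N\<^sup>2 * b)))
      - X * ((C * N\<^sup>2 * a') * (C * N\<^sup>2 * b')))
    = V + C * (N * N) * (X * ((1 / (1 - C * N)) * (1 / (1 - C * N))) * (a * b) + (- 1) * (X * (a' * b')))"
    for V X a b a' b' :: real
    using C Ny(2) by (simp add: power2_eq_square field_simps)
  then show "met_minus C (inversion (sqrt C) y) (D v) (D w) = v \<bullet> w + C * (N * N) *
      ((2 - C * N) * ((1 / (1 - C * N)) * (1 / (1 - C * N))) * ((y \<bullet> v) * (y \<bullet> w))
       + (- 1) * ((2 - C * N) * ((imul y \<bullet> v) * (imul y \<bullet> w))))"
    unfolding met_def P r xd id dd .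
qed

lemma ale_end_minus:
  assumes C: "0 < C" and g: "\<And>x. x \<in> M0 \<Longrightarrow> g x = met_minus C x"
  shows "ale_end M0 g z_infinity_end"
proof -
  define c where "c = sqrt C"
  define R where "R = c * exp (1 / 2)"
  have c: "0 < c" "c * c = C" using C by (auto simp: c_def)
  have R: "0 < R" "C < R\<^sup>2"
  proof -
    show "0 < R" using c by (simp add: R_def)
    have "exp (1/2 :: real) * exp (1/2) = exp 1" by (simp flip: exp_add)
    then have "R\<^sup>2 = C * exp 1" using c(2) by (simp add: R_def power2_eq_square mult.left_commute mult.assoc[symmetric])
    then show "C < R\<^sup>2" using C by simp
  qed
  let ?U = "{y :: c2. R < norm y}"
  let ?P = "inversion c"
  have y0: "y \<noteq> 0" if "R < norm y" for y :: c2 using that R by auto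
  have nP: "norm (?P y) = c / norm y" if "y \<noteq> 0" for y
    using c(1) that by (simp add: inversion_def dot_square_norm power2_eq_square)
  have PP: "?P (?P y) = y" if "y \<noteq> 0" for y
    using c(1) that by (simp add: inversion_def field_simps)
  have E: "z_infinity_end 1 = annulus 0 (exp (- 1 / 2))" using z_infinity_end_eq[of 1] by simp
  have Re: "c / R = exp (- 1 / 2)"
  proof -
    have "R * exp (- 1 / 2) = c" by (simp add: R_def mult.assoc flip: exp_add)
    then have "c / R = R * exp (- 1 / 2) / R" by simp
    then show ?thesis using R(1) by simp
  qed
  have img1: "?P y \<in> annulus 0 (exp (- 1 / 2))" if y: "R < norm y" for y
  proof -
    have "0 < norm y" using y R(1) by linarith
    have "c / norm y < c / R" using \<open>0 < norm y\<close> y R c by (intro divide_strict_left_mono mult_pos_pos) auto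
    moreover have "0 < c / norm y" using c \<open>0 < norm y\<close> by simp
    ultimately show ?thesis unfolding annulus_def mem_Collect_eq nP[OF y0[OF y]] Re[symmetric] by blast
  qed
  have img2: "x \<in> ?P ` ?U" if x: "x \<in> annulus 0 (exp (- 1 / 2))" for x
  proof -
    have n: "0 < norm x" "norm x < c / R" using x by (auto simp: annulus_def Re)
    then have x0: "x \<noteq> 0" by auto
    have "R < norm (?P x)" using n R by (simp add: nP x0 field_simps)
    then show ?thesis using PP[OF x0] by (metis (mono_tags) image_eqI mem_Collect_eq)
  qed
  have inM: "?P y \<in> M0" if "R < norm y" for y
    using img1[OF that] z_infinity_end_eq[of 1] end_of_z_infinity E by (auto simp: end_of_def)
  have sm: "smooth_on ?U ?P"
    unfolding inversion_def[abs_def]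
    by (intro smooth_on_scaleR smooth_on_mult smooth_on_divide smooth_on_const smooth_on_inner smooth_on_ident
        open_outside) (use y0 in auto)
  note D = frechet_derivative_at[OF inversion_has_derivative, symmetric]
  have inj: "inj (frechet_derivative ?P (at y))" if y: "R < norm y" for y
  proof -
    have lin: "linear (frechet_derivative ?P (at y))"
      by (rule has_derivative_linear[OF smooth_on_has_derivative[OF open_outside sm]]) (use y in simp)
    show ?thesis
      unfolding linear_injective_0[OF lin]
    proof (intro allI impI)
      fix v assume "frechet_derivative ?P (at y) v = 0"
      then have "C * (1 / (y \<bullet> y))\<^sup>2 * (v \<bullet> v) = 0"
        using inversion_pullback(1)[OF C y0[OF y], of v v] unfolding D[OF y0[OF y]] c_def by simp
      then show "v = 0" using C y0[OF y] by simp
    qed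
  qed
  have decay: "\<exists>K. \<forall>y. R < norm y \<longrightarrow> \<bar>iter_deriv bs (\<lambda>y. g (?P y) (frechet_derivative ?P (at y) v)
      (frechet_derivative ?P (at y) w) - v \<bullet> w) y\<bar> \<le> K * norm y powr (- 2 - real (length bs))"
    if bs: "set bs \<subseteq> Basis" for v w bs
  proof -
    define f where "f y = C * ((1 / (y \<bullet> y)) * (1 / (y \<bullet> y)) *
      ((2 + (- 1) * (C * (1 / (y \<bullet> y)))) * ((1 / (1 - C * (1 / (y \<bullet> y)))) * (1 / (1 - C * (1 / (y \<bullet> y))))) * ((y \<bullet> v) * (y \<bullet> w))
       + (- 1) * ((2 + (- 1) * (C * (1 / (y \<bullet> y)))) * ((imul y \<bullet> v) * (imul y \<bullet> w)))))" for y :: c2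
    have "symb n R (- 2) f" for n
    proof -
      note N = symb_inverse_square[OF R(1), of n] and K = symb_pole[OF R C, of n]
      have q: "symb n R 0 (\<lambda>y. 2 + (- 1) * (C * (1 / (y \<bullet> y))))"
        by (intro symb_add symb_const[OF R(1)] symb_cmult[OF R(1)] symb_weaken[OF R(1) _ N]) simp
      have l: "symb n R 1 (\<lambda>y. y \<bullet> v)" "symb n R 1 (\<lambda>y. y \<bullet> w)" "symb n R 1 (\<lambda>y. imul y \<bullet> v)"
        "symb n R 1 (\<lambda>y. imul y \<bullet> w)"
        by (intro symb_linear[OF R(1)] bounded_linear_inner_left
            bounded_linear_compose[OF bounded_linear_inner_left bounded_linear_imul])+
      have "symb n R (- 2 + - 2 + 2) f"
        unfolding f_def[abs_def]
        by (intro symb_cmult[OF R(1)] symb_mult[OF symb_mult[OF N N]] symb_add)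
          (use symb_mult[OF symb_mult[OF q symb_mult[OF K K]] symb_mult[OF l(1,2)]]
            symb_mult[OF q symb_mult[OF l(3,4)]] in simp_all)
      then show ?thesis by simp
    qed
    from symb_iter_deriv[OF this bs] obtain K where
      K: "\<And>y. R < norm y \<Longrightarrow> \<bar>iter_deriv bs f y\<bar> \<le> K * norm y powr (- 2 - real (length bs))" by auto
    have "iter_deriv bs (\<lambda>y. g (?P y) (frechet_derivative ?P (at y) v)
      (frechet_derivative ?P (at y) w) - v \<bullet> w) y = iter_deriv bs f y" if "R < norm y" for y
    proof (rule iter_deriv_cong[OF open_outside])
      fix y :: c2 assume "y \<in> {y. R < norm y}"
      then have y: "R < norm y" by simp
      show "g (?P y) (frechet_derivative ?P (at y) v) (frechet_derivative ?P (at y) w) - v \<bullet> w = f y"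
        unfolding g[OF inM[OF y]] D[OF y0[OF y]] f_def
        using inversion_pullback(2)[OF C y0[OF y], of v w] by (simp add: c_def)
    qed (use that in simp)
    with K show ?thesis by (intro exI[of _ K]) simp
  qed
  show ?thesis
    unfolding ale_end_def
  proof (rule conjI[OF end_of_z_infinity], rule exI[of _ "{id}"], rule exI[of _ R], rule exI[of _ 2],
      rule exI[of _ ?P], rule exI[of _ 1], intro conjI)
    show "?P ` ?U = z_infinity_end 1" unfolding E using img1 img2 by blast
    show "\<forall>y. R < norm y \<longrightarrow> inj (frechet_derivative ?P (at y))" using inj by blast
    show "\<forall>y y'. R < norm y \<and> R < norm y' \<longrightarrow> (?P y = ?P y') = (\<exists>\<gamma>\<in>{id}. y' = \<gamma> y)"
      using PP y0 by (metis id_apply singletonD singletonI)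
    show "\<forall>K. compact K \<and> K \<subseteq> M0 \<longrightarrow> bounded {y. R < norm y \<and> ?P y \<in> K}"
    proof (intro allI impI)
      fix K assume "compact K \<and> K \<subseteq> M0"
      then obtain a where a: "0 < a" "\<And>x. x \<in> K \<Longrightarrow> a \<le> norm x" using compact_M0_bound by metis
      have "norm y \<le> c / a" if "y \<in> {y. R < norm y \<and> ?P y \<in> K}" for y
      proof -
        have y: "R < norm y" "?P y \<in> K" using that by auto
        have "0 < norm y" using y(1) R(1) by linarith
        moreover have "a \<le> c / norm y" using a(2)[OF y(2)] unfolding nP[OF y0[OF y(1)]] .
        ultimately have "a * norm y \<le> c" by (simp add: pos_le_divide_eq)
        then show ?thesis using a(1) by (simp add: pos_le_divide_eq mult.commute)
      qed
      then show "bounded {y. R < norm y \<and> ?P y \<in> K}" by (rule boundedI)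
    qed
    show "\<forall>v w bs. set bs \<subseteq> Basis \<longrightarrow> (\<exists>K. \<forall>y. R < norm y \<longrightarrow>
        \<bar>iter_deriv bs (\<lambda>y. g (?P y) (frechet_derivative ?P (at y) v) (frechet_derivative ?P (at y) w) - v \<bullet> w) y\<bar>
        \<le> K * norm y powr (- 2 - real (length bs)))" using decay by blast
  qed (use R sm in \<open>auto simp: orthogonal_transformation_def id_def linear_id[unfolded id_def]\<close>)
qed

section \<open>The cusp\<close>

text \<open>The Hopf map and the coframe in which the metrics have bounded geometry.  The three forms
  \<open>2 (H j x \<bullet> v)\<close> are the differentials of the quadratic functions \<open>hopf j\<close>; they are redundant but,
  unlike the horizontal forms dual to \<^const>\<open>E2\<close> and \<^const>\<open>E3\<close>, invariant under the Hopf action.\<close>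

definition H :: "nat \<Rightarrow> c2 \<Rightarrow> c2" where
  "H j x = (if j = 0 then (snd x, fst x) else if j = 1 then (- \<i> * snd x, \<i> * fst x) else (fst x, - snd x))"

definition hopf :: "nat \<Rightarrow> c2 \<Rightarrow> real" where "hopf j x = x \<bullet> H j x"

definition theta :: "nat \<Rightarrow> c2 \<Rightarrow> c2 \<Rightarrow> real" where
  "theta i x v = (if i = 0 then (x \<bullet> v) / (1 - x \<bullet> x) else if i = 1 then (1 - x \<bullet> x) * (imul x \<bullet> v)
     else 2 * (H (i - 2) x \<bullet> v))"

lemma theta_simps:
  "theta 0 x v = (x \<bullet> v) / (1 - x \<bullet> x)" "theta 1 x v = (1 - x \<bullet> x) * (imul x \<bullet> v)"
  "theta (Suc 0) x v = (1 - x \<bullet> x) * (imul x \<bullet> v)"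
  "theta 2 x v = 2 * (H 0 x \<bullet> v)" "theta 3 x v = 2 * (H 1 x \<bullet> v)" "theta 4 x v = 2 * (H 2 x \<bullet> v)"
  by (simp_all add: theta_def)

lemmas hopf_coords = hopf_def H_def inner_c2 imul_def

lemma H_linear: "bounded_linear (H j)"
  by (auto intro!: linear_conv_bounded_linear[THEN iffD1] linearI
      simp: H_def algebra_simps scaleR_conv_of_real)

lemma H_sym: "H j x \<bullet> y = x \<bullet> H j y"
  by (simp add: H_def inner_c2)

lemma H_imul: "H j (imul x) = imul (H j x)"
  by (simp add: H_def imul_def prod_eq_iff)

lemma hopf_sq: "(hopf 0 x)\<^sup>2 + (hopf 1 x)\<^sup>2 + (hopf 2 x)\<^sup>2 = (x \<bullet> x)\<^sup>2"
  unfolding hopf_coords by (simp add: power2_eq_square algebra_simps)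

lemma hopf_identity_metric:
  "(x \<bullet> x) * (v \<bullet> w) = (imul x \<bullet> v) * (imul x \<bullet> w)
    + (H 0 x \<bullet> v) * (H 0 x \<bullet> w) + (H 1 x \<bullet> v) * (H 1 x \<bullet> w) + (H 2 x \<bullet> v) * (H 2 x \<bullet> w)"
  unfolding hopf_coords by (simp add: algebra_simps)

lemma hopf_identity_imul:
  "(x \<bullet> x) * (H 0 (imul x) \<bullet> w) = hopf 0 x * (imul x \<bullet> w) + hopf 2 x * (H 1 x \<bullet> w) - hopf 1 x * (H 2 x \<bullet> w)"
  "(x \<bullet> x) * (H 1 (imul x) \<bullet> w) = hopf 1 x * (imul x \<bullet> w) + hopf 0 x * (H 2 x \<bullet> w) - hopf 2 x * (H 0 x \<bullet> w)"
  "(x \<bullet> x) * (H 2 (imul x) \<bullet> w) = hopf 2 x * (imul x \<bullet> w) + hopf 1 x * (H 0 x \<bullet> w) - hopf 0 x * (H 1 x \<bullet> w)"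
  unfolding hopf_coords by (simp_all add: algebra_simps)

lemma hopf_identity_hessian:
  "(x \<bullet> x) * (H j v \<bullet> w) = (x \<bullet> v) * (H j x \<bullet> w) + (x \<bullet> w) * (H j x \<bullet> v)
    + (imul x \<bullet> v) * (H j (imul x) \<bullet> w) + (imul x \<bullet> w) * (H j (imul x) \<bullet> v) - hopf j x * (v \<bullet> w)"
  unfolding hopf_coords by (auto simp: algebra_simps)

lemma hopf_identity_symplectic:
  "(x \<bullet> x)\<^sup>2 * (imul v \<bullet> w) = (x \<bullet> x) * ((x \<bullet> v) * (imul x \<bullet> w) - (imul x \<bullet> v) * (x \<bullet> w))
    + hopf 2 x * ((H 0 x \<bullet> v) * (H 1 x \<bullet> w) - (H 1 x \<bullet> v) * (H 0 x \<bullet> w))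
    + hopf 0 x * ((H 1 x \<bullet> v) * (H 2 x \<bullet> w) - (H 2 x \<bullet> v) * (H 1 x \<bullet> w))
    + hopf 1 x * ((H 2 x \<bullet> v) * (H 0 x \<bullet> w) - (H 0 x \<bullet> v) * (H 2 x \<bullet> w))"
proof -
  obtain x1 x2 x3 x4 v1 v2 v3 v4 w1 w2 w3 w4 where
    e: "x = (Complex x1 x2, Complex x3 x4)" "v = (Complex v1 v2, Complex v3 v4)"
      "w = (Complex w1 w2, Complex w3 w4)"
    by (metis complex.exhaust surj_pair)
  show ?thesis unfolding hopf_coords e by simp algebra
qed

lemma met_theta:
  assumes x: "x \<in> M0"
  shows "met a x v w = a (x \<bullet> x) / (x \<bullet> x) * ((theta 2 x v * theta 2 x w + theta 3 x v * theta 3 x w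
    + theta 4 x v * theta 4 x w) / 4 + (x \<bullet> x) * (2 - x \<bullet> x) * (theta 0 x v * theta 0 x w)
    + theta 1 x v * theta 1 x w)"
proof -
  define r where "r = x \<bullet> x"
  have r: "r \<noteq> 0" "1 - r \<noteq> 0" using x by (auto simp: r_def M0_iff)
  have vw: "v \<bullet> w = ((imul x \<bullet> v) * (imul x \<bullet> w)
    + (H 0 x \<bullet> v) * (H 0 x \<bullet> w) + (H 1 x \<bullet> v) * (H 1 x \<bullet> w) + (H 2 x \<bullet> v) * (H 2 x \<bullet> w)) / r"
    using hopf_identity_metric[of x v w] r(1) by (simp add: r_def field_simps)
  have key: "A * ((b * b' + p1 * q1 + p2 * q2 + p3 * q3) / r + (2 - r) / (1 - r)\<^sup>2 * (X * Y) - (2 - r) * (b * b'))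
      = A / r * ((2 * p1 * (2 * q1) + 2 * p2 * (2 * q2) + 2 * p3 * (2 * q3)) / 4
        + r * (2 - r) * (X / (1 - r) * (Y / (1 - r))) + (1 - r) * b * ((1 - r) * b'))"
    for A b b' p1 q1 p2 q2 p3 q3 X Y :: real
  proof -
    define s where "s = 1 - r"
    have s: "r = 1 - s" "s \<noteq> 0" "1 - s \<noteq> 0" using r by (auto simp: s_def)
    show ?thesis unfolding s(1) using s(2,3) by (simp add: divide_simps) (simp add: algebra_simps power2_eq_square)
  qed
  show ?thesis
    unfolding met_def theta_simps r_def[symmetric] vw by (rule key)
qed

subsection \<open>Functions with bounded derivatives of all orders\<close>

text \<open>The charts of the two-sphere are \<open>fst x \<noteq> 0\<close> (\<open>e = 1\<close>) and \<open>snd x \<noteq> 0\<close> (\<open>e = -1\<close>); the algebra is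
  generated by invariant functions and is closed under differentiation in the sense of \<open>alg_derivative\<close>.\<close>

inductive alg :: "real \<Rightarrow> (c2 \<Rightarrow> real) \<Rightarrow> bool" for e where
  const: "alg e (\<lambda>x. c)"
| rho: "alg e (\<lambda>x. x \<bullet> x)"
| inv_rho: "alg e (\<lambda>x. 1 / (x \<bullet> x))"
| hopf: "alg e (\<lambda>x. hopf j x)"
| chart: "alg e (\<lambda>x. 1 / (x \<bullet> x + e * hopf 2 x))"
| add: "alg e f \<Longrightarrow> alg e g \<Longrightarrow> alg e (\<lambda>x. f x + g x)"
| mult: "alg e f \<Longrightarrow> alg e g \<Longrightarrow> alg e (\<lambda>x. f x * g x)"

definition cusp_chart :: "real \<Rightarrow> c2 set" where
  "cusp_chart e = {x. exp (- 1 / 2) < norm x \<and> norm x < 1 \<and> (x \<bullet> x) / 2 < x \<bullet> x + e * hopf 2 x}"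

lemma alg_minus: "alg e f \<Longrightarrow> alg e (\<lambda>x. - f x)"
  using alg.mult[OF alg.const[of e "- 1"], of f] by simp

lemma alg_diff: "alg e f \<Longrightarrow> alg e g \<Longrightarrow> alg e (\<lambda>x. f x - g x)"
  using alg.add[OF _ alg_minus, of e f g] by simp

lemmas alg_intros = alg.intros alg_minus alg_diff

lemma cusp_chartD:
  assumes "x \<in> cusp_chart e"
  shows "x \<in> M0" "exp (- 1) < x \<bullet> x" "0 < x \<bullet> x" "x \<bullet> x < 1" "x \<bullet> x / 2 < x \<bullet> x + e * hopf 2 x"
    "0 < x \<bullet> x + e * hopf 2 x"
proof -
  have n: "exp (- 1 / 2) < norm x" "norm x < 1" "x \<bullet> x / 2 < x \<bullet> x + e * hopf 2 x"
    using assms by (auto simp: cusp_chart_def)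
  have "0 < exp (- 1 / 2 :: real)" by simp
  then have n0: "0 < norm x" using n(1) by linarith
  have "exp (- 1 / 2 :: real) * exp (- 1 / 2) = exp (- 1)" by (simp flip: exp_add)
  then show e: "exp (- 1) < x \<bullet> x"
    using mult_strict_mono[OF n(1) n(1)] n0 by (simp add: dot_square_norm power2_eq_square)
  show "0 < x \<bullet> x" "x \<bullet> x < 1" "x \<in> M0" "x \<bullet> x / 2 < x \<bullet> x + e * hopf 2 x"
    using n n0 by (auto simp: M0_iff dot_square_norm power_less_one_iff abs_square_less_1)
  then show "0 < x \<bullet> x + e * hopf 2 x" by linarith
qed

lemma continuous_on_hopf: "continuous_on S (hopf j)"
  unfolding hopf_def[abs_def]
  by (intro continuous_intros bounded_linear.continuous_on[OF H_linear])

lemma open_cusp_chart: "open (cusp_chart e)"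
  unfolding cusp_chart_def
  by (intro open_Collect_conj open_Collect_less continuous_intros continuous_on_hopf) auto

lemma hopf_bound: "\<bar>hopf j x\<bar> \<le> x \<bullet> x"
proof -
  have "(hopf j x)\<^sup>2 \<le> (x \<bullet> x)\<^sup>2"
  proof -
    have "hopf j x = hopf 0 x \<or> hopf j x = hopf 1 x \<or> hopf j x = hopf 2 x" by (auto simp: hopf_def H_def)
    then have "(hopf j x)\<^sup>2 \<le> (hopf 0 x)\<^sup>2 + (hopf 1 x)\<^sup>2 + (hopf 2 x)\<^sup>2" by (elim disjE) auto
    then show ?thesis unfolding hopf_sq .
  qed
  then show ?thesis using abs_le_square_iff[of "hopf j x" "x \<bullet> x"] by simp
qed

lemma alg_bounded:
  assumes "alg e f" shows "\<exists>C. \<forall>x\<in>cusp_chart e. \<bar>f x\<bar> \<le> C"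
  using assms
proof induction
  case rho
  then show ?case using cusp_chartD(3,4) by (intro exI[of _ 1]) (simp add: less_imp_le)
next
  case inv_rho
  have "\<bar>1 / (x \<bullet> x)\<bar> \<le> 1 / exp (- 1)" if "x \<in> cusp_chart e" for x
  proof -
    have "1 / (x \<bullet> x) \<le> 1 / exp (- 1)" using cusp_chartD(2,3)[OF that] by (intro frac_le) auto
    then show ?thesis using cusp_chartD(3)[OF that] by (simp only: abs_of_pos zero_less_divide_1_iff)
  qed
  then show ?case by blast
next
  case (hopf j)
  have "\<bar>hopf j x\<bar> \<le> 1" if "x \<in> cusp_chart e" for x
    using hopf_bound[of j x] cusp_chartD(4)[OF that] by linarith
  then show ?case by blast
next
  case chart
  have "\<bar>1 / (x \<bullet> x + e * hopf 2 x)\<bar> \<le> 1 / (exp (- 1) / 2)" if "x \<in> cusp_chart e" for x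
  proof -
    have "exp (- 1) / 2 \<le> x \<bullet> x + e * hopf 2 x" using cusp_chartD(2,5)[OF that] by linarith
    then have "1 / (x \<bullet> x + e * hopf 2 x) \<le> 1 / (exp (- 1) / 2)" by (intro frac_le) auto
    then show ?thesis using cusp_chartD(6)[OF that] by (simp only: abs_of_pos zero_less_divide_1_iff)
  qed
  then show ?case by blast
next
  case (add f g)
  then obtain C D where "\<forall>x\<in>cusp_chart e. \<bar>f x\<bar> \<le> C" "\<forall>x\<in>cusp_chart e. \<bar>g x\<bar> \<le> D" by blast
  then have "\<bar>f x + g x\<bar> \<le> C + D" if "x \<in> cusp_chart e" for x
    using that abs_triangle_ineq[of "f x" "g x"] by fastforce
  then show ?case by blast
next
  case (mult f g)
  then obtain C D where CD: "\<forall>x\<in>cusp_chart e. \<bar>f x\<bar> \<le> C" "\<forall>x\<in>cusp_chart e. \<bar>g x\<bar> \<le> D" by blast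
  have "\<bar>f x * g x\<bar> \<le> C * D" if "x \<in> cusp_chart e" for x
    unfolding abs_mult using CD that by (intro mult_mono) (auto intro: order_trans[OF abs_ge_zero])
  then show ?case by blast
qed auto

text \<open>Covariant one-forms and two-tensors with coefficients in the algebra.\<close>

definition lin_form :: "real \<Rightarrow> (c2 \<Rightarrow> c2 \<Rightarrow> real) \<Rightarrow> bool" where
  "lin_form e D \<longleftrightarrow> (\<exists>c. (\<forall>j. alg e (c j)) \<and> (\<forall>x\<in>cusp_chart e. \<forall>v. D x v = (\<Sum>j<5. c j x * theta j x v)))"

definition bil_form :: "real \<Rightarrow> (c2 \<Rightarrow> c2 \<Rightarrow> c2 \<Rightarrow> real) \<Rightarrow> bool" where
  "bil_form e B \<longleftrightarrow> (\<exists>c. (\<forall>j l. alg e (c j l)) \<and>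
     (\<forall>x\<in>cusp_chart e. \<forall>v w. B x v w = (\<Sum>j<5. \<Sum>l<5. c j l x * (theta j x v * theta l x w))))"

lemma lin_form_basic:
  assumes "i < 5" "alg e f" shows "lin_form e (\<lambda>x v. f x * theta i x v)"
  unfolding lin_form_def
proof (intro exI[of _ "\<lambda>j. if j = i then f else (\<lambda>x. 0)"] conjI allI ballI)
  show "alg e (if j = i then f else (\<lambda>x. 0))" for j using assms(2) by (auto intro: alg.const)
  show "f x * theta i x v = (\<Sum>j<5. (if j = i then f else (\<lambda>x. 0)) x * theta j x v)" for x v
  proof -
    have "(\<Sum>j<5. (if j = i then f else (\<lambda>x. 0)) x * theta j x v) = (\<Sum>j<5. if j = i then f x * theta i x v else 0)"
      by (rule sum.cong) auto
    then show ?thesis using assms(1) by simp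
  qed
qed

lemma lin_form_add:
  assumes "lin_form e D" "lin_form e D'" shows "lin_form e (\<lambda>x v. D x v + D' x v)"
proof -
  obtain c c' where "\<forall>j. alg e (c j)" "\<forall>x\<in>cusp_chart e. \<forall>v. D x v = (\<Sum>j<5. c j x * theta j x v)"
    "\<forall>j. alg e (c' j)" "\<forall>x\<in>cusp_chart e. \<forall>v. D' x v = (\<Sum>j<5. c' j x * theta j x v)"
    using assms unfolding lin_form_def by blast
  then show ?thesis
    unfolding lin_form_def
    by (intro exI[of _ "\<lambda>j x. c j x + c' j x"]) (auto intro: alg.add simp: distrib_right sum.distrib)
qed

lemma lin_form_mult:
  assumes "lin_form e D" "alg e f" shows "lin_form e (\<lambda>x v. f x * D x v)"
proof -
  obtain c where "\<forall>j. alg e (c j)" "\<forall>x\<in>cusp_chart e. \<forall>v. D x v = (\<Sum>j<5. c j x * theta j x v)"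
    using assms unfolding lin_form_def by blast
  then show ?thesis
    unfolding lin_form_def using assms(2)
    by (intro exI[of _ "\<lambda>j x. f x * c j x"]) (auto intro: alg.mult simp: sum_distrib_left mult.assoc)
qed

lemma bil_form_basic:
  assumes "i < 5" "k < 5" "alg e f" shows "bil_form e (\<lambda>x v w. f x * (theta i x v * theta k x w))"
  unfolding bil_form_def
proof (intro exI[of _ "\<lambda>j l. if j = i then (if l = k then f else (\<lambda>x. 0)) else (\<lambda>x. 0)"] conjI allI ballI)
  show "alg e (if j = i then (if l = k then f else (\<lambda>x. 0)) else (\<lambda>x. 0))" for j l
    using assms(3) by (auto intro: alg.const)
  show "f x * (theta i x v * theta k x w) = (\<Sum>j<5. \<Sum>l<5.
      (if j = i then (if l = k then f else (\<lambda>x. 0)) else (\<lambda>x. 0)) x * (theta j x v * theta l x w))" for x v w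
  proof -
    have "(\<Sum>l<5. (if j = i then (if l = k then f else (\<lambda>x. 0)) else (\<lambda>x. 0)) x * (theta j x v * theta l x w))
        = (if j = i then f x * (theta i x v * theta k x w) else 0)" for j
    proof -
      have "(\<Sum>l<5. (if j = i then (if l = k then f else (\<lambda>x. 0)) else (\<lambda>x. 0)) x * (theta j x v * theta l x w))
        = (\<Sum>l<5. if l = k then (if j = i then f x * (theta i x v * theta k x w) else 0) else 0)"
        by (rule sum.cong) auto
      then show ?thesis using assms(2) by simp
    qed
    then show ?thesis using assms(1) by simp
  qed
qed

lemma bil_form_add:
  assumes "bil_form e D" "bil_form e D'" shows "bil_form e (\<lambda>x v w. D x v w + D' x v w)"
proof -
  obtain c c' where "\<forall>j l. alg e (c j l)" "\<forall>x\<in>cusp_chart e. \<forall>v w. D x v w = (\<Sum>j<5. \<Sum>l<5. c j l x * (theta j x v * theta l x w))"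
    "\<forall>j l. alg e (c' j l)" "\<forall>x\<in>cusp_chart e. \<forall>v w. D' x v w = (\<Sum>j<5. \<Sum>l<5. c' j l x * (theta j x v * theta l x w))"
    using assms unfolding bil_form_def by blast
  then show ?thesis
    unfolding bil_form_def
    by (intro exI[of _ "\<lambda>j l x. c j l x + c' j l x"]) (auto intro: alg.add simp: distrib_right sum.distrib)
qed

lemma hopf_has_derivative: "(hopf j has_derivative (\<lambda>v. 2 * (H j x \<bullet> v))) (at x)"
proof -
  have "((\<lambda>y. y \<bullet> H j y) has_derivative (\<lambda>v. x \<bullet> H j v + v \<bullet> H j x)) (at x)"
    by (rule has_derivative_inner[OF has_derivative_ident bounded_linear_imp_has_derivative[OF H_linear]])
  then show ?thesis
    unfolding hopf_def[abs_def]
    by (rule has_derivative_eq_rhs) (simp add: fun_eq_iff inner_commute[of _ "H j x"] H_sym)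
qed

lemma inner_self_has_derivative: "((\<lambda>y::c2. y \<bullet> y) has_derivative (\<lambda>v. 2 * (x \<bullet> v))) (at x)"
  by (rule has_derivative_eq_rhs, rule has_derivative_inner[OF has_derivative_ident has_derivative_ident])
    (simp add: fun_eq_iff inner_commute[of _ x])

lemma hopf_theta:
  obtains i where "i < 5" "\<And>x v. 2 * (H j x \<bullet> v) = theta i x v"
proof -
  consider "j = 0" | "j = 1" | "j \<noteq> 0 \<and> j \<noteq> 1" by blast
  then show ?thesis
  proof cases
    case 3
    then have "2 * (H j x \<bullet> v) = theta 4 x v" for x v by (simp add: theta_simps H_def)
    then show ?thesis by (intro that[of 4]) auto
  qed (use that[of 2] that[of 3] in \<open>auto simp: theta_simps\<close>)
qed

lemma alg_derivative:
  assumes "alg e f"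
  shows "\<exists>D. lin_form e D \<and> (\<forall>x\<in>cusp_chart e. (f has_derivative D x) (at x))"
  using assms
proof induction
  case (const c)
  then show ?case using lin_form_basic[of 0 e "\<lambda>x. 0"] by (intro exI[of _ "\<lambda>x v. 0"]) (auto intro: alg.const)
next
  case rho
  have "lin_form e (\<lambda>x v. (2 * (1 - x \<bullet> x)) * theta 0 x v)"
    by (intro lin_form_basic alg_intros) auto
  moreover have "((\<lambda>x. x \<bullet> x) has_derivative (\<lambda>v. (2 * (1 - x \<bullet> x)) * theta 0 x v)) (at x)" if "x \<in> cusp_chart e" for x
    using cusp_chartD(4)[OF that]
    by (intro has_derivative_eq_rhs[OF inner_self_has_derivative])
      (auto simp: fun_eq_iff theta_simps field_simps simp del: split_paired_All)
  ultimately show ?case by blast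
next
  case inv_rho
  have "lin_form e (\<lambda>x v. (- (2 * (1 - x \<bullet> x)) * ((1 / (x \<bullet> x)) * (1 / (x \<bullet> x)))) * theta 0 x v)"
    by (intro lin_form_basic alg_intros) auto
  moreover have "((\<lambda>x. 1 / (x \<bullet> x)) has_derivative
      (\<lambda>v. (- (2 * (1 - x \<bullet> x)) * ((1 / (x \<bullet> x)) * (1 / (x \<bullet> x)))) * theta 0 x v)) (at x)" if "x \<in> cusp_chart e" for x
    using cusp_chartD(3,4)[OF that]
    by (intro has_derivative_eq_rhs[OF has_derivative_divide[OF has_derivative_const inner_self_has_derivative]])
      (auto simp: fun_eq_iff theta_simps field_simps power2_eq_square simp del: split_paired_All)
  ultimately show ?case by blast
next
  case (hopf j)
  obtain i where i: "i < 5" "\<And>x v. 2 * (H j x \<bullet> v) = theta i x v" using hopf_theta by blast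
  have "lin_form e (\<lambda>x v. 1 * theta i x v)" using i by (intro lin_form_basic alg_intros)
  moreover have "((\<lambda>x. hopf j x) has_derivative (\<lambda>v. 1 * theta i x v)) (at x)" for x
    using hopf_has_derivative[of j x] i by simp
  ultimately show ?case by blast
next
  case chart
  let ?q = "\<lambda>x. 1 / (x \<bullet> x + e * hopf 2 x)"
  have "lin_form e (\<lambda>x v. (- (?q x * ?q x) * (2 * (1 - x \<bullet> x))) * theta 0 x v + (- (?q x * ?q x) * e) * theta 4 x v)"
    by (intro lin_form_add lin_form_basic alg_intros) auto
  moreover have "(?q has_derivative (\<lambda>v. (- (?q x * ?q x) * (2 * (1 - x \<bullet> x))) * theta 0 x v
      + (- (?q x * ?q x) * e) * theta 4 x v)) (at x)" if x: "x \<in> cusp_chart e" for x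
  proof -
    have d: "((\<lambda>y. y \<bullet> y + e * hopf 2 y) has_derivative (\<lambda>v. 2 * (x \<bullet> v) + e * (2 * (H 2 x \<bullet> v)))) (at x)"
      by (auto intro!: derivative_eq_intros hopf_has_derivative simp: inner_commute)
    show ?thesis
    proof (rule has_derivative_eq_rhs[OF has_derivative_divide[OF has_derivative_const d]])
      show "x \<bullet> x + e * hopf 2 x \<noteq> 0" using cusp_chartD(6)[OF x] by simp
      have "- 1 * (inverse (x \<bullet> x + e * hopf 2 x) * (2 * (x \<bullet> v) + e * (2 * (H 2 x \<bullet> v))) * inverse (x \<bullet> x + e * hopf 2 x))
          + 0 / (x \<bullet> x + e * hopf 2 x) = - (?q x * ?q x) * (2 * (1 - x \<bullet> x)) * theta 0 x v + - (?q x * ?q x) * e * theta 4 x v" for v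
      proof -
        have "- (?q x * ?q x) * (2 * (1 - x \<bullet> x)) * theta 0 x v = - (?q x * ?q x) * (2 * (x \<bullet> v))"
        proof -
          have "(1 - x \<bullet> x) * theta 0 x v = x \<bullet> v" using cusp_chartD(4)[OF x] by (simp add: theta_simps(1))
          then show ?thesis by (simp only: mult.assoc)
        qed
        then show ?thesis by (simp add: theta_simps(6) divide_inverse algebra_simps)
      qed
      then show "(\<lambda>v. - 1 * (inverse (x \<bullet> x + e * hopf 2 x) * (2 * (x \<bullet> v) + e * (2 * (H 2 x \<bullet> v))) * inverse (x \<bullet> x + e * hopf 2 x))
          + 0 / (x \<bullet> x + e * hopf 2 x)) = (\<lambda>v. - (?q x * ?q x) * (2 * (1 - x \<bullet> x)) * theta 0 x v + - (?q x * ?q x) * e * theta 4 x v)"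
        by blast
    qed
  qed
  ultimately show ?case by blast
next
  case (add f g)
  then obtain D D' where "lin_form e D" "lin_form e D'" "\<forall>x\<in>cusp_chart e. (f has_derivative D x) (at x)"
    "\<forall>x\<in>cusp_chart e. (g has_derivative D' x) (at x)" by blast
  then show ?case
    by (intro exI[of _ "\<lambda>x v. D x v + D' x v"]) (auto intro: lin_form_add has_derivative_add)
next
  case (mult f g)
  then obtain D D' where D: "lin_form e D" "lin_form e D'" "\<forall>x\<in>cusp_chart e. (f has_derivative D x) (at x)"
    "\<forall>x\<in>cusp_chart e. (g has_derivative D' x) (at x)" by blast
  have "lin_form e (\<lambda>x v. f x * D' x v + g x * D x v)"
    using D mult.hyps by (intro lin_form_add lin_form_mult)
  moreover have "((\<lambda>x. f x * g x) has_derivative (\<lambda>v. f x * D' x v + g x * D x v)) (at x)"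
    if "x \<in> cusp_chart e" for x
    using has_derivative_mult[of f "D x" x UNIV g "D' x"] D(3,4) that by (simp add: mult.commute)
  ultimately show ?case by blast
qed


subsection \<open>Covariant derivatives\<close>

lemma inner_conn:
  "x \<bullet> conn c1 c2 c3 c4 c5 c6 x v w = c1 (x \<bullet> x) * (2 * ((x \<bullet> v) * (x \<bullet> w)))
    + (c2 (x \<bullet> x) * (v \<bullet> w) + c3 (x \<bullet> x) * ((x \<bullet> v) * (x \<bullet> w)) + c4 (x \<bullet> x) * ((imul x \<bullet> v) * (imul x \<bullet> w))) * (x \<bullet> x)
    - 2 * c6 (x \<bullet> x) * ((imul x \<bullet> v) * (imul x \<bullet> w))"
  "imul x \<bullet> conn c1 c2 c3 c4 c5 c6 x v w = (c1 (x \<bullet> x) + c5 (x \<bullet> x) * (x \<bullet> x) + c6 (x \<bullet> x))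
    * ((x \<bullet> v) * (imul x \<bullet> w) + (x \<bullet> w) * (imul x \<bullet> v))"
  "H j x \<bullet> conn c1 c2 c3 c4 c5 c6 x v w = c1 (x \<bullet> x) * ((x \<bullet> v) * (H j x \<bullet> w) + (x \<bullet> w) * (H j x \<bullet> v))
    + (c2 (x \<bullet> x) * (v \<bullet> w) + c3 (x \<bullet> x) * ((x \<bullet> v) * (x \<bullet> w)) + c4 (x \<bullet> x) * ((imul x \<bullet> v) * (imul x \<bullet> w))) * hopf j x
    - c6 (x \<bullet> x) * ((imul x \<bullet> w) * (H j (imul x) \<bullet> v) + (imul x \<bullet> v) * (H j (imul x) \<bullet> w))"
proof -
  have h: "H j x \<bullet> x = hopf j x" "H j x \<bullet> imul x = 0" "H j x \<bullet> imul u = - (H j (imul x) \<bullet> u)" for u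
    by (simp_all add: hopf_def inner_commute[of "H j x" x] inner_imul_right[of "H j x"] H_imul)
      (simp add: H_def imul_def inner_c2)
  have h': "H j (imul x) \<bullet> x = 0" by (simp add: H_def imul_def inner_c2)
  show "x \<bullet> conn c1 c2 c3 c4 c5 c6 x v w = c1 (x \<bullet> x) * (2 * ((x \<bullet> v) * (x \<bullet> w)))
    + (c2 (x \<bullet> x) * (v \<bullet> w) + c3 (x \<bullet> x) * ((x \<bullet> v) * (x \<bullet> w)) + c4 (x \<bullet> x) * ((imul x \<bullet> v) * (imul x \<bullet> w))) * (x \<bullet> x)
    - 2 * c6 (x \<bullet> x) * ((imul x \<bullet> v) * (imul x \<bullet> w))"
    unfolding conn_def inner_add_right inner_scaleR_right inner_imul_right[of x] inner_imul
    by (simp add: algebra_simps)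
  show "imul x \<bullet> conn c1 c2 c3 c4 c5 c6 x v w = (c1 (x \<bullet> x) + c5 (x \<bullet> x) * (x \<bullet> x) + c6 (x \<bullet> x))
    * ((x \<bullet> v) * (imul x \<bullet> w) + (x \<bullet> w) * (imul x \<bullet> v))"
    unfolding conn_def inner_add_right inner_scaleR_right inner_imul
    by (simp add: algebra_simps)
  show "H j x \<bullet> conn c1 c2 c3 c4 c5 c6 x v w = c1 (x \<bullet> x) * ((x \<bullet> v) * (H j x \<bullet> w) + (x \<bullet> w) * (H j x \<bullet> v))
    + (c2 (x \<bullet> x) * (v \<bullet> w) + c3 (x \<bullet> x) * ((x \<bullet> v) * (x \<bullet> w)) + c4 (x \<bullet> x) * ((imul x \<bullet> v) * (imul x \<bullet> w))) * hopf j x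
    - c6 (x \<bullet> x) * ((imul x \<bullet> w) * (H j (imul x) \<bullet> v) + (imul x \<bullet> v) * (H j (imul x) \<bullet> w))"
    unfolding conn_def inner_add_right inner_scaleR_right h h'
    by (simp add: algebra_simps)
qed

lemma theta_hopf: "theta (j + 2) x v = 2 * (H j x \<bullet> v)"
  by (simp add: theta_def)

text \<open>The covariant derivative of \<open>theta i\<close> has coefficients in the algebra, so that nothing becomes unbounded
  towards the cusp.\<close>

definition nabla_ok :: "real \<Rightarrow> (real \<Rightarrow> real) \<Rightarrow> nat \<Rightarrow> bool" where
  "nabla_ok e k i \<longleftrightarrow> (\<exists>B. bil_form e B \<and> (\<forall>x\<in>cusp_chart e. \<forall>w. \<exists>D. ((\<lambda>y. theta i y w) has_derivative D) (at x) \<and>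
     (\<forall>v. D v - theta i x (met_conn k x v w) = B x v w)))"

lemma inner_theta:
  assumes "x \<in> M0"
  shows "v \<bullet> w = ((imul x \<bullet> v) * (imul x \<bullet> w)
    + ((H 0 x \<bullet> v) * (H 0 x \<bullet> w) + (H 1 x \<bullet> v) * (H 1 x \<bullet> w) + (H 2 x \<bullet> v) * (H 2 x \<bullet> w))) / (x \<bullet> x)"
  using hopf_identity_metric[of x v w] M0_pos[OF assms] by (simp add: field_simps)

text \<open>In the next three lemmas the terms with a negative power of \<open>1 - x \<bullet> x\<close> cancel, because
  \<open>1 - r * (2 - r) = (1 - r)\<^sup>2\<close>.\<close>

lemma nabla_theta_0: "nabla_ok e (\<lambda>r. - m * (1 / r)) 0"
  unfolding nabla_ok_def
proof (intro exI conjI ballI allI)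
  let ?B = "\<lambda>x v w. ((1 - x \<bullet> x) * (1 - m) * (1 / (x \<bullet> x)) * (1 / 4)) * (theta 2 x v * theta 2 x w)
    + ((1 - x \<bullet> x) * (1 - m) * (1 / (x \<bullet> x)) * (1 / 4)) * (theta 3 x v * theta 3 x w)
    + ((1 - x \<bullet> x) * (1 - m) * (1 / (x \<bullet> x)) * (1 / 4)) * (theta 4 x v * theta 4 x w)
    + (((3 - m) * (1 - x \<bullet> x) - 2) * (1 / (x \<bullet> x))) * (theta 1 x v * theta 1 x w)
    + ((1 - x \<bullet> x) * (2 + 2 * m * (1 / (x \<bullet> x)) - x \<bullet> x - m * (2 - x \<bullet> x))) * (theta 0 x v * theta 0 x w)"
  show "bil_form e ?B" by (intro bil_form_add bil_form_basic alg_intros) auto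
  fix x w assume x: "x \<in> cusp_chart e"
  let ?D = "\<lambda>v. - (x \<bullet> w) * (inverse (1 - x \<bullet> x) * (0 - 2 * (x \<bullet> v)) * inverse (1 - x \<bullet> x)) + (v \<bullet> w) / (1 - x \<bullet> x)"
  show "((\<lambda>y. theta 0 y w) has_derivative ?D) (at x)"
    unfolding theta_simps using cusp_chartD(4)[OF x]
    by (intro has_derivative_divide has_derivative_inner_left has_derivative_ident has_derivative_diff
        has_derivative_const inner_self_has_derivative) simp
  define s where "s = 1 - x \<bullet> x"
  have s: "x \<bullet> x = 1 - s" "s \<noteq> 0" "1 - s \<noteq> 0" using cusp_chartD(3,4)[OF x] by (auto simp: s_def)
  have key: "- Y * (inverse (1 - (1 - s)) * (0 - 2 * X) * inverse (1 - (1 - s))) + G / (1 - (1 - s))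
      - (- m * (1 / (1 - s)) * (2 * (X * Y)) + (((2 - (1 - s)) - (- m * (1 / (1 - s))) * (1 - (1 - s))\<^sup>2) * G
        + (1 + 2 / (1 - (1 - s)) - (- m * (1 / (1 - s))) * (2 - (1 - s))) * (X * Y)
        + (((- m * (1 / (1 - s))) * (2 - (1 - s)) - 1) * (1 - (1 - s))\<^sup>2 - 2 * (2 - (1 - s))\<^sup>2) * (b * b')) * (1 - s)
        - 2 * (- (2 - (1 - s))) * (b * b')) / (1 - (1 - s))
      = ((1 - (1 - s)) * (1 - m) * (1 / (1 - s)) * (1 / 4)) * (2 * p1 * (2 * q1))
       + ((1 - (1 - s)) * (1 - m) * (1 / (1 - s)) * (1 / 4)) * (2 * p2 * (2 * q2))
       + ((1 - (1 - s)) * (1 - m) * (1 / (1 - s)) * (1 / 4)) * (2 * p3 * (2 * q3))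
       + (((3 - m) * (1 - (1 - s)) - 2) * (1 / (1 - s))) * ((1 - (1 - s)) * b * ((1 - (1 - s)) * b'))
       + ((1 - (1 - s)) * (2 + 2 * m * (1 / (1 - s)) - (1 - s) - m * (2 - (1 - s)))) * (X / (1 - (1 - s)) * (Y / (1 - (1 - s))))"
    if G: "G = (b * b' + (p1 * q1 + p2 * q2 + p3 * q3)) / (1 - s)" for X Y G b b' p1 p2 p3 q1 q2 q3
    unfolding G using s(2,3) by (simp add: divide_simps) (algebra | (simp add: algebra_simps power2_eq_square))
  fix v
  show "?D v - theta 0 x (met_conn (\<lambda>r. - m * (1 / r)) x v w) = ?B x v w"
    using key[OF inner_theta[OF cusp_chartD(1)[OF x], of v w, unfolded s(1)], of "x \<bullet> w" "x \<bullet> v"]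
    unfolding theta_simps inner_conn s(1) by (simp add: algebra_simps)
qed

lemma nabla_theta_1: "nabla_ok e (\<lambda>r. - m * (1 / r)) 1"
  unfolding nabla_ok_def
proof (intro exI conjI ballI allI)
  let ?c = "\<lambda>x. m * (1 - x \<bullet> x) * (1 / (x \<bullet> x)) + x \<bullet> x * (3 - x \<bullet> x) + (1 - x \<bullet> x) * (2 - x \<bullet> x)"
  let ?u = "\<lambda>x. (1 - x \<bullet> x) * (1 / 4) * ((1 / (x \<bullet> x)) * (1 / (x \<bullet> x)))"
  let ?B = "\<lambda>x v w. (- 2 + (1 - x \<bullet> x) * (1 / (x \<bullet> x)) + ?c x) * (theta 0 x v * theta 1 x w)
    + (?c x - (1 - x \<bullet> x) * (1 / (x \<bullet> x))) * (theta 1 x v * theta 0 x w)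
    + (?u x * hopf 2 x) * (theta 2 x v * theta 3 x w) + (- (?u x * hopf 2 x)) * (theta 3 x v * theta 2 x w)
    + (?u x * hopf 0 x) * (theta 3 x v * theta 4 x w) + (- (?u x * hopf 0 x)) * (theta 4 x v * theta 3 x w)
    + (?u x * hopf 1 x) * (theta 4 x v * theta 2 x w) + (- (?u x * hopf 1 x)) * (theta 2 x v * theta 4 x w)"
  show "bil_form e ?B" by (intro bil_form_add bil_form_basic alg_intros) auto
  fix x w assume x: "x \<in> cusp_chart e"
  let ?D = "\<lambda>v. (1 - x \<bullet> x) * (imul v \<bullet> w) + (0 - 2 * (x \<bullet> v)) * (imul x \<bullet> w)"
  show "((\<lambda>y. theta 1 y w) has_derivative ?D) (at x)"
    unfolding theta_simps
    by (intro has_derivative_mult has_derivative_inner_left has_derivative_imul has_derivative_diff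
        has_derivative_const inner_self_has_derivative)
  define s where "s = 1 - x \<bullet> x"
  have s: "x \<bullet> x = 1 - s" "s \<noteq> 0" "1 - s \<noteq> 0" using cusp_chartD(3,4)[OF x] by (auto simp: s_def)
  have key: "s * I + (0 - 2 * X) * b' - s * ((- m * (1 / (1 - s)) + (- 1 - 2 / s) * (1 - s) + (- (1 + s))) * (X * b' + Y * b))
      = (- 2 + s * (1 / (1 - s)) + (m * s * (1 / (1 - s)) + (1 - s) * (2 + s) + s * (1 + s))) * (X / s * (s * b'))
       + ((m * s * (1 / (1 - s)) + (1 - s) * (2 + s) + s * (1 + s)) - s * (1 / (1 - s))) * (s * b * (Y / s))
       + (s * (1 / 4) * ((1 / (1 - s)) * (1 / (1 - s)))) * (4 * Z)"
    if "(1 - s)\<^sup>2 * I = (1 - s) * (X * b' - b * Y) + Z" for I X Y b b' Z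
  proof -
    have I: "I = ((1 - s) * (X * b' - b * Y) + Z) / (1 - s)\<^sup>2" using that s(3) by (simp add: field_simps)
    show ?thesis unfolding I using s(2,3)
      by (simp add: divide_simps) (algebra | (simp add: algebra_simps power2_eq_square))
  qed
  fix v
  note hs = hopf_identity_symplectic[of x v w, unfolded s(1)]
  show "?D v - theta 1 x (met_conn (\<lambda>r. - m * (1 / r)) x v w) = ?B x v w"
    using key[of "imul v \<bullet> w" "x \<bullet> v" "imul x \<bullet> w" "imul x \<bullet> v" "x \<bullet> w"
      "hopf 2 x * ((H 0 x \<bullet> v) * (H 1 x \<bullet> w) - (H 1 x \<bullet> v) * (H 0 x \<bullet> w))
    + hopf 0 x * ((H 1 x \<bullet> v) * (H 2 x \<bullet> w) - (H 2 x \<bullet> v) * (H 1 x \<bullet> w))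
    + hopf 1 x * ((H 2 x \<bullet> v) * (H 0 x \<bullet> w) - (H 0 x \<bullet> v) * (H 2 x \<bullet> w))"] hs
    unfolding theta_simps inner_conn s(1) by (simp add: algebra_simps)
qed

lemma nabla_theta_hopf:
  assumes jpq: "j < 3" "p < 3" "q < 3"
    and Q: "\<And>x w. (x \<bullet> x) * (H j (imul x) \<bullet> w) = hopf j x * (imul x \<bullet> w) + (hopf p x * (H q x \<bullet> w) - hopf q x * (H p x \<bullet> w))"
  shows "nabla_ok e (\<lambda>r. - m * (1 / r)) (j + 2)"
  unfolding nabla_ok_def
proof (intro exI conjI ballI allI)
  let ?i = "\<lambda>x. 1 / (x \<bullet> x)"
  let ?a = "\<lambda>x. (1 - x \<bullet> x) * ((1 + m) * ?i x)"
  let ?b = "\<lambda>x. (1 - x \<bullet> x) * (?i x * ?i x)"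
  let ?s = "\<lambda>x. - (hopf j x * (1 / 2) * (?i x * (?i x + (2 - x \<bullet> x) + m * ?i x * ((1 - x \<bullet> x) * (1 - x \<bullet> x)))))"
  let ?B = "\<lambda>x v w. ?a x * (theta 0 x v * theta (j + 2) x w) + ?a x * (theta (j + 2) x v * theta 0 x w)
    + (?b x * hopf p x) * (theta 1 x v * theta (q + 2) x w) + (- (?b x * hopf q x)) * (theta 1 x v * theta (p + 2) x w)
    + (?b x * hopf p x) * (theta (q + 2) x v * theta 1 x w) + (- (?b x * hopf q x)) * (theta (p + 2) x v * theta 1 x w)
    + (hopf j x * (4 * (?i x * ?i x) - 2 * ((1 + 2 * (x \<bullet> x) * (2 - x \<bullet> x)) * (?i x * ?i x) + m * (?i x * ?i x)
        - m * ?i x * (2 - x \<bullet> x) - 1))) * (theta 1 x v * theta 1 x w)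
    + (- (2 * hopf j x * (1 - x \<bullet> x) * (3 - x \<bullet> x + m * (2 - x \<bullet> x) * (1 - x \<bullet> x) * ?i x))) * (theta 0 x v * theta 0 x w)
    + ?s x * (theta 2 x v * theta 2 x w) + ?s x * (theta 3 x v * theta 3 x w) + ?s x * (theta 4 x v * theta 4 x w)"
  show "bil_form e ?B" using jpq by (intro bil_form_add bil_form_basic alg_intros) auto
  fix x w assume x: "x \<in> cusp_chart e"
  let ?D = "\<lambda>v. 2 * (H j v \<bullet> w)"
  show "((\<lambda>y. theta (j + 2) y w) has_derivative ?D) (at x)"
    unfolding theta_hopf
    by (intro has_derivative_mult_right has_derivative_inner_left bounded_linear_imp_has_derivative H_linear)
  define s where "s = 1 - x \<bullet> x"
  have s: "x \<bullet> x = 1 - s" "s \<noteq> 0" "1 - s \<noteq> 0" using cusp_chartD(3,4)[OF x] by (auto simp: s_def)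
  have key: "2 * HH - 2 * (- m * (1 / (1 - s)) * (X * P' + Y * P) + ((1 + s - (- m * (1 / (1 - s))) * s\<^sup>2) * G
        + (1 + 2 / s - (- m * (1 / (1 - s))) * (1 + s)) * (X * Y)
        + ((- m * (1 / (1 - s)) * (1 + s) - 1) * s\<^sup>2 - 2 * (1 + s)\<^sup>2) * (b * b')) * h + (1 + s) * (b' * K + b * K'))
      = s * ((1 + m) * (1 / (1 - s))) * (X / s * (2 * P')) + s * ((1 + m) * (1 / (1 - s))) * (2 * P * (Y / s))
       + s * ((1 / (1 - s)) * (1 / (1 - s))) * (s * b * (2 * L')) + s * ((1 / (1 - s)) * (1 / (1 - s))) * (2 * L * (s * b'))
       + (h * (4 * ((1 / (1 - s)) * (1 / (1 - s))) - 2 * ((1 + 2 * (1 - s) * (1 + s)) * ((1 / (1 - s)) * (1 / (1 - s)))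
          + m * ((1 / (1 - s)) * (1 / (1 - s))) - m * (1 / (1 - s)) * (1 + s) - 1))) * (s * b * (s * b'))
       + (- (2 * h * s * (2 + s + m * (1 + s) * s * (1 / (1 - s))))) * (X / s * (Y / s))
       + (- (h * (1 / 2) * ((1 / (1 - s)) * ((1 / (1 - s)) + (1 + s) + m * (1 / (1 - s)) * (s * s))))) * (4 * S)"
    if "(1 - s) * HH = X * P' + Y * P + b * K' + b' * K - h * G" and G: "G = (b * b' + S) / (1 - s)"
      and "(1 - s) * K = h * b + L" "(1 - s) * K' = h * b' + L'" for HH X Y P P' G b b' h K K' L L' S
  proof -
    have d: "y = z / (1 - s)" if "(1 - s) * y = z" for y z using that s(3) by (auto simp: eq_divide_eq mult.commute)
    note HH = d[OF that(1)] and K = d[OF that(3)] d[OF that(4)]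
    show ?thesis unfolding HH G K using s(2,3)
      by (simp add: divide_simps) (algebra | (simp add: algebra_simps power2_eq_square))
  qed
  fix v
  show "?D v - theta (j + 2) x (met_conn (\<lambda>r. - m * (1 / r)) x v w) = ?B x v w"
    using key[OF hopf_identity_hessian[of x j v w, unfolded s(1)] inner_theta[OF cusp_chartD(1)[OF x], of v w, unfolded s(1)]
      Q[of x v, unfolded s(1)] Q[of x w, unfolded s(1)]]
    unfolding theta_hopf theta_simps inner_conn s(1) by (simp add: algebra_simps)
qed

lemma nabla_theta:
  assumes "i < 5" shows "nabla_ok e (\<lambda>r. - m * (1 / r)) i"
proof -
  have "i = 0 \<or> i = 1 \<or> i = 0 + 2 \<or> i = 1 + 2 \<or> i = 2 + 2" using assms by auto
  moreover have "nabla_ok e (\<lambda>r. - m * (1 / r)) (0 + 2)"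
    by (rule nabla_theta_hopf[where p = 2 and q = 1]) (use hopf_identity_imul(1) in \<open>auto simp: algebra_simps simp del: split_paired_All\<close>)
  moreover have "nabla_ok e (\<lambda>r. - m * (1 / r)) (1 + 2)"
    by (rule nabla_theta_hopf[where p = 0 and q = 2]) (use hopf_identity_imul(2) in \<open>auto simp: algebra_simps simp del: split_paired_All\<close>)
  moreover have "nabla_ok e (\<lambda>r. - m * (1 / r)) (2 + 2)"
    by (rule nabla_theta_hopf[where p = 1 and q = 0]) (use hopf_identity_imul(3) in \<open>auto simp: algebra_simps simp del: split_paired_All\<close>)
  ultimately show ?thesis using nabla_theta_0 nabla_theta_1 by metis
qed

text \<open>Tensors of the size \<open>1 - x \<bullet> x\<close>.  The factor survives differentiation, its differential being
  \<open>- 2 * (1 - x \<bullet> x)\<close> times \<open>theta 0\<close>.\<close>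

inductive tens :: "real \<Rightarrow> nat \<Rightarrow> (c2 \<Rightarrow> c2 list \<Rightarrow> real) \<Rightarrow> bool" for e n where
  zero: "tens e n (\<lambda>x vs. 0)"
| add: "tens e n T \<Longrightarrow> tens e n T' \<Longrightarrow> tens e n (\<lambda>x vs. T x vs + T' x vs)"
| simple: "alg e f \<Longrightarrow> (\<And>i. i < n \<Longrightarrow> I i < 5) \<Longrightarrow>
    tens e n (\<lambda>x vs. (1 - x \<bullet> x) * f x * (\<Prod>i<n. theta (I i) x (vs ! i)))"

lemma tens_sum:
  assumes "finite A" "\<And>a. a \<in> A \<Longrightarrow> tens e n (T a)" shows "tens e n (\<lambda>x vs. \<Sum>a\<in>A. T a x vs)"
  using assms by (induction A rule: finite_induct) (auto intro: tens.zero tens.add)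

lemma tens_derivative:
  assumes "tens e n T"
  shows "\<exists>T'. tens e (Suc n) T' \<and> (\<forall>x\<in>cusp_chart e. \<forall>v ws. length ws = n \<longrightarrow>
    (\<exists>D. ((\<lambda>y. T y ws) has_derivative D) (at x) \<and>
      D v - (\<Sum>i<n. T x (ws[i := met_conn (\<lambda>r. - m * (1 / r)) x v (ws ! i)])) = T' x (v # ws)))"
  using assms
proof induction
  case zero
  have "((\<lambda>y::c2. 0::real) has_derivative (\<lambda>v. 0)) (at x)" for x by simp
  then show ?case by (intro exI[of _ "\<lambda>x vs. 0"] conjI tens.zero ballI allI impI exI[of _ "\<lambda>v. 0"]) auto
next
  case (add T1 T2)
  let ?G = "\<lambda>x v w. met_conn (\<lambda>r. - m * (1 / r)) x v w"
  from add.IH(1) obtain S1 where S1: "tens e (Suc n) S1" "\<And>x v ws. x \<in> cusp_chart e \<Longrightarrow> length ws = n \<Longrightarrow>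
    \<exists>D. ((\<lambda>y. T1 y ws) has_derivative D) (at x) \<and> D v - (\<Sum>i<n. T1 x (ws[i := ?G x v (ws ! i)])) = S1 x (v # ws)" by blast
  from add.IH(2) obtain S2 where S2: "tens e (Suc n) S2" "\<And>x v ws. x \<in> cusp_chart e \<Longrightarrow> length ws = n \<Longrightarrow>
    \<exists>D. ((\<lambda>y. T2 y ws) has_derivative D) (at x) \<and> D v - (\<Sum>i<n. T2 x (ws[i := ?G x v (ws ! i)])) = S2 x (v # ws)" by blast
  show ?case
  proof (intro exI[of _ "\<lambda>x vs. S1 x vs + S2 x vs"] conjI tens.add S1(1) S2(1) ballI allI impI)
    fix x v :: c2 and ws :: "c2 list" assume x: "x \<in> cusp_chart e" and l: "length ws = n"
    obtain D1 where D1: "((\<lambda>y. T1 y ws) has_derivative D1) (at x)" "D1 v - (\<Sum>i<n. T1 x (ws[i := ?G x v (ws ! i)])) = S1 x (v # ws)"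
      using S1(2)[OF x l] by blast
    obtain D2 where D2: "((\<lambda>y. T2 y ws) has_derivative D2) (at x)" "D2 v - (\<Sum>i<n. T2 x (ws[i := ?G x v (ws ! i)])) = S2 x (v # ws)"
      using S2(2)[OF x l] by blast
    show "\<exists>D. ((\<lambda>y. T1 y ws + T2 y ws) has_derivative D) (at x) \<and>
      D v - (\<Sum>i<n. T1 x (ws[i := ?G x v (ws ! i)]) + T2 x (ws[i := ?G x v (ws ! i)])) = S1 x (v # ws) + S2 x (v # ws)"
      using D1(2) D2(2) by (intro exI[of _ "\<lambda>v. D1 v + D2 v"] conjI has_derivative_add D1(1) D2(1)) (simp add: sum.distrib)
  qed
next
  case (simple f I)
  let ?G = "\<lambda>x v w. met_conn (\<lambda>r. - m * (1 / r)) x v w"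
  obtain Df where Df: "lin_form e Df" "\<And>x. x \<in> cusp_chart e \<Longrightarrow> (f has_derivative Df x) (at x)"
    using alg_derivative[OF simple(1)] by blast
  have "lin_form e (\<lambda>x v. Df x v + (- 2 * f x) * theta 0 x v)"
    using Df(1) simple(1) by (intro lin_form_add lin_form_basic alg_intros) auto
  then obtain c where c0: "\<forall>j. alg e (c j)"
    "\<forall>x\<in>cusp_chart e. \<forall>v. Df x v + (- 2 * f x) * theta 0 x v = (\<Sum>j<5. c j x * theta j x v)"
    unfolding lin_form_def by blast
  have c: "alg e (c j)" "x \<in> cusp_chart e \<Longrightarrow> Df x v - 2 * f x * theta 0 x v = (\<Sum>j<5. c j x * theta j x v)" for j x v
    using c0(1) c0(2)[THEN bspec, of x, THEN spec, of v] by simp_all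
  have "\<forall>i. \<exists>d. i < n \<longrightarrow> (\<forall>j l. alg e (d j l)) \<and> (\<forall>x\<in>cusp_chart e. \<forall>w. \<exists>D. ((\<lambda>y. theta (I i) y w) has_derivative D) (at x) \<and>
     (\<forall>v. D v - theta (I i) x (?G x v w) = (\<Sum>j<5. \<Sum>l<5. d j l x * (theta j x v * theta l x w))))"
  proof
    fix i
    show "\<exists>d. i < n \<longrightarrow> (\<forall>j l. alg e (d j l)) \<and> (\<forall>x\<in>cusp_chart e. \<forall>w. \<exists>D. ((\<lambda>y. theta (I i) y w) has_derivative D) (at x) \<and>
     (\<forall>v. D v - theta (I i) x (?G x v w) = (\<Sum>j<5. \<Sum>l<5. d j l x * (theta j x v * theta l x w))))"
    proof (cases "i < n")
      case True
      obtain B where B: "bil_form e B" "\<forall>x\<in>cusp_chart e. \<forall>w. \<exists>D. ((\<lambda>y. theta (I i) y w) has_derivative D) (at x) \<and>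
          (\<forall>v. D v - theta (I i) x (?G x v w) = B x v w)"
        using nabla_theta[OF simple(2)[OF True], of e m] unfolding nabla_ok_def by blast
      obtain d where d: "\<forall>j l. alg e (d j l)" "\<forall>x\<in>cusp_chart e. \<forall>v w. B x v w = (\<Sum>j<5. \<Sum>l<5. d j l x * (theta j x v * theta l x w))"
        using B(1) unfolding bil_form_def by blast
      show ?thesis
      proof (intro exI[of _ d] impI conjI d(1) ballI allI)
        fix x w assume x: "x \<in> cusp_chart e"
        obtain D where D: "((\<lambda>y. theta (I i) y w) has_derivative D) (at x)"
          "\<And>v. D v - theta (I i) x (?G x v w) = B x v w" using B(2) x by blast
        show "\<exists>D. ((\<lambda>y. theta (I i) y w) has_derivative D) (at x) \<and>
          (\<forall>v. D v - theta (I i) x (?G x v w) = (\<Sum>j<5. \<Sum>l<5. d j l x * (theta j x v * theta l x w)))"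
        proof (intro exI[of _ D] conjI D(1) allI)
          fix v
          show "D v - theta (I i) x (?G x v w) = (\<Sum>j<5. \<Sum>l<5. d j l x * (theta j x v * theta l x w))"
            using D(2)[of v] d(2) x by (simp del: split_paired_All)
        qed
      qed
    qed blast
  qed
  then obtain d where d': "\<forall>i. i < n \<longrightarrow> (\<forall>j l. alg e (d i j l)) \<and> (\<forall>x\<in>cusp_chart e. \<forall>w. \<exists>D. ((\<lambda>y. theta (I i) y w) has_derivative D) (at x) \<and>
     (\<forall>v. D v - theta (I i) x (?G x v w) = (\<Sum>j<5. \<Sum>l<5. d i j l x * (theta j x v * theta l x w))))"
    by (rule choice[THEN exE])
  have d1: "alg e (d i j l)" if "i < n" for i j l using d' that by blast
  have d2: "\<exists>D. ((\<lambda>y. theta (I i) y w) has_derivative D) (at x) \<and>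
     (\<forall>v. D v - theta (I i) x (?G x v w) = (\<Sum>j<5. \<Sum>l<5. d i j l x * (theta j x v * theta l x w)))"
    if "i < n" "x \<in> cusp_chart e" for i x w using d' that by blast
  let ?T1 = "\<lambda>x vs. \<Sum>j<5. (1 - x \<bullet> x) * c j x * (\<Prod>a<Suc n. theta (case_nat j I a) x (vs ! a))"
  let ?T2 = "\<lambda>x vs. \<Sum>i<n. \<Sum>j<5. \<Sum>l<5. (1 - x \<bullet> x) * (f x * d i j l x) * (\<Prod>a<Suc n. theta (case_nat j (I(i := l)) a) x (vs ! a))"
  show ?case
  proof (intro exI[of _ "\<lambda>x vs. ?T1 x vs + ?T2 x vs"] conjI ballI allI impI)
    show "tens e (Suc n) (\<lambda>x vs. ?T1 x vs + ?T2 x vs)"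
      using simple by (intro tens.add tens_sum tens.simple c(1) alg.mult d1 simple(1)) (auto split: nat.split)
    fix x v :: c2 and ws :: "c2 list" assume x: "x \<in> cusp_chart e" and l: "length ws = n"
    have "\<forall>i. \<exists>D. i < n \<longrightarrow> ((\<lambda>y. theta (I i) y (ws ! i)) has_derivative D) (at x) \<and>
     (\<forall>v. D v - theta (I i) x (?G x v (ws ! i)) = (\<Sum>j<5. \<Sum>l<5. d i j l x * (theta j x v * theta l x (ws ! i))))"
      using d2[OF _ x] by blast
    then obtain D where D': "\<forall>i. i < n \<longrightarrow> ((\<lambda>y. theta (I i) y (ws ! i)) has_derivative D i) (at x) \<and>
     (\<forall>v. D i v - theta (I i) x (?G x v (ws ! i)) = (\<Sum>j<5. \<Sum>l<5. d i j l x * (theta j x v * theta l x (ws ! i))))"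
      by (rule choice[THEN exE])
    let ?p = "\<lambda>A. \<Prod>a\<in>A. theta (I a) x (ws ! a)"
    have P: "((\<lambda>y. \<Prod>a<n. theta (I a) y (ws ! a)) has_derivative (\<lambda>v. \<Sum>i<n. D i v * ?p ({..<n} - {i}))) (at x)"
      using D' by (intro has_derivative_prod) auto
    have r: "((\<lambda>y. (1 - y \<bullet> y) * f y) has_derivative (\<lambda>v. (1 - x \<bullet> x) * Df x v + (0 - 2 * (x \<bullet> v)) * f x)) (at x)"
      by (intro has_derivative_mult has_derivative_diff has_derivative_const inner_self_has_derivative Df(2) x)
    define N where "N = (\<lambda>v. (1 - x \<bullet> x) * f x * (\<Sum>i<n. D i v * ?p ({..<n} - {i})) + ((1 - x \<bullet> x) * Df x v + (0 - 2 * (x \<bullet> v)) * f x) * ?p {..<n})"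
    have N: "((\<lambda>y. (1 - y \<bullet> y) * f y * (\<Prod>a<n. theta (I a) y (ws ! a))) has_derivative N) (at x)"
      unfolding N_def by (rule has_derivative_mult[OF r P])
    have upd: "(\<Prod>a<n. theta (I a) x (ws[i := u] ! a)) = theta (I i) x u * ?p ({..<n} - {i})" if "i < n" for i u
    proof -
      have "(\<Prod>a<n. theta (I a) x (ws[i := u] ! a)) = theta (I i) x (ws[i := u] ! i) * (\<Prod>a\<in>{..<n} - {i}. theta (I a) x (ws[i := u] ! a))"
        using that by (intro prod.remove) auto
      also have "(\<Prod>a\<in>{..<n} - {i}. theta (I a) x (ws[i := u] ! a)) = ?p ({..<n} - {i})" by (intro prod.cong) auto
      finally show ?thesis using that l by simp
    qed
    have s0: "(1 - x \<bullet> x) * theta 0 x v = x \<bullet> v" using cusp_chartD(4)[OF x] by (simp add: theta_simps)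
    have shift: "(\<Prod>a<Suc n. theta (case_nat j I' a) x ((v # ws) ! a)) = theta j x v * (\<Prod>a<n. theta (I' a) x (ws ! a))" for j I'
      by (simp only: prod.lessThan_Suc_shift) simp
    have upd2: "(\<Prod>a<n. theta ((I(i := l)) a) x (ws ! a)) = theta l x (ws ! i) * ?p ({..<n} - {i})" if "i < n" for i l
    proof -
      have "(\<Prod>a<n. theta ((I(i := l)) a) x (ws ! a)) = theta ((I(i := l)) i) x (ws ! i) * (\<Prod>a\<in>{..<n} - {i}. theta ((I(i := l)) a) x (ws ! a))"
        using that by (intro prod.remove) auto
      also have "(\<Prod>a\<in>{..<n} - {i}. theta ((I(i := l)) a) x (ws ! a)) = ?p ({..<n} - {i})" by (intro prod.cong) auto
      finally show ?thesis by simp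
    qed
    have T1: "?T1 x (v # ws) = ((1 - x \<bullet> x) * Df x v + (0 - 2 * (x \<bullet> v)) * f x) * ?p {..<n}"
    proof -
      have "?T1 x (v # ws) = (1 - x \<bullet> x) * (\<Sum>j<5. c j x * theta j x v) * ?p {..<n}"
        unfolding shift by (simp add: sum_distrib_left sum_distrib_right mult.assoc)
      then show ?thesis unfolding c(2)[OF x, symmetric] s0[symmetric] by (simp add: algebra_simps)
    qed
    have T2: "?T2 x (v # ws) = (\<Sum>i<n. (1 - x \<bullet> x) * f x * ((D i v - theta (I i) x (?G x v (ws ! i))) * ?p ({..<n} - {i})))"
    proof (rule sum.cong[OF refl])
      fix i assume "i \<in> {..<n}"
      then have i: "i < n" by simp
      have D2: "D i v - theta (I i) x (?G x v (ws ! i)) = (\<Sum>j<5. \<Sum>l<5. d i j l x * (theta j x v * theta l x (ws ! i)))"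
        using D' i by blast
      show "(\<Sum>j<5. \<Sum>l<5. (1 - x \<bullet> x) * (f x * d i j l x) * (\<Prod>a<Suc n. theta (case_nat j (I(i := l)) a) x ((v # ws) ! a)))
          = (1 - x \<bullet> x) * f x * ((D i v - theta (I i) x (?G x v (ws ! i))) * ?p ({..<n} - {i}))"
        unfolding D2 shift upd2[OF i] sum_distrib_left sum_distrib_right
        by (intro sum.cong refl) (simp only: mult_ac)
    qed
    have "N v - (\<Sum>i<n. (1 - x \<bullet> x) * f x * (\<Prod>a<n. theta (I a) x (ws[i := ?G x v (ws ! i)] ! a)))
        = N v - (\<Sum>i<n. (1 - x \<bullet> x) * f x * (theta (I i) x (?G x v (ws ! i)) * ?p ({..<n} - {i})))"
      using upd by (intro arg_cong2[where f = "(-)"] refl sum.cong) auto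
    also have "\<dots> = ?T1 x (v # ws) + ?T2 x (v # ws)"
      unfolding T1 T2 N_def by (simp add: sum_distrib_left left_diff_distrib right_diff_distrib sum_subtractf)
    finally show "\<exists>D. ((\<lambda>y. (1 - y \<bullet> y) * f y * (\<Prod>a<n. theta (I a) y (ws ! a))) has_derivative D) (at x) \<and>
      D v - (\<Sum>i<n. (1 - x \<bullet> x) * f x * (\<Prod>a<n. theta (I a) x (ws[i := ?G x v (ws ! i)] ! a))) = ?T1 x (v # ws) + ?T2 x (v # ws)"
      using N by blast
  qed
qed


lemma cov_deriv_tens:
  assumes G: "\<And>x v w. x \<in> cusp_chart e \<Longrightarrow> christoffel g x v w = met_conn (\<lambda>r. - m * (1 / r)) x v w"
    and T: "tens e 2 T" "\<And>x ws. x \<in> cusp_chart e \<Longrightarrow> length ws = 2 \<Longrightarrow> T0 x ws = T x ws"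
  shows "\<exists>T'. tens e (k + 2) T' \<and>
    (\<forall>x\<in>cusp_chart e. \<forall>ws. length ws = k + 2 \<longrightarrow> (cov_deriv g ^^ k) T0 x ws = T' x ws)"
proof (induction k)
  case 0
  show ?case using T by (intro exI[of _ T]) (simp add: numeral_2_eq_2 del: split_paired_All)
next
  case (Suc k)
  then obtain T1 where T1: "tens e (k + 2) T1"
    "\<And>x ws. x \<in> cusp_chart e \<Longrightarrow> length ws = k + 2 \<Longrightarrow> (cov_deriv g ^^ k) T0 x ws = T1 x ws" by blast
  obtain T2 where T2: "tens e (Suc (k + 2)) T2" and d: "\<forall>x\<in>cusp_chart e. \<forall>v ws. length ws = k + 2 \<longrightarrow>
    (\<exists>D. ((\<lambda>y. T1 y ws) has_derivative D) (at x) \<and>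
      D v - (\<Sum>i<k + 2. T1 x (ws[i := met_conn (\<lambda>r. - m * (1 / r)) x v (ws ! i)])) = T2 x (v # ws))"
    using tens_derivative[OF T1(1), of m] by blast
  show ?case
  proof (intro exI[of _ T2] conjI ballI allI impI)
    show "tens e (Suc k + 2) T2" using T2 by simp
    fix x :: c2 and ws :: "c2 list" assume x: "x \<in> cusp_chart e" and l: "length ws = Suc k + 2"
    then obtain v us where ws: "ws = v # us" "length us = k + 2" by (cases ws) auto
    obtain D where D: "((\<lambda>y. T1 y us) has_derivative D) (at x)"
      "D v - (\<Sum>i<k + 2. T1 x (us[i := met_conn (\<lambda>r. - m * (1 / r)) x v (us ! i)])) = T2 x (v # us)"
      using d x ws(2) by blast
    have "frechet_derivative (\<lambda>y. (cov_deriv g ^^ k) T0 y us) (at x) = frechet_derivative (\<lambda>y. T1 y us) (at x)"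
      by (rule frechet_derivative_cong_open[OF open_cusp_chart x]) (rule T1(2)[OF _ ws(2)])
    then have f: "frechet_derivative (\<lambda>y. (cov_deriv g ^^ k) T0 y us) (at x) = D"
      using frechet_derivative_at[OF D(1)] by simp
    have "(cov_deriv g ^^ Suc k) T0 x ws = D v - (\<Sum>i<length us. (cov_deriv g ^^ k) T0 x (us[i := christoffel g x v (us ! i)]))"
      unfolding ws(1) by (simp add: cov_deriv_def f)
    also have "(\<Sum>i<length us. (cov_deriv g ^^ k) T0 x (us[i := christoffel g x v (us ! i)]))
        = (\<Sum>i<k + 2. T1 x (us[i := met_conn (\<lambda>r. - m * (1 / r)) x v (us ! i)]))"
      unfolding ws(2) G[OF x] by (intro sum.cong refl T1(2) x) (simp add: ws(2))
    finally show "(cov_deriv g ^^ Suc k) T0 x ws = T2 x ws" using D(2) ws(1) by simp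
  qed
qed

lemma bil_form_tens:
  assumes "bil_form e B"
  shows "\<exists>T. tens e 2 T \<and> (\<forall>x\<in>cusp_chart e. \<forall>ws. T x ws = (1 - x \<bullet> x) * B x (ws ! 0) (ws ! 1))"
proof -
  obtain c where c: "\<And>j l. alg e (c j l)"
    "\<And>x v w. x \<in> cusp_chart e \<Longrightarrow> B x v w = (\<Sum>j<5. \<Sum>l<5. c j l x * (theta j x v * theta l x w))"
    using assms unfolding bil_form_def by blast
  let ?T = "\<lambda>x vs. \<Sum>j<5. \<Sum>l<5. (1 - x \<bullet> x) * c j l x * (\<Prod>i<2. theta (case_nat j (\<lambda>_. l) i) x (vs ! i))"
  show ?thesis
  proof (intro exI[of _ ?T] conjI ballI allI)
    show "tens e 2 ?T" by (intro tens_sum tens.simple c(1)) (auto split: nat.split)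
    fix x :: c2 and ws :: "c2 list" assume x: "x \<in> cusp_chart e"
    have 2: "(\<Prod>i<2. F i) = F 0 * F 1" for F :: "nat \<Rightarrow> real" by (simp add: numeral_2_eq_2)
    show "?T x ws = (1 - x \<bullet> x) * B x (ws ! 0) (ws ! 1)"
      unfolding c(2)[OF x] 2 by (simp add: sum_distrib_left mult.assoc)
  qed
qed

lemma theta_bound:
  assumes x: "x \<in> cusp_chart e" and c: "0 < c" "c \<le> a (x \<bullet> x) / (x \<bullet> x)" and i: "i < 5"
  shows "\<bar>theta i x v\<bar> \<le> sqrt (4 / c) * sqrt (met a x v v)"
proof -
  let ?S = "((theta 2 x v * theta 2 x v + theta 3 x v * theta 3 x v + theta 4 x v * theta 4 x v) / 4
    + (x \<bullet> x) * (2 - x \<bullet> x) * (theta 0 x v * theta 0 x v) + theta 1 x v * theta 1 x v)"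
  have "1 / 3 \<le> exp (- 1 :: real)" using exp_le by (simp add: exp_minus field_simps)
  then have "1 / 4 \<le> x \<bullet> x" using cusp_chartD(2)[OF x] by linarith
  then have "1 / 4 * 1 \<le> (x \<bullet> x) * (2 - x \<bullet> x)" using cusp_chartD(4)[OF x] by (intro mult_mono) auto
  then have Z: "1 / 4 * (theta 0 x v * theta 0 x v) \<le> (x \<bullet> x) * (2 - x \<bullet> x) * (theta 0 x v * theta 0 x v)"
    by (intro mult_right_mono) auto
  define t where "t = (\<lambda>j. theta j x v * theta j x v)"
  define z where "z = (x \<bullet> x) * (2 - x \<bullet> x) * t 0"
  have t: "0 \<le> t j" for j by (simp add: t_def)
  have z: "1 / 4 * t 0 \<le> z" using Z by (simp add: z_def t_def)
  have St: "?S = (t 2 + t 3 + t 4) / 4 + z + t 1" by (simp add: t_def z_def)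
  note le = t[of 0] t[of 1] t[of 2] t[of 3] t[of 4] z
  have key: "a0 / 4 \<le> (a2 + a3 + a4) / 4 + y + a1 \<and> a1 / 4 \<le> (a2 + a3 + a4) / 4 + y + a1
      \<and> a2 / 4 \<le> (a2 + a3 + a4) / 4 + y + a1 \<and> a3 / 4 \<le> (a2 + a3 + a4) / 4 + y + a1
      \<and> a4 / 4 \<le> (a2 + a3 + a4) / 4 + y + a1"
    if "0 \<le> a0" "0 \<le> a1" "0 \<le> a2" "0 \<le> a3" "0 \<le> a4" "1 / 4 * a0 \<le> y" for a0 a1 a2 a3 a4 y :: real
    using that by (intro conjI) (simp_all add: field_simps)
  note key[OF le]
  moreover have "i = 0 \<or> i = 1 \<or> i = 2 \<or> i = 3 \<or> i = 4" using i by auto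
  ultimately have "t i / 4 \<le> (t 2 + t 3 + t 4) / 4 + z + t 1" by metis
  then have S1: "t i / 4 \<le> ?S" unfolding St .
  have e: "(theta i x v)\<^sup>2 / 4 = t i / 4" by (simp add: t_def power2_eq_square)
  have S: "(theta i x v)\<^sup>2 / 4 \<le> ?S" unfolding e by (rule S1)
  have S0: "0 \<le> ?S" by (rule order_trans[OF _ S1]) (use t[of i] in simp)
  have "c * ((theta i x v)\<^sup>2 / 4) \<le> met a x v v"
    unfolding met_theta[OF cusp_chartD(1)[OF x]] using c S S0 by (intro mult_mono) auto
  then have "(theta i x v)\<^sup>2 \<le> 4 / c * met a x v v" using c(1) by (simp add: field_simps)
  then have "sqrt ((theta i x v)\<^sup>2) \<le> sqrt (4 / c * met a x v v)" by (rule real_sqrt_le_mono)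
  then show ?thesis unfolding real_sqrt_mult real_sqrt_abs .
qed

lemma tens_bound:
  assumes "tens e n T" and K: "0 \<le> K" "\<And>i x v. i < 5 \<Longrightarrow> x \<in> cusp_chart e \<Longrightarrow> \<bar>theta i x v\<bar> \<le> K * sqrt (g x v v)"
    and g: "\<And>x v. x \<in> cusp_chart e \<Longrightarrow> 0 \<le> g x v v"
  shows "\<exists>C. \<forall>x\<in>cusp_chart e. \<forall>vs. length vs = n \<longrightarrow> \<bar>T x vs\<bar> \<le> C * (1 - x \<bullet> x) * (\<Prod>v\<leftarrow>vs. sqrt (g x v v))"
  using assms(1)
proof induction
  case zero
  show ?case by (intro exI[of _ 0]) simp
next
  case (add T T')
  obtain C where C: "\<And>x vs. x \<in> cusp_chart e \<Longrightarrow> length vs = n \<Longrightarrow> \<bar>T x vs\<bar> \<le> C * (1 - x \<bullet> x) * (\<Prod>v\<leftarrow>vs. sqrt (g x v v))"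
    using add.IH(1) by blast
  obtain D where D: "\<And>x vs. x \<in> cusp_chart e \<Longrightarrow> length vs = n \<Longrightarrow> \<bar>T' x vs\<bar> \<le> D * (1 - x \<bullet> x) * (\<Prod>v\<leftarrow>vs. sqrt (g x v v))"
    using add.IH(2) by blast
  have "\<bar>T x vs + T' x vs\<bar> \<le> (C + D) * (1 - x \<bullet> x) * (\<Prod>v\<leftarrow>vs. sqrt (g x v v))"
    if "x \<in> cusp_chart e" "length vs = n" for x vs
    using C[OF that] D[OF that] abs_triangle_ineq[of "T x vs" "T' x vs"] unfolding distrib_right by linarith
  then show ?case by blast
next
  case (simple f I)
  obtain C where C: "\<And>x. x \<in> cusp_chart e \<Longrightarrow> \<bar>f x\<bar> \<le> C" using alg_bounded[OF simple(1)] by blast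
  have "\<bar>(1 - x \<bullet> x) * f x * (\<Prod>i<n. theta (I i) x (vs ! i))\<bar> \<le> (C * K ^ n) * (1 - x \<bullet> x) * (\<Prod>v\<leftarrow>vs. sqrt (g x v v))"
    if x: "x \<in> cusp_chart e" and l: "length vs = n" for x vs
  proof -
    have C0: "0 \<le> C" using C[OF x] by (rule order_trans[OF abs_ge_zero])
    have "(\<Prod>i<n. \<bar>theta (I i) x (vs ! i)\<bar>) \<le> (\<Prod>i<n. K * sqrt (g x (vs ! i) (vs ! i)))"
      using K(2)[OF simple(2) x] by (intro prod_mono) auto
    also have "\<dots> = K ^ n * (\<Prod>v\<leftarrow>vs. sqrt (g x v v))"
      by (simp add: prod.distrib prod.list_conv_set_nth l atLeast0LessThan)
    finally have P: "\<bar>\<Prod>i<n. theta (I i) x (vs ! i)\<bar> \<le> K ^ n * (\<Prod>v\<leftarrow>vs. sqrt (g x v v))" by (simp add: abs_prod)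
    have "\<bar>1 - x \<bullet> x\<bar> * \<bar>f x\<bar> * \<bar>\<Prod>i<n. theta (I i) x (vs ! i)\<bar> \<le> (1 - x \<bullet> x) * C * (K ^ n * (\<Prod>v\<leftarrow>vs. sqrt (g x v v)))"
      using C[OF x] cusp_chartD(4)[OF x] C0 P by (intro mult_mono) auto
    then show ?thesis by (simp add: abs_mult mult_ac)
  qed
  then show ?case by blast
qed


subsection \<open>The maps to the pseudosphere and to the sphere\<close>

text \<open>The angle on the pseudosphere is twice the argument of \<open>cusp_coord e\<close>, because its radius is
  half of \<open>sqrt C\<close>: near the cusp a Hopf fiber has length about \<open>2 * pi * sqrt C * (1 - x \<bullet> x)\<close>, twice that of the circle
  of the tractroid.\<close>

definition cusp_coord :: "real \<Rightarrow> c2 \<Rightarrow> complex" where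
  "cusp_coord e x = (if e = 1 then fst x else snd x)"

definition squared_arg :: "complex \<Rightarrow> complex" where
  "squared_arg w = (1 / (w \<bullet> w)) *\<^sub>R (w * w)"

definition tractrix :: "real \<Rightarrow> real" where
  "tractrix r = ln ((1 + sqrt (1 - (1 - r)\<^sup>2)) / (1 - r)) - sqrt (1 - (1 - r)\<^sup>2)"

definition pseudo_map :: "real \<Rightarrow> real \<Rightarrow> c2 \<Rightarrow> complex \<times> real" where
  "pseudo_map e A x = ((A * (1 - x \<bullet> x)) *\<^sub>R squared_arg (cusp_coord e x), A * tractrix (x \<bullet> x))"

definition vec3 :: "real \<Rightarrow> real \<Rightarrow> real \<Rightarrow> complex \<times> real" where
  "vec3 a b c = (Complex a b, c)"

definition sphere_map :: "real \<Rightarrow> c2 \<Rightarrow> complex \<times> real" where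
  "sphere_map B x = vec3 (B * (hopf 0 x * (1 / (x \<bullet> x)))) (B * (hopf 1 x * (1 / (x \<bullet> x)))) (B * (hopf 2 x * (1 / (x \<bullet> x))))"

lemma vec3_eq: "vec3 a b c = a *\<^sub>R (1, 0) + b *\<^sub>R (\<i>, 0) + c *\<^sub>R (0, 1)"
  by (simp add: vec3_def complex_eq_iff)

lemma vec3_inner: "vec3 a b c \<bullet> vec3 a' b' c' = a * a' + b * b' + c * c'"
  by (simp add: vec3_def inner_complex_def)

lemma vec3_has_derivative:
  assumes "(f has_derivative f') (at x)" "(g has_derivative g') (at x)" "(h has_derivative h') (at x)"
  shows "((\<lambda>x. vec3 (f x) (g x) (h x)) has_derivative (\<lambda>v. vec3 (f' v) (g' v) (h' v))) (at x)"
  unfolding vec3_eq by (intro has_derivative_add has_derivative_scaleR_left assms)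

lemma squared_arg_has_derivative:
  assumes w: "w \<noteq> 0"
  shows "(squared_arg has_derivative (\<lambda>h. (2 * (Im (cnj w * h) / (w \<bullet> w))) *\<^sub>R (\<i> * squared_arg w))) (at w)"
proof -
  have n: "w \<bullet> w \<noteq> 0" using w by simp
  have 1: "((\<lambda>w. 1 / (w \<bullet> w)) has_derivative (\<lambda>h. - 1 * (inverse (w \<bullet> w) * (w \<bullet> h + h \<bullet> w) * inverse (w \<bullet> w)) + 0 / (w \<bullet> w))) (at w)"
    by (intro has_derivative_divide has_derivative_inner has_derivative_const has_derivative_ident n)
  have 2: "((\<lambda>w. w * w) has_derivative (\<lambda>h. w * h + h * w)) (at w)"
    by (intro has_derivative_mult has_derivative_ident)
  have e: "(1 / (w \<bullet> w)) *\<^sub>R (w * h + h * w)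
      + (- 1 * (inverse (w \<bullet> w) * (w \<bullet> h + h \<bullet> w) * inverse (w \<bullet> w)) + 0 / (w \<bullet> w)) *\<^sub>R (w * w)
      = (2 * (Im (cnj w * h) / (w \<bullet> w))) *\<^sub>R (\<i> * squared_arg w)" for h
  proof -
    obtain a b where ab: "w = Complex a b" by (cases w)
    obtain c d where cd: "h = Complex c d" by (cases h)
    have N: "a * a + b * b \<noteq> 0" using n by (simp add: ab inner_complex_def)
    have I: "w \<bullet> w = a * a + b * b" by (simp add: ab inner_complex_def)
    show ?thesis
      unfolding squared_arg_def I
      by (rule complex_eqI; simp add: ab cd inner_complex_def N divide_simps; algebra)
  qed
  show ?thesis
    unfolding squared_arg_def[abs_def]
    by (rule has_derivative_eq_rhs[OF has_derivative_scaleR[OF 1 2]]) (simp only: e squared_arg_def)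
qed

lemma squared_arg_inner:
  assumes "w \<noteq> 0"
  shows "squared_arg w \<bullet> squared_arg w = 1" "squared_arg w \<bullet> (\<i> * squared_arg w) = 0"
    "(\<i> * squared_arg w) \<bullet> squared_arg w = 0" "(\<i> * squared_arg w) \<bullet> (\<i> * squared_arg w) = 1"
    "norm (squared_arg w) = 1"
proof -
  show n: "norm (squared_arg w) = 1"
    using assms by (simp add: squared_arg_def dot_square_norm norm_mult power2_eq_square)
  show "squared_arg w \<bullet> squared_arg w = 1" by (simp add: dot_square_norm n)
  have "norm (\<i> * squared_arg w) = 1" by (simp add: norm_mult n)
  then show "(\<i> * squared_arg w) \<bullet> (\<i> * squared_arg w) = 1" by (simp add: dot_square_norm)
qed (simp_all add: inner_complex_def)

lemma tractrix_has_derivative: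
  assumes r: "0 < r" "r < 1"
  shows "(tractrix has_real_derivative sqrt (1 - (1 - r)\<^sup>2) / (1 - r)) (at r)"
proof -
  define q where "q = sqrt (1 - (1 - r)\<^sup>2)"
  have "(1 - r)\<^sup>2 < 1" using r by (simp add: abs_square_less_1)
  then have q: "0 < q" "q * q = 1 - (1 - r)\<^sup>2" by (simp_all add: q_def)
  have dq: "((\<lambda>r. sqrt (1 - (1 - r)\<^sup>2)) has_real_derivative (1 - r) / q) (at r)"
    unfolding q_def using \<open>(1 - r)\<^sup>2 < 1\<close>
    by (auto intro!: derivative_eq_intros simp: field_simps)
  have d1: "((\<lambda>r. 1 + sqrt (1 - (1 - r)\<^sup>2)) has_real_derivative (1 - r) / q) (at r)"
    using DERIV_add[OF DERIV_const dq, of 1] by simp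
  have d2: "((\<lambda>r. 1 - r) has_real_derivative - 1) (at r)" by (auto intro!: derivative_eq_intros)
  have p: "0 < 1 + sqrt (1 - (1 - r)\<^sup>2)" "0 < 1 - r" using q(1) r unfolding q_def by linarith+
  have "((\<lambda>r. ln (1 + sqrt (1 - (1 - r)\<^sup>2)) - ln (1 - r) - sqrt (1 - (1 - r)\<^sup>2)) has_real_derivative
      (1 - r) / q / (1 + q) + 1 / (1 - r) - (1 - r) / q) (at r)"
    by (rule DERIV_cong[OF DERIV_diff[OF DERIV_diff[OF DERIV_chain2[OF DERIV_ln[OF p(1)] d1] DERIV_chain2[OF DERIV_ln[OF p(2)] d2]] dq]])
      (simp add: q_def divide_inverse mult_ac)
  moreover have "(1 - r) / q / (1 + q) + 1 / (1 - r) - (1 - r) / q = q / (1 - r)"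
  proof -
    have q1: "1 + q \<noteq> 0" using q(1) by linarith
    have "(1 - r) / q / (1 + q) - (1 - r) / q = - ((1 - r) / (1 + q))"
      using q(1) q1 by (simp add: divide_simps; algebra)
    moreover have "(1 - r) * (1 - r) = (1 - q) * (1 + q)" using q(2) by (simp add: power2_eq_square algebra_simps)
    then have "(1 - r) / (1 + q) = (1 - q) / (1 - r)" using q1 r by (simp add: frac_eq_eq)
    ultimately show ?thesis by (simp add: diff_divide_distrib)
  qed
  ultimately have d3: "((\<lambda>r. ln (1 + sqrt (1 - (1 - r)\<^sup>2)) - ln (1 - r) - sqrt (1 - (1 - r)\<^sup>2)) has_real_derivative q / (1 - r)) (at r)"
    by simp
  have ev: "eventually (\<lambda>r. ln (1 + sqrt (1 - (1 - r)\<^sup>2)) - ln (1 - r) - sqrt (1 - (1 - r)\<^sup>2) = tractrix r) (nhds r)"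
  proof (rule eventually_nhds_in_open[of "{0<..<1}", THEN eventually_mono])
    fix t :: real assume t: "t \<in> {0<..<1}"
    then have "0 \<le> sqrt (1 - (1 - t)\<^sup>2)" by (simp add: abs_square_le_1)
    then have "0 < 1 + sqrt (1 - (1 - t)\<^sup>2)" by linarith
    then show "ln (1 + sqrt (1 - (1 - t)\<^sup>2)) - ln (1 - t) - sqrt (1 - (1 - t)\<^sup>2) = tractrix t"
      using t by (simp add: tractrix_def ln_div)
  qed (use r in auto)
  show ?thesis using DERIV_cong_ev[OF refl ev refl, THEN iffD1, OF d3] unfolding q_def .
qed

lemma cusp_coord_facts:
  assumes e: "e = 1 \<or> e = - 1"
  shows "2 * (cusp_coord e x \<bullet> cusp_coord e x) = x \<bullet> x + e * hopf 2 x"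
    "2 * (x \<bullet> x) * Im (cnj (cusp_coord e x) * cusp_coord e v) = (imul x \<bullet> v) * (x \<bullet> x + e * hopf 2 x)
      - e * (hopf 0 x * (H 1 x \<bullet> v) - hopf 1 x * (H 0 x \<bullet> v))"
    "bounded_linear (cusp_coord e)"
proof -
  show "2 * (cusp_coord e x \<bullet> cusp_coord e x) = x \<bullet> x + e * hopf 2 x"
    using e by (auto simp: cusp_coord_def hopf_coords inner_complex_def algebra_simps)
  obtain x1 x2 x3 x4 v1 v2 v3 v4 where
    xv: "x = (Complex x1 x2, Complex x3 x4)" "v = (Complex v1 v2, Complex v3 v4)"
    by (metis complex.exhaust surj_pair)
  show "2 * (x \<bullet> x) * Im (cnj (cusp_coord e x) * cusp_coord e v) = (imul x \<bullet> v) * (x \<bullet> x + e * hopf 2 x)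
      - e * (hopf 0 x * (H 1 x \<bullet> v) - hopf 1 x * (H 0 x \<bullet> v))"
  proof (cases "e = 1")
    case True
    show ?thesis unfolding True cusp_coord_def hopf_coords xv by simp algebra
  next
    case False
    then have m: "e = - 1" using e by simp
    show ?thesis unfolding m cusp_coord_def hopf_coords xv by simp algebra
  qed
  show "bounded_linear (cusp_coord e)"
    using e by (auto simp: cusp_coord_def[abs_def] bounded_linear_fst bounded_linear_snd)
qed

definition cusp_angle :: "real \<Rightarrow> c2 \<Rightarrow> c2 \<Rightarrow> real" where
  "cusp_angle e x v = (- e * (1 / 2) * (1 / (x \<bullet> x)) * (1 / (x \<bullet> x + e * hopf 2 x)) * hopf 0 x) * theta 3 x v
    + (e * (1 / 2) * (1 / (x \<bullet> x)) * (1 / (x \<bullet> x + e * hopf 2 x)) * hopf 1 x) * theta 2 x v"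

lemma cusp_coord_angle:
  assumes e: "e = 1 \<or> e = - 1" and x: "x \<in> cusp_chart e"
  shows "Im (cnj (cusp_coord e x) * cusp_coord e v) / (cusp_coord e x \<bullet> cusp_coord e x)
    = (imul x \<bullet> v) / (x \<bullet> x) + cusp_angle e x v"
proof -
  let ?M = "x \<bullet> x + e * hopf 2 x"
  have I: "Im (cnj (cusp_coord e x) * cusp_coord e v) = ((imul x \<bullet> v) * ?M
      - e * (hopf 0 x * (H 1 x \<bullet> v) - hopf 1 x * (H 0 x \<bullet> v))) / (2 * (x \<bullet> x))"
    unfolding cusp_coord_facts(2)[OF e, of x v, symmetric] using cusp_chartD(3)[OF x] by simp
  have W: "cusp_coord e x \<bullet> cusp_coord e x = ?M / 2" using cusp_coord_facts(1)[OF e, of x] by simp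
  have key: "(b * M - e * (h0 * p1 - h1 * p0)) / (2 * r) / (M / 2) = b / r
      + ((- e * (1 / 2) * (1 / r) * (1 / M) * h0) * (2 * p1) + (e * (1 / 2) * (1 / r) * (1 / M) * h1) * (2 * p0))"
    if "M \<noteq> 0" "r \<noteq> 0" for b M h0 h1 p0 p1 r :: real
    using that by (simp add: field_simps)
  show ?thesis
    unfolding cusp_angle_def theta_simps I W by (rule key) (use cusp_chartD(3,6)[OF x] in auto)
qed

lemma pseudo_map_derivative:
  assumes e: "e = 1 \<or> e = - 1" and x: "x \<in> cusp_chart e"
  shows "(pseudo_map e A has_derivative (\<lambda>v. ((A * (1 - x \<bullet> x)) *\<^sub>R
      ((2 * ((imul x \<bullet> v) / (x \<bullet> x) + cusp_angle e x v)) *\<^sub>R (\<i> * squared_arg (cusp_coord e x)))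
      + (A * (0 - 2 * (x \<bullet> v))) *\<^sub>R squared_arg (cusp_coord e x),
      A * (2 * (x \<bullet> v) * (sqrt (1 - (1 - x \<bullet> x)\<^sup>2) / (1 - x \<bullet> x)))))) (at x)"
proof -
  have w: "cusp_coord e x \<noteq> 0" using cusp_coord_facts(1)[OF e, of x] cusp_chartD(6)[OF x] by auto
  have "((\<lambda>y. squared_arg (cusp_coord e y)) has_derivative (\<lambda>v. (2 * (Im (cnj (cusp_coord e x) * cusp_coord e v)
      / (cusp_coord e x \<bullet> cusp_coord e x))) *\<^sub>R (\<i> * squared_arg (cusp_coord e x)))) (at x)"
    by (rule has_derivative_compose[OF bounded_linear_imp_has_derivative[OF cusp_coord_facts(3)[OF e]] squared_arg_has_derivative[OF w]])
  note u = this[unfolded cusp_coord_angle[OF e x]]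
  note t = has_derivative_radial[OF tractrix_has_derivative[OF cusp_chartD(3,4)[OF x]]]
  show ?thesis
    unfolding pseudo_map_def[abs_def]
    by (intro has_derivative_Pair has_derivative_scaleR has_derivative_mult_right u t has_derivative_diff
      has_derivative_const inner_self_has_derivative)
qed

lemma hopf_radial:
  "hopf 0 x * (H 0 x \<bullet> v) + hopf 1 x * (H 1 x \<bullet> v) + hopf 2 x * (H 2 x \<bullet> v) = (x \<bullet> x) * (x \<bullet> v)"
  unfolding hopf_coords by (simp add: algebra_simps)

lemma sphere_map_derivative:
  assumes x: "x \<noteq> 0"
  shows "(sphere_map B has_derivative (\<lambda>v. vec3
      (B * (hopf 0 x * (- 1 * (inverse (x \<bullet> x) * (2 * (x \<bullet> v)) * inverse (x \<bullet> x)) + 0 / (x \<bullet> x)) + 2 * (H 0 x \<bullet> v) * (1 / (x \<bullet> x))))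
      (B * (hopf 1 x * (- 1 * (inverse (x \<bullet> x) * (2 * (x \<bullet> v)) * inverse (x \<bullet> x)) + 0 / (x \<bullet> x)) + 2 * (H 1 x \<bullet> v) * (1 / (x \<bullet> x))))
      (B * (hopf 2 x * (- 1 * (inverse (x \<bullet> x) * (2 * (x \<bullet> v)) * inverse (x \<bullet> x)) + 0 / (x \<bullet> x)) + 2 * (H 2 x \<bullet> v) * (1 / (x \<bullet> x)))))) (at x)"
  unfolding sphere_map_def[abs_def]
  by (intro vec3_has_derivative has_derivative_mult_right has_derivative_mult hopf_has_derivative
    has_derivative_divide has_derivative_const inner_self_has_derivative) (use x in simp_all)


lemma pseudo_inner:
  fixes u j :: complex and c d :: real
  assumes "j \<bullet> j = 1" "j \<bullet> u = 0" "u \<bullet> j = 0" "u \<bullet> u = 1"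
  shows "(p *\<^sub>R (q *\<^sub>R j) + r *\<^sub>R u, c) \<bullet> (p' *\<^sub>R (q' *\<^sub>R j) + r' *\<^sub>R u, d) = p * q * (p' * q') + r * r' + c * d"
  unfolding inner_Pair inner_add_left inner_add_right inner_scaleR_left inner_scaleR_right assms by simp

text \<open>The metric and the pulled back product metric agree to first order in \<open>1 - x \<bullet> x\<close>, that is, in \<open>z\<close>.\<close>

lemma cusp_difference:
  assumes e: "e = 1 \<or> e = - 1" and C: "0 < C" and K: "alg e (\<lambda>x. \<kappa> (x \<bullet> x))"
    and a: "\<And>r. 0 < r \<Longrightarrow> r < 1 \<Longrightarrow> a r = C * r * ((1 / r) * (1 / r) + (1 - r) * \<kappa> r)"
  defines "A \<equiv> sqrt C / 2"
  shows "\<exists>B. bil_form e B \<and> (\<forall>x\<in>cusp_chart e. \<forall>v w. met a x v w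
      - (frechet_derivative (pseudo_map e A) (at x) v \<bullet> frechet_derivative (pseudo_map e A) (at x) w
       + frechet_derivative (sphere_map A) (at x) v \<bullet> frechet_derivative (sphere_map A) (at x) w)
      = (1 - x \<bullet> x) * B x v w)"
proof (intro exI conjI ballI allI)
  let ?i = "\<lambda>x::c2. 1 / (x \<bullet> x)"
  let ?b3 = "\<lambda>x. - e * (1 / 2) * (1 / (x \<bullet> x)) * (1 / (x \<bullet> x + e * hopf 2 x)) * hopf 0 x"
  let ?b2 = "\<lambda>x. e * (1 / 2) * (1 / (x \<bullet> x)) * (1 / (x \<bullet> x + e * hopf 2 x)) * hopf 1 x"
  let ?B = "\<lambda>x v w. (C * (1 / 4) * \<kappa> (x \<bullet> x)) * (theta 2 x v * theta 2 x w)
    + (C * (1 / 4) * \<kappa> (x \<bullet> x)) * (theta 3 x v * theta 3 x w)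
    + (C * (1 / 4) * \<kappa> (x \<bullet> x)) * (theta 4 x v * theta 4 x w)
    + (C * ((x \<bullet> x) * (2 - x \<bullet> x) * \<kappa> (x \<bullet> x) + 2 * ?i x + (1 - x \<bullet> x) * (?i x * ?i x))) * (theta 0 x v * theta 0 x w)
    + (C * \<kappa> (x \<bullet> x)) * (theta 1 x v * theta 1 x w)
    + (- (C * ?i x * ?b2 x)) * (theta 1 x v * theta 2 x w) + (- (C * ?i x * ?b3 x)) * (theta 1 x v * theta 3 x w)
    + (- (C * ?i x * ?b2 x)) * (theta 2 x v * theta 1 x w) + (- (C * ?i x * ?b3 x)) * (theta 3 x v * theta 1 x w)
    + (- (C * (1 - x \<bullet> x) * (?b2 x * ?b2 x))) * (theta 2 x v * theta 2 x w)
    + (- (C * (1 - x \<bullet> x) * (?b2 x * ?b3 x))) * (theta 2 x v * theta 3 x w)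
    + (- (C * (1 - x \<bullet> x) * (?b2 x * ?b3 x))) * (theta 3 x v * theta 2 x w)
    + (- (C * (1 - x \<bullet> x) * (?b3 x * ?b3 x))) * (theta 3 x v * theta 3 x w)"
  show "bil_form e ?B" by (intro bil_form_add bil_form_basic alg_intros K) auto
  fix x v w assume x: "x \<in> cusp_chart e"
  define s where "s = 1 - x \<bullet> x"
  have s: "x \<bullet> x = 1 - s" "s \<noteq> 0" "1 - s \<noteq> 0" "s\<^sup>2 < 1"
    using cusp_chartD(3,4)[OF x] by (auto simp: s_def abs_square_less_1)
  define q where "q = sqrt (1 - s\<^sup>2)"
  have q: "q * q = 1 - s\<^sup>2" using s(4) by (simp add: q_def)
  have A: "A * A = C / 4" using C by (simp add: A_def)
  define b where "b = cusp_angle e x"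
  have w0: "cusp_coord e x \<noteq> 0" using cusp_coord_facts(1)[OF e, of x] cusp_chartD(6)[OF x] by auto
  have \<alpha>: "x \<bullet> v = s * theta 0 x v" "imul x \<bullet> v = theta 1 x v / s" for v
    using s by (simp_all add: theta_simps s_def)
  have x0: "x \<noteq> 0" using cusp_chartD(3)[OF x] by auto
  let ?\<phi> = "\<lambda>v. theta 1 x v / s / (1 - s) + b v"
  let ?S = "theta 2 x v * theta 2 x w + theta 3 x v * theta 3 x w + theta 4 x v * theta 4 x w"
  have "frechet_derivative (pseudo_map e A) (at x) v \<bullet> frechet_derivative (pseudo_map e A) (at x) w
      = A * s * (2 * ?\<phi> v) * (A * s * (2 * ?\<phi> w)) + A * (0 - 2 * (s * theta 0 x v)) * (A * (0 - 2 * (s * theta 0 x w)))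
        + A * (2 * (s * theta 0 x v) * (q / s)) * (A * (2 * (s * theta 0 x w) * (q / s)))"
    unfolding frechet_derivative_at[OF pseudo_map_derivative[OF e x], symmetric] pseudo_inner[OF squared_arg_inner(4,3,2,1)[OF w0]]
      \<alpha>[of v] \<alpha>[of w] s_def[symmetric] q_def[symmetric] b_def[symmetric] s(1) by (simp add: q_def[symmetric])
  also have "\<dots> = (A * A) * 4 * (s * s * (?\<phi> v * ?\<phi> w) + s * s * (theta 0 x v * theta 0 x w))
      + (A * A) * 4 * (q * q) * (theta 0 x v * theta 0 x w)"
    using s(2) by (simp add: algebra_simps)
  finally have P: "frechet_derivative (pseudo_map e A) (at x) v \<bullet> frechet_derivative (pseudo_map e A) (at x) w
      = C * (s * s * (?\<phi> v * ?\<phi> w) + theta 0 x v * theta 0 x w)"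
    unfolding A q by (simp add: power2_eq_square algebra_simps)
  have hr: "hopf 0 x * theta 2 x v + hopf 1 x * theta 3 x v + hopf 2 x * theta 4 x v = 2 * (1 - s) * (s * theta 0 x v)" for v
    using hopf_radial[of x v] unfolding \<alpha>[of v] s(1) by (simp add: theta_simps(4-6) algebra_simps)
  have "frechet_derivative (sphere_map A) (at x) v \<bullet> frechet_derivative (sphere_map A) (at x) w
      = (A * A) * (?S * (1 - s)\<^sup>2 - 2 * (s * theta 0 x w) * (1 - s) * (hopf 0 x * theta 2 x v + hopf 1 x * theta 3 x v + hopf 2 x * theta 4 x v)
        - 2 * (s * theta 0 x v) * (1 - s) * (hopf 0 x * theta 2 x w + hopf 1 x * theta 3 x w + hopf 2 x * theta 4 x w)
        + 4 * (s * theta 0 x v) * (s * theta 0 x w) * ((hopf 0 x)\<^sup>2 + (hopf 1 x)\<^sup>2 + (hopf 2 x)\<^sup>2)) / ((1 - s)\<^sup>2)\<^sup>2"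
    unfolding frechet_derivative_at[OF sphere_map_derivative[OF x0], symmetric] vec3_inner
      theta_simps(4-6)[symmetric] \<alpha>[of v] \<alpha>[of w] s(1)
    using s(3) by (simp add: divide_simps) (algebra | (simp add: algebra_simps power2_eq_square))
  also have "\<dots> = C / 4 * (?S - 4 * ((s * theta 0 x v) * (s * theta 0 x w))) / (1 - s)\<^sup>2"
    unfolding hr hopf_sq A s(1) using s(3)
    by (simp add: divide_simps) (algebra | (simp add: algebra_simps power2_eq_square))
  finally have Q: "frechet_derivative (sphere_map A) (at x) v \<bullet> frechet_derivative (sphere_map A) (at x) w
      = C / 4 * (?S - 4 * ((s * theta 0 x v) * (s * theta 0 x w))) / (1 - s)\<^sup>2" .
  have key: "C * (1 - s) * ((1 / (1 - s)) * (1 / (1 - s)) + s * k) / (1 - s) * (S / 4 + (1 - s) * (1 + s) * (t * t') + p * p')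
      - (C * (s * s * ((p / s / (1 - s) + b) * (p' / s / (1 - s) + b')) + t * t') + C / 4 * (S - 4 * ((s * t) * (s * t'))) / (1 - s)\<^sup>2)
      = s * (C * (1 / 4) * k * S + C * ((1 - s) * (1 + s) * k + 2 * (1 / (1 - s)) + s * ((1 / (1 - s)) * (1 / (1 - s)))) * (t * t')
        + C * k * (p * p') - C * (1 / (1 - s)) * (p * b' + b * p') - C * s * (b * b'))" for k S t t' p p' b b'
    using s(2,3) by (simp add: divide_simps) (algebra | (simp add: algebra_simps power2_eq_square))
  have "met a x v w - (C * (s * s * (?\<phi> v * ?\<phi> w) + theta 0 x v * theta 0 x w)
       + C / 4 * (?S - 4 * ((s * theta 0 x v) * (s * theta 0 x w))) / (1 - s)\<^sup>2)
      = s * (C * (1 / 4) * \<kappa> (1 - s) * ?S + C * ((1 - s) * (1 + s) * \<kappa> (1 - s) + 2 * (1 / (1 - s)) + s * ((1 / (1 - s)) * (1 / (1 - s)))) * (theta 0 x v * theta 0 x w)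
        + C * \<kappa> (1 - s) * (theta 1 x v * theta 1 x w) - C * (1 / (1 - s)) * (theta 1 x v * b w + b v * theta 1 x w) - C * s * (b v * b w))"
  proof -
    have m: "met a x v w = C * (1 - s) * ((1 / (1 - s)) * (1 / (1 - s)) + s * \<kappa> (1 - s)) / (1 - s)
        * (?S / 4 + (1 - s) * (1 + s) * (theta 0 x v * theta 0 x w) + theta 1 x v * theta 1 x w)"
    proof -
      have "a (1 - s) = C * (1 - s) * ((1 / (1 - s)) * (1 / (1 - s)) + s * \<kappa> (1 - s))"
        using a[OF cusp_chartD(3,4)[OF x]] unfolding s(1) by simp
      then show ?thesis unfolding met_theta[OF cusp_chartD(1)[OF x]] s(1) by simp
    qed
    show ?thesis unfolding m by (rule key)
  qed
  also have "\<dots> = (1 - x \<bullet> x) * ?B x v w"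
    unfolding s(1) b_def cusp_angle_def by (simp add: algebra_simps)
  finally show "met a x v w
      - (frechet_derivative (pseudo_map e A) (at x) v \<bullet> frechet_derivative (pseudo_map e A) (at x) w
       + frechet_derivative (sphere_map A) (at x) v \<bullet> frechet_derivative (sphere_map A) (at x) w)
      = (1 - x \<bullet> x) * ?B x v w" unfolding P Q .
qed

lemma cusp_chart_polar:
  "cusp_chart e = polar ` ({0<..<1} \<times> ({u. (u \<bullet> u) / 2 < u \<bullet> u + e * hopf 2 u} \<inter> sphere 0 1))"
proof
  have hs: "hopf 2 (c *\<^sub>R u) = c * c * hopf 2 u" for c u
    by (simp add: hopf_def H_def inner_c2 algebra_simps)
  have scale: "((c *\<^sub>R u) \<bullet> (c *\<^sub>R u)) / 2 < (c *\<^sub>R u) \<bullet> (c *\<^sub>R u) + e * hopf 2 (c *\<^sub>R u)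
      \<longleftrightarrow> (u \<bullet> u) / 2 < u \<bullet> u + e * hopf 2 u" if "0 < c" for c and u :: c2
  proof -
    have "(c *\<^sub>R u) \<bullet> (c *\<^sub>R u) + e * hopf 2 (c *\<^sub>R u) - ((c *\<^sub>R u) \<bullet> (c *\<^sub>R u)) / 2
        = (c * c) * (u \<bullet> u + e * hopf 2 u - (u \<bullet> u) / 2)"
      unfolding hs inner_scaleR_left inner_scaleR_right by (simp add: algebra_simps)
    moreover have "0 < c * c" using that by simp
    ultimately show ?thesis by (smt (verit) zero_less_mult_pos mult_pos_pos)
  qed
  show "cusp_chart e \<subseteq> polar ` ({0<..<1} \<times> ({u. (u \<bullet> u) / 2 < u \<bullet> u + e * hopf 2 u} \<inter> sphere 0 1))"
  proof
    fix x assume x: "x \<in> cusp_chart e"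
    have x0: "x \<noteq> 0" using cusp_chartD(3)[OF x] by auto
    have "ln (exp (- 1 / 2)) < ln (norm x)" using x x0 by (subst ln_less_cancel_iff) (auto simp: cusp_chart_def)
    then have z: "zcoord x < 1" "0 < zcoord x" using cusp_chartD(1)[OF x] by (simp_all add: zcoord_def zcoord_pos_iff[symmetric])
    have "x /\<^sub>R norm x \<in> {u. (u \<bullet> u) / 2 < u \<bullet> u + e * hopf 2 u} \<inter> sphere 0 1"
      using scale[of "inverse (norm x)" x] cusp_chartD(5)[OF x] x0 by (simp del: inner_scaleR_left inner_scaleR_right)
    then show "x \<in> polar ` ({0<..<1} \<times> ({u. (u \<bullet> u) / 2 < u \<bullet> u + e * hopf 2 u} \<inter> sphere 0 1))"
      using polar_zcoord[OF x0] z by (intro image_eqI[of _ _ "(zcoord x, x /\<^sub>R norm x)"]) auto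
  qed
  show "polar ` ({0<..<1} \<times> ({u. (u \<bullet> u) / 2 < u \<bullet> u + e * hopf 2 u} \<inter> sphere 0 1)) \<subseteq> cusp_chart e"
  proof
    fix x assume "x \<in> polar ` ({0<..<1} \<times> ({u. (u \<bullet> u) / 2 < u \<bullet> u + e * hopf 2 u} \<inter> sphere 0 1))"
    then obtain z u where x: "x = exp (- z / 2) *\<^sub>R u" and z: "0 < z" "z < 1"
      and u: "(u \<bullet> u) / 2 < u \<bullet> u + e * hopf 2 u" "norm u = 1"
      by (auto simp: polar_def simp del: scaleR_Pair)
    show "x \<in> cusp_chart e"
      using scale[of "exp (- z / 2)" u] z u unfolding cusp_chart_def x by (simp del: inner_scaleR_left inner_scaleR_right)
  qed
qed


lemma pseudo_map_in_pseudosphere: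
  assumes e: "e = 1 \<or> e = - 1" and x: "x \<in> cusp_chart e"
  shows "pseudo_map e A x \<in> pseudosphere A"
proof -
  define s where "s = 1 - x \<bullet> x"
  define q where "q = sqrt (1 - s\<^sup>2)"
  define t where "t = ln ((1 + q) / s)"
  have s: "0 < s" "s < 1" using cusp_chartD(3,4)[OF x] by (auto simp: s_def)
  have s2: "s\<^sup>2 < 1" using s by (simp add: abs_square_less_1)
  have q: "0 < q" "q * q = 1 - s\<^sup>2" using s2 by (simp_all add: q_def)
  have q1: "1 + q \<noteq> 0" "0 < 1 + q" using q(1) by linarith+
  have et: "exp t = (1 + q) / s" using s q1 by (simp add: t_def)
  have "(1 - q) * (1 + q) = s * s" using q(2) by (simp add: power2_eq_square algebra_simps)
  then have "s / (1 + q) = (1 - q) / s" using q1(1) s by (simp add: frac_eq_eq)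
  then have emt: "exp (- t) = (1 - q) / s" by (simp add: exp_minus et)
  have ch: "cosh t = 1 / s" "sinh t = q / s"
    unfolding cosh_field_def sinh_field_def et emt by (simp_all add: add_divide_distrib diff_divide_distrib)
  have th: "tanh t = q" using s by (simp add: tanh_def ch)
  have "1 < (1 + q) / s" using s q by (simp add: less_divide_eq)
  then have t0: "0 < t" by (simp add: t_def)
  have w: "cusp_coord e x \<noteq> 0" using cusp_coord_facts(1)[OF e, of x] cusp_chartD(6)[OF x] by auto
  let ?u = "squared_arg (cusp_coord e x)"
  have "?u \<noteq> 0" using squared_arg_inner(5)[OF w] by auto
  then have u: "?u = cis (Arg ?u)" using squared_arg_inner(5)[OF w] by (simp add: cis_Arg sgn_div_norm)
  have "pseudo_map e A x = (complex_of_real (A / cosh t) * cis (Arg ?u), A * (t - tanh t))"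
    unfolding pseudo_map_def u[symmetric] ch th tractrix_def s_def[symmetric] q_def[symmetric] t_def[symmetric]
    by (simp add: scaleR_conv_of_real)
  then show ?thesis using t0 unfolding pseudosphere_def by blast
qed

lemma sphere_map_in_sphere:
  assumes "x \<noteq> 0" "0 < B" shows "sphere_map B x \<in> sphere 0 B"
proof -
  have "sphere_map B x \<bullet> sphere_map B x = B\<^sup>2 * ((hopf 0 x)\<^sup>2 + (hopf 1 x)\<^sup>2 + (hopf 2 x)\<^sup>2) * (1 / (x \<bullet> x))\<^sup>2"
    unfolding sphere_map_def vec3_inner by (simp add: power2_eq_square algebra_simps)
  also have "\<dots> = B\<^sup>2" unfolding hopf_sq using assms by (simp add: power2_eq_square)
  finally have "norm (sphere_map B x) = sqrt (B\<^sup>2)" by (simp add: norm_eq_sqrt_inner)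
  then show ?thesis using assms(2) by simp
qed

lemma smooth_on_hopf: "open U \<Longrightarrow> smooth_on U (hopf j)"
  unfolding hopf_def[abs_def] by (intro smooth_on_inner smooth_on_ident smooth_on_linear H_linear)

lemma smooth_on_cusp_maps:
  assumes e: "e = 1 \<or> e = - 1"
  shows "smooth_on (cusp_chart e) (pseudo_map e A)" "smooth_on (cusp_chart e) (sphere_map B)"
proof -
  note o = open_cusp_chart[of e]
  have n: "x \<bullet> x \<noteq> 0" "1 - x \<bullet> x \<noteq> 0" "0 < 1 - (1 - x \<bullet> x)\<^sup>2"
    "0 < (1 + sqrt (1 - (1 - x \<bullet> x)\<^sup>2)) / (1 - x \<bullet> x)" "cusp_coord e x \<bullet> cusp_coord e x \<noteq> 0" if x: "x \<in> cusp_chart e" for x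
  proof -
    show 1: "x \<bullet> x \<noteq> 0" "1 - x \<bullet> x \<noteq> 0" using cusp_chartD(3,4)[OF x] by auto
    show 2: "0 < 1 - (1 - x \<bullet> x)\<^sup>2" using cusp_chartD(3,4)[OF x] by (simp add: abs_square_less_1)
    have "0 < 1 + sqrt (1 - (1 - x \<bullet> x)\<^sup>2)" using 2 by (smt (verit) real_sqrt_gt_zero)
    then show "0 < (1 + sqrt (1 - (1 - x \<bullet> x)\<^sup>2)) / (1 - x \<bullet> x)" using cusp_chartD(4)[OF x] by simp
    show "cusp_coord e x \<bullet> cusp_coord e x \<noteq> 0" using cusp_coord_facts(1)[OF e, of x] cusp_chartD(6)[OF x] by linarith
  qed
  have c: "smooth_on (cusp_chart e) (cusp_coord e)" by (rule smooth_on_linear[OF o cusp_coord_facts(3)[OF e]])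
  have r: "smooth_on (cusp_chart e) (\<lambda>x. 1 - (1 - x \<bullet> x)\<^sup>2)"
    by (intro smooth_on_diff smooth_on_power smooth_on_const smooth_on_inner smooth_on_ident o)
  have q: "smooth_on (cusp_chart e) (\<lambda>x. sqrt (1 - (1 - x \<bullet> x)\<^sup>2))" by (rule smooth_on_sqrt[OF o r n(3)])
  have "smooth_on (cusp_chart e) (\<lambda>x. (1 + sqrt (1 - (1 - x \<bullet> x)\<^sup>2)) / (1 - x \<bullet> x))"
    by (intro smooth_on_divide smooth_on_add q smooth_on_diff smooth_on_const smooth_on_inner smooth_on_ident o n(2))
  then have l: "smooth_on (cusp_chart e) (\<lambda>x. ln ((1 + sqrt (1 - (1 - x \<bullet> x)\<^sup>2)) / (1 - x \<bullet> x)))"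
    by (rule smooth_on_ln[OF o _ n(4)])
  show "smooth_on (cusp_chart e) (pseudo_map e A)"
    unfolding pseudo_map_def[abs_def] squared_arg_def tractrix_def
    by (intro smooth_on_Pair smooth_on_scaleR smooth_on_mult smooth_on_divide smooth_on_diff smooth_on_const
      smooth_on_inner smooth_on_ident o c l q n(5))
  show "smooth_on (cusp_chart e) (sphere_map B)"
    unfolding sphere_map_def[abs_def] vec3_eq
    by (intro smooth_on_add smooth_on_scaleR smooth_on_mult smooth_on_divide smooth_on_const
      smooth_on_inner smooth_on_ident o smooth_on_hopf n(1))
qed

lemma eventually_M0: "eventually (\<lambda>x. x \<in> M0) to_zero"
  unfolding eventually_to_zero by (auto intro!: exI[of _ 1] simp: zcoord_pos_iff simp del: split_paired_All)

lemma pseudo_map_at_top: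
  assumes A: "0 < A" shows "filterlim (\<lambda>x. snd (pseudo_map e A x)) at_top to_zero"
  unfolding filterlim_at_top
proof
  fix Z :: real
  have "eventually (\<lambda>x. 1 - exp (- (Z / A + 1)) < x \<bullet> x) to_zero"
    by (rule order_tendstoD(1)[OF tendsto_rho_to_zero]) simp
  then show "eventually (\<lambda>x. Z \<le> snd (pseudo_map e A x)) to_zero"
    using eventually_M0
  proof eventually_elim
    case (elim x)
    define s where "s = 1 - x \<bullet> x"
    have s: "0 < s" "s < 1" "s < exp (- (Z / A + 1))" using elim by (auto simp: s_def M0_iff)
    have s2: "s\<^sup>2 < 1" using s by (simp add: abs_square_less_1)
    have q: "0 \<le> sqrt (1 - s\<^sup>2)" "sqrt (1 - s\<^sup>2) \<le> 1" using s2 by simp_all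
    have "ln s < - (Z / A + 1)" using ln_less_cancel_iff[of s "exp (- (Z / A + 1))"] s by simp
    moreover have "ln ((1 + sqrt (1 - s\<^sup>2)) / s) = ln (1 + sqrt (1 - s\<^sup>2)) - ln s"
    proof -
      have "0 < 1 + sqrt (1 - s\<^sup>2)" using q(1) by linarith
      then show ?thesis using s(1) ln_div[of "1 + sqrt (1 - s\<^sup>2)" s] by simp
    qed
    moreover have "0 \<le> ln (1 + sqrt (1 - s\<^sup>2))" using q by simp
    ultimately have "Z / A \<le> tractrix (x \<bullet> x)" using q unfolding tractrix_def s_def[symmetric] by linarith
    then have "A * (Z / A) \<le> A * tractrix (x \<bullet> x)" using A by (intro mult_left_mono) auto
    then show ?case using A by (simp add: pseudo_map_def)
  qed
qed

lemma asymptotic_met: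
  assumes C: "0 < C" and U: "M0 \<subseteq> U" and R: "riemannian_on U (met a)"
    and g: "\<And>x. x \<in> M0 \<Longrightarrow> g x = met a x"
    and K: "\<And>e. alg e (\<lambda>x. \<kappa> (x \<bullet> x))"
    and a: "\<And>r. 0 < r \<Longrightarrow> r < 1 \<Longrightarrow> a r = C * r * ((1 / r) * (1 / r) + (1 - r) * \<kappa> r)"
      "\<And>r. 0 < r \<Longrightarrow> r < 1 \<Longrightarrow> (a has_real_derivative (- m * (1 / r)) * a r) (at r)"
      "\<And>r. 0 < r \<Longrightarrow> r < 1 \<Longrightarrow> C \<le> a r / r"
  shows "asymptotic_to_pseudosphere_times_sphere g"
  unfolding asymptotic_to_pseudosphere_times_sphere_def
proof -
  define A where "A = sqrt C / 2"
  have A: "0 < A" using C by (simp add: A_def)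
  have main: "\<exists>W a E. \<exists>\<Psi>1 :: c2 \<Rightarrow> complex \<times> real. \<exists>\<Psi>2 :: c2 \<Rightarrow> complex \<times> real.
        open W \<and> u0 \<in> W \<and> 0 < a \<and> E = polar ` ({0<..<a} \<times> (W \<inter> sphere 0 1)) \<and>
        smooth_on E \<Psi>1 \<and> \<Psi>1 ` E \<subseteq> pseudosphere A \<and>
        smooth_on E \<Psi>2 \<and> \<Psi>2 ` E \<subseteq> sphere 0 A \<and>
        filterlim (\<lambda>x. snd (\<Psi>1 x)) at_top (inf to_zero (principal E)) \<and>
        (\<forall>k. \<exists>\<epsilon>. (\<epsilon> \<longlongrightarrow> 0) (at_right 0) \<and>
           (\<forall>x\<in>E. \<forall>vs. length vs = k + 2 \<longrightarrow>
              \<bar>(cov_deriv g ^^ k)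
                 (\<lambda>y ws. g y (ws ! 0) (ws ! 1)
                    - (frechet_derivative \<Psi>1 (at y) (ws ! 0) \<bullet> frechet_derivative \<Psi>1 (at y) (ws ! 1)
                     + frechet_derivative \<Psi>2 (at y) (ws ! 0) \<bullet> frechet_derivative \<Psi>2 (at y) (ws ! 1)))
                 x vs\<bar>
                \<le> \<epsilon> (zcoord x) * (\<Prod>v\<leftarrow>vs. sqrt (g x v v))))" if u0: "u0 \<in> sphere 0 1" for u0
  proof -
    have n: "u0 \<bullet> u0 = 1" using u0 by (simp add: dot_square_norm)
    obtain e :: real where e: "e = 1 \<or> e = - 1" and ue: "(u0 \<bullet> u0) / 2 < u0 \<bullet> u0 + e * hopf 2 u0"
    proof (cases "0 \<le> hopf 2 u0")
      case True
      then show ?thesis using n by (intro that[of 1]) auto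
    next
      case False
      then show ?thesis using n by (intro that[of "- 1"]) auto
    qed
    obtain B where B: "bil_form e B" "\<forall>x\<in>cusp_chart e. \<forall>v w. met a x v w
      - (frechet_derivative (pseudo_map e A) (at x) v \<bullet> frechet_derivative (pseudo_map e A) (at x) w
       + frechet_derivative (sphere_map A) (at x) v \<bullet> frechet_derivative (sphere_map A) (at x) w)
      = (1 - x \<bullet> x) * B x v w"
      using cusp_difference[of e C \<kappa> a, OF e C K a(1)] unfolding A_def[symmetric] by blast
    obtain T where T: "tens e 2 T" "\<forall>x\<in>cusp_chart e. \<forall>ws. T x ws = (1 - x \<bullet> x) * B x (ws ! 0) (ws ! 1)"
      using bil_form_tens[OF B(1)] by blast
    let ?T0 = "\<lambda>y ws. g y (ws ! 0) (ws ! 1)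
      - (frechet_derivative (pseudo_map e A) (at y) (ws ! 0) \<bullet> frechet_derivative (pseudo_map e A) (at y) (ws ! 1)
       + frechet_derivative (sphere_map A) (at y) (ws ! 0) \<bullet> frechet_derivative (sphere_map A) (at y) (ws ! 1))"
    have T0: "?T0 x ws = T x ws" if x: "x \<in> cusp_chart e" for x ws
      using B(2)[rule_format, OF x, of "ws ! 0" "ws ! 1"] T(2)[rule_format, OF x, of ws] g[OF cusp_chartD(1)[OF x]] by simp
    have G: "christoffel g x v w = met_conn (\<lambda>r. - m * (1 / r)) x v w" if x: "x \<in> cusp_chart e" for x v w
    proof -
      note x0 = cusp_chartD(1)[OF x]
      have "christoffel g x v w = christoffel (met a) x v w" by (rule christoffel_cong[OF open_M(1) x0 g])
      also have "\<dots> = met_conn (\<lambda>r. - m * (1 / r)) x v w"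
        using x0 U M0_M1 cusp_chartD(3,4)[OF x] by (intro christoffel_met[OF R] a(2)) auto
      finally show ?thesis .
    qed
    have pos: "0 \<le> met a x v v" if x: "x \<in> cusp_chart e" for x v
    proof (cases "v = 0")
      case False
      have "x \<in> U" using cusp_chartD(1)[OF x] U by blast
      then have "0 < met a x v v" using R False unfolding riemannian_on_def by blast
      then show ?thesis by simp
    qed (simp add: met_def)
    have decay: "\<exists>\<epsilon>. (\<epsilon> \<longlongrightarrow> 0) (at_right 0) \<and> (\<forall>x\<in>cusp_chart e. \<forall>vs. length vs = k + 2 \<longrightarrow>
      \<bar>(cov_deriv g ^^ k) ?T0 x vs\<bar> \<le> \<epsilon> (zcoord x) * (\<Prod>v\<leftarrow>vs. sqrt (g x v v)))" for k
    proof -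
      obtain T' where T': "tens e (k + 2) T'"
        "\<forall>x\<in>cusp_chart e. \<forall>ws. length ws = k + 2 \<longrightarrow> (cov_deriv g ^^ k) ?T0 x ws = T' x ws"
        using cov_deriv_tens[of e g m T ?T0 k, OF G T(1) T0] by blast
      have tb: "\<bar>theta i x v\<bar> \<le> sqrt (4 / C) * sqrt (met a x v v)" if "i < 5" "x \<in> cusp_chart e" for i x v
        by (rule theta_bound[of x e C a i v, OF that(2) C a(3)[OF cusp_chartD(3,4)[OF that(2)]] that(1)])
      obtain L where L: "\<forall>x\<in>cusp_chart e. \<forall>vs. length vs = k + 2 \<longrightarrow> \<bar>T' x vs\<bar> \<le> L * (1 - x \<bullet> x) * (\<Prod>v\<leftarrow>vs. sqrt (met a x v v))"
        using tens_bound[of e "k + 2" T' "sqrt (4 / C)" "met a", OF T'(1) _ tb pos] C by auto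
      show ?thesis
      proof (intro exI[of _ "\<lambda>z. L * (1 - exp (- z))"] conjI ballI allI impI)
        show "((\<lambda>z. L * (1 - exp (- z))) \<longlongrightarrow> 0) (at_right 0)" by (auto intro!: tendsto_eq_intros)
        fix x :: c2 and vs :: "c2 list" assume x: "x \<in> cusp_chart e" and l: "length vs = k + 2"
        have x0: "x \<noteq> 0" using cusp_chartD(3)[OF x] by auto
        show "\<bar>(cov_deriv g ^^ k) ?T0 x vs\<bar> \<le> L * (1 - exp (- zcoord x)) * (\<Prod>v\<leftarrow>vs. sqrt (g x v v))"
          unfolding exp_zcoord[OF x0] g[OF cusp_chartD(1)[OF x]] T'(2)[rule_format, OF x l] by (rule L[rule_format, OF x l])
      qed
    qed
    show ?thesis
    proof (rule exI[of _ "{u. (u \<bullet> u) / 2 < u \<bullet> u + e * hopf 2 u}"], rule exI[of _ "1 :: real"], rule exI[of _ "cusp_chart e"],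
        rule exI[of _ "pseudo_map e A"], rule exI[of _ "sphere_map A"], intro conjI)
      show "open {u. (u \<bullet> u) / 2 < u \<bullet> u + e * hopf 2 u}"
        by (intro open_Collect_less continuous_intros continuous_on_hopf) auto
      show "u0 \<in> {u. (u \<bullet> u) / 2 < u \<bullet> u + e * hopf 2 u}" using ue by simp
      show "cusp_chart e = polar ` ({0<..<1} \<times> ({u. (u \<bullet> u) / 2 < u \<bullet> u + e * hopf 2 u} \<inter> sphere 0 1))"
        by (rule cusp_chart_polar)
      show "pseudo_map e A ` cusp_chart e \<subseteq> pseudosphere A" using pseudo_map_in_pseudosphere[OF e] by blast
      show "sphere_map A ` cusp_chart e \<subseteq> sphere 0 A"
      proof
        fix p assume "p \<in> sphere_map A ` cusp_chart e"
        then obtain x where x: "x \<in> cusp_chart e" "p = sphere_map A x" by blast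
        then have "x \<noteq> 0" using cusp_chartD(3)[OF x(1)] by auto
        then show "p \<in> sphere 0 A" unfolding x(2) by (rule sphere_map_in_sphere[OF _ A])
      qed
      show "filterlim (\<lambda>x. snd (pseudo_map e A x)) at_top (inf to_zero (principal (cusp_chart e)))"
        by (rule filterlim_mono[OF pseudo_map_at_top[OF A] order_refl inf_le1])
      show "\<forall>k. \<exists>\<epsilon>. (\<epsilon> \<longlongrightarrow> 0) (at_right 0) \<and> (\<forall>x\<in>cusp_chart e. \<forall>vs. length vs = k + 2 \<longrightarrow>
          \<bar>(cov_deriv g ^^ k) ?T0 x vs\<bar> \<le> \<epsilon> (zcoord x) * (\<Prod>v\<leftarrow>vs. sqrt (g x v v)))"
        using decay by blast
    qed (simp_all add: smooth_on_cusp_maps[OF e])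
  qed
  show "\<exists>A>0. \<exists>B>0. \<forall>u0 \<in> sphere 0 1. \<exists>W a E. \<exists>\<Psi>1 :: c2 \<Rightarrow> complex \<times> real. \<exists>\<Psi>2 :: c2 \<Rightarrow> complex \<times> real.
        open W \<and> u0 \<in> W \<and> 0 < a \<and> E = polar ` ({0<..<a} \<times> (W \<inter> sphere 0 1)) \<and>
        smooth_on E \<Psi>1 \<and> \<Psi>1 ` E \<subseteq> pseudosphere A \<and>
        smooth_on E \<Psi>2 \<and> \<Psi>2 ` E \<subseteq> sphere 0 B \<and>
        filterlim (\<lambda>x. snd (\<Psi>1 x)) at_top (inf to_zero (principal E)) \<and>
        (\<forall>k. \<exists>\<epsilon>. (\<epsilon> \<longlongrightarrow> 0) (at_right 0) \<and>
           (\<forall>x\<in>E. \<forall>vs. length vs = k + 2 \<longrightarrow>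
              \<bar>(cov_deriv g ^^ k)
                 (\<lambda>y ws. g y (ws ! 0) (ws ! 1)
                    - (frechet_derivative \<Psi>1 (at y) (ws ! 0) \<bullet> frechet_derivative \<Psi>1 (at y) (ws ! 1)
                     + frechet_derivative \<Psi>2 (at y) (ws ! 0) \<bullet> frechet_derivative \<Psi>2 (at y) (ws ! 1)))
                 x vs\<bar>
                \<le> \<epsilon> (zcoord x) * (\<Prod>v\<leftarrow>vs. sqrt (g x v v))))"
    by (rule exI[of _ A], rule conjI[OF A], rule exI[of _ A], rule conjI[OF A], rule ballI, rule main)
qed

subsection \<open>The length of the Hopf fibers\<close>

lemma hopf_fiber_eq: "hopf_fiber x t = cos (2 * pi * t) *\<^sub>R x + sin (2 * pi * t) *\<^sub>R imul x"
  by (simp add: hopf_fiber_def imul_def prod_eq_iff complex_eq_iff)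

lemma rlength_hopf_fiber:
  assumes x: "x \<in> M0" and g: "\<And>x. x \<in> M0 \<Longrightarrow> g x = met a x"
  shows "rlength g (hopf_fiber x) = sqrt (4 * pi\<^sup>2 * (a (x \<bullet> x) * (x \<bullet> x) * (1 - x \<bullet> x)\<^sup>2))"
proof -
  have sp: "rspeed g (hopf_fiber x) t = sqrt (4 * pi\<^sup>2 * (a (x \<bullet> x) * (x \<bullet> x) * (1 - x \<bullet> x)\<^sup>2))" for t
  proof -
    let ?p = "hopf_fiber x t"
    have c: "((\<lambda>t. cos (2 * pi * t)) has_field_derivative - (2 * pi * sin (2 * pi * t))) (at t)"
      "((\<lambda>t. sin (2 * pi * t)) has_field_derivative 2 * pi * cos (2 * pi * t)) (at t)"
      by (auto intro!: derivative_eq_intros)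
    have "((\<lambda>t. cos (2 * pi * t) *\<^sub>R x + sin (2 * pi * t) *\<^sub>R imul x) has_vector_derivative
      (cos (2 * pi * t) *\<^sub>R 0 + (- (2 * pi * sin (2 * pi * t))) *\<^sub>R x) + (sin (2 * pi * t) *\<^sub>R 0 + (2 * pi * cos (2 * pi * t)) *\<^sub>R imul x)) (at t)"
      by (intro has_vector_derivative_add has_vector_derivative_scaleR c has_vector_derivative_const)
    then have "(hopf_fiber x has_vector_derivative
      (cos (2 * pi * t) *\<^sub>R 0 + (- (2 * pi * sin (2 * pi * t))) *\<^sub>R x) + (sin (2 * pi * t) *\<^sub>R 0 + (2 * pi * cos (2 * pi * t)) *\<^sub>R imul x)) (at t)"
      unfolding hopf_fiber_eq[abs_def] .
    moreover have "(cos (2 * pi * t) *\<^sub>R 0 + (- (2 * pi * sin (2 * pi * t))) *\<^sub>R x) + (sin (2 * pi * t) *\<^sub>R 0 + (2 * pi * cos (2 * pi * t)) *\<^sub>R imul x)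
        = (2 * pi) *\<^sub>R imul ?p"
      unfolding hopf_fiber_eq by (simp add: algebra_simps)
    ultimately have v: "vector_derivative (hopf_fiber x) (at t) = (2 * pi) *\<^sub>R imul ?p"
      by (simp add: vector_derivative_at)
    have "?p \<bullet> ?p = (cos (2 * pi * t))\<^sup>2 * (x \<bullet> x) + (sin (2 * pi * t))\<^sup>2 * (x \<bullet> x)"
      unfolding hopf_fiber_eq by (simp add: inner_add_left inner_add_right power2_eq_square algebra_simps)
    also have "\<dots> = x \<bullet> x" by (simp flip: distrib_right)
    finally have pp: "?p \<bullet> ?p = x \<bullet> x" .
    then have "?p \<in> M0" using x by (metis M0_iff inner_eq_zero_iff)
    then have "g ?p ((2 * pi) *\<^sub>R imul ?p) ((2 * pi) *\<^sub>R imul ?p) = 4 * pi\<^sup>2 * (a (x \<bullet> x) * (x \<bullet> x) * (1 - x \<bullet> x)\<^sup>2)"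
      unfolding g[OF \<open>?p \<in> M0\<close>] met_def pp by (simp add: pp power2_eq_square algebra_simps)
    then show ?thesis unfolding rspeed_def v by simp
  qed
  show ?thesis unfolding rlength_def sp[abs_def] by simp
qed

lemma cusp_like_end_met:
  assumes U: "U = M0 \<or> U = M1" and F: "F = (\<lambda>z. (1 - exp (- z))\<^sup>2)" and C: "0 < C"
    and R: "riemannian_on U (met a)" and g: "\<And>x. x \<in> U \<Longrightarrow> g x = met a x"
    and mu: "\<And>x. x \<in> M0 \<Longrightarrow> \<mu> (zcoord x) = a (x \<bullet> x) * (x \<bullet> x)" "(\<mu> \<longlongrightarrow> C) (at_right 0)" "isCont a 1"
    and b: "\<And>x. x \<in> U \<Longrightarrow> C * (x \<bullet> x) \<le> a (x \<bullet> x)" "\<And>x. x \<in> U \<Longrightarrow> 0 < a (x \<bullet> x)"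
    and K: "\<And>e. alg e (\<lambda>x. \<kappa> (x \<bullet> x))"
    and a: "\<And>r. 0 < r \<Longrightarrow> r < 1 \<Longrightarrow> a r = C * r * ((1 / r) * (1 / r) + (1 - r) * \<kappa> r)"
      "\<And>r. 0 < r \<Longrightarrow> r < 1 \<Longrightarrow> (a has_real_derivative (- m * (1 / r)) * a r) (at r)"
      "\<And>r. 0 < r \<Longrightarrow> r < 1 \<Longrightarrow> C \<le> a r / r"
  shows "cusp_like_end U g \<mu> F"
proof -
  have U0: "M0 \<subseteq> U" using U M0_M1 by auto
  have g0: "g x = met a x" if "x \<in> M0" for x using g U0 that by blast
  have W: "g x v w = warped_metric \<mu> F x v w" if "x \<in> M0" for x v w
    using warped_metric_met[of x F \<mu> a v w, OF that F mu(1)[OF that]] g0[OF that] by simp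
  have dist: "filterlim (rdist U g p) at_top to_zero" if "p \<in> U" for p
  proof -
    have "rdist U g = rdist U (met a)" by (rule rdist_cong) (rule g)
    then show ?thesis using rdist_cusp_at_top[OF U R C b that] by simp
  qed
  have Fz: "((\<lambda>z. F z / z\<^sup>2) \<longlongrightarrow> 1) (at_right 0)"
  proof -
    have "((\<lambda>z::real. 1 - exp (- z)) has_field_derivative 1) (at 0 within {0<..})"
      by (auto intro!: derivative_eq_intros)
    then have "((\<lambda>z::real. (1 - exp (- z)) / z) \<longlongrightarrow> 1) (at_right 0)"
      unfolding has_field_derivative_iff by simp
    then have "((\<lambda>z::real. ((1 - exp (- z)) / z)\<^sup>2) \<longlongrightarrow> 1\<^sup>2) (at_right 0)" by (rule tendsto_power)
    then show ?thesis by (simp add: F power_divide)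
  qed
  have fib: "((\<lambda>x. rlength g (hopf_fiber x)) \<longlongrightarrow> 0) to_zero"
  proof -
    have "((\<lambda>x. a (x \<bullet> x)) \<longlongrightarrow> a 1) to_zero" by (rule isCont_tendsto_compose[OF mu(3) tendsto_rho_to_zero])
    then have "((\<lambda>x. sqrt (4 * pi\<^sup>2 * (a (x \<bullet> x) * (x \<bullet> x) * (1 - x \<bullet> x)\<^sup>2))) \<longlongrightarrow> sqrt (4 * pi\<^sup>2 * (a 1 * 1 * (1 - 1)\<^sup>2))) to_zero"
      by (intro tendsto_intros tendsto_rho_to_zero)
    then have "((\<lambda>x. sqrt (4 * pi\<^sup>2 * (a (x \<bullet> x) * (x \<bullet> x) * (1 - x \<bullet> x)\<^sup>2))) \<longlongrightarrow> 0) to_zero" by simp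
    then show ?thesis
    proof (rule Lim_transform_eventually)
      show "eventually (\<lambda>x. sqrt (4 * pi\<^sup>2 * (a (x \<bullet> x) * (x \<bullet> x) * (1 - x \<bullet> x)\<^sup>2)) = rlength g (hopf_fiber x)) to_zero"
        using eventually_M0 by eventually_elim (simp only: rlength_hopf_fiber[OF _ g0])
    qed
  qed
  have asy: "asymptotic_to_pseudosphere_times_sphere g" by (rule asymptotic_met[OF C U0 R g0 K a])
  show ?thesis
    unfolding cusp_like_end_def
  proof (intro conjI ballI allI end_of_z_zero[OF U] W dist fib asy)
    show "\<exists>c. c \<noteq> 0 \<and> ((\<lambda>z. F z / z\<^sup>2) \<longlongrightarrow> c) (at_right 0)" using Fz by (intro exI[of _ 1]) simp
    show "\<exists>c. c \<noteq> 0 \<and> (\<mu> \<longlongrightarrow> c) (at_right 0)" using mu(2) C by (intro exI[of _ C]) simp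
  qed
qed

section \<open>The ambiKaehler pair\<close>

theorem mainTheorem8:
  fixes C0 :: real and F :: "real \<Rightarrow> real" and gTN gm gp :: "c2 metric_field"
  assumes C0: "0 < C0"
    and F: "F = (\<lambda>z. (1 - exp (- z))\<^sup>2)"
    and gTN: "gTN = warped_metric (\<lambda>z. C0 * exp (- z) / (1 - exp (- z))\<^sup>2) F"
    and gm: "gm = warped_metric (\<lambda>z. C0 * exp z) F"
    and gp: "gp = warped_metric (\<lambda>z. C0 * exp (- z)) F"
  shows
    "(\<comment> \<open>(i)\<close>
      conformal_on M0 gTN gm \<and>
      kahler_on M0 gm (J_minus F) \<and>
      complete_on M0 gm \<and>
      has_num_ends M0 2 \<and>
      (\<forall>x\<in>M0. scalar_curvature gm x = 0) \<and>
      biholomorphic M0 (J_minus F) (- {(0, 0)}) J_std \<and>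
      ale_end M0 gm z_infinity_end \<and>
      cusp_like_end M0 gm (\<lambda>z. C0 * exp z) F) \<and>
     (\<comment> \<open>(ii), on the manifold with the nut added\<close>
      \<exists>gTN' gp' J'.
        extends_over_nut gTN gTN' \<and> extends_over_nut gp gp' \<and>
        (\<forall>x\<in>M0. \<forall>v. J' x v = J_plus F x v) \<and>
        conformal_on M1 gTN' gp' \<and>
        extremal_kahler_on M1 gp' J' \<and>
        complete_on M1 gp' \<and>
        has_num_ends M1 1 \<and>
        biholomorphic M1 J' UNIV J_std \<and>
        cusp_like_end M1 gp' (\<lambda>z. C0 * exp (- z)) F \<and>
        (\<forall>x\<in>M0. scalar_curvature gp' x = 48 / C0 * (1 - exp (- zcoord x))) \<and>
        scalar_curvature gp' 0 = 48 / C0 \<and>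
        (\<forall>x\<in>M1. 0 < scalar_curvature gp' x) \<and>
        (scalar_curvature gp' \<longlongrightarrow> 0) to_zero) \<and>
     ambikahler_on M0 gm (J_minus F) gp (J_plus F)"
proof -
  have gm': "gm x = met_minus C0 x" if x: "x \<in> M0" for x
  proof (intro ext)
    fix v w
    have "C0 * exp (zcoord x) = C0 / (x \<bullet> x)\<^sup>2 * (x \<bullet> x)"
      using exp_zcoord[of x] x M0_pos[OF x] by (auto simp: M0_iff exp_minus field_simps power2_eq_square)
    then show "gm x v w = met_minus C0 x v w"
      unfolding gm by (intro warped_metric_met[OF x F])
  qed
  have gp': "gp x = met_plus C0 x" if x: "x \<in> M0" for x
  proof (intro ext)
    fix v w
    have "C0 * exp (- zcoord x) = C0 * (x \<bullet> x)" using exp_zcoord[of x] x by (simp add: M0_iff)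
    then show "gp x v w = met_plus C0 x v w"
      unfolding gp by (intro warped_metric_met[OF x F])
  qed
  have gTN': "gTN x = met (\<lambda>r. C0 / (1 - r)\<^sup>2) x" if x: "x \<in> M0" for x
  proof (intro ext)
    fix v w
    have "C0 * exp (- zcoord x) / (1 - exp (- zcoord x))\<^sup>2 = C0 / (1 - x \<bullet> x)\<^sup>2 * (x \<bullet> x)"
      using exp_zcoord[of x] x by (simp add: M0_iff)
    then show "gTN x v w = met (\<lambda>r. C0 / (1 - r)\<^sup>2) x v w"
      unfolding gTN by (intro warped_metric_met[OF x F])
  qed
  have Jm: "J_minus F x = Jrad c_minus d_minus x" if "x \<in> M0" for x using J_minus_eq[OF that F] by (intro ext)
  have Jp: "J_plus F x = J_ext x" if "x \<in> M0" for x using J_plus_eq[OF that F] by (intro ext)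
  have r0: "0 < x \<bullet> x" "x \<bullet> x < 1" if "x \<in> M0" for x using M0_pos[OF that] that by (simp_all add: M0_iff)
  have r1: "0 \<le> x \<bullet> x" "x \<bullet> x < 1" if "x \<in> M1" for x using that by (simp_all add: M1_iff)
  have smooth1: "smooth_on M1 (\<lambda>x. C0 / (1 - x \<bullet> x)\<^sup>2)"
    by (intro smooth_intros open_M) (use r1 in force)
  have RTN: "riemannian_on M1 (met (\<lambda>r. C0 / (1 - r)\<^sup>2))"
    by (rule riemannian_met[OF open_M(2) order_refl smooth1]) (use r1(2) C0 in force)
  note Rm = riemannian_met_minus[OF C0]
  note Rp = riemannian_met_plus[OF C0 open_M(2) order_refl]
  have km: "kahler_on M0 gm (J_minus F)" by (rule kahler_on_cong[OF kahler_minus[OF C0] gm' Jm])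
  have kp: "kahler_on M0 gp (J_plus F)" by (rule kahler_on_cong[OF kahler_plus[OF C0 open_M(1) M0_M1] gp' Jp])
  have lim: "((\<lambda>z. C0 * exp z) \<longlongrightarrow> C0) (at_right 0)" "((\<lambda>z. C0 * exp (- z)) \<longlongrightarrow> C0) (at_right 0)"
    by (auto intro!: tendsto_eq_intros)
  have sq: "r\<^sup>2 \<le> 1" "r * r\<^sup>2 \<le> 1" if "0 < r" "r < 1" for r :: real
  proof -
    show 1: "r\<^sup>2 \<le> 1" using that by (simp add: abs_square_le_1)
    show "r * r\<^sup>2 \<le> 1" using mult_mono[of r 1 "r\<^sup>2" 1] that 1 by simp
  qed
  have bm: "C0 * (x \<bullet> x) \<le> C0 / (x \<bullet> x)\<^sup>2" "0 < C0 / (x \<bullet> x)\<^sup>2" "C0 \<le> C0 / (x \<bullet> x)\<^sup>2 * (x \<bullet> x)" if "x \<in> M0" for x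
  proof -
    note r = r0[OF that]
    have p: "0 < (x \<bullet> x)\<^sup>2" using r by simp
    have "C0 * ((x \<bullet> x) * (x \<bullet> x)\<^sup>2) \<le> C0 * 1" using sq(2)[OF r] C0 by (intro mult_left_mono) auto
    then show "C0 * (x \<bullet> x) \<le> C0 / (x \<bullet> x)\<^sup>2" using p by (simp add: pos_le_divide_eq mult.assoc)
    show "0 < C0 / (x \<bullet> x)\<^sup>2" using p C0 by simp
    have "C0 * (x \<bullet> x) \<le> C0" using r C0 by (simp add: mult_left_le)
    moreover have "C0 / (x \<bullet> x)\<^sup>2 * (x \<bullet> x) = C0 / (x \<bullet> x)" using r by (simp add: power2_eq_square)
    ultimately show "C0 \<le> C0 / (x \<bullet> x)\<^sup>2 * (x \<bullet> x)" using r by (simp add: pos_le_divide_eq)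
  qed
  have bp: "C0 * (x \<bullet> x) \<le> C0" "0 < C0" if "x \<in> M1" for x :: c2
    using r1[OF that] C0 by (simp_all add: mult_left_le)
  have cm: "complete_on M0 gm"
    using complete_met_M0[OF Rm C0 bm] complete_on_cong[of M0 gm "met_minus C0", OF gm'] by blast
  have cp: "complete_on M1 (met_plus C0)" by (rule complete_met_M1[OF Rp C0 bp])
  have sm: "scalar_curvature gm x = 0" if "x \<in> M0" for x
    using scalar_curvature_cong[of M0 x gm "met_minus C0", OF open_M(1) that gm'] scalar_curvature_minus[OF C0 that] by simp
  have cusp_m: "cusp_like_end M0 gm (\<lambda>z. C0 * exp z) F"
  proof (rule cusp_like_end_met[where a = "\<lambda>r. C0 / r\<^sup>2" and \<kappa> = "\<lambda>r. (1 / r) * ((1 / r) * (1 / r))" and m = 2 and C = C0,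
      OF _ F C0 Rm gm' _ lim(1) _ bm(1,2)])
    show "C0 * exp (zcoord x) = C0 / (x \<bullet> x)\<^sup>2 * (x \<bullet> x)" if "x \<in> M0" for x
      using exp_zcoord[of x] that M0_pos[OF that] by (auto simp: M0_iff exp_minus field_simps power2_eq_square)
    show "isCont (\<lambda>r. C0 / r\<^sup>2) 1" by (intro continuous_intros) auto
    show "alg e (\<lambda>x. (1 / (x \<bullet> x)) * ((1 / (x \<bullet> x)) * (1 / (x \<bullet> x))))" for e by (intro alg_intros)
    fix r :: real assume r: "0 < r" "r < 1"
    show "C0 / r\<^sup>2 = C0 * r * (1 / r * (1 / r) + (1 - r) * (1 / r * (1 / r * (1 / r))))"
      using r by (simp add: field_simps power2_eq_square)
    show "((\<lambda>r. C0 / r\<^sup>2) has_real_derivative (- 2 * (1 / r)) * (C0 / r\<^sup>2)) (at r)"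
      using r by (auto intro!: derivative_eq_intros simp: field_simps power2_eq_square)
    have "C0 * (r * r\<^sup>2) \<le> C0 * 1" using sq(2)[OF r] C0 by (intro mult_left_mono) auto
    then show "C0 \<le> C0 / r\<^sup>2 / r" using r by (simp add: pos_le_divide_eq mult_ac)
  qed simp
  have cusp_p: "cusp_like_end M1 (met_plus C0) (\<lambda>z. C0 * exp (- z)) F"
  proof (rule cusp_like_end_met[where a = "\<lambda>r. C0" and \<kappa> = "\<lambda>r. - ((1 / r) * (1 / r))" and m = 0 and C = C0,
      OF _ F C0 Rp refl _ lim(2) _ bp])
    show "C0 * exp (- zcoord x) = C0 * (x \<bullet> x)" if "x \<in> M0" for x
      using exp_zcoord[of x] that by (simp add: M0_iff)
    show "alg e (\<lambda>x. - ((1 / (x \<bullet> x)) * (1 / (x \<bullet> x))))" for e by (intro alg_intros)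
    fix r :: real assume r: "0 < r" "r < 1"
    show "C0 = C0 * r * (1 / r * (1 / r) + (1 - r) * - (1 / r * (1 / r)))"
      using r by (simp add: field_simps)
    show "((\<lambda>r. C0) has_real_derivative (- 0 * (1 / r)) * C0) (at r)" by simp
    show "C0 \<le> C0 / r" using r C0 by (simp add: pos_le_divide_eq mult_left_le)
  qed simp_all
  have opp: "opposite_orientations M0 (J_minus F) (J_plus F)"
    using opposite_orientations_pm unfolding opposite_orientations_def
    by (simp add: Jm Jp cong: ball_cong del: split_paired_All)
  have conf1: "conformal_on M0 gTN gm"
  proof (rule conformal_on_met[OF gTN' gm', where f = "\<lambda>r. (1 - r)\<^sup>2 / r\<^sup>2"])
    show "smooth_on M0 (\<lambda>x. (1 - x \<bullet> x)\<^sup>2 / (x \<bullet> x)\<^sup>2)" by (intro smooth_intros open_M) (use r0 in force)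
    fix x assume x: "x \<in> M0"
    show "0 < (1 - x \<bullet> x)\<^sup>2 / (x \<bullet> x)\<^sup>2" using r0[OF x] by simp
    show "C0 / (x \<bullet> x)\<^sup>2 = (1 - x \<bullet> x)\<^sup>2 / (x \<bullet> x)\<^sup>2 * (C0 / (1 - x \<bullet> x)\<^sup>2)" using r0[OF x] by simp
  qed
  have conf2: "conformal_on M1 (met (\<lambda>r. C0 / (1 - r)\<^sup>2)) (met_plus C0)"
  proof (rule conformal_on_met[OF refl refl, where f = "\<lambda>r. (1 - r)\<^sup>2"])
    show "smooth_on M1 (\<lambda>x. (1 - x \<bullet> x)\<^sup>2)" by (intro smooth_intros open_M)
    fix x assume x: "x \<in> M1"
    show "0 < (1 - x \<bullet> x)\<^sup>2" using r1[OF x] by simp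
    show "C0 = (1 - x \<bullet> x)\<^sup>2 * (C0 / (1 - x \<bullet> x)\<^sup>2)" using r1[OF x] by simp
  qed
  have conf3: "conformal_on M0 gm gp"
  proof (rule conformal_on_met[OF gm' gp', where f = "\<lambda>r. r\<^sup>2"])
    show "smooth_on M0 (\<lambda>x. (x \<bullet> x)\<^sup>2)" by (intro smooth_intros open_M)
    fix x assume x: "x \<in> M0"
    show "0 < (x \<bullet> x)\<^sup>2" using r0[OF x] by simp
    show "C0 = (x \<bullet> x)\<^sup>2 * (C0 / (x \<bullet> x)\<^sup>2)" using r0[OF x] by simp
  qed
  have sp: "scalar_curvature (met_plus C0) x = 48 / C0 * (1 - x \<bullet> x)" if "x \<in> M1" for x
    by (rule scalar_curvature_plus[OF C0 that])
  have slim: "(scalar_curvature (met_plus C0) \<longlongrightarrow> 0) to_zero"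
  proof -
    have "((\<lambda>x. 48 / C0 * (1 - x \<bullet> x)) \<longlongrightarrow> 48 / C0 * (1 - 1)) to_zero"
      by (intro tendsto_intros tendsto_rho_to_zero)
    then have "((\<lambda>x. 48 / C0 * (1 - x \<bullet> x)) \<longlongrightarrow> 0) to_zero" by simp
    then show ?thesis
    proof (rule Lim_transform_eventually)
      show "eventually (\<lambda>x. 48 / C0 * (1 - x \<bullet> x) = scalar_curvature (met_plus C0) x) to_zero"
        using eventually_M0 by eventually_elim (use sp M0_M1 in force)
    qed
  qed
  have ext: "extremal_kahler_on M1 (met_plus C0) J_ext"
    unfolding extremal_kahler_on_def using kahler_plus[OF C0 open_M(2) order_refl] killing_plus[OF C0] by blast
  have s0: "scalar_curvature (met_plus C0) x = 48 / C0 * (1 - exp (- zcoord x))" if "x \<in> M0" for x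
    using sp[of x] exp_zcoord[of x] that M0_M1 by (auto simp: M0_iff)
  have s1: "scalar_curvature (met_plus C0) 0 = 48 / C0" using sp[of 0] by (simp add: M1_def)
  have s2: "0 < scalar_curvature (met_plus C0) x" if "x \<in> M1" for x
    unfolding sp[OF that] using r1[OF that] C0 by simp
  have i: "conformal_on M0 gTN gm \<and> kahler_on M0 gm (J_minus F) \<and> complete_on M0 gm \<and> has_num_ends M0 2 \<and>
      (\<forall>x\<in>M0. scalar_curvature gm x = 0) \<and> biholomorphic M0 (J_minus F) (- {(0, 0)}) J_std \<and>
      ale_end M0 gm z_infinity_end \<and> cusp_like_end M0 gm (\<lambda>z. C0 * exp z) F"
    by (intro conjI ballI conf1 km cm has_num_ends_M0 sm biholomorphic_minus J_minus_eq[OF _ F] ale_end_minus[OF C0 gm'] cusp_m)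
  have ii: "\<exists>gTN' gp' J'. extends_over_nut gTN gTN' \<and> extends_over_nut gp gp' \<and>
        (\<forall>x\<in>M0. \<forall>v. J' x v = J_plus F x v) \<and> conformal_on M1 gTN' gp' \<and> extremal_kahler_on M1 gp' J' \<and>
        complete_on M1 gp' \<and> has_num_ends M1 1 \<and> biholomorphic M1 J' UNIV J_std \<and>
        cusp_like_end M1 gp' (\<lambda>z. C0 * exp (- z)) F \<and>
        (\<forall>x\<in>M0. scalar_curvature gp' x = 48 / C0 * (1 - exp (- zcoord x))) \<and>
        scalar_curvature gp' 0 = 48 / C0 \<and> (\<forall>x\<in>M1. 0 < scalar_curvature gp' x) \<and>
        (scalar_curvature gp' \<longlongrightarrow> 0) to_zero"
  proof (rule exI[of _ "met (\<lambda>r. C0 / (1 - r)\<^sup>2)"], rule exI[of _ "met_plus C0"], rule exI[of _ J_ext], intro conjI)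
    show "extends_over_nut gTN (met (\<lambda>r. C0 / (1 - r)\<^sup>2))" by (rule extends_over_nut_met[OF RTN gTN'])
    show "extends_over_nut gp (met_plus C0)" by (rule extends_over_nut_met[OF Rp gp'])
    show "\<forall>x\<in>M0. \<forall>v. J_ext x v = J_plus F x v" using Jp by (intro ballI allI) metis
    show "biholomorphic M1 J_ext UNIV J_std" by (rule biholomorphic_plus) (rule refl)
    show "\<forall>x\<in>M0. scalar_curvature (met_plus C0) x = 48 / C0 * (1 - exp (- zcoord x))" using s0 by blast
    show "\<forall>x\<in>M1. 0 < scalar_curvature (met_plus C0) x" using s2 by blast
  qed (rule conf2 ext cp has_num_ends_M1 cusp_p s1 slim)+
  have iii: "ambikahler_on M0 gm (J_minus F) gp (J_plus F)"
    unfolding ambikahler_on_def by (intro conjI km kp opp conf3)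
  show ?thesis by (rule conjI[OF i conjI[OF ii iii]])
qed

end
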